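(* Let $(X_n)_{n\in\mathbb{N}}$ be a stationary sequence of real-valued random variables, and let $X,Y$ be independent random variables with the same distribution as $X_1$. Let $h:\mathbb{R}\times\mathbb{R}\times\mathbb{R}\to\mathbb{R}$ be a measurable function which is symmetric in its first two arguments, and put $U(t)=E[h(X,Y,t)]$. Assume: (1) $h$ is bounded and non-decreasing in its third argument, $U$ is continuous, and for all $x,y\in\mathbb{R}$, $\lim_{t\to\infty}h(x,y,t)=1$ and $\lim_{t\to-\infty}h(x,y,t)=0$. (2) There is a constant $L$ such that for all $t\in\mathbb{R}$ and $\epsilon>0$, $$E\Big[\sup_{\|(x,y)-(X,Y)\|\le\epsilon}|h(x,y,t)-h(X,Y,t)|\Big]\le L\epsilon,$$ where $\|\cdot\|$ is the Euclidean norm. (3) $U$ is differentiable on an interval $[C_1,C_2]$ with derivative $u=U'$ satisfying $0<\inf_{t\in[C_1,C_2]}u(t)\le\sup_{t\in[C_1,C_2]}u(t)<\infty$ and, as $x\to0$, $$\sup_{t,t'\in[C_1,C_2]:\,|t-t'|\le x}|U(t)-U(t')-u(t)(t-t')|=O\big(x^{5/4}\big).$$ (4) One of the following holds: (i) $(X_n)$ is strongly mixing with coefficients $\alpha(n)=O(n^{-\alpha})$ for some $\alpha\ge 8$ and $E|X_1|^r<\infty$ for some $r>\frac15$; or (ii) $(X_n)$ is $L^1$ near epoch dependent, with approximation constants $a_n=O(n^{-a})$, $a=\max\{\beta+3,12\}$, on an absolutely regular process $(Z_n)_{n\in\mathbb{Z}}$ with coefficients $\beta(n)=O(n^{-\beta})$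 for some $\beta\ge 8$. Let $I=[\tilde C_1,\tilde C_2]$ with $U(C_1)<\tilde C_1<\tilde C_2<U(C_2)$, and let $\gamma=\frac{\alpha-2}{\alpha}$ in case (i), respectively $\gamma=\frac{\beta-3}{\beta+1}$ in case (ii). Then almost surely, as $n\to\infty$, $$\sup_{p\in I,\,s\in[0,1]}\frac{\lfloor ns\rfloor}{\sqrt n}\,\big|R_{\lfloor ns\rfloor}(p)\big|=o\big(n^{-\frac{\gamma}{8}}\log n\big),$$ where $$R_n(p)=U_n^{-1}(p)-t_p-\frac{p-U_n(t_p)}{u(t_p)}.$$
   Context: For $n\ge2$, the empirical $U$-distribution function is $U_n(t)=\frac{2}{n(n-1)}\sum_{1\le i<j\le n}h(X_i,X_j,t)$, and the empirical $U$-quantile is $U_n^{-1}(p)=\inf\{t:U_n(t)\ge p\}$, $p\in(0,1)$. By convention $U_0=U_1=0$ and $U_0^{-1}(p)=U_1^{-1}(p)=0$. For $p\in I$, $t_p=U^{-1}(p)$ is the $p$-th $U$-quantile (the unique $t\in[C_1,C_2]$ with $U(t)=p$). Strong mixing: $\alpha(k)=\sup\{|P(A\cap B)-P(A)P(B)|:A\in\mathcal F_1^n,\ B\in\mathcal F_{n+k}^\infty,\ n\in\mathbb{N}\}$, where $\mathcal F_a^l$ is the $\sigma$-field generated by $X_a,\dots,X_l$; $(X_n)$ is strongly mixing if $\alpha(k)\to0$. Absolute regularity: for a stationary process $(Z_n)_{n\in\mathbb{Z}}$, $\beta(k)=\sup_{n\in\mathbb N}E\sup\{|P(A\mid\mathcal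 G_{-\infty}^n)-P(A)|:A\in\mathcal G_{n+k}^\infty\}$, where $\mathcal G_a^l$ is the $\sigma$-field generated by $Z_a,\dots,Z_l$; $(Z_n)$ is absolutely regular if $\beta(k)\to0$. Near epoch dependence: $(X_n)_{n\in\mathbb N}$ is $L^1$ near epoch dependent on $(Z_n)_{n\in\mathbb{Z}}$ with approximation constants $(a_l)_{l\in\mathbb{N}}$ if $E|X_1-E(X_1\mid\mathcal G_{-l}^l)|\le a_l$ for $l=0,1,2,\dots$ and $a_l\to0$. Here $(X_n)$ and $(Z_n)$ are jointly stationary, i.e. the law of $\big((X_{n+j})_{n\in\mathbb{N}},(Z_{n+j})_{n\in\mathbb{Z}}\big)$ does not depend on $j\in\{0,1,2,\dots\}$. *)

theory Defs
  imports "HOL-Probability.Probability" "HOL-Library.Landau_Symbols"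
begin

section \<open>Stationarity\<close>

text \<open>
  One-sided processes are indexed by the positive integers: for \<open>X :: nat \<Rightarrow> _\<close> only the
  variables \<open>X n\<close> with \<open>n \<ge> 1\<close> are ever used, and \<open>X 0\<close> is irrelevant.
\<close>

definition stationary :: "'a measure \<Rightarrow> (nat \<Rightarrow> 'a \<Rightarrow> real) \<Rightarrow> bool" where
  "stationary M X \<longleftrightarrow> (\<forall>j.
     distr M (\<Pi>\<^sub>M n\<in>{1..}. borel) (\<lambda>\<omega>. \<lambda>n\<in>{1..}. X (n + j) \<omega>) =
     distr M (\<Pi>\<^sub>M n\<in>{1..}. borel) (\<lambda>\<omega>. \<lambda>n\<in>{1..}. X n \<omega>))"

definition jointly_stationary ::
  "'a measure \<Rightarrow> (nat \<Rightarrow> 'a \<Rightarrow> real) \<Rightarrow> 'b measure \<Rightarrow> (int \<Rightarrow> 'a \<Rightarrow> 'b) \<Rightarrow> bool" where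
  "jointly_stationary M X S Z \<longleftrightarrow> (\<forall>j::nat.
     distr M ((\<Pi>\<^sub>M n\<in>{1..}. borel) \<Otimes>\<^sub>M (\<Pi>\<^sub>M n\<in>UNIV. S))
       (\<lambda>\<omega>. (\<lambda>n\<in>{1..}. X (n + j) \<omega>, \<lambda>n. Z (n + int j) \<omega>)) =
     distr M ((\<Pi>\<^sub>M n\<in>{1..}. borel) \<Otimes>\<^sub>M (\<Pi>\<^sub>M n\<in>UNIV. S))
       (\<lambda>\<omega>. (\<lambda>n\<in>{1..}. X n \<omega>, \<lambda>n. Z n \<omega>)))"

section \<open>Mixing conditions\<close>

text \<open>The \<open>\<sigma>\<close>-field generated by the \<open>S\<close>-valued random variables \<open>X i\<close>, \<open>i \<in> I\<close>.\<close>

definition generated_field ::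
  "'a measure \<Rightarrow> 'b measure \<Rightarrow> ('i \<Rightarrow> 'a \<Rightarrow> 'b) \<Rightarrow> 'i set \<Rightarrow> 'a measure" where
  "generated_field M S X I =
     sigma (space M) (\<Union>i\<in>I. {X i -` A \<inter> space M | A. A \<in> sets S})"

definition alpha_coeff :: "'a measure \<Rightarrow> (nat \<Rightarrow> 'a \<Rightarrow> real) \<Rightarrow> nat \<Rightarrow> real" where
  "alpha_coeff M X k =
     (SUP (n, A, B) \<in> {(n, A, B). 1 \<le> n \<and>
          A \<in> sets (generated_field M borel X {1..n}) \<and>
          B \<in> sets (generated_field M borel X {n + k..})}.
        \<bar>measure M (A \<inter> B) - measure M A * measure M B\<bar>)"

definition strongly_mixing :: "'a measure \<Rightarrow> (nat \<Rightarrow> 'a \<Rightarrow> real) \<Rightarrow> bool" where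
  "strongly_mixing M X \<longleftrightarrow> alpha_coeff M X \<longlonglongrightarrow> 0"

text \<open>
  Conditional probabilities are only determined up to null sets, and the supremum in the
  coefficient of absolute regularity is over an uncountable family of them. It is
  therefore an essential supremum of a family of functions: the almost surely least measurable
  function that dominates every member of the family almost surely.
\<close>

definition is_family_esssup ::
  "'a measure \<Rightarrow> ('a \<Rightarrow> ennreal) set \<Rightarrow> ('a \<Rightarrow> ennreal) \<Rightarrow> bool" where
  "is_family_esssup M F g \<longleftrightarrow>
     g \<in> borel_measurable M \<and> (\<forall>f\<in>F. AE \<omega> in M. f \<omega> \<le> g \<omega>) \<and>
     (\<forall>g'\<in>borel_measurable M. (\<forall>f\<in>F. AE \<omega> in M. f \<omega> \<le> g' \<omega>) \<longrightarrow> (AE \<omega> in M. g \<omega> \<le> g' \<omega>))"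

definition family_esssup :: "'a measure \<Rightarrow> ('a \<Rightarrow> ennreal) set \<Rightarrow> 'a \<Rightarrow> ennreal" where
  "family_esssup M F = (SOME g. is_family_esssup M F g)"

lemma (in finite_measure) is_family_esssup_family_esssup:
  assumes meas: "F \<subseteq> borel_measurable M"
    and bound: "\<And>f. f \<in> F \<Longrightarrow> AE \<omega> in M. f \<omega> \<le> ennreal c"
  shows "is_family_esssup M F (family_esssup M F)"
proof -
  define J where "J C = (\<integral>\<^sup>+\<omega>. (SUP f\<in>C. f \<omega>) \<partial>M)" for C :: "('a \<Rightarrow> ennreal) set"
  define CC where "CC = {C. countable C \<and> C \<subseteq> F}"
  have ne: "CC \<noteq> {}" by (auto simp: CC_def)
  have mono: "J C \<le> J D" if "C \<subseteq> D" for C D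
    unfolding J_def using that by (intro nn_integral_mono SUP_subset_mono) auto
  obtain A :: "nat \<Rightarrow> ennreal" where A: "range A \<subseteq> J ` CC" "(SUP C\<in>CC. J C) = (SUP n. A n)"
    using ennreal_Sup_countable_SUP[of "J ` CC"] ne by auto
  then have "\<forall>n. \<exists>C\<in>CC. A n = J C" by auto
  then obtain C where C: "\<And>n. C n \<in> CC" "\<And>n. A n = J (C n)" by metis
  define D where "D = (\<Union>n. C n)"
  have D: "D \<in> CC" using C(1) unfolding D_def CC_def by auto
  have top: "J E \<le> J D" if "E \<in> CC" for E
  proof -
    have "J E \<le> (SUP n. A n)" using A(2) that by (metis SUP_upper)
    also have "\<dots> \<le> J D" unfolding C(2) by (intro SUP_least mono) (auto simp: D_def)
    finally show ?thesis .
  qed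
  have Dc: "countable D" and DF: "D \<subseteq> F" using D by (auto simp: CC_def)
  define g where "g \<omega> = (SUP f\<in>D. f \<omega>)" for \<omega>
  have gm: "g \<in> borel_measurable M"
    unfolding g_def using meas DF Dc by (intro borel_measurable_SUP) auto
  have "AE \<omega> in M. \<forall>f\<in>D. f \<omega> \<le> ennreal c"
    using bound DF Dc by (subst AE_ball_countable) auto
  then have "AE \<omega> in M. g \<omega> \<le> ennreal c"
    by eventually_elim (auto simp: g_def intro: SUP_least)
  then have "(\<integral>\<^sup>+\<omega>. g \<omega> \<partial>M) \<le> (\<integral>\<^sup>+\<omega>. ennreal c \<partial>M)"
    by (rule nn_integral_mono_AE)
  also have "\<dots> < \<infinity>" by (simp add: less_top[symmetric] ennreal_mult_eq_top_iff)
  finally have fin: "(\<integral>\<^sup>+\<omega>. g \<omega> \<partial>M) \<noteq> \<infinity>" by simp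
  have upper: "AE \<omega> in M. f \<omega> \<le> g \<omega>" if f: "f \<in> F" for f
  proof -
    have fm: "f \<in> borel_measurable M" using f meas by auto
    have "J (insert f D) \<le> J D" using f Dc DF by (intro top) (auto simp: CC_def)
    then have le: "(\<integral>\<^sup>+\<omega>. sup (f \<omega>) (g \<omega>) \<partial>M) \<le> (\<integral>\<^sup>+\<omega>. g \<omega> \<partial>M)"
      by (simp add: J_def g_def)
    have "(\<integral>\<^sup>+\<omega>. sup (f \<omega>) (g \<omega>) - g \<omega> \<partial>M) = (\<integral>\<^sup>+\<omega>. sup (f \<omega>) (g \<omega>) \<partial>M) - (\<integral>\<^sup>+\<omega>. g \<omega> \<partial>M)"
      using fm gm fin by (intro nn_integral_diff) auto
    also have "\<dots> = 0" using le fin by (simp add: diff_eq_0_iff_ennreal less_top)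
    finally have "AE \<omega> in M. sup (f \<omega>) (g \<omega>) - g \<omega> = 0"
      using fm gm by (subst (asm) nn_integral_0_iff_AE) auto
    then show ?thesis
      by eventually_elim (metis ennreal_minus_eq_0 le_sup_iff)
  qed
  have least: "AE \<omega> in M. g \<omega> \<le> g' \<omega>" if "\<forall>f\<in>F. AE \<omega> in M. f \<omega> \<le> g' \<omega>" for g'
  proof -
    have "AE \<omega> in M. \<forall>f\<in>D. f \<omega> \<le> g' \<omega>"
      using that DF Dc by (subst AE_ball_countable) auto
    then show ?thesis by eventually_elim (auto simp: g_def intro: SUP_least)
  qed
  have "is_family_esssup M F g"
    using gm upper least by (auto simp: is_family_esssup_def)
  then show ?thesis unfolding family_esssup_def by (rule someI[of "is_family_esssup M F"])
qed

text \<open>\<open>S\<close> is the state space of the process \<open>Z\<close>.\<close>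

definition beta_coeff :: "'a measure \<Rightarrow> 'b measure \<Rightarrow> (int \<Rightarrow> 'a \<Rightarrow> 'b) \<Rightarrow> nat \<Rightarrow> real" where
  "beta_coeff M S Z k =
     enn2real (SUP n\<in>{1::nat..}.
       \<integral>\<^sup>+\<omega>. family_esssup M
         ((\<lambda>A \<omega>'. ennreal \<bar>real_cond_exp M (generated_field M S Z {..int n}) (indicator A) \<omega>'
                          - measure M A\<bar>)
            ` sets (generated_field M S Z {int n + int k..})) \<omega> \<partial>M)"

definition absolutely_regular :: "'a measure \<Rightarrow> 'b measure \<Rightarrow> (int \<Rightarrow> 'a \<Rightarrow> 'b) \<Rightarrow> bool" where
  "absolutely_regular M S Z \<longleftrightarrow> beta_coeff M S Z \<longlonglongrightarrow> 0"

text \<open>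
  Integrability of \<open>X 1\<close> is implicit in the existence of its conditional expectations; it has to
  be demanded here because Bochner integrals of non-integrable functions are \<open>0\<close>.
\<close>

definition near_epoch_dependent ::
  "'a measure \<Rightarrow> (nat \<Rightarrow> 'a \<Rightarrow> real) \<Rightarrow> 'b measure \<Rightarrow> (int \<Rightarrow> 'a \<Rightarrow> 'b) \<Rightarrow> (nat \<Rightarrow> real) \<Rightarrow> bool" where
  "near_epoch_dependent M X S Z a \<longleftrightarrow>
     jointly_stationary M X S Z \<and> integrable M (X 1) \<and>
     (\<forall>l. (\<integral>\<omega>. \<bar>X 1 \<omega> - real_cond_exp M (generated_field M S Z {- int l..int l}) (X 1) \<omega>\<bar> \<partial>M)
            \<le> a l) \<and>
     a \<longlonglongrightarrow> 0"

section \<open>\<open>U\<close>-distribution functions and \<open>U\<close>-quantiles\<close>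

definition U_distribution ::
  "'c measure \<Rightarrow> ('c \<Rightarrow> real) \<Rightarrow> ('c \<Rightarrow> real) \<Rightarrow> (real \<Rightarrow> real \<Rightarrow> real \<Rightarrow> real) \<Rightarrow> real \<Rightarrow> real" where
  "U_distribution N X Y h t = (\<integral>\<omega>. h (X \<omega>) (Y \<omega>) t \<partial>N)"

definition U_quantile :: "(real \<Rightarrow> real) \<Rightarrow> real \<Rightarrow> real \<Rightarrow> real \<Rightarrow> real" where
  "U_quantile U C1 C2 p = (THE t. t \<in> {C1..C2} \<and> U t = p)"

definition emp_U ::
  "(real \<Rightarrow> real \<Rightarrow> real \<Rightarrow> real) \<Rightarrow> (nat \<Rightarrow> 'a \<Rightarrow> real) \<Rightarrow> nat \<Rightarrow> real \<Rightarrow> 'a \<Rightarrow> real" where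
  "emp_U h X n t \<omega> = (if n < 2 then 0 else
     2 / (real n * (real n - 1)) * (\<Sum>i=1..n. \<Sum>j=i+1..n. h (X i \<omega>) (X j \<omega>) t))"

definition emp_U_quantile ::
  "(real \<Rightarrow> real \<Rightarrow> real \<Rightarrow> real) \<Rightarrow> (nat \<Rightarrow> 'a \<Rightarrow> real) \<Rightarrow> nat \<Rightarrow> real \<Rightarrow> 'a \<Rightarrow> real" where
  "emp_U_quantile h X n p \<omega> = (if n < 2 then 0 else Inf {t. p \<le> emp_U h X n t \<omega>})"

text \<open>The remainder \<open>R\<^sub>n(p)\<close> of the Bahadur representation; \<open>u\<close> is the derivative of \<open>U\<close>.\<close>

definition bahadur_remainder ::
  "(real \<Rightarrow> real \<Rightarrow> real \<Rightarrow> real) \<Rightarrow> (nat \<Rightarrow> 'a \<Rightarrow> real) \<Rightarrow> (real \<Rightarrow> real) \<Rightarrow> (real \<Rightarrow> real) \<Rightarrow>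
   real \<Rightarrow> real \<Rightarrow> nat \<Rightarrow> real \<Rightarrow> 'a \<Rightarrow> real" where
  "bahadur_remainder h X U u C1 C2 n p \<omega> =
     (let tp = U_quantile U C1 C2 p
      in emp_U_quantile h X n p \<omega> - tp - (p - emp_U h X n tp \<omega>) / u tp)"

section \<open>Conditions on the kernel\<close>

text \<open>
  The supremum over a ball need not be Borel measurable in \<open>\<omega>\<close>, but it is measurable with respect
  to the completion of \<open>N\<close>. The nonnegative integral takes the same value on \<open>N\<close> and on its
  completion (\<open>nn_integral_completion\<close>), whereas the Bochner integral would be \<open>0\<close>
  for a function that is not measurable. The norm on \<open>real \<times> real\<close> is the Euclidean one.
\<close>

definition variation_condition ::
  "'c measure \<Rightarrow> ('c \<Rightarrow> real) \<Rightarrow> ('c \<Rightarrow> real) \<Rightarrow> (real \<Rightarrow> real \<Rightarrow> real \<Rightarrow> real) \<Rightarrow> bool" where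
  "variation_condition N X Y h \<longleftrightarrow> (\<exists>L::real. \<forall>t. \<forall>\<epsilon>>0.
     (\<integral>\<^sup>+\<omega>. (SUP (x, y)\<in>{(x, y). norm ((x, y) - (X \<omega>, Y \<omega>)) \<le> \<epsilon>}.
              ennreal \<bar>h x y t - h (X \<omega>) (Y \<omega>) t\<bar>) \<partial>N) \<le> ennreal (L * \<epsilon>))"

end

theory Submission
 imports Defs "HOL-Real_Asymp.Real_Asymp"
begin

text \<open>
Bahadur's argument compares the quantile of a monotone function \<open>U\<^sub>m\<close> with that of \<open>U\<close>: the
remainder \<open>R\<^sub>m(p)\<close> is at most a constant times the oscillation of \<open>U\<^sub>m - U\<close> around \<open>t\<^sub>p\<close>, on an
interval as long as the uniform distance of \<open>U\<^sub>m\<close> and \<open>U\<close>, plus the error of the first order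
expansion of \<open>U\<close> there (lemma \<open>bahadur_bound_at_point\<close>). It is shown that almost surely, for all
large \<open>l\<close> and all \<open>2^(l-1) \<le> m < 2^l\<close>, the uniform distance is \<open>O(l^(1/2) 2^(-l/2))\<close> and the
oscillation is \<open>O(l^(3/4) 2^(-(1/2 + \<gamma>/8) l))\<close>; the expansion error is then
\<open>O(l^(5/8) 2^(-5l/8))\<close>, which is smaller because \<open>\<gamma> < 1\<close>. The supremum over \<open>s\<close> costs nothing
because the resulting bound for \<open>m |R\<^sub>m(p)|\<close> is increasing in \<open>m\<close>, and the exponent \<open>3/4 < 1\<close> of
the logarithm leaves room for the \<open>o\<close>.

The Hoeffding decomposition splits \<open>U\<^sub>m - U\<close> into \<open>2/m\<close> times the sum of \<open>g(X\<^sub>i, t) - U(t)\<close>, where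
\<open>g(x, t) = E h(x, Y, t)\<close>, and a degenerate part.

For the linear part, \<open>g(_, t') - g(_, t)\<close> has values in \<open>[0, 1]\<close> and a mean of order \<open>\<delta> = t' - t\<close>.
Decorrelation at the rate \<open>(1 + r)^(-A)\<close>, with \<open>\<gamma> = 1 - 2/A\<close>, and the trivial bound \<open>\<delta>\<close> together
give a fourth moment of order \<open>m^2 \<delta>^(1 + \<gamma>) + m \<delta>^(1 - 7/(2A))\<close> for blocks of length \<open>m\<close> (lemma
\<open>fourth_moment_observable\<close>). A dyadic maximal inequality in \<open>m\<close> and dyadic chaining in \<open>t\<close> turn
this into the two uniform bounds: chaining from the coarsest grid gives the distance, chaining
from mesh about \<open>l 2^(-l/2)\<close> gives the oscillation. The exponent \<open>1 + \<gamma> > 1\<close> pays for the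
number of grid points, and Markov's inequality and the Borel--Cantelli lemma finish the argument.

The degenerate part must be small although \<open>h\<close> is regular only on average and the arguments
are dependent. The tool is a coupling (lemma \<open>ex_coupling_measure\<close>): under strong mixing, a
random variable can be exchanged for an independent copy that differs from it by at most \<open>e\<close>,
up to a small loss of mass. Since the marginals of the coupling are dominated by the correct
laws, the averaged regularity of \<open>h\<close> survives the exchange. Consequently
\<open>E d(X\<^sub>i, X\<^sub>j) d(X\<^sub>k, X\<^sub>r)\<close> is small whenever the first or the last of the four indices is
isolated, which makes the degenerate sum over pairs of distance more than \<open>2^(3l/8)\<close> small in
second moment; the remaining pairs are few enough to be bounded trivially.

Both dependence conditions of the theorem are instances of one locale (\<open>dependent_process\<close>): there are
approximations \<open>V l i\<close> of \<open>X i\<close> that depend on the past up to time \<open>i + l\<close> and on the future from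
time \<open>i - l - 1\<close>, and these fields are polynomially mixing. Under strong mixing \<open>V l i = X i\<close>;
under near epoch dependence \<open>V l i\<close> is a shifted version of the conditional expectation of \<open>X 1\<close>
given the window \<open>Z\<^bsub>-l\<^esub>, \<dots>, Z\<^bsub>l\<^esub>\<close>. Absolute regularity enters only through \<open>\<alpha> \<le> \<beta>\<close>.
\<close>

section \<open>Integrals of oscillations under couplings\<close>

text \<open>The function \<open>f\<close> may be non-measurable, like an oscillation over balls. Simple functions below
\<open>f\<close> pull back along \<open>T\<close>, hence one inequality survives.\<close>
lemma nn_integral_distr_le:
 assumes T: "T \<in> measurable M N"
 shows "(\<integral>\<^sup>+x. f x \<partial>distr M N T) \<le> (\<integral>\<^sup>+x. f (T x) \<partial>M)"
 unfolding nn_integral_def[of "distr M N T" f]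
proof (rule SUP_least, safe)
 fix g assume g: "simple_function (distr M N T) g" "g \<le> f"
 have gm: "g \<in> borel_measurable N" using borel_measurable_simple_function[OF g(1)] by simp
 have "integral\<^sup>S (distr M N T) g = (\<integral>\<^sup>+x. g x \<partial>distr M N T)"
  by (rule nn_integral_eq_simple_integral[symmetric, OF g(1)])
 also have "\<dots> = (\<integral>\<^sup>+x. g (T x) \<partial>M)" using T gm by (simp add: nn_integral_distr)
 also have "\<dots> \<le> (\<integral>\<^sup>+x. f (T x) \<partial>M)"
  using g(2) by (intro nn_integral_mono) (auto simp: le_fun_def)
 finally show "integral\<^sup>S (distr M N T) g \<le> (\<integral>\<^sup>+x. f (T x) \<partial>M)" .
qed

text \<open>A measurable minorant of a possibly non-measurable \<open>f\<close>. By inner regularity the superlevel sets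
of \<open>G\<close> are exhausted by compact sets, whose projections are compact, hence Borel, and lie in
the superlevel sets of \<open>f\<close>. Averaging the indicators of these projections over \<open>N\<close> levels gives
a Borel function below \<open>f\<close> that misses the integral of \<open>G\<close> by \<open>O(1/N)\<close>.\<close>
lemma nn_integral_le_nn_integral_marginal:
 fixes \<pi> :: "('a::{second_countable_topology, complete_space} \<times> 'b::{second_countable_topology, complete_space}) measure"
  and G :: "'a \<times> 'b \<Rightarrow> real" and f :: "'b \<Rightarrow> ennreal"
 assumes fin: "finite_measure \<pi>" and s: "sets \<pi> = sets borel"
  and G[measurable]: "G \<in> borel_measurable borel"
  and G01: "\<And>p. 0 \<le> G p" "\<And>p. G p \<le> 1"
  and le: "\<And>a b. ennreal (G (a, b)) \<le> f b"
 shows "(\<integral>\<^sup>+p. ennreal (G p) \<partial>\<pi>) \<le> (\<integral>\<^sup>+b. f b \<partial>distr \<pi> borel snd)"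
proof -
 interpret finite_measure \<pi> by fact
 have sp: "space \<pi> = UNIV" using sets_eq_imp_space_eq[OF s] by simp
 have [measurable]: "G \<in> borel_measurable \<pi>" using G s by (simp cong: measurable_cong_sets)
 have snd_m: "snd \<in> measurable \<pi> borel"
  using s by (simp add: measurable_cong_sets[OF s refl] borel_measurable_continuous_onI continuous_on_snd continuous_on_id)
 define \<nu> where "\<nu> = distr \<pi> borel (snd :: 'a \<times> 'b \<Rightarrow> 'b)"
 have main: "(\<integral>\<^sup>+p. ennreal (G p) \<partial>\<pi>) \<le> (\<integral>\<^sup>+b. f b \<partial>\<nu>) + ennreal ((measure \<pi> (space \<pi>) + 1) / real N)"
  if N: "N > 0" for N :: nat
 proof -
  \<comment> \<open>layers of \<open>G\<close>: \<open>G\<close> is within \<open>1/N\<close> of the average of their indicators\<close>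
  define E where "E i = {p. G p > real i / real N}" for i
  have Em: "E i \<in> sets borel" for i unfolding E_def by measurable
  have "\<exists>K. K \<subseteq> E i \<and> compact K \<and> emeasure \<pi> (E i) \<le> emeasure \<pi> K + ennreal (1 / real N)" for i
  proof -
   have 1: "emeasure \<pi> (E i) = (SUP K \<in> {K. K \<subseteq> E i \<and> compact K}. emeasure \<pi> K)"
    using inner_regular[OF s _ Em] by simp
   have 2: "{K. K \<subseteq> E i \<and> compact K} \<noteq> {}" by auto
   have 3: "0 < 1 / real N" using N by simp
   have 4: "emeasure \<pi> (E i) \<noteq> \<infinity>" by simp
   obtain L where "L \<in> {K. K \<subseteq> E i \<and> compact K}" "emeasure \<pi> (E i) < emeasure \<pi> L + ennreal (1 / real N)"
    using SUP_approx_ennreal[OF 3 2 1 4] by blast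
   then show ?thesis by (auto intro: less_imp_le)
  qed
  then have "\<forall>i. \<exists>K. K \<subseteq> E i \<and> compact K \<and> emeasure \<pi> (E i) \<le> emeasure \<pi> K + ennreal (1 / real N)"
   by blast
  from choice[OF this] obtain K where K: "\<And>i. K i \<subseteq> E i" "\<And>i. compact (K i)"
    "\<And>i. emeasure \<pi> (E i) \<le> emeasure \<pi> (K i) + ennreal (1 / real N)" by blast
  have cK: "compact (snd ` K i)" for i
   using K(2) by (intro compact_continuous_image continuous_on_snd continuous_on_id) auto
  have Lm[measurable]: "snd ` K i \<in> sets borel" for i
   by (intro borel_closed compact_imp_closed cK)
  have Km: "K i \<in> sets \<pi>" for i
   unfolding s by (intro borel_closed compact_imp_closed K(2))
  define g where "g b = (\<Sum>i\<in>{1..N}. indicator (snd ` K i) b / real N)" for b :: 'b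
  have g0: "0 \<le> g b" for b unfolding g_def by (intro sum_nonneg) auto
  have gf: "ennreal (g b) \<le> f b" for b
  proof (cases "\<exists>i\<in>{1..N}. b \<in> snd ` K i")
   case False
   then have "g b = 0" unfolding g_def by (intro sum.neutral) auto
   then show ?thesis by simp
  next
   case True
   define m where "m = Max {i\<in>{1..N}. b \<in> snd ` K i}"
   have m: "m \<in> {i\<in>{1..N}. b \<in> snd ` K i}" unfolding m_def using True by (intro Max_in) auto
   have "g b \<le> (\<Sum>i\<in>{1..N}. (if i \<le> m then 1 / real N else 0))"
    unfolding g_def
   proof (intro sum_mono)
    fix i assume i: "i \<in> {1..N}"
    show "indicator (snd ` K i) b / real N \<le> (if i \<le> m then 1 / real N else 0)"
     using i Max_ge[of "{i\<in>{1..N}. b \<in> snd ` K i}" i]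
     by (auto simp: m_def indicator_def divide_simps)
   qed
   also have "\<dots> = (\<Sum>i\<in>{1..m}. 1 / real N)"
    using m by (intro sum.mono_neutral_cong_right) auto
   also have "\<dots> = real m / real N" by simp
   finally have 1: "g b \<le> real m / real N" .
   from m obtain a where "(a, b) \<in> K m" by auto
   then have "(a, b) \<in> E m" using K(1) by auto
   then have "g b \<le> G (a, b)" using 1 by (simp add: E_def)
   then have "ennreal (g b) \<le> ennreal (G (a, b))" by (rule ennreal_leI)
   also have "\<dots> \<le> f b" by (rule le)
   finally show ?thesis .
  qed
  have Gle: "G p \<le> 1 / real N + (\<Sum>i\<in>{1..N}. indicator (E i) p / real N)" for p
  proof -
   define c where "c = nat \<lceil>real N * G p\<rceil>"
   have NG: "0 \<le> real N * G p" using G01(1)[of p] by simp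
   have "real N * G p \<le> real N" using G01(2)[of p] mult_left_le[of "G p" "real N"] by simp
   then have cN: "c \<le> N" unfolding c_def by linarith
   have c1: "real N * G p \<le> real c" unfolding c_def by linarith
   have c2: "real i < real N * G p" if "i < c" for i using that unfolding c_def by linarith
   have "(\<Sum>i\<in>{1..<c}. 1 / real N) = (\<Sum>i\<in>{1..<c}. indicator (E i) p / real N)"
    using c2 N by (intro sum.cong) (auto simp: E_def indicator_def field_simps)
   also have "\<dots> \<le> (\<Sum>i\<in>{1..N}. indicator (E i) p / real N)"
    using cN by (intro sum_mono2) auto
   finally have "real (c - 1) / real N \<le> (\<Sum>i\<in>{1..N}. indicator (E i) p / real N)" by simp
   moreover have "G p \<le> 1 / real N + real (c - 1) / real N"
    using c1 N by (cases c) (auto simp: field_simps)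
   ultimately show ?thesis by linarith
  qed
  have iE: "integrable \<pi> (indicator (E i) :: _ \<Rightarrow> real)" for i
   using Em s by (intro integrable_real_indicator) (auto simp: emeasure_eq_measure)
  have "(\<integral>\<^sup>+p. ennreal (G p) \<partial>\<pi>) \<le> (\<integral>\<^sup>+p. ennreal (1 / real N + (\<Sum>i\<in>{1..N}. indicator (E i) p / real N)) \<partial>\<pi>)"
   using Gle by (intro nn_integral_mono ennreal_leI) auto
  also have "\<dots> = ennreal (\<integral>p. (1 / real N + (\<Sum>i\<in>{1..N}. indicator (E i) p / real N)) \<partial>\<pi>)"
  proof (intro nn_integral_eq_integral AE_I2)
   show "integrable \<pi> (\<lambda>p. 1 / real N + (\<Sum>i\<in>{1..N}. indicator (E i) p / real N))"
    using iE by (intro Bochner_Integration.integrable_add Bochner_Integration.integrable_sum integrable_divide) auto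
  qed (auto intro!: sum_nonneg add_nonneg_nonneg)
  also have "(\<integral>p. (1 / real N + (\<Sum>i\<in>{1..N}. indicator (E i) p / real N)) \<partial>\<pi>)
    = measure \<pi> (space \<pi>) / real N + (\<Sum>i\<in>{1..N}. measure \<pi> (E i) / real N)"
  proof -
   have "(\<integral>p. (\<Sum>i\<in>{1..N}. indicator (E i) p / real N) \<partial>\<pi>) = (\<Sum>i\<in>{1..N}. \<integral>p. indicator (E i) p / real N \<partial>\<pi>)"
    using iE by (intro Bochner_Integration.integral_sum integrable_divide)
   also have "\<dots> = (\<Sum>i\<in>{1..N}. measure \<pi> (E i) / real N)" by (simp add: sp)
   finally have 1: "(\<integral>p. (\<Sum>i\<in>{1..N}. indicator (E i) p / real N) \<partial>\<pi>) = (\<Sum>i\<in>{1..N}. measure \<pi> (E i) / real N)" .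
   have "integrable \<pi> (\<lambda>p. \<Sum>i\<in>{1..N}. indicator (E i) p / real N :: real)"
    using iE by (intro Bochner_Integration.integrable_sum integrable_divide)
   then show ?thesis by (subst Bochner_Integration.integral_add) (auto simp: 1[simplified])
  qed
  also have "\<dots> \<le> measure \<pi> (space \<pi>) / real N + (\<Sum>i\<in>{1..N}. (measure \<pi> (K i) + 1 / real N) / real N)"
  proof (intro add_left_mono sum_mono divide_right_mono)
   fix i
   have "ennreal (measure \<pi> (E i)) \<le> ennreal (measure \<pi> (K i) + 1 / real N)"
    using K(3)[of i] by (simp add: emeasure_eq_measure)
   then show "measure \<pi> (E i) \<le> measure \<pi> (K i) + 1 / real N" by (subst (asm) ennreal_le_iff) auto
  qed auto
  also have "\<dots> \<le> measure \<pi> (space \<pi>) / real N + (\<Sum>i\<in>{1..N}. (measure \<nu> (snd ` K i) + 1 / real N) / real N)"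
  proof (intro add_left_mono sum_mono divide_right_mono add_right_mono)
   fix i
   have "measure \<nu> (snd ` K i) = measure \<pi> (snd -` (snd ` K i) \<inter> space \<pi>)"
    unfolding \<nu>_def using snd_m by (subst measure_distr) auto
   moreover have "measure \<pi> (K i) \<le> measure \<pi> (snd -` (snd ` K i) \<inter> space \<pi>)"
    using snd_m by (intro finite_measure_mono measurable_sets[OF snd_m Lm]) (auto simp: sp)
   ultimately show "measure \<pi> (K i) \<le> measure \<nu> (snd ` K i)" by simp
  qed auto
  also have "\<dots> = (measure \<pi> (space \<pi>) + 1) / real N + (\<Sum>i\<in>{1..N}. measure \<nu> (snd ` K i) / real N)"
   using N by (simp add: add_divide_distrib sum.distrib)
  finally have A: "(\<integral>\<^sup>+p. ennreal (G p) \<partial>\<pi>) \<le> ennreal ((measure \<pi> (space \<pi>) + 1) / real N + (\<Sum>i\<in>{1..N}. measure \<nu> (snd ` K i) / real N))"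
   by (simp add: ennreal_leI)
  interpret \<nu>: finite_measure \<nu> unfolding \<nu>_def using snd_m by (rule finite_measure_distr)
  have "ennreal (\<Sum>i\<in>{1..N}. measure \<nu> (snd ` K i) / real N) = ennreal (\<integral>b. g b \<partial>\<nu>)"
   unfolding g_def using Lm by (subst Bochner_Integration.integral_sum) (auto simp: \<nu>_def intro!: integrable_real_indicator simp: emeasure_eq_measure \<nu>.emeasure_eq_measure[unfolded \<nu>_def])
  also have "\<dots> = (\<integral>\<^sup>+b. ennreal (g b) \<partial>\<nu>)"
  proof (intro nn_integral_eq_integral[symmetric] AE_I2 g0)
   show "integrable \<nu> g" unfolding g_def using Lm
    by (intro Bochner_Integration.integrable_sum integrable_divide) (auto simp: \<nu>_def intro!: integrable_real_indicator simp: \<nu>.emeasure_eq_measure[unfolded \<nu>_def])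
  qed
  also have "\<dots> \<le> (\<integral>\<^sup>+b. f b \<partial>\<nu>)" using gf by (intro nn_integral_mono) auto
  finally have B: "ennreal (\<Sum>i\<in>{1..N}. measure \<nu> (snd ` K i) / real N) \<le> (\<integral>\<^sup>+b. f b \<partial>\<nu>)" .
  define T where "T = (\<Sum>i\<in>{1..N}. measure \<nu> (snd ` K i) / real N)"
  have T0: "0 \<le> T" unfolding T_def by (intro sum_nonneg) auto
  have "(\<integral>\<^sup>+p. ennreal (G p) \<partial>\<pi>) \<le> ennreal ((measure \<pi> (space \<pi>) + 1) / real N + T)"
   using A by (simp only: T_def)
  also have "\<dots> = ennreal ((measure \<pi> (space \<pi>) + 1) / real N) + ennreal T"
   by (rule ennreal_plus) (use T0 in auto)
  also have "\<dots> \<le> ennreal ((measure \<pi> (space \<pi>) + 1) / real N) + (\<integral>\<^sup>+b. f b \<partial>\<nu>)"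
   using B unfolding T_def by (rule add_left_mono)
  finally show ?thesis by (simp only: add.commute)
 qed
 have "(\<lambda>N. (\<integral>\<^sup>+b. f b \<partial>\<nu>) + ennreal ((measure \<pi> (space \<pi>) + 1) / real N)) \<longlonglongrightarrow> (\<integral>\<^sup>+b. f b \<partial>\<nu>) + ennreal 0"
  by (intro tendsto_add tendsto_const tendsto_ennrealI real_tendsto_divide_at_top[OF tendsto_const] filterlim_real_sequentially)
 then have "(\<integral>\<^sup>+p. ennreal (G p) \<partial>\<pi>) \<le> (\<integral>\<^sup>+b. f b \<partial>\<nu>) + ennreal 0"
  using main by (intro LIMSEQ_le_const) (auto intro!: exI[of _ 1])
 then show ?thesis by (simp add: \<nu>_def)
qed

lemma nn_integral_coupled_le:
 fixes a :: "'q \<Rightarrow> 'a::{second_countable_topology, complete_space}"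
  and w :: "'q \<Rightarrow> 'b::{second_countable_topology, complete_space}"
  and G :: "'a \<times> 'b \<Rightarrow> real" and f :: "'b \<Rightarrow> ennreal"
 assumes fin: "finite_measure Q"
  and [measurable]: "a \<in> borel_measurable Q" "w \<in> borel_measurable Q"
  and G[measurable]: "G \<in> borel_measurable borel"
  and G01: "\<And>p. 0 \<le> G p" "\<And>p. G p \<le> 1"
  and le: "\<And>x y. ennreal (G (x, y)) \<le> f y"
  and s: "sets \<mu> = sets borel"
  and dom: "\<And>E. E \<in> sets borel \<Longrightarrow> emeasure Q (w -` E \<inter> space Q) \<le> emeasure \<mu> E"
 shows "(\<integral>\<^sup>+q. ennreal (G (a q, w q)) \<partial>Q) \<le> (\<integral>\<^sup>+y. f y \<partial>\<mu>)"
proof -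
 interpret finite_measure Q by fact
 have aw: "(\<lambda>q. (a q, w q)) \<in> measurable Q borel" by measurable
 define \<pi> where "\<pi> = distr Q borel (\<lambda>q. (a q, w q))"
 have "(\<integral>\<^sup>+q. ennreal (G (a q, w q)) \<partial>Q) = (\<integral>\<^sup>+p. ennreal (G p) \<partial>\<pi>)"
  unfolding \<pi>_def using aw by (subst nn_integral_distr) auto
 also have "\<dots> \<le> (\<integral>\<^sup>+y. f y \<partial>distr \<pi> borel snd)"
  using G01 le unfolding \<pi>_def
  by (intro nn_integral_le_nn_integral_marginal finite_measure_distr[OF aw]) auto
 also have "distr \<pi> borel snd = distr Q borel w"
 proof -
  have "snd \<in> measurable (borel :: ('a \<times> 'b) measure) (borel :: 'b measure)"
   by (intro borel_measurable_continuous_onI continuous_on_snd continuous_on_id)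
  then show ?thesis unfolding \<pi>_def using aw by (subst distr_distr) (auto simp: comp_def)
 qed
 also have "(\<integral>\<^sup>+y. f y \<partial>distr Q borel w) \<le> (\<integral>\<^sup>+y. f y \<partial>\<mu>)"
  using s dom by (intro nn_integral_mono_measure) (auto simp: le_measure emeasure_distr)
 finally show ?thesis .
qed

lemma borel_measurable_fst_snd [measurable]:
 "fst \<in> measurable (borel :: ('a::second_countable_topology \<times> 'b::second_countable_topology) measure) borel"
 "snd \<in> measurable (borel :: ('a::second_countable_topology \<times> 'b::second_countable_topology) measure) borel"
 by (intro borel_measurable_continuous_onI continuous_on_fst continuous_on_snd continuous_on_id)+

definition osc :: "(real \<times> real \<Rightarrow> real) \<Rightarrow> real \<Rightarrow> real \<times> real \<Rightarrow> ennreal" where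
 "osc k e w = (SUP v\<in>{v. norm (v - w) \<le> e}. ennreal \<bar>k v - k w\<bar>)"

lemma osc_upper: "norm (v - w) \<le> e \<Longrightarrow> ennreal \<bar>k v - k w\<bar> \<le> osc k e w"
 unfolding osc_def by (intro SUP_upper) auto

lemma osc_le_one:
 assumes "\<And>p. 0 \<le> k p" "\<And>p. k p \<le> 1"
 shows "osc k e w \<le> 1"
 unfolding osc_def
proof (intro SUP_least)
 fix v
 have "\<bar>k v - k w\<bar> \<le> 1" using assms(1)[of v] assms(2)[of v] assms(1)[of w] assms(2)[of w] by linarith
 then show "ennreal \<bar>k v - k w\<bar> \<le> 1" using ennreal_leI by fastforce
qed

lemma osc_shift:
 assumes "norm (a - w) \<le> d" "0 \<le> e"
 shows "osc k e a \<le> 2 * osc k (e + d) w"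
 unfolding osc_def[of k e a]
proof (intro SUP_least, safe)
 fix v1 v2 assume "norm ((v1, v2) - a) \<le> e"
 then have v: "norm ((v1, v2) - w) \<le> e + d"
  using assms(1) norm_triangle_ineq[of "(v1, v2) - a" "a - w"] by simp
 have a: "norm (a - w) \<le> e + d" using assms by simp
 have "ennreal \<bar>k (v1, v2) - k a\<bar> \<le> ennreal (\<bar>k (v1, v2) - k w\<bar> + \<bar>k a - k w\<bar>)"
  by (intro ennreal_leI) linarith
 also have "\<dots> = ennreal \<bar>k (v1, v2) - k w\<bar> + ennreal \<bar>k a - k w\<bar>" by simp
 also have "\<dots> \<le> osc k (e + d) w + osc k (e + d) w"
  by (intro add_mono osc_upper v a)
 finally show "ennreal \<bar>k (v1, v2) - k a\<bar> \<le> 2 * osc k (e + d) w" by (simp add: mult_2)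
qed

text \<open>Where the two points are \<open>e\<close>-close the difference is at most the oscillation of \<open>k\<close> at \<open>w\<close>, whose
integral only grows when the law of \<open>w\<close> is replaced by the dominating \<open>\<mu>\<close>.\<close>
lemma nn_integral_kernel_diff_le:
 assumes fin: "finite_measure Q"
  and [measurable]: "v \<in> borel_measurable Q" "w \<in> borel_measurable Q"
  and k[measurable]: "k \<in> borel_measurable borel"
  and k01: "\<And>p. 0 \<le> k p" "\<And>p. k p \<le> 1"
  and s: "sets \<mu> = sets borel"
  and dom: "\<And>E. E \<in> sets borel \<Longrightarrow> emeasure Q (w -` E \<inter> space Q) \<le> emeasure \<mu> E"
 shows "(\<integral>\<^sup>+q. ennreal \<bar>k (v q) - k (w q)\<bar> \<partial>Q)
    \<le> (\<integral>\<^sup>+x. osc k e x \<partial>\<mu>) + emeasure Q {q\<in>space Q. e < norm (v q - w q)}"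
proof -
 define G where "G p = \<bar>k (fst p) - k (snd p)\<bar> * (if norm (fst p - snd p) \<le> e then 1 else 0)" for p
 have Gm: "G \<in> borel_measurable borel" unfolding G_def by measurable
 have kd: "\<bar>k x - k y\<bar> \<le> 1" for x y
  using k01(1)[of x] k01(2)[of x] k01(1)[of y] k01(2)[of y] by linarith
 have "(\<integral>\<^sup>+q. ennreal \<bar>k (v q) - k (w q)\<bar> \<partial>Q)
   \<le> (\<integral>\<^sup>+q. ennreal (G (v q, w q)) + indicator {q\<in>space Q. e < norm (v q - w q)} q \<partial>Q)"
 proof (rule nn_integral_mono)
  fix q assume "q \<in> space Q"
  then show "ennreal \<bar>k (v q) - k (w q)\<bar> \<le> ennreal (G (v q, w q)) + indicator {q\<in>space Q. e < norm (v q - w q)} q"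
   using ennreal_leI[OF kd[of "v q" "w q"]] by (auto simp: G_def indicator_def)
 qed
 also have "\<dots> = (\<integral>\<^sup>+q. ennreal (G (v q, w q)) \<partial>Q) + emeasure Q {q\<in>space Q. e < norm (v q - w q)}"
 proof -
  have "(\<lambda>q. (v q, w q)) \<in> measurable Q borel" by measurable
  from measurable_compose[OF this Gm] have [measurable]: "(\<lambda>q. G (v q, w q)) \<in> borel_measurable Q" .
  show ?thesis by (subst nn_integral_add) (auto simp: nn_integral_indicator)
 qed
 also have "(\<integral>\<^sup>+q. ennreal (G (v q, w q)) \<partial>Q) \<le> (\<integral>\<^sup>+x. osc k e x \<partial>\<mu>)"
 proof (rule nn_integral_coupled_le[OF fin _ _ Gm _ _ _ s dom])
  show "0 \<le> G p" "G p \<le> 1" for p using kd unfolding G_def by auto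
  show "ennreal (G (x, y)) \<le> osc k e y" for x y
   using osc_upper[of x y e k] by (auto simp: G_def)
 qed auto
 finally show ?thesis by (simp add: add_right_mono)
qed

text \<open>The regularity of the kernel is given under the law of independent copies, but it is needed
under the laws of their approximations. A ball around \<open>a\<close> lies in a slightly larger ball
around \<open>w\<close>; the factor 2 comes from comparing both \<open>k v\<close> and \<open>k a\<close> with \<open>k w\<close>.\<close>
lemma nn_integral_osc_transfer:
 assumes fin: "finite_measure Q"
  and a[measurable]: "a \<in> borel_measurable Q" and w[measurable]: "w \<in> borel_measurable Q"
  and k01: "\<And>p. 0 \<le> k p" "\<And>p. k p \<le> 1"
  and s: "sets \<mu> = sets borel"
  and dom: "\<And>E. E \<in> sets borel \<Longrightarrow> emeasure Q (w -` E \<inter> space Q) \<le> emeasure \<mu> E"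
  and e: "0 \<le> e"
 shows "(\<integral>\<^sup>+x. osc k e x \<partial>distr Q borel a)
    \<le> 2 * (\<integral>\<^sup>+x. osc k (e + d) x \<partial>\<mu>) + emeasure Q {q\<in>space Q. d < norm (a q - w q)}"
 unfolding nn_integral_def[of "distr Q borel a"]
proof (rule SUP_least, safe)
 fix g assume g: "simple_function (distr Q borel a) g" "g \<le> osc k e"
 have gm[measurable]: "g \<in> borel_measurable borel" using borel_measurable_simple_function[OF g(1)] by simp
 have gle: "g x \<le> osc k e x" for x using g(2) unfolding le_fun_def by blast
 then have g1: "g x \<le> 1" for x using osc_le_one[of k e x] k01 order_trans by blast
 have gr: "g x = ennreal (enn2real (g x))" for x
  using g1[of x] by (metis ennreal_enn2real ennreal_one_less_top le_less_trans)
 have gr1: "enn2real (g x) \<le> 1" for x using g1[of x] enn2real_leI by fastforce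
 define G where "G p = enn2real (g (fst p)) / 2 * (if norm (fst p - snd p) \<le> d then 1 else 0)" for p
 have Gm: "G \<in> borel_measurable borel" unfolding G_def by measurable
 have "integral\<^sup>S (distr Q borel a) g = (\<integral>\<^sup>+x. g x \<partial>distr Q borel a)"
  by (rule nn_integral_eq_simple_integral[symmetric, OF g(1)])
 also have "\<dots> = (\<integral>\<^sup>+q. g (a q) \<partial>Q)" by (simp add: nn_integral_distr)
 also have "\<dots> \<le> (\<integral>\<^sup>+q. 2 * ennreal (G (a q, w q)) + indicator {q\<in>space Q. d < norm (a q - w q)} q \<partial>Q)"
 proof (rule nn_integral_mono)
  fix q assume q: "q \<in> space Q"
  have "2 * ennreal (enn2real (g (a q)) / 2) = ennreal (2 * (enn2real (g (a q)) / 2))"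
   by (subst ennreal_mult) auto
  then show "g (a q) \<le> 2 * ennreal (G (a q, w q)) + indicator {q\<in>space Q. d < norm (a q - w q)} q"
   using q g1[of "a q"] gr[of "a q"] by (auto simp: G_def indicator_def)
 qed
 also have "\<dots> = 2 * (\<integral>\<^sup>+q. ennreal (G (a q, w q)) \<partial>Q) + emeasure Q {q\<in>space Q. d < norm (a q - w q)}"
 proof -
  have "(\<lambda>q. (a q, w q)) \<in> measurable Q borel" by measurable
  from measurable_compose[OF this Gm] have [measurable]: "(\<lambda>q. G (a q, w q)) \<in> borel_measurable Q" .
  show ?thesis by (subst nn_integral_add) (auto simp: nn_integral_indicator nn_integral_cmult)
 qed
 also have "(\<integral>\<^sup>+q. ennreal (G (a q, w q)) \<partial>Q) \<le> (\<integral>\<^sup>+x. osc k (e + d) x \<partial>\<mu>)"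
 proof (rule nn_integral_coupled_le[OF fin _ _ Gm _ _ _ s dom])
  show "0 \<le> G p" "G p \<le> 1" for p using gr1[of "fst p"] unfolding G_def by auto
  show "ennreal (G (x, y)) \<le> osc k (e + d) y" for x y
  proof (cases "norm (x - y) \<le> d")
   case True
   have "ennreal (enn2real (g x)) \<le> 2 * osc k (e + d) y"
    using osc_shift[OF True e, of k] gle[of x] gr[of x] by (metis order_trans)
   then have "ennreal (1/2) * ennreal (enn2real (g x)) \<le> ennreal (1/2) * (ennreal 2 * osc k (e + d) y)"
    by (intro mult_left_mono) auto
   also have "\<dots> = ennreal (1/2 * 2) * osc k (e + d) y"
    by (subst ennreal_mult) (auto simp only: mult.assoc)
   also have "\<dots> = osc k (e + d) y" by simp
   finally have "ennreal (1/2) * ennreal (enn2real (g x)) \<le> osc k (e + d) y" .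
   moreover have "ennreal (G (x, y)) = ennreal (1/2 * enn2real (g x))" using True by (simp add: G_def)
   moreover have "\<dots> = ennreal (1/2) * ennreal (enn2real (g x))" by (rule ennreal_mult) auto
   ultimately show ?thesis by simp
  qed (simp add: G_def)
 qed auto
 finally show "integral\<^sup>S (distr Q borel a) g \<le> 2 * (\<integral>\<^sup>+x. osc k (e + d) x \<partial>\<mu>) + emeasure Q {q\<in>space Q. d < norm (a q - w q)}"
  by (simp add: add_right_mono mult_left_mono)
qed

section \<open>Mixing of two sigma-algebras and an inequality of Khinchine\<close>

definition mixing_bound :: "'a measure \<Rightarrow> 'a measure \<Rightarrow> 'a measure \<Rightarrow> real \<Rightarrow> bool" where
 "mixing_bound M A G \<alpha> \<longleftrightarrow>
   (\<forall>a\<in>sets A. \<forall>b\<in>sets G. \<bar>measure M (a \<inter> b) - measure M a * measure M b\<bar> \<le> \<alpha>)"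

lemma mixing_bound_commute: "mixing_bound M A G \<alpha> \<longleftrightarrow> mixing_bound M G A \<alpha>"
 unfolding mixing_bound_def by (metis Int_commute mult.commute)

definition sgn_ind :: "'a set \<Rightarrow> 'a \<Rightarrow> real" where
 "sgn_ind b x = 2 * indicator b x - 1"

lemma abs_sgn_ind [simp]: "\<bar>sgn_ind b x\<bar> = 1"
 by (auto simp: sgn_ind_def indicator_def)

lemma sgn_ind_measurable: "b \<in> sets G \<Longrightarrow> sgn_ind b \<in> borel_measurable G"
 unfolding sgn_ind_def[abs_def]
 by (intro borel_measurable_diff borel_measurable_times borel_measurable_const borel_measurable_indicator)

context prob_space
begin

lemma integrable_bounded:
 fixes f :: "'a \<Rightarrow> real"
 assumes "f \<in> borel_measurable M" "\<And>x. x \<in> space M \<Longrightarrow> \<bar>f x\<bar> \<le> B"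
 shows "integrable M f"
 using assms by (intro integrable_const_bound[of _ B]) auto

lemma covariance_sgn_ind_le:
 assumes sub: "subalgebra M A" "subalgebra M G"
  and mix: "mixing_bound M A G \<alpha>" and ab: "a \<in> sets A" "b \<in> sets G"
 shows "\<bar>expectation (\<lambda>x. sgn_ind a x * sgn_ind b x) - expectation (sgn_ind a) * expectation (sgn_ind b)\<bar> \<le> 4 * \<alpha>"
proof -
 have [measurable]: "a \<in> events" "b \<in> events" using sub ab by (auto simp: subalgebra_def)
 have ii: "integrable M (indicator c :: 'a \<Rightarrow> real)" if "c \<in> events" for c
  using that by (intro integrable_bounded[of _ 1]) auto
 have ie: "expectation (indicator c) = prob c" if "c \<in> events" for c
  using that by (simp add: Int_absorb2 sets.sets_into_space)
 have e: "expectation (sgn_ind c) = 2 * prob c - 1" if "c \<in> events" for c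
  unfolding sgn_ind_def[abs_def] using ii[OF that] ie[OF that]
  by (subst Bochner_Integration.integral_diff) (auto simp: prob_space)
 have "expectation (\<lambda>x. sgn_ind a x * sgn_ind b x) =
    expectation (\<lambda>x. 4 * indicator (a \<inter> b) x - 2 * indicator a x - 2 * indicator b x + 1)"
  by (intro Bochner_Integration.integral_cong) (auto simp: sgn_ind_def indicator_def)
 also have "\<dots> = 4 * prob (a \<inter> b) - 2 * prob a - 2 * prob b + 1"
  using ii[of "a \<inter> b"] ii[of a] ii[of b] ie[of "a \<inter> b"] ie[of a] ie[of b] by (simp add: prob_space)
 finally have "expectation (\<lambda>x. sgn_ind a x * sgn_ind b x) - expectation (sgn_ind a) * expectation (sgn_ind b)
   = 4 * (prob (a \<inter> b) - prob a * prob b)"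
  by (simp add: e algebra_simps)
 moreover have "\<bar>prob (a \<inter> b) - prob a * prob b\<bar> \<le> \<alpha>"
  using mix ab by (auto simp: mixing_bound_def)
 ultimately show ?thesis by (simp add: abs_mult)
qed

text \<open>The set \<open>b\<close> is where the conditional expectation exceeds the mean, so its sign function turns
the absolute value into a covariance.\<close>
lemma cond_exp_deviation_eq_covariance:
 fixes f :: "'a \<Rightarrow> real"
 assumes sub: "subalgebra M G" and f[measurable]: "f \<in> borel_measurable M"
  and fb: "\<And>x. x \<in> space M \<Longrightarrow> \<bar>f x\<bar> \<le> 1"
 obtains b where "b \<in> sets G"
  "(\<integral>x. \<bar>real_cond_exp M G f x - expectation f\<bar> \<partial>M)
    = expectation (\<lambda>x. f x * sgn_ind b x) - expectation f * expectation (sgn_ind b)"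
proof -
 interpret G: finite_measure_subalgebra M G by unfold_locales (rule sub)
 have fi: "integrable M f" using fb by (intro integrable_bounded[of _ 1]) auto
 define b where "b = {x\<in>space M. 0 \<le> real_cond_exp M G f x - expectation f}"
 have sp: "space G = space M" using sub by (simp add: subalgebra_def)
 have bG: "b \<in> sets G" unfolding b_def sp[symmetric] by measurable
 have [measurable]: "b \<in> events" using bG sub by (auto simp: subalgebra_def)
 have sG: "sgn_ind b \<in> borel_measurable G" using bG by (rule sgn_ind_measurable)
 have sM[measurable]: "sgn_ind b \<in> borel_measurable M" by (rule sgn_ind_measurable) measurable
 have ci: "integrable M (real_cond_exp M G f)" using fi by (rule G.real_cond_exp_int)
 have i1: "integrable M (\<lambda>x. sgn_ind b x * f x)"
  by (rule Bochner_Integration.integrable_bound[OF fi]) (auto simp: abs_mult)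
 have i2: "integrable M (\<lambda>x. sgn_ind b x * real_cond_exp M G f x)"
  by (rule Bochner_Integration.integrable_bound[OF ci]) (auto simp: abs_mult)
 have i3: "integrable M (sgn_ind b)" by (rule integrable_bounded[of _ 1]) auto
 have "(\<integral>x. \<bar>real_cond_exp M G f x - expectation f\<bar> \<partial>M)
   = (\<integral>x. sgn_ind b x * real_cond_exp M G f x - expectation f * sgn_ind b x \<partial>M)"
  by (intro Bochner_Integration.integral_cong) (auto simp: sgn_ind_def b_def indicator_def)
 also have "\<dots> = (\<integral>x. sgn_ind b x * real_cond_exp M G f x \<partial>M) - expectation f * expectation (sgn_ind b)"
  using i2 i3 by simp
 also have "(\<integral>x. sgn_ind b x * real_cond_exp M G f x \<partial>M) = (\<integral>x. sgn_ind b x * f x \<partial>M)"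
  using i1 sG f by (intro G.real_cond_exp_intg) auto
 finally show ?thesis using that[OF bG] by (simp add: mult.commute)
qed

lemma covariance_eq_cond_exp:
 fixes f g :: "'a \<Rightarrow> real"
 assumes sub: "subalgebra M G" and f[measurable]: "f \<in> borel_measurable M"
  and fb: "\<And>x. x \<in> space M \<Longrightarrow> \<bar>f x\<bar> \<le> 1"
  and g: "g \<in> borel_measurable G" and gb: "\<And>x. x \<in> space M \<Longrightarrow> \<bar>g x\<bar> \<le> 1"
 shows "\<bar>expectation (\<lambda>x. f x * g x) - expectation f * expectation g\<bar>
   \<le> (\<integral>x. \<bar>real_cond_exp M G f x - expectation f\<bar> \<partial>M)"
proof -
 interpret G: finite_measure_subalgebra M G by unfold_locales (rule sub)
 have gM[measurable]: "g \<in> borel_measurable M" using measurable_from_subalg[OF sub g] .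
 have fi: "integrable M f" using fb by (intro integrable_bounded[of _ 1]) auto
 have gi: "integrable M g" using gb by (intro integrable_bounded[of _ 1]) auto
 have ci: "integrable M (real_cond_exp M G f)" using fi by (rule G.real_cond_exp_int)
 have i1: "integrable M (\<lambda>x. g x * f x)"
  by (rule Bochner_Integration.integrable_bound[OF fi]) (auto simp: abs_mult intro!: mult_left_le_one_le gb)
 have i2: "integrable M (\<lambda>x. g x * real_cond_exp M G f x)"
  by (rule Bochner_Integration.integrable_bound[OF ci]) (auto simp: abs_mult intro!: mult_left_le_one_le gb)
 have i3: "integrable M (\<lambda>x. \<bar>real_cond_exp M G f x - expectation f\<bar>)" using ci by simp
 have "expectation (\<lambda>x. f x * g x) - expectation f * expectation g
   = (\<integral>x. g x * real_cond_exp M G f x \<partial>M) - expectation f * expectation g"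
  using G.real_cond_exp_intg(2)[OF i1 g f] by (simp add: mult.commute)
 also have "\<dots> = (\<integral>x. g x * (real_cond_exp M G f x - expectation f) \<partial>M)"
  using i2 gi by (simp add: right_diff_distrib)
 finally have "\<bar>expectation (\<lambda>x. f x * g x) - expectation f * expectation g\<bar>
   \<le> (\<integral>x. \<bar>g x * (real_cond_exp M G f x - expectation f)\<bar> \<partial>M)"
  by simp
 also have "\<dots> \<le> (\<integral>x. \<bar>real_cond_exp M G f x - expectation f\<bar> \<partial>M)"
 proof (rule integral_mono[OF _ i3])
  show "integrable M (\<lambda>x. \<bar>g x * (real_cond_exp M G f x - expectation f)\<bar>)"
   using i2 gi by (auto simp: right_diff_distrib)
  show "\<bar>g x * (real_cond_exp M G f x - expectation f)\<bar> \<le> \<bar>real_cond_exp M G f x - expectation f\<bar>"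
   if "x \<in> space M" for x using gb[OF that] by (auto simp: abs_mult intro!: mult_left_le_one_le)
 qed
 finally show ?thesis .
qed

text \<open>The sign trick is applied twice, first to \<open>f\<close> and then to the resulting sign function. This
reduces bounded functions to events.\<close>
lemma cond_exp_deviation_le:
 fixes f :: "'a \<Rightarrow> real"
 assumes sub: "subalgebra M A" "subalgebra M G" and mix: "mixing_bound M A G \<alpha>"
  and f: "f \<in> borel_measurable A" and fb: "\<And>x. x \<in> space M \<Longrightarrow> \<bar>f x\<bar> \<le> 1"
 shows "(\<integral>x. \<bar>real_cond_exp M G f x - expectation f\<bar> \<partial>M) \<le> 4 * \<alpha>"
proof -
 have fM: "f \<in> borel_measurable M" using measurable_from_subalg[OF sub(1) f] .
 obtain b where b: "b \<in> sets G" and eq: "(\<integral>x. \<bar>real_cond_exp M G f x - expectation f\<bar> \<partial>M)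
    = expectation (\<lambda>x. f x * sgn_ind b x) - expectation f * expectation (sgn_ind b)"
  using cond_exp_deviation_eq_covariance[OF sub(2) fM fb] by auto
 have bM: "sgn_ind b \<in> borel_measurable M"
  using measurable_from_subalg[OF sub(2) sgn_ind_measurable[OF b]] .
 obtain a where a: "a \<in> sets A" and eq2: "(\<integral>x. \<bar>real_cond_exp M A (sgn_ind b) x - expectation (sgn_ind b)\<bar> \<partial>M)
    = expectation (\<lambda>x. sgn_ind b x * sgn_ind a x) - expectation (sgn_ind b) * expectation (sgn_ind a)"
  using cond_exp_deviation_eq_covariance[OF sub(1) bM] by auto
 have "expectation (\<lambda>x. f x * sgn_ind b x) - expectation f * expectation (sgn_ind b)
   \<le> \<bar>expectation (\<lambda>x. sgn_ind b x * f x) - expectation (sgn_ind b) * expectation f\<bar>"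
  by (simp add: mult.commute)
 also have "\<dots> \<le> (\<integral>x. \<bar>real_cond_exp M A (sgn_ind b) x - expectation (sgn_ind b)\<bar> \<partial>M)"
  by (rule covariance_eq_cond_exp[OF sub(1) bM _ f fb]) auto
 also have "\<dots> \<le> 4 * \<alpha>"
  using covariance_sgn_ind_le[OF sub mix a b] eq2 by (simp add: mult.commute)
 finally show ?thesis using eq by simp
qed

lemma covariance_le:
 fixes f g :: "'a \<Rightarrow> real"
 assumes sub: "subalgebra M A" "subalgebra M G" and mix: "mixing_bound M A G \<alpha>"
  and f: "f \<in> borel_measurable A" and fb: "\<And>x. x \<in> space M \<Longrightarrow> \<bar>f x\<bar> \<le> 1"
  and g: "g \<in> borel_measurable G" and gb: "\<And>x. x \<in> space M \<Longrightarrow> \<bar>g x\<bar> \<le> 1"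
 shows "\<bar>expectation (\<lambda>x. f x * g x) - expectation f * expectation g\<bar> \<le> 4 * \<alpha>"
 using covariance_eq_cond_exp[OF sub(2) measurable_from_subalg[OF sub(1) f] fb g gb]
  cond_exp_deviation_le[OF sub mix f fb] by linarith

end

definition sgn_in :: "'i set \<Rightarrow> 'i \<Rightarrow> real" where
 "sgn_in S i = (if i \<in> S then 1 else - 1)"

lemma sum_Pow_insert:
 fixes f :: "'i set \<Rightarrow> real"
 assumes "finite F" "x \<notin> F"
 shows "(\<Sum>S\<in>Pow (insert x F). f S) = (\<Sum>S\<in>Pow F. f S + f (insert x S))"
proof -
 have "inj_on (insert x) (Pow F)" using assms by (auto simp: inj_on_def)
 moreover have "Pow F \<inter> insert x ` Pow F = {}" using assms by auto
 ultimately show ?thesis using assms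
  by (simp add: Pow_insert sum.union_disjoint sum.reindex sum.distrib)
qed

lemma rademacher_moments:
 fixes a :: "'i \<Rightarrow> real"
 assumes "finite I"
 shows "(\<Sum>S\<in>Pow I. (\<Sum>i\<in>I. sgn_in S i * a i)\<^sup>2) = 2 ^ card I * (\<Sum>i\<in>I. (a i)\<^sup>2)"
  and "(\<Sum>S\<in>Pow I. (\<Sum>i\<in>I. sgn_in S i * a i) ^ 4) \<le> 2 ^ card I * (3 * (\<Sum>i\<in>I. (a i)\<^sup>2)\<^sup>2)"
 using assms
proof (induction I)
 case empty
 { case 1 show ?case by simp }
 { case 2 show ?case by simp }
next
 case (insert x F)
 define Y where "Y S = (\<Sum>i\<in>F. sgn_in S i * a i)" for S
 \<comment> \<open>a set of positive signs for \<open>insert x F\<close> either omits or contains \<open>x\<close>\<close>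
 have Y1: "(\<Sum>i\<in>insert x F. sgn_in S i * a i) = Y S - a x" if "S \<in> Pow F" for S
  using that insert.hyps unfolding Y_def by (auto simp: sgn_in_def)
 have Y2: "(\<Sum>i\<in>insert x F. sgn_in (insert x S) i * a i) = Y S + a x" if "S \<in> Pow F" for S
 proof -
  have "(\<Sum>i\<in>F. sgn_in (insert x S) i * a i) = Y S"
   unfolding Y_def using insert.hyps by (intro sum.cong) (auto simp: sgn_in_def)
  then show ?thesis using insert.hyps by (simp add: sgn_in_def)
 qed
 have IH1: "(\<Sum>S\<in>Pow F. (Y S)\<^sup>2) = 2 ^ card F * (\<Sum>i\<in>F. (a i)\<^sup>2)"
  and IH2: "(\<Sum>S\<in>Pow F. (Y S) ^ 4) \<le> 2 ^ card F * (3 * (\<Sum>i\<in>F. (a i)\<^sup>2)\<^sup>2)"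
  using insert.IH unfolding Y_def by auto
 have cF: "card (Pow F) = 2 ^ card F" using insert.hyps by (simp add: card_Pow)
 have s: "(\<Sum>S\<in>Pow (insert x F). g (\<Sum>i\<in>insert x F. sgn_in S i * a i)) = (\<Sum>S\<in>Pow F. g (Y S - a x) + g (Y S + a x))" for g :: "real \<Rightarrow> real"
  unfolding sum_Pow_insert[OF insert.hyps] by (intro sum.cong refl) (simp add: Y1 Y2)
 { case 1
  have "(\<Sum>S\<in>Pow F. (Y S - a x)\<^sup>2 + (Y S + a x)\<^sup>2) = (\<Sum>S\<in>Pow F. 2 * (Y S)\<^sup>2 + 2 * (a x)\<^sup>2)"
   by (intro sum.cong) (auto simp: power2_eq_square algebra_simps)
  also have "\<dots> = 2 * (2 ^ card F * (\<Sum>i\<in>F. (a i)\<^sup>2)) + 2 ^ card F * (2 * (a x)\<^sup>2)"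
   using cF by (simp add: sum.distrib sum_distrib_left[symmetric] IH1)
  finally show ?case using s[of "\<lambda>y. y\<^sup>2"] insert.hyps by (simp add: algebra_simps) }
 { case 2
  let ?s = "\<Sum>i\<in>F. (a i)\<^sup>2"
  have e4: "(y - b) ^ 4 + (y + b) ^ 4 = 2 * y ^ 4 + 12 * (b\<^sup>2 * y\<^sup>2) + 2 * b ^ 4" for y b :: real
   by (simp add: power2_eq_square power4_eq_xxxx algebra_simps)
  have "(\<Sum>S\<in>Pow F. (Y S - a x) ^ 4 + (Y S + a x) ^ 4)
    = (\<Sum>S\<in>Pow F. 2 * (Y S) ^ 4 + 12 * ((a x)\<^sup>2 * (Y S)\<^sup>2) + 2 * (a x) ^ 4)"
   by (simp only: e4)
  also have "\<dots> = 2 * (\<Sum>S\<in>Pow F. (Y S) ^ 4) + 12 * ((a x)\<^sup>2 * (\<Sum>S\<in>Pow F. (Y S)\<^sup>2)) + 2 ^ card F * (2 * (a x) ^ 4)"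
   using cF by (simp add: sum.distrib sum_distrib_left[symmetric])
  also have "\<dots> \<le> 2 * (2 ^ card F * (3 * ?s\<^sup>2)) + 12 * ((a x)\<^sup>2 * (2 ^ card F * ?s)) + 2 ^ card F * (6 * (a x) ^ 4)"
   unfolding IH1 using IH2 by (intro add_mono mult_left_mono) auto
  also have "\<dots> = 2 ^ card (insert x F) * (3 * (\<Sum>i\<in>insert x F. (a i)\<^sup>2)\<^sup>2)"
   using insert.hyps by (simp add: power2_eq_square power4_eq_xxxx algebra_simps)
  finally show ?case using s[of "\<lambda>y. y ^ 4"] by simp }
qed

text \<open>The average of \<open>|Y|\<close> over all signs is bounded below by integrating
\<open>y^2/\<sigma> - y^4/(6 \<sigma>^3) \<le> |y|\<close> and using the fourth moment of a Rademacher sum.\<close>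
lemma khinchine_lower_bound:
 fixes a :: "'i \<Rightarrow> real"
 assumes I: "finite I"
 shows "2 ^ card I * (\<Sum>i\<in>I. \<bar>a i\<bar>) \<le> 2 * sqrt (card I) * (\<Sum>S\<in>Pow I. \<bar>\<Sum>i\<in>I. sgn_in S i * a i\<bar>)"
proof -
 define \<sigma> where "\<sigma> = sqrt (\<Sum>i\<in>I. (a i)\<^sup>2)"
 have s2: "(\<Sum>i\<in>I. (a i)\<^sup>2) = \<sigma>\<^sup>2" unfolding \<sigma>_def by (simp add: sum_nonneg)
 have s0: "0 \<le> \<sigma>" by (simp add: \<sigma>_def sum_nonneg)
 let ?Y = "\<lambda>S. \<Sum>i\<in>I. sgn_in S i * a i"
 have 1: "2 ^ card I * \<sigma> \<le> 2 * (\<Sum>S\<in>Pow I. \<bar>?Y S\<bar>)"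
 proof (cases "\<sigma> = 0")
  case False
  then have sp: "0 < \<sigma>" using s0 by simp
  have pt: "y\<^sup>2 / \<sigma> - y ^ 4 / (6 * \<sigma> ^ 3) \<le> \<bar>y\<bar>" for y
  proof -
   define x where "x = \<bar>y\<bar> / \<sigma>"
   have x0: "0 \<le> x" using sp by (simp add: x_def)
   have "0 \<le> 1 - x + x ^ 3 / 6"
   proof -
    have "0 \<le> (x - sqrt 2)\<^sup>2 * (x + 2 * sqrt 2)" using x0 by simp
    also have "\<dots> = x ^ 3 - 3 * x * (sqrt 2)\<^sup>2 + 2 * sqrt 2 * (sqrt 2)\<^sup>2"
     by (simp only: power2_eq_square power3_eq_cube) (simp add: algebra_simps del: real_sqrt_mult_self)
    also have "\<dots> = x ^ 3 - 6 * x + 4 * sqrt 2" by simp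
    finally have "0 \<le> x ^ 3 - 6 * x + 4 * sqrt 2" .
    moreover have "sqrt 2 \<le> 3 / 2" by (rule real_le_lsqrt) (auto simp: power2_eq_square)
    ultimately show ?thesis by simp
   qed
   then have "0 \<le> x * (1 - x + x ^ 3 / 6)" using x0 by simp
   then have "x\<^sup>2 - x ^ 4 / 6 \<le> x" by (simp add: power2_eq_square power3_eq_cube power4_eq_xxxx algebra_simps)
   then have "\<sigma> * (x\<^sup>2 - x ^ 4 / 6) \<le> \<sigma> * x" using sp by simp
   moreover have "\<sigma> * x = \<bar>y\<bar>" using sp by (simp add: x_def)
   moreover have "\<sigma> * (x\<^sup>2 - x ^ 4 / 6) = y\<^sup>2 / \<sigma> - y ^ 4 / (6 * \<sigma> ^ 3)"
    using sp by (simp add: x_def power_divide field_simps power2_eq_square power3_eq_cube power4_eq_xxxx)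
   ultimately show ?thesis by simp
  qed
  have "2 ^ card I * \<sigma> / 2 = 2 ^ card I * \<sigma>\<^sup>2 / \<sigma> - 2 ^ card I * (3 * (\<sigma>\<^sup>2)\<^sup>2) / (6 * \<sigma> ^ 3)"
   using sp by (simp add: field_simps power2_eq_square power3_eq_cube)
  also have "\<dots> \<le> (\<Sum>S\<in>Pow I. (?Y S)\<^sup>2) / \<sigma> - (\<Sum>S\<in>Pow I. (?Y S) ^ 4) / (6 * \<sigma> ^ 3)"
   using rademacher_moments[OF I, of a] sp unfolding s2 by (intro diff_mono divide_right_mono) auto
  also have "\<dots> = (\<Sum>S\<in>Pow I. (?Y S)\<^sup>2 / \<sigma> - (?Y S) ^ 4 / (6 * \<sigma> ^ 3))"
   by (simp add: sum_subtractf sum_divide_distrib)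
  also have "\<dots> \<le> (\<Sum>S\<in>Pow I. \<bar>?Y S\<bar>)" by (intro sum_mono pt)
  finally show ?thesis by simp
 qed (simp add: sum_nonneg)
 have 2: "(\<Sum>i\<in>I. \<bar>a i\<bar>) \<le> sqrt (card I) * \<sigma>"
 proof -
  have "(\<Sum>i\<in>I. \<bar>a i\<bar> * 1)\<^sup>2 \<le> (\<Sum>i\<in>I. \<bar>a i\<bar>\<^sup>2) * (\<Sum>i\<in>I. 1\<^sup>2)"
   by (rule Cauchy_Schwarz_ineq_sum)
  then have "(\<Sum>i\<in>I. \<bar>a i\<bar>)\<^sup>2 \<le> card I * \<sigma>\<^sup>2" by (simp add: s2 mult.commute)
  then have "sqrt ((\<Sum>i\<in>I. \<bar>a i\<bar>)\<^sup>2) \<le> sqrt (card I * \<sigma>\<^sup>2)" by (rule real_sqrt_le_mono)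
  then show ?thesis using s0 by (simp add: real_sqrt_mult sum_nonneg)
 qed
 have "2 ^ card I * (\<Sum>i\<in>I. \<bar>a i\<bar>) \<le> 2 ^ card I * (sqrt (card I) * \<sigma>)" using 2 by simp
 also have "\<dots> = sqrt (card I) * (2 ^ card I * \<sigma>)" by simp
 also have "\<dots> \<le> sqrt (card I) * (2 * (\<Sum>S\<in>Pow I. \<bar>?Y S\<bar>))" using 1 by (intro mult_left_mono) auto
 finally show ?thesis by simp
qed

section \<open>Couplings under strong mixing\<close>

text \<open>The first component plays the given probability space and the second an independent copy. Only
domination is asked of the marginals, so that \<open>\<delta>\<close> measures the missing mass.\<close>
definition (in prob_space) coupling_measure ::
 "'a measure \<Rightarrow> ('a \<Rightarrow> real) \<Rightarrow> real \<Rightarrow> real \<Rightarrow> ('a \<times> 'a) measure \<Rightarrow> bool" where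
 "coupling_measure G \<xi> e \<delta> Q \<longleftrightarrow>
   finite_measure Q \<and> sets Q = sets (M \<Otimes>\<^sub>M M) \<and>
   (AE p in Q. \<bar>\<xi> (fst p) - \<xi> (snd p)\<bar> \<le> e) \<and>
   (\<forall>E\<in>events. emeasure Q (E \<times> space M) \<le> emeasure M E) \<and>
   (\<forall>E\<in>sets (G \<Otimes>\<^sub>M M). emeasure Q E \<le> emeasure (M \<Otimes>\<^sub>M M) E) \<and>
   1 - \<delta> \<le> measure Q (space Q)"

context prob_space
begin

text \<open>The values of \<open>\<xi>\<close> are cut into \<open>2 m\<close> cells of length \<open>e\<close>, and a point is paired with an independent
point of the same cell. The density is damped by \<open>min(c\<^sub>k, p\<^sub>k) / c\<^sub>k\<close>, with \<open>c\<^sub>k\<close> the conditional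
and \<open>p\<^sub>k\<close> the unconditional probability of the cell; this keeps the joint law with \<open>G\<close> below
the product. The missing mass is the mass outside the cells plus the sum of \<open>E|c\<^sub>k - p\<^sub>k|\<close>.
A sum over cells would lose a factor \<open>2 m\<close> against \<open>\<alpha>\<close>; Khinchine's inequality reduces
it to \<open>\<plusminus>1\<close>-combinations of indicators, which are bounded by 1, and loses only its root.\<close>
lemma ex_coupling_measure:
 fixes \<xi> :: "'a \<Rightarrow> real" and m :: nat and e :: real
 assumes sub: "subalgebra M A" "subalgebra M G" and mix: "mixing_bound M A G \<alpha>"
  and \<xi>: "\<xi> \<in> borel_measurable A" and e: "0 < e"
 shows "\<exists>Q. coupling_measure G \<xi> e (prob {x\<in>space M. real m * e \<le> \<bar>\<xi> x\<bar>} + 8 * sqrt (2 * real m) * \<alpha>) Q"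
proof -
 interpret G: finite_measure_subalgebra M G by unfold_locales (rule sub)
 interpret MM: pair_prob_space M M ..
 have spA: "space A = space M" and spG: "space G = space M" using sub by (auto simp: subalgebra_def)
 have \<xi>M[measurable]: "\<xi> \<in> borel_measurable M" using measurable_from_subalg[OF sub(1) \<xi>] .
 define D where "D k = {x\<in>space M. \<lfloor>\<xi> x / e\<rfloor> = k}" for k :: int
 have DA: "D k \<in> sets A" for k
 proof -
  note \<xi>[measurable]
  show ?thesis unfolding D_def spA[symmetric] by measurable
 qed
 have DM[measurable]: "D k \<in> events" for k using DA sub by (auto simp: subalgebra_def)
 define I where "I = {- int m..<int m}"
 have fI: "finite I" and cI: "card I = 2 * m" by (auto simp: I_def)
 define c where "c k = real_cond_exp M G (indicator (D k))" for k
 define p where "p k = prob (D k)" for k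
 have p0: "0 \<le> p k" for k by (simp add: p_def)
 have ind: "integrable M (indicator (D k) :: 'a \<Rightarrow> real)" for k
  by (intro integrable_bounded[of _ 1]) auto
 have indp: "expectation (indicator (D k)) = p k" for k
  using sets.sets_into_space[OF DM] by (simp add: p_def Int_absorb2)
 have cG: "c k \<in> borel_measurable G" for k unfolding c_def by measurable
 have cM[measurable]: "c k \<in> borel_measurable M" for k unfolding c_def by measurable
 have ci: "integrable M (c k)" for k unfolding c_def by (rule G.real_cond_exp_int(1)[OF ind])
 have c0: "AE x in M. 0 \<le> c k x" for k unfolding c_def by (rule G.real_cond_exp_pos) auto
 \<comment> \<open>the value 0 where \<open>c k x\<close> vanishes avoids a division by 0 and concerns a null set of \<open>D k\<close>\<close>
 define r where "r k x = (if c k x \<le> 0 then 0 else min (c k x) (p k) / c k x)" for k x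
 have rG: "r k \<in> borel_measurable G" for k
 proof -
  note cG[measurable]
  show ?thesis unfolding r_def[abs_def] by measurable
 qed
 have rM[measurable]: "r k \<in> borel_measurable M" for k using measurable_from_subalg[OF sub(2) rG] .
 have r0: "0 \<le> r k x" and r1: "r k x \<le> 1" for k x using p0[of k] by (auto simp: r_def divide_simps)
 have cr: "c k x * r k x \<le> p k" for k x using p0[of k] by (auto simp: r_def)
 have rp0: "r k x = 0" if "p k = 0" for k x using that by (auto simp: r_def)
 have Dsum: "(\<Sum>k\<in>I. indicator (D k) x) \<le> (1::real)" for x
 proof -
  have "(\<Sum>k\<in>I. indicator (D k) x) \<le> (\<Sum>k\<in>I. if k = \<lfloor>\<xi> x / e\<rfloor> then (1::real) else 0)"
   by (intro sum_mono) (auto simp: D_def indicator_def)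
  also have "\<dots> \<le> 1" using fI by (simp add: sum.delta)
  finally show ?thesis .
 qed
 have dev: "(\<integral>x. (\<Sum>k\<in>I. \<bar>c k x - p k\<bar>) \<partial>M) \<le> 8 * sqrt (2 * real m) * \<alpha>"
 proof -
  define Y where "Y S x = (\<Sum>k\<in>I. sgn_in S k * (c k x - p k))" for S x
  have Yi: "integrable M (\<lambda>x. \<bar>Y S x\<bar>)" for S unfolding Y_def
   using ci by (intro integrable_abs Bochner_Integration.integrable_sum) auto
  have Y: "(\<integral>x. \<bar>Y S x\<bar> \<partial>M) \<le> 4 * \<alpha>" for S
  proof -
   define f where "f x = (\<Sum>k\<in>I. sgn_in S k * indicator (D k) x)" for x
   have fA: "f \<in> borel_measurable A" unfolding f_def[abs_def]
    by (intro borel_measurable_sum borel_measurable_times borel_measurable_const borel_measurable_indicator DA)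
   have fb: "\<bar>f x\<bar> \<le> 1" for x
   proof -
    have "\<bar>f x\<bar> \<le> (\<Sum>k\<in>I. \<bar>sgn_in S k * indicator (D k) x\<bar>)" unfolding f_def by (rule sum_abs)
    also have "\<dots> \<le> (\<Sum>k\<in>I. indicator (D k) x)"
     by (intro sum_mono) (auto simp: sgn_in_def indicator_def)
    also have "\<dots> \<le> 1" by (rule Dsum)
    finally show ?thesis .
   qed
   have Ef: "expectation f = (\<Sum>k\<in>I. sgn_in S k * p k)"
    unfolding f_def using ind by (subst Bochner_Integration.integral_sum) (auto simp: p_def)
   have "AE x in M. real_cond_exp M G f x = (\<Sum>k\<in>I. real_cond_exp M G (\<lambda>x. sgn_in S k * indicator (D k) x) x)"
    unfolding f_def using ind by (intro G.real_cond_exp_sum) auto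
   moreover have "AE x in M. \<forall>k\<in>I. real_cond_exp M G (\<lambda>x. sgn_in S k * indicator (D k) x) x = sgn_in S k * c k x"
    unfolding c_def using fI by (intro AE_finite_allI G.real_cond_exp_cmult ind)
   ultimately have "AE x in M. \<bar>Y S x\<bar> = \<bar>real_cond_exp M G f x - expectation f\<bar>"
   proof eventually_elim
    case (elim x)
    then have "real_cond_exp M G f x = (\<Sum>k\<in>I. sgn_in S k * c k x)" by simp
    then show ?case unfolding Y_def Ef by (simp add: right_diff_distrib sum_subtractf)
   qed
   then have "(\<integral>x. \<bar>Y S x\<bar> \<partial>M) = (\<integral>x. \<bar>real_cond_exp M G f x - expectation f\<bar> \<partial>M)"
    unfolding Y_def by (intro integral_cong_AE) auto
   also have "\<dots> \<le> 4 * \<alpha>" by (rule cond_exp_deviation_le[OF sub mix fA fb])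
   finally show ?thesis .
  qed
  have K: "2 ^ card I * (\<Sum>k\<in>I. \<bar>c k x - p k\<bar>) \<le> 2 * sqrt (card I) * (\<Sum>S\<in>Pow I. \<bar>Y S x\<bar>)" for x
   using khinchine_lower_bound[OF fI, of "\<lambda>k. c k x - p k"] by (simp add: Y_def)
  have "2 ^ card I * (\<integral>x. (\<Sum>k\<in>I. \<bar>c k x - p k\<bar>) \<partial>M) = (\<integral>x. 2 ^ card I * (\<Sum>k\<in>I. \<bar>c k x - p k\<bar>) \<partial>M)"
   by simp
  also have "\<dots> \<le> (\<integral>x. 2 * sqrt (card I) * (\<Sum>S\<in>Pow I. \<bar>Y S x\<bar>) \<partial>M)"
  proof (rule integral_mono[OF _ _ K])
   show "integrable M (\<lambda>x. 2 ^ card I * (\<Sum>k\<in>I. \<bar>c k x - p k\<bar>))"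
    using ci by (intro integrable_mult_right Bochner_Integration.integrable_sum integrable_abs) auto
   show "integrable M (\<lambda>x. 2 * sqrt (card I) * (\<Sum>S\<in>Pow I. \<bar>Y S x\<bar>))"
    using Yi by (intro integrable_mult_right Bochner_Integration.integrable_sum)
  qed
  also have "\<dots> = 2 * sqrt (card I) * (\<Sum>S\<in>Pow I. \<integral>x. \<bar>Y S x\<bar> \<partial>M)"
   using Yi by (simp add: Bochner_Integration.integral_sum)
  also have "\<dots> \<le> 2 * sqrt (card I) * (\<Sum>S\<in>Pow I. 4 * \<alpha>)"
   using Y by (intro mult_left_mono sum_mono) auto
  also have "\<dots> = 2 ^ card I * (8 * sqrt (2 * real m) * \<alpha>)" using fI by (simp add: card_Pow cI)
  finally show ?thesis by simp
 qed
 define \<rho> where "\<rho> q = (\<Sum>k\<in>I. indicator (D k) (fst q) * indicator (D k) (snd q) * (r k (fst q) / p k))" for q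
 have \<rho>0: "0 \<le> \<rho> q" for q unfolding \<rho>_def using r0 p0 by (intro sum_nonneg) auto
 have \<rho>m[measurable]: "\<rho> \<in> borel_measurable (M \<Otimes>\<^sub>M M)" unfolding \<rho>_def[abs_def] by measurable
 define s where "s x = (\<Sum>k\<in>I. indicator (D k) x * r k x)" for x
 have sM[measurable]: "s \<in> borel_measurable M" unfolding s_def[abs_def] by measurable
 have s0: "0 \<le> s x" for x unfolding s_def using r0 by (intro sum_nonneg) auto
 have s1: "s x \<le> 1" for x
 proof -
  have "s x \<le> (\<Sum>k\<in>I. indicator (D k) x)"
   unfolding s_def using r1 r0 by (intro sum_mono) (auto simp: indicator_def)
  then show ?thesis using Dsum[of x] by linarith
 qed
 have si: "integrable M s" using s0 s1 by (intro integrable_bounded[of _ 1]) auto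
 have inner1: "(\<integral>\<^sup>+y. ennreal (\<rho> (x, y)) \<partial>M) = ennreal (s x)" for x
 proof -
  have "(\<integral>\<^sup>+y. ennreal (\<rho> (x, y)) \<partial>M) = ennreal (\<integral>y. \<rho> (x, y) \<partial>M)"
  proof (intro nn_integral_eq_integral AE_I2 \<rho>0)
   show "integrable M (\<lambda>y. \<rho> (x, y))" unfolding \<rho>_def using ind
    by (intro Bochner_Integration.integrable_sum) (auto intro!: integrable_mult_right integrable_mult_left)
  qed
  also have "(\<integral>y. \<rho> (x, y) \<partial>M) = (\<Sum>k\<in>I. \<integral>y. indicator (D k) x * indicator (D k) y * (r k x / p k) \<partial>M)"
   unfolding \<rho>_def fst_conv snd_conv using ind
   by (intro Bochner_Integration.integral_sum) (auto intro!: integrable_mult_right integrable_mult_left)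
  also have "\<dots> = s x" unfolding s_def
  proof (intro sum.cong refl)
   fix k
   have "(\<integral>y. indicator (D k) x * indicator (D k) y * (r k x / p k) \<partial>M) = indicator (D k) x * p k * (r k x / p k)"
    using indp[of k] by simp
   then show "(\<integral>y. indicator (D k) x * indicator (D k) y * (r k x / p k) \<partial>M) = indicator (D k) x * r k x"
    using rp0[of k x] by (cases "p k = 0") auto
  qed
  finally show ?thesis .
 qed
 define Q where "Q = density (M \<Otimes>\<^sub>M M) (\<lambda>q. ennreal (\<rho> q))"
 have sQ: "sets Q = sets (M \<Otimes>\<^sub>M M)" by (simp add: Q_def)
 have spQ: "space Q = space M \<times> space M" by (simp add: Q_def space_pair_measure)
 have marg1: "emeasure Q (E \<times> space M) = (\<integral>\<^sup>+x. ennreal (s x) * indicator E x \<partial>M)" if [measurable]: "E \<in> events" for E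
 proof -
  have "emeasure Q (E \<times> space M) = (\<integral>\<^sup>+q. ennreal (\<rho> q) * indicator (E \<times> space M) q \<partial>(M \<Otimes>\<^sub>M M))"
   unfolding Q_def by (subst emeasure_density) auto
  also have "\<dots> = (\<integral>\<^sup>+x. \<integral>\<^sup>+y. ennreal (\<rho> (x, y)) * indicator (E \<times> space M) (x, y) \<partial>M \<partial>M)"
   by (subst nn_integral_fst[symmetric]) auto
  also have "\<dots> = (\<integral>\<^sup>+x. (\<integral>\<^sup>+y. ennreal (\<rho> (x, y)) \<partial>M) * indicator E x \<partial>M)"
   by (intro nn_integral_cong) (auto simp: indicator_def intro!: nn_integral_cong)
  finally show ?thesis by (simp add: inner1)
 qed
 have mass: "emeasure Q (space Q) = ennreal (expectation s)"
 proof -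
  have "emeasure Q (space Q) = (\<integral>\<^sup>+x. ennreal (s x) * indicator (space M) x \<partial>M)"
   unfolding spQ by (rule marg1) auto
  also have "\<dots> = (\<integral>\<^sup>+x. ennreal (s x) \<partial>M)" by (intro nn_integral_cong) auto
  also have "\<dots> = ennreal (expectation s)" using si s0 by (intro nn_integral_eq_integral) auto
  finally show ?thesis .
 qed
 have Es: "expectation s = (\<Sum>k\<in>I. \<integral>x. min (c k x) (p k) \<partial>M)"
 proof -
  have "expectation s = (\<Sum>k\<in>I. \<integral>x. r k x * indicator (D k) x \<partial>M)"
   unfolding s_def using r0 r1
   by (subst Bochner_Integration.integral_sum) (auto intro!: integrable_bounded[of _ 1] simp: indicator_def mult.commute)
  also have "\<dots> = (\<Sum>k\<in>I. \<integral>x. min (c k x) (p k) \<partial>M)"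
  proof (intro sum.cong refl)
   fix k
   have "(\<integral>x. r k x * indicator (D k) x \<partial>M) = (\<integral>x. r k x * c k x \<partial>M)"
    unfolding c_def using r0 r1 rG
    by (intro G.real_cond_exp_intg(2)[symmetric] integrable_bounded[of _ 1]) (auto simp: indicator_def)
   also have "\<dots> = (\<integral>x. min (c k x) (p k) \<partial>M)"
    using c0[of k] p0[of k] by (intro integral_cong_AE) (auto simp: r_def)
   finally show "(\<integral>x. r k x * indicator (D k) x \<partial>M) = (\<integral>x. min (c k x) (p k) \<partial>M)" .
  qed
  finally show ?thesis .
 qed
 have low: "1 - prob {x\<in>space M. real m * e \<le> \<bar>\<xi> x\<bar>} - 8 * sqrt (2 * real m) * \<alpha> \<le> expectation s"
 proof -
  have mi: "integrable M (\<lambda>x. min (c k x) (p k))" for k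
   using ci[of k] by (intro integrable_min) auto
  have "(\<Sum>k\<in>I. p k) - (\<integral>x. (\<Sum>k\<in>I. \<bar>c k x - p k\<bar>) \<partial>M) = (\<Sum>k\<in>I. \<integral>x. (p k - \<bar>c k x - p k\<bar>) \<partial>M)"
   using ci by (subst Bochner_Integration.integral_sum) (auto simp: prob_space sum_subtractf)
  also have "\<dots> \<le> expectation s"
   unfolding Es using ci mi by (intro sum_mono integral_mono) auto
  finally have 1: "(\<Sum>k\<in>I. p k) - 8 * sqrt (2 * real m) * \<alpha> \<le> expectation s" using dev by linarith
  have "(\<Sum>k\<in>I. p k) = prob (\<Union>k\<in>I. D k)"
   unfolding p_def using fI
   by (intro finite_measure_finite_Union[symmetric]) (auto simp: disjoint_family_on_def D_def)
  also have "\<dots> \<ge> 1 - prob {x\<in>space M. real m * e \<le> \<bar>\<xi> x\<bar>}"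
  proof -
   have "1 = prob (space M)" by (simp add: prob_space)
   also have "\<dots> \<le> prob ((\<Union>k\<in>I. D k) \<union> {x\<in>space M. real m * e \<le> \<bar>\<xi> x\<bar>})"
   proof (intro finite_measure_mono)
    show "space M \<subseteq> (\<Union>k\<in>I. D k) \<union> {x\<in>space M. real m * e \<le> \<bar>\<xi> x\<bar>}"
    proof
     fix x assume x: "x \<in> space M"
     show "x \<in> (\<Union>k\<in>I. D k) \<union> {x\<in>space M. real m * e \<le> \<bar>\<xi> x\<bar>}"
     proof (cases "real m * e \<le> \<bar>\<xi> x\<bar>")
      case False
      then have "- real m \<le> \<xi> x / e" "\<xi> x / e < real m" using e by (auto simp: field_simps)
      then have "\<lfloor>\<xi> x / e\<rfloor> \<in> I" unfolding I_def by (simp add: le_floor_iff floor_less_iff)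
      then show ?thesis using x by (auto simp: D_def)
     qed (use x in auto)
    qed
   qed (use fI in \<open>auto intro!: sets.finite_UN\<close>)
   also have "\<dots> \<le> prob (\<Union>k\<in>I. D k) + prob {x\<in>space M. real m * e \<le> \<bar>\<xi> x\<bar>}"
    using fI by (intro measure_Un_le) (auto intro!: sets.finite_UN)
   finally show ?thesis by simp
  qed
  finally show ?thesis using 1 by linarith
 qed
 show ?thesis
  unfolding coupling_measure_def
 proof (intro exI[of _ Q] conjI ballI)
  show "finite_measure Q" by (rule finite_measureI) (simp add: mass)
  show "sets Q = sets (M \<Otimes>\<^sub>M M)" by (rule sQ)
  show "AE q in Q. \<bar>\<xi> (fst q) - \<xi> (snd q)\<bar> \<le> e"
   unfolding Q_def
  proof (subst AE_density, measurable, intro AE_I2 impI)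
   fix q assume "0 < ennreal (\<rho> q)"
   then have "\<rho> q \<noteq> 0" by auto
   then obtain k where "k \<in> I" "indicator (D k) (fst q) * indicator (D k) (snd q) * (r k (fst q) / p k) \<noteq> 0"
    unfolding \<rho>_def using sum.not_neutral_contains_not_neutral by blast
   then have "\<lfloor>\<xi> (fst q) / e\<rfloor> = k" "\<lfloor>\<xi> (snd q) / e\<rfloor> = k"
    by (auto simp: D_def indicator_def split: if_splits)
   then have "\<bar>\<xi> (fst q) / e - \<xi> (snd q) / e\<bar> \<le> 1" by linarith
   then have "\<bar>(\<xi> (fst q) - \<xi> (snd q)) / e\<bar> \<le> 1" by (simp add: diff_divide_distrib)
   then show "\<bar>\<xi> (fst q) - \<xi> (snd q)\<bar> \<le> e" using e by (simp add: abs_divide divide_simps)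
  qed
  show "emeasure Q (E \<times> space M) \<le> emeasure M E" if E: "E \<in> events" for E
  proof -
   have "emeasure Q (E \<times> space M) \<le> (\<integral>\<^sup>+x. indicator E x \<partial>M)"
    unfolding marg1[OF E] using s1 by (intro nn_integral_mono) (auto simp: indicator_def)
   then show ?thesis using E by simp
  qed
  show "1 - (prob {x\<in>space M. real m * e \<le> \<bar>\<xi> x\<bar>} + 8 * sqrt (2 * real m) * \<alpha>) \<le> measure Q (space Q)"
   using low mass s0 by (simp add: measure_def integral_nonneg_AE)
  show "emeasure Q E \<le> emeasure (M \<Otimes>\<^sub>M M) E" if E: "E \<in> sets (G \<Otimes>\<^sub>M M)" for E
  proof -
   have "sets (G \<Otimes>\<^sub>M M) \<subseteq> sets (M \<Otimes>\<^sub>M M)"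
   proof -
    have "id \<in> measurable M G" using sub(2) by (auto simp: subalgebra_def measurable_def)
    then have "(\<lambda>q. (id (fst q), snd q)) \<in> measurable (M \<Otimes>\<^sub>M M) (G \<Otimes>\<^sub>M M)"
     by (intro measurable_Pair measurable_compose[OF measurable_fst] measurable_snd)
    from measurable_sets[OF this] show ?thesis
     using sets.sets_into_space[of _ "G \<Otimes>\<^sub>M M"] by (auto simp: space_pair_measure spG Int_absorb2 vimage_def dest!: )
   qed
   then have EM[measurable]: "E \<in> sets (M \<Otimes>\<^sub>M M)" using E by auto
   have "emeasure Q E = (\<integral>\<^sup>+q. ennreal (\<rho> q) * indicator E q \<partial>(M \<Otimes>\<^sub>M M))"
    unfolding Q_def by (subst emeasure_density) auto
   also have "\<dots> = (\<integral>\<^sup>+y. \<integral>\<^sup>+x. ennreal (\<rho> (x, y)) * indicator E (x, y) \<partial>M \<partial>M)"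
    by (subst MM.nn_integral_snd[symmetric]) auto
   also have "\<dots> \<le> (\<integral>\<^sup>+y. \<integral>\<^sup>+x. indicator E (x, y) \<partial>M \<partial>M)"
   proof (rule nn_integral_mono)
    fix y assume y: "y \<in> space M"
    define \<psi> where "\<psi> x = (indicator E (x, y) :: real)" for x
    have \<psi>G: "\<psi> \<in> borel_measurable G"
    proof -
     have "(\<lambda>x. (x, y)) \<in> measurable G (G \<Otimes>\<^sub>M M)" using y by (rule measurable_Pair2')
     then show ?thesis unfolding \<psi>_def[abs_def] using E by measurable
    qed
    have \<psi>M[measurable]: "\<psi> \<in> borel_measurable M" using measurable_from_subalg[OF sub(2) \<psi>G] .
    have \<psi>01: "0 \<le> \<psi> x" "\<psi> x \<le> 1" for x by (auto simp: \<psi>_def indicator_def)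
    have \<psi>i: "integrable M \<psi>" using \<psi>01 by (intro integrable_bounded[of _ 1]) auto
    have le: "(\<integral>x. (r k x * \<psi> x) * indicator (D k) x \<partial>M) \<le> p k * expectation \<psi>" for k
    proof -
     have i: "integrable M (\<lambda>x. (r k x * \<psi> x) * indicator (D k) x)"
      using r0 r1 \<psi>01 by (intro integrable_bounded[of _ 1]) (auto simp: indicator_def abs_mult intro!: mult_le_one)
     have g: "(\<lambda>x. r k x * \<psi> x) \<in> borel_measurable G" using rG \<psi>G by measurable
     have "(\<integral>x. (r k x * \<psi> x) * indicator (D k) x \<partial>M) = (\<integral>x. (r k x * \<psi> x) * c k x \<partial>M)"
      unfolding c_def using G.real_cond_exp_intg(2)[OF i g] by simp
     also have "\<dots> \<le> (\<integral>x. p k * \<psi> x \<partial>M)"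
     proof (rule integral_mono)
      show "integrable M (\<lambda>x. (r k x * \<psi> x) * c k x)"
       unfolding c_def using G.real_cond_exp_intg(1)[OF i g] by simp
      show "integrable M (\<lambda>x. p k * \<psi> x)" using \<psi>i by simp
      show "r k x * \<psi> x * c k x \<le> p k * \<psi> x" for x
       using mult_right_mono[OF cr[of k x] \<psi>01(1)[of x]] by (simp add: mult_ac)
     qed
     finally show ?thesis by simp
    qed
    have ii: "integrable M (\<lambda>x. (r k x * \<psi> x) * indicator (D k) x)" for k
     using r0 r1 \<psi>01 by (intro integrable_bounded[of _ 1]) (auto simp: indicator_def abs_mult intro!: mult_le_one)
    have eq: "\<rho> (x, y) * \<psi> x = (\<Sum>k\<in>I. indicator (D k) y / p k * ((r k x * \<psi> x) * indicator (D k) x))" for x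
     unfolding \<rho>_def by (simp add: sum_distrib_left mult_ac)
    have "(\<integral>\<^sup>+x. ennreal (\<rho> (x, y)) * indicator E (x, y) \<partial>M) = (\<integral>\<^sup>+x. ennreal (\<rho> (x, y) * \<psi> x) \<partial>M)"
     by (intro nn_integral_cong) (auto simp: \<psi>_def indicator_def)
    also have "\<dots> = ennreal (\<integral>x. \<rho> (x, y) * \<psi> x \<partial>M)"
    proof (intro nn_integral_eq_integral AE_I2)
     show "integrable M (\<lambda>x. \<rho> (x, y) * \<psi> x)" unfolding eq using ii
      by (intro Bochner_Integration.integrable_sum integrable_mult_right) auto
     show "0 \<le> \<rho> (x, y) * \<psi> x" for x using \<rho>0 \<psi>01 by simp
    qed
    also have "(\<integral>x. \<rho> (x, y) * \<psi> x \<partial>M) = (\<Sum>k\<in>I. indicator (D k) y / p k * (\<integral>x. (r k x * \<psi> x) * indicator (D k) x \<partial>M))"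
     unfolding eq using ii by (subst Bochner_Integration.integral_sum) (auto intro!: integrable_mult_right)
    also have "\<dots> \<le> (\<Sum>k\<in>I. indicator (D k) y / p k * (p k * expectation \<psi>))"
     using le p0 by (intro sum_mono mult_left_mono) auto
    also have "\<dots> \<le> (\<Sum>k\<in>I. indicator (D k) y * expectation \<psi>)"
     using \<psi>01 by (intro sum_mono) (auto simp: indicator_def intro!: integral_nonneg_AE)
    also have "\<dots> = (\<Sum>k\<in>I. indicator (D k) y) * expectation \<psi>" by (simp add: sum_distrib_right)
    also have "\<dots> \<le> 1 * expectation \<psi>"
     using Dsum \<psi>01 by (intro mult_right_mono) (auto intro!: integral_nonneg_AE)
    finally have "(\<integral>\<^sup>+x. ennreal (\<rho> (x, y)) * indicator E (x, y) \<partial>M) \<le> ennreal (expectation \<psi>)"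
     by (simp add: ennreal_leI)
    also have "\<dots> = (\<integral>\<^sup>+x. ennreal (\<psi> x) \<partial>M)" using \<psi>i \<psi>01 by (intro nn_integral_eq_integral[symmetric]) auto
    also have "\<dots> = (\<integral>\<^sup>+x. indicator E (x, y) \<partial>M)"
     by (intro nn_integral_cong) (auto simp: \<psi>_def indicator_def)
    finally show "(\<integral>\<^sup>+x. ennreal (\<rho> (x, y)) * indicator E (x, y) \<partial>M) \<le> (\<integral>\<^sup>+x. indicator E (x, y) \<partial>M)" .
   qed
   also have "\<dots> = (\<integral>\<^sup>+q. indicator E q \<partial>(M \<Otimes>\<^sub>M M))"
    by (subst MM.nn_integral_snd) auto
   also have "\<dots> = emeasure (M \<Otimes>\<^sub>M M) E" by simp
   finally show ?thesis .
  qed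
 qed
qed

end

section \<open>Kernels and their Hoeffding decomposition\<close>

lemma integral_abs_le_of_nn_integral:
 fixes f :: "'q \<Rightarrow> real"
 assumes "f \<in> borel_measurable Q" "(\<integral>\<^sup>+q. ennreal \<bar>f q\<bar> \<partial>Q) \<le> ennreal B" "0 \<le> B"
 shows "(\<integral>q. \<bar>f q\<bar> \<partial>Q) \<le> B"
proof -
 have "(\<integral>q. \<bar>f q\<bar> \<partial>Q) = enn2real (\<integral>\<^sup>+q. ennreal \<bar>f q\<bar> \<partial>Q)"
  using assms(1) by (intro integral_eq_nn_integral) auto
 also have "\<dots> \<le> enn2real (ennreal B)" using assms(2) by (intro enn2real_mono) auto
 finally show ?thesis using assms(3) by simp
qed

text \<open>The functions \<open>1 + f\<close> and \<open>1 - f\<close> are nonnegative, and so the domination of the laws can be used for both.\<close>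
lemma integral_diff_le_mass_diff:
 fixes f :: "'p \<Rightarrow> real" and g :: "'q \<Rightarrow> real"
 assumes P: "finite_measure P" and Q: "finite_measure Q"
  and f[measurable]: "f \<in> borel_measurable P" and g[measurable]: "g \<in> borel_measurable Q"
  and fb: "\<And>x. x \<in> space P \<Longrightarrow> \<bar>f x\<bar> \<le> 1" and gb: "\<And>x. x \<in> space Q \<Longrightarrow> \<bar>g x\<bar> \<le> 1"
  and dom: "\<And>S. S \<in> sets borel \<Longrightarrow> emeasure Q (g -` S \<inter> space Q) \<le> emeasure P (f -` S \<inter> space P)"
 shows "\<bar>(\<integral>x. f x \<partial>P) - (\<integral>x. g x \<partial>Q)\<bar> \<le> measure P (space P) - measure Q (space Q)"
proof -
 interpret P: finite_measure P by fact
 interpret Q: finite_measure Q by fact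
 have fi: "integrable P f" using fb by (intro P.integrable_const_bound[of _ 1]) auto
 have gi: "integrable Q g" using gb by (intro Q.integrable_const_bound[of _ 1]) auto
 have le: "distr Q borel g \<le> distr P borel f"
  using dom by (auto simp: le_measure emeasure_distr)
 have main: "(\<integral>x. (1 + a * g x) \<partial>Q) \<le> (\<integral>x. (1 + a * f x) \<partial>P)" if a: "a = 1 \<or> a = -1" for a :: real
 proof -
  have f0: "0 \<le> 1 + a * f x" if "x \<in> space P" for x using fb[OF that] a by auto
  have g0: "0 \<le> 1 + a * g x" if "x \<in> space Q" for x using gb[OF that] a by auto
  have "(\<integral>\<^sup>+x. ennreal (1 + a * g x) \<partial>Q) = (\<integral>\<^sup>+y. ennreal (1 + a * y) \<partial>distr Q borel g)"
   by (subst nn_integral_distr) auto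
  also have "\<dots> \<le> (\<integral>\<^sup>+y. ennreal (1 + a * y) \<partial>distr P borel f)"
   using le by (intro nn_integral_mono_measure) auto
  also have "\<dots> = (\<integral>\<^sup>+x. ennreal (1 + a * f x) \<partial>P)"
   by (subst nn_integral_distr) auto
  also have "\<dots> = ennreal (\<integral>x. (1 + a * f x) \<partial>P)"
   using fi f0 by (intro nn_integral_eq_integral) auto
  also have "(\<integral>\<^sup>+x. ennreal (1 + a * g x) \<partial>Q) = ennreal (\<integral>x. (1 + a * g x) \<partial>Q)"
   using gi g0 by (intro nn_integral_eq_integral) auto
  finally show ?thesis
   using f0 by (subst (asm) ennreal_le_iff) (auto intro!: integral_nonneg_AE)
 qed
 have E: "(\<integral>x. (1 + a * g x) \<partial>Q) = measure Q (space Q) + a * (\<integral>x. g x \<partial>Q)"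
  "(\<integral>x. (1 + a * f x) \<partial>P) = measure P (space P) + a * (\<integral>x. f x \<partial>P)" for a
  using fi gi by auto
 show ?thesis using main[of 1] main[of "-1"] unfolding E by auto
qed

text \<open>The function \<open>proj\<close> is the first order part of the kernel and \<open>degen\<close> the degenerate one:
integrating out either of its arguments gives 0.\<close>
locale regular_kernel = law: prob_space \<mu> for \<mu> :: "real measure" +
 fixes k :: "real \<times> real \<Rightarrow> real" and L :: real
 assumes sets_law: "sets \<mu> = sets borel"
  and k_meas[measurable]: "k \<in> borel_measurable borel"
  and k_nonneg: "\<And>p. 0 \<le> k p" and k_le_1: "\<And>p. k p \<le> 1"
  and k_sym: "\<And>x y. k (x, y) = k (y, x)"
  and L_nonneg: "0 \<le> L"
  and osc_le: "\<And>e. 0 < e \<Longrightarrow> (\<integral>\<^sup>+p. osc k e p \<partial>(\<mu> \<Otimes>\<^sub>M \<mu>)) \<le> ennreal (L * e)"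
begin

definition proj :: "real \<Rightarrow> real" where "proj x = (\<integral>y. k (x, y) \<partial>\<mu>)"
definition mean :: real where "mean = (\<integral>x. proj x \<partial>\<mu>)"
definition degen :: "real \<times> real \<Rightarrow> real" where
 "degen p = k p - proj (fst p) - proj (snd p) + mean"

lemma measurable_law: "f \<in> measurable \<mu> N \<longleftrightarrow> f \<in> measurable borel N"
 using sets_law by (simp cong: measurable_cong_sets)

lemma k_diff: "\<bar>k p - k q\<bar> \<le> 1"
 using k_nonneg[of p] k_nonneg[of q] k_le_1[of p] k_le_1[of q] by linarith

lemma k_pair_measurable[measurable (raw)]:
 assumes [measurable]: "f \<in> borel_measurable N" "g \<in> borel_measurable N"
 shows "(\<lambda>x. k (f x, g x)) \<in> borel_measurable N"
 by measurable

lemma integrable_k: "integrable \<mu> (\<lambda>y. k (x, y))"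
 using k_nonneg k_le_1 by (intro law.integrable_const_bound[of _ 1]) (auto simp: measurable_law)

lemma proj_meas[measurable]: "proj \<in> borel_measurable borel"
proof -
 have "(\<lambda>(x, y). k (x, y)) \<in> borel_measurable (borel \<Otimes>\<^sub>M borel)"
  unfolding borel_prod by simp
 then have "(\<lambda>(x, y). k (x, y)) \<in> borel_measurable (borel \<Otimes>\<^sub>M \<mu>)"
  using sets_law by (simp cong: measurable_cong_sets sets_pair_measure_cong)
 then show ?thesis unfolding proj_def[abs_def] by (intro law.borel_measurable_lebesgue_integral) simp
qed

lemma proj_nonneg: "0 \<le> proj x"
 unfolding proj_def by (intro integral_nonneg_AE) (simp add: k_nonneg)

lemma proj_le_1: "proj x \<le> 1"
 unfolding proj_def using integral_mono[OF integrable_k[of x], of "\<lambda>_. 1"] k_le_1 law.prob_space by auto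

lemma integrable_proj: "integrable \<mu> proj"
 using proj_nonneg proj_le_1 by (intro law.integrable_const_bound[of _ 1]) (auto simp: measurable_law)

lemma mean_nonneg: "0 \<le> mean" unfolding mean_def by (intro integral_nonneg_AE) (simp add: proj_nonneg)

lemma mean_le_1: "mean \<le> 1"
 unfolding mean_def using integral_mono[OF integrable_proj, of "\<lambda>_. 1"] proj_le_1 law.prob_space by auto

lemma degen_meas[measurable]: "degen \<in> borel_measurable borel"
 unfolding degen_def[abs_def] by measurable

lemma abs_degen_le: "\<bar>degen p\<bar> \<le> 2"
 using k_nonneg[of p] k_le_1[of p] proj_nonneg[of "fst p"] proj_le_1[of "fst p"] proj_nonneg[of "snd p"] proj_le_1[of "snd p"]
  mean_nonneg mean_le_1 unfolding degen_def abs_le_iff by linarith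

lemma degen_sym: "degen (x, y) = degen (y, x)"
 unfolding degen_def using k_sym[of x y] by simp

end

locale kernel_on_space = prob_space M + regular_kernel \<mu> k L
 for M :: "'a measure" and \<mu> k L
begin

sublocale MM: pair_prob_space M M ..

lemma prob_pair_fst: "E \<in> events \<Longrightarrow> emeasure (M \<Otimes>\<^sub>M M) (E \<times> space M) = emeasure M E"
 by (subst emeasure_pair_measure_Times) (auto simp: emeasure_space_1)

lemma prob_pair_snd: "E \<in> events \<Longrightarrow> emeasure (M \<Otimes>\<^sub>M M) (space M \<times> E) = emeasure M E"
 by (subst emeasure_pair_measure_Times) (auto simp: emeasure_space_1)

lemma distr_pair_law:
 assumes [measurable]: "x \<in> borel_measurable M" "y \<in> borel_measurable M"
  and "distr M borel x = \<mu>" "distr M borel y = \<mu>"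
 shows "distr (M \<Otimes>\<^sub>M M) borel (\<lambda>q. (y (fst q), x (snd q))) = \<mu> \<Otimes>\<^sub>M \<mu>"
proof -
 interpret D: prob_space "distr M borel x" by (rule prob_space_distr) simp
 have "distr M borel y \<Otimes>\<^sub>M distr M borel x = distr (M \<Otimes>\<^sub>M M) (borel \<Otimes>\<^sub>M borel) (\<lambda>(q, r). (y q, x r))"
  by (rule pair_measure_distr) (auto intro: D.sigma_finite_measure_axioms)
 then show ?thesis using assms by (simp add: borel_prod case_prod_unfold)
qed

lemma sets_law_pair: "sets (\<mu> \<Otimes>\<^sub>M \<mu>) = sets borel"
 using sets_law by (metis borel_prod sets_pair_measure_cong)

text \<open>The pair of approximations \<open>y'\<close>, \<open>x'\<close>, made independent, is close to a pair with law
\<open>\<mu> \<Otimes>\<^sub>M \<mu>\<close>, so it inherits the averaged regularity.\<close>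
lemma osc_approx_law:
 assumes [measurable]: "x \<in> borel_measurable M" "y \<in> borel_measurable M" "x' \<in> borel_measurable M" "y' \<in> borel_measurable M"
  and law: "distr M borel x = \<mu>" "distr M borel y = \<mu>"
  and near: "prob {q\<in>space M. e < \<bar>x q - x' q\<bar>} \<le> \<eta>" "prob {q\<in>space M. e < \<bar>y q - y' q\<bar>} \<le> \<eta>"
  and e: "0 < e" and c: "0 \<le> c"
 shows "(\<integral>\<^sup>+p. osc k c p \<partial>distr (M \<Otimes>\<^sub>M M) borel (\<lambda>q. (y' (fst q), x' (snd q)))) \<le> ennreal (2 * L * (c + 2 * e) + 2 * \<eta>)"
proof -
 have \<eta>: "0 \<le> \<eta>" using near(1) measure_nonneg order_trans by blast
 let ?a = "\<lambda>q. (y' (fst q), x' (snd q))" and ?w = "\<lambda>q. (y (fst q), x (snd q))"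
 have [measurable]: "?a \<in> borel_measurable (M \<Otimes>\<^sub>M M)" "?w \<in> borel_measurable (M \<Otimes>\<^sub>M M)"
  unfolding borel_prod[symmetric] by measurable
 have "(\<integral>\<^sup>+p. osc k c p \<partial>distr (M \<Otimes>\<^sub>M M) borel ?a)
   \<le> 2 * (\<integral>\<^sup>+p. osc k (c + 2 * e) p \<partial>(\<mu> \<Otimes>\<^sub>M \<mu>)) + emeasure (M \<Otimes>\<^sub>M M) {q\<in>space (M \<Otimes>\<^sub>M M). 2 * e < norm (?a q - ?w q)}"
 proof (rule nn_integral_osc_transfer)
  show "finite_measure (M \<Otimes>\<^sub>M M)" by unfold_locales
  fix E :: "(real \<times> real) set" assume E: "E \<in> sets borel"
  show "emeasure (M \<Otimes>\<^sub>M M) (?w -` E \<inter> space (M \<Otimes>\<^sub>M M)) \<le> emeasure (\<mu> \<Otimes>\<^sub>M \<mu>) E"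
   using E by (subst distr_pair_law[OF _ _ law, symmetric]) (auto simp: emeasure_distr)
 qed (use k_nonneg k_le_1 c in \<open>auto simp: sets_law_pair\<close>)
 also have "\<dots> \<le> 2 * ennreal (L * (c + 2 * e)) + ennreal (2 * \<eta>)"
 proof (intro add_mono mult_left_mono)
  show "(\<integral>\<^sup>+p. osc k (c + 2 * e) p \<partial>(\<mu> \<Otimes>\<^sub>M \<mu>)) \<le> ennreal (L * (c + 2 * e))"
   using e c by (intro osc_le) auto
  let ?X = "{q\<in>space M. e < \<bar>x q - x' q\<bar>}" and ?Y = "{q\<in>space M. e < \<bar>y q - y' q\<bar>}"
  have "emeasure (M \<Otimes>\<^sub>M M) {q\<in>space (M \<Otimes>\<^sub>M M). 2 * e < norm (?a q - ?w q)}
    \<le> emeasure (M \<Otimes>\<^sub>M M) (?Y \<times> space M \<union> space M \<times> ?X)"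
  proof (intro emeasure_mono subsetI)
   fix q assume q: "q \<in> {q\<in>space (M \<Otimes>\<^sub>M M). 2 * e < norm (?a q - ?w q)}"
   have "norm (?a q - ?w q) \<le> \<bar>y' (fst q) - y (fst q)\<bar> + \<bar>x' (snd q) - x (snd q)\<bar>"
    using norm_Pair_le[of "y' (fst q) - y (fst q)" "x' (snd q) - x (snd q)"] by simp
   then show "q \<in> ?Y \<times> space M \<union> space M \<times> ?X" using q by (cases q) (auto simp: space_pair_measure)
  qed auto
  also have "\<dots> \<le> emeasure (M \<Otimes>\<^sub>M M) (?Y \<times> space M) + emeasure (M \<Otimes>\<^sub>M M) (space M \<times> ?X)"
   by (intro emeasure_subadditive) auto
  also have "\<dots> = emeasure M ?Y + emeasure M ?X" by (simp add: prob_pair_fst prob_pair_snd)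
  also have "\<dots> \<le> ennreal \<eta> + ennreal \<eta>" using near by (intro add_mono) (auto simp: emeasure_eq_measure ennreal_leI)
  also have "\<dots> = ennreal (2 * \<eta>)" using \<eta> by (simp flip: ennreal_plus)
  finally show "emeasure (M \<Otimes>\<^sub>M M) {q\<in>space (M \<Otimes>\<^sub>M M). 2 * e < norm (?a q - ?w q)} \<le> ennreal (2 * \<eta>)" .
 qed auto
 also have "\<dots> = ennreal (2 * (L * (c + 2 * e))) + ennreal (2 * \<eta>)"
  using L_nonneg e c by (subst ennreal_mult) auto
 also have "\<dots> = ennreal (2 * L * (c + 2 * e) + 2 * \<eta>)"
  using L_nonneg e c \<eta> by (subst ennreal_plus) (auto simp: mult.assoc)
 finally show ?thesis .
qed

text \<open>On the coupling both components of the two arguments of \<open>k\<close> are close. The second argument has a law below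
that of independent approximations, to which \<open>osc_approx_law\<close> applies.\<close>
lemma coupled_kernel_diff:
 assumes [measurable]: "x \<in> borel_measurable M" "y \<in> borel_measurable M" "x' \<in> borel_measurable M"
   "x'' \<in> borel_measurable M" "y'' \<in> borel_measurable M"
  and sub: "subalgebra M G" and y'G: "y' \<in> borel_measurable G"
  and law: "distr M borel x = \<mu>" "distr M borel y = \<mu>"
  and near: "prob {q\<in>space M. e < \<bar>x q - x' q\<bar>} \<le> \<eta>" "prob {q\<in>space M. e < \<bar>y q - y' q\<bar>} \<le> \<eta>"
  and near': "prob {q\<in>space M. c < \<bar>x'' q - x' q\<bar>} \<le> \<eta>'" "prob {q\<in>space M. c < \<bar>y'' q - y' q\<bar>} \<le> \<eta>'"
  and e: "0 < e" and c: "0 \<le> c" and Q: "coupling_measure G x' e \<delta> Q"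
 shows "(\<integral>q. \<bar>k (y'' (fst q), x'' (fst q)) - k (y' (fst q), x' (snd q))\<bar> \<partial>Q) \<le> 2 * L * (2 * c + 3 * e) + 2 * \<eta> + 2 * \<eta>'"
proof -
 have \<eta>: "0 \<le> \<eta>" "0 \<le> \<eta>'" using near(1) near'(1) measure_nonneg order_trans by blast+
 have [measurable]: "y' \<in> borel_measurable M" using measurable_from_subalg[OF sub y'G] .
 have finQ: "finite_measure Q" and sQ: "sets Q = sets (M \<Otimes>\<^sub>M M)"
  and QAE: "AE p in Q. \<bar>x' (fst p) - x' (snd p)\<bar> \<le> e"
  and Q1: "\<And>E. E \<in> events \<Longrightarrow> emeasure Q (E \<times> space M) \<le> emeasure M E"
  and Q2: "\<And>E. E \<in> sets (G \<Otimes>\<^sub>M M) \<Longrightarrow> emeasure Q E \<le> emeasure (M \<Otimes>\<^sub>M M) E"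
  using Q by (auto simp: coupling_measure_def)
 interpret Q: finite_measure Q by fact
 have spQ: "space Q = space M \<times> space M" using sets_eq_imp_space_eq[OF sQ] by (simp add: space_pair_measure)
 note measurable_cong_sets[OF sQ refl, simp]
 let ?v = "\<lambda>q. (y'' (fst q), x'' (fst q))" and ?w = "\<lambda>q. (y' (fst q), x' (snd q))"
 have vm[measurable]: "?v \<in> borel_measurable (M \<Otimes>\<^sub>M M)" and wm[measurable]: "?w \<in> borel_measurable (M \<Otimes>\<^sub>M M)"
  unfolding borel_prod[symmetric] by measurable
 have wG: "?w \<in> borel_measurable (G \<Otimes>\<^sub>M M)"
 proof -
  note y'G[measurable]
  show ?thesis unfolding borel_prod[symmetric] by measurable
 qed
 have sG: "space (G \<Otimes>\<^sub>M M) = space M \<times> space M" using sub by (simp add: space_pair_measure subalgebra_def)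
 have "(\<integral>\<^sup>+q. ennreal \<bar>k (?v q) - k (?w q)\<bar> \<partial>Q)
   \<le> (\<integral>\<^sup>+p. osc k (2 * c + e) p \<partial>distr (M \<Otimes>\<^sub>M M) borel ?w) + emeasure Q {q\<in>space Q. 2 * c + e < norm (?v q - ?w q)}"
 proof (rule nn_integral_kernel_diff_le[OF finQ])
  fix E :: "(real \<times> real) set" assume E: "E \<in> sets borel"
  have "?w -` E \<inter> space (G \<Otimes>\<^sub>M M) \<in> sets (G \<Otimes>\<^sub>M M)" using wG E by (rule measurable_sets)
  from Q2[OF this] show "emeasure Q (?w -` E \<inter> space Q) \<le> emeasure (distr (M \<Otimes>\<^sub>M M) borel ?w) E"
   using E sub by (simp add: emeasure_distr sG spQ space_pair_measure subalgebra_def)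
 qed (use k_nonneg k_le_1 in auto)
 also have "\<dots> \<le> ennreal (2 * L * ((2 * c + e) + 2 * e) + 2 * \<eta>) + ennreal (2 * \<eta>')"
 proof (intro add_mono)
  show "(\<integral>\<^sup>+p. osc k (2 * c + e) p \<partial>distr (M \<Otimes>\<^sub>M M) borel ?w) \<le> ennreal (2 * L * ((2 * c + e) + 2 * e) + 2 * \<eta>)"
   using e c by (intro osc_approx_law[OF _ _ _ _ law near]) auto
  let ?X = "{q\<in>space M. c < \<bar>x'' q - x' q\<bar>}" and ?Y = "{q\<in>space M. c < \<bar>y'' q - y' q\<bar>}"
  have "emeasure Q {q\<in>space Q. 2 * c + e < norm (?v q - ?w q)} \<le> emeasure Q (?Y \<times> space M \<union> ?X \<times> space M)"
  proof (rule emeasure_mono_AE)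
   show "AE q in Q. q \<in> {q\<in>space Q. 2 * c + e < norm (?v q - ?w q)} \<longrightarrow> q \<in> ?Y \<times> space M \<union> ?X \<times> space M"
    using QAE
   proof eventually_elim
    case (elim q)
    have "norm (?v q - ?w q) \<le> \<bar>y'' (fst q) - y' (fst q)\<bar> + \<bar>x'' (fst q) - x' (snd q)\<bar>"
     using norm_Pair_le[of "y'' (fst q) - y' (fst q)" "x'' (fst q) - x' (snd q)"] by simp
    then show ?case using elim by (cases q) (auto simp: spQ)
   qed
   show "?Y \<times> space M \<union> ?X \<times> space M \<in> sets Q" unfolding sQ by measurable
  qed
  also have "\<dots> \<le> emeasure Q (?Y \<times> space M) + emeasure Q (?X \<times> space M)"
   by (intro emeasure_subadditive) (auto simp: sQ)
  also have "\<dots> \<le> emeasure M ?Y + emeasure M ?X" by (intro add_mono Q1) auto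
  also have "\<dots> \<le> ennreal \<eta>' + ennreal \<eta>'" using near' by (intro add_mono) (auto simp: emeasure_eq_measure ennreal_leI)
  also have "\<dots> = ennreal (2 * \<eta>')" using \<eta> by (simp flip: ennreal_plus)
  finally show "emeasure Q {q\<in>space Q. 2 * c + e < norm (?v q - ?w q)} \<le> ennreal (2 * \<eta>')" .
 qed
 also have "\<dots> = ennreal (2 * L * (2 * c + 3 * e) + 2 * \<eta> + 2 * \<eta>')"
  using L_nonneg e c \<eta> by (subst ennreal_plus[symmetric]) auto
 finally show ?thesis
  using L_nonneg e c \<eta> by (intro integral_abs_le_of_nn_integral) auto
qed

end

section \<open>Decoupling the arguments of a kernel\<close>

context kernel_on_space
begin

lemma coupling_facts:
 assumes sub: "subalgebra M G" and Q: "coupling_measure G \<xi> e \<delta> Q"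
 shows "finite_measure Q" "sets Q = sets (M \<Otimes>\<^sub>M M)" "space Q = space M \<times> space M"
  "space (G \<Otimes>\<^sub>M M) = space M \<times> space M" "1 - \<delta> \<le> measure Q (space Q)"
  "sets (G \<Otimes>\<^sub>M M) \<subseteq> sets (M \<Otimes>\<^sub>M M)"
proof -
 show "sets Q = sets (M \<Otimes>\<^sub>M M)" using Q by (simp add: coupling_measure_def)
 then have "space Q = space (M \<Otimes>\<^sub>M M)" by (rule sets_eq_imp_space_eq)
 then show "space Q = space M \<times> space M" by (simp add: space_pair_measure)
 have id: "(\<lambda>x. x) \<in> measurable M G" using sub by (auto simp: subalgebra_def measurable_def)
 then have "(\<lambda>q. q) \<in> measurable (M \<Otimes>\<^sub>M M) (G \<Otimes>\<^sub>M M)"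
  using measurable_Pair[OF measurable_compose[OF measurable_fst id] measurable_snd] by simp
 from measurable_sets[OF this] show "sets (G \<Otimes>\<^sub>M M) \<subseteq> sets (M \<Otimes>\<^sub>M M)"
  using sub sets.sets_into_space[of _ "G \<Otimes>\<^sub>M M"] by (auto simp: space_pair_measure subalgebra_def Int_absorb2)
qed (use sub Q in \<open>auto simp: coupling_measure_def space_pair_measure subalgebra_def\<close>)

lemma coupling_fst_diff:
 assumes sub: "subalgebra M G" and Q: "coupling_measure G \<xi> e \<delta> Q"
  and f[measurable]: "f \<in> borel_measurable M" and fb: "\<And>x. x \<in> space M \<Longrightarrow> \<bar>f x\<bar> \<le> 1"
 shows "\<bar>expectation f - (\<integral>q. f (fst q) \<partial>Q)\<bar> \<le> \<delta>"
proof -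
 note [simp] = measurable_cong_sets[OF coupling_facts(2)[OF sub Q] refl]
 have "\<bar>expectation f - (\<integral>q. f (fst q) \<partial>Q)\<bar> \<le> measure M (space M) - measure Q (space Q)"
 proof (rule integral_diff_le_mass_diff)
  show "finite_measure M" by unfold_locales
  show "finite_measure Q" by (rule coupling_facts[OF sub Q])
  fix S :: "real set" assume [measurable]: "S \<in> sets borel"
  have "(\<lambda>q. f (fst q)) -` S \<inter> space Q = (f -` S \<inter> space M) \<times> space M"
   by (auto simp: coupling_facts[OF sub Q])
  then show "emeasure Q ((\<lambda>q. f (fst q)) -` S \<inter> space Q) \<le> emeasure M (f -` S \<inter> space M)"
   using Q by (simp add: coupling_measure_def)
 qed (use fb in \<open>auto simp: coupling_facts[OF sub Q]\<close>)
 also have "\<dots> \<le> \<delta>" using coupling_facts(5)[OF sub Q] by (simp add: prob_space)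
 finally show ?thesis .
qed

lemma coupling_prod_diff:
 assumes sub: "subalgebra M G" and Q: "coupling_measure G \<xi> e \<delta> Q"
  and f: "f \<in> borel_measurable (G \<Otimes>\<^sub>M M)" and fb: "\<And>q. q \<in> space M \<times> space M \<Longrightarrow> \<bar>f q\<bar> \<le> 1"
 shows "\<bar>(\<integral>q. f q \<partial>(M \<Otimes>\<^sub>M M)) - (\<integral>q. f q \<partial>Q)\<bar> \<le> \<delta>"
proof -
 note [simp] = measurable_cong_sets[OF coupling_facts(2)[OF sub Q] refl]
 have [measurable]: "f \<in> borel_measurable (M \<Otimes>\<^sub>M M)"
  using f coupling_facts(4,6)[OF sub Q] by (auto simp: measurable_def space_pair_measure)
 have "\<bar>(\<integral>q. f q \<partial>(M \<Otimes>\<^sub>M M)) - (\<integral>q. f q \<partial>Q)\<bar> \<le> measure (M \<Otimes>\<^sub>M M) (space (M \<Otimes>\<^sub>M M)) - measure Q (space Q)"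
 proof (rule integral_diff_le_mass_diff)
  show "finite_measure (M \<Otimes>\<^sub>M M)" by unfold_locales
  show "finite_measure Q" by (rule coupling_facts[OF sub Q])
  fix S :: "real set" assume S: "S \<in> sets borel"
  have "f -` S \<inter> space (G \<Otimes>\<^sub>M M) \<in> sets (G \<Otimes>\<^sub>M M)" using f S by (rule measurable_sets)
  then show "emeasure Q (f -` S \<inter> space Q) \<le> emeasure (M \<Otimes>\<^sub>M M) (f -` S \<inter> space (M \<Otimes>\<^sub>M M))"
   using Q sub by (simp add: coupling_measure_def coupling_facts[OF sub Q] space_pair_measure subalgebra_def)
 qed (use fb in \<open>auto simp: coupling_facts[OF sub Q] space_pair_measure\<close>)
 also have "\<dots> \<le> \<delta>" using coupling_facts(5)[OF sub Q] by (simp add: MM.P.prob_space)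
 finally show ?thesis .
qed

lemma proj_eq:
 assumes [measurable]: "x \<in> borel_measurable M" and law: "distr M borel x = \<mu>"
 shows "proj c = (\<integral>r. k (c, x r) \<partial>M)"
proof -
 have "(\<integral>z. k (c, z) \<partial>distr M borel x) = (\<integral>r. k (c, x r) \<partial>M)" by (rule integral_distr) auto
 then show ?thesis using law by (simp add: proj_def)
qed

lemma mean_eq:
 assumes [measurable]: "x \<in> borel_measurable M" and law: "distr M borel x = \<mu>"
 shows "mean = expectation (\<lambda>r. proj (x r))"
proof -
 have "(\<integral>z. proj z \<partial>distr M borel x) = (\<integral>r. proj (x r) \<partial>M)" by (rule integral_distr) auto
 then show ?thesis using law by (simp add: mean_def)
qed

lemma integral_kernel_indep:
 assumes [measurable]: "y \<in> borel_measurable M" "x \<in> borel_measurable M" "H \<in> borel_measurable M"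
  and law: "distr M borel x = \<mu>" and Hb: "\<And>q. q \<in> space M \<Longrightarrow> \<bar>H q\<bar> \<le> 1"
 shows "(\<integral>q. k (y (fst q), x (snd q)) * H (fst q) \<partial>(M \<Otimes>\<^sub>M M)) = expectation (\<lambda>q. proj (y q) * H q)"
proof -
 have b: "\<bar>k p * H q\<bar> \<le> 1" if "q \<in> space M" for p q
  using Hb[OF that] k_nonneg[of p] k_le_1[of p] by (auto simp: abs_mult intro!: mult_le_one)
 have "integrable (M \<Otimes>\<^sub>M M) (\<lambda>q. k (y (fst q), x (snd q)) * H (fst q))"
  using b by (intro MM.P.integrable_bounded[of _ 1]) (auto simp: space_pair_measure)
 then have "(\<integral>q. k (y (fst q), x (snd q)) * H (fst q) \<partial>(M \<Otimes>\<^sub>M M))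
   = (\<integral>q. \<integral>r. k (y q, x r) * H q \<partial>M \<partial>M)"
  using MM.integral_fst[of "\<lambda>q r. k (y q, x r) * H q"] by (simp add: case_prod_unfold)
 also have "\<dots> = expectation (\<lambda>q. proj (y q) * H q)"
 proof (intro Bochner_Integration.integral_cong refl)
  fix q
  have "(\<integral>r. k (y q, x r) \<partial>M) = proj (y q)" by (rule proj_eq[OF _ law, symmetric]) simp
  then show "(\<integral>r. k (y q, x r) * H q \<partial>M) = proj (y q) * H q" by simp
 qed
 finally show ?thesis .
qed

lemma kernel_diff_indep:
 assumes [measurable]: "x \<in> borel_measurable M" "y \<in> borel_measurable M" "x' \<in> borel_measurable M" "y' \<in> borel_measurable M"
  and law: "distr M borel x = \<mu>" "distr M borel y = \<mu>"
  and near: "prob {q\<in>space M. e < \<bar>x q - x' q\<bar>} \<le> \<eta>" "prob {q\<in>space M. e < \<bar>y q - y' q\<bar>} \<le> \<eta>"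
  and e: "0 < e"
 shows "(\<integral>q. \<bar>k (y' (fst q), x' (snd q)) - k (y (fst q), x (snd q))\<bar> \<partial>(M \<Otimes>\<^sub>M M)) \<le> 2 * L * e + 2 * \<eta>"
proof -
 have \<eta>: "0 \<le> \<eta>" using near(1) measure_nonneg order_trans by blast
 let ?v = "\<lambda>q. (y' (fst q), x' (snd q))" and ?w = "\<lambda>q. (y (fst q), x (snd q))"
 have [measurable]: "?v \<in> borel_measurable (M \<Otimes>\<^sub>M M)" "?w \<in> borel_measurable (M \<Otimes>\<^sub>M M)"
  unfolding borel_prod[symmetric] by measurable
 have "(\<integral>\<^sup>+q. ennreal \<bar>k (?v q) - k (?w q)\<bar> \<partial>(M \<Otimes>\<^sub>M M))
   \<le> (\<integral>\<^sup>+p. osc k (2 * e) p \<partial>(\<mu> \<Otimes>\<^sub>M \<mu>)) + emeasure (M \<Otimes>\<^sub>M M) {q\<in>space (M \<Otimes>\<^sub>M M). 2 * e < norm (?v q - ?w q)}"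
 proof (rule nn_integral_kernel_diff_le)
  show "finite_measure (M \<Otimes>\<^sub>M M)" by unfold_locales
  fix E :: "(real \<times> real) set" assume E: "E \<in> sets borel"
  show "emeasure (M \<Otimes>\<^sub>M M) (?w -` E \<inter> space (M \<Otimes>\<^sub>M M)) \<le> emeasure (\<mu> \<Otimes>\<^sub>M \<mu>) E"
   using E by (subst distr_pair_law[OF _ _ law, symmetric]) (auto simp: emeasure_distr)
 qed (use k_nonneg k_le_1 in \<open>auto simp: sets_law_pair\<close>)
 also have "\<dots> \<le> ennreal (L * (2 * e)) + ennreal (2 * \<eta>)"
 proof (intro add_mono osc_le)
  let ?X = "{q\<in>space M. e < \<bar>x q - x' q\<bar>}" and ?Y = "{q\<in>space M. e < \<bar>y q - y' q\<bar>}"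
  have "emeasure (M \<Otimes>\<^sub>M M) {q\<in>space (M \<Otimes>\<^sub>M M). 2 * e < norm (?v q - ?w q)}
    \<le> emeasure (M \<Otimes>\<^sub>M M) (?Y \<times> space M \<union> space M \<times> ?X)"
  proof (intro emeasure_mono subsetI)
   fix q assume q: "q \<in> {q\<in>space (M \<Otimes>\<^sub>M M). 2 * e < norm (?v q - ?w q)}"
   have "norm (?v q - ?w q) \<le> \<bar>y' (fst q) - y (fst q)\<bar> + \<bar>x' (snd q) - x (snd q)\<bar>"
    using norm_Pair_le[of "y' (fst q) - y (fst q)" "x' (snd q) - x (snd q)"] by simp
   then show "q \<in> ?Y \<times> space M \<union> space M \<times> ?X" using q by (cases q) (auto simp: space_pair_measure)
  qed auto
  also have "\<dots> \<le> emeasure (M \<Otimes>\<^sub>M M) (?Y \<times> space M) + emeasure (M \<Otimes>\<^sub>M M) (space M \<times> ?X)"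
   by (intro emeasure_subadditive) auto
  also have "\<dots> = emeasure M ?Y + emeasure M ?X" by (simp add: prob_pair_fst prob_pair_snd)
  also have "\<dots> \<le> ennreal \<eta> + ennreal \<eta>" using near by (intro add_mono) (auto simp: emeasure_eq_measure ennreal_leI)
  also have "\<dots> = ennreal (2 * \<eta>)" using \<eta> by (simp flip: ennreal_plus)
  finally show "emeasure (M \<Otimes>\<^sub>M M) {q\<in>space (M \<Otimes>\<^sub>M M). 2 * e < norm (?v q - ?w q)} \<le> ennreal (2 * \<eta>)" .
 qed (use e in auto)
 also have "\<dots> = ennreal (2 * L * e + 2 * \<eta>)" using L_nonneg e \<eta> by (subst ennreal_plus[symmetric]) auto
 finally show ?thesis using L_nonneg e \<eta> by (intro integral_abs_le_of_nn_integral) auto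
qed

lemma abs_integral_diff_le:
 fixes f g :: "'q \<Rightarrow> real"
 assumes "integrable Q f" "integrable Q g"
 shows "\<bar>(\<integral>x. f x \<partial>Q) - (\<integral>x. g x \<partial>Q)\<bar> \<le> (\<integral>x. \<bar>f x - g x\<bar> \<partial>Q)"
 using assms integral_abs_bound[of Q "\<lambda>x. f x - g x"] by simp

lemma proj_diff_le:
 assumes [measurable]: "x \<in> borel_measurable M" "x' \<in> borel_measurable M"
  and law: "distr M borel x = \<mu>"
  and near: "prob {q\<in>space M. e < \<bar>x q - x' q\<bar>} \<le> \<eta>" and e: "0 < e"
 shows "expectation (\<lambda>q. \<bar>proj (x' q) - proj (x q)\<bar>) \<le> 2 * L * e + 2 * \<eta>"
proof -
 have \<eta>: "0 \<le> \<eta>" using near measure_nonneg order_trans by blast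
 have p: "proj z = (\<integral>r. k (z, x r) \<partial>M)" for z by (rule proj_eq[OF _ law]) simp
 have ki: "integrable M (\<lambda>r. k (z, x r))" for z
  using k_nonneg k_le_1 by (intro integrable_bounded[of _ 1]) auto
 let ?F = "\<lambda>q r. \<bar>k (x' q, x r) - k (x q, x r)\<bar>"
 have Fi: "integrable (M \<Otimes>\<^sub>M M) (\<lambda>(q, r). ?F q r)"
  using k_diff by (intro MM.P.integrable_bounded[of _ 1]) (auto simp: case_prod_unfold)
 have "expectation (\<lambda>q. \<bar>proj (x' q) - proj (x q)\<bar>) \<le> (\<integral>q. (\<integral>r. ?F q r \<partial>M) \<partial>M)"
 proof (rule integral_mono)
  show "integrable M (\<lambda>q. \<bar>proj (x' q) - proj (x q)\<bar>)"
  proof (rule integrable_bounded[of _ 1])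
   show "\<bar>\<bar>proj (x' q) - proj (x q)\<bar>\<bar> \<le> 1" for q
    using proj_nonneg[of "x' q"] proj_nonneg[of "x q"] proj_le_1[of "x' q"] proj_le_1[of "x q"] by linarith
  qed auto
  show "integrable M (\<lambda>q. \<integral>r. ?F q r \<partial>M)" using MM.integrable_fst[OF Fi] by simp
  show "\<bar>proj (x' q) - proj (x q)\<bar> \<le> (\<integral>r. ?F q r \<partial>M)" for q
   unfolding p using ki by (intro abs_integral_diff_le)
 qed
 also have "\<dots> = (\<integral>p. ?F (fst p) (snd p) \<partial>(M \<Otimes>\<^sub>M M))"
  using MM.integral_fst[OF Fi] by (simp add: case_prod_unfold)
 also have "\<dots> \<le> 2 * L * e + 2 * \<eta>"
  using kernel_diff_indep[of x x x x' e \<eta>] near e \<eta> law by auto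
 finally show ?thesis .
qed

text \<open>The expectation on the left is moved to the coupling (mass loss \<open>\<delta>\<close>), \<open>x\<close> is exchanged for
the copy \<open>x' (snd q)\<close>, the coupling is replaced by the product measure (mass loss \<open>\<delta>\<close> again), and
the approximations are undone. In the product, integrating the copy gives \<open>proj\<close>.\<close>
lemma decouple:
 assumes sub: "subalgebra M A" "subalgebra M G" and mix: "mixing_bound M A G \<alpha>"
  and [measurable]: "x \<in> borel_measurable M" "y \<in> borel_measurable M"
  and x'A: "x' \<in> borel_measurable A" and y'G: "y' \<in> borel_measurable G" and HG: "H \<in> borel_measurable G"
  and law: "distr M borel x = \<mu>" "distr M borel y = \<mu>"
  and near: "prob {q\<in>space M. e < \<bar>x q - x' q\<bar>} \<le> \<eta>" "prob {q\<in>space M. e < \<bar>y q - y' q\<bar>} \<le> \<eta>"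
  and e: "0 < e" and Hb: "\<And>q. q \<in> space M \<Longrightarrow> \<bar>H q\<bar> \<le> 1"
 shows "\<bar>expectation (\<lambda>q. k (y q, x q) * H q) - expectation (\<lambda>q. proj (y q) * H q)\<bar>
   \<le> 2 * (prob {q\<in>space M. real m * e \<le> \<bar>x' q\<bar>} + 8 * sqrt (2 * real m) * \<alpha>) + 12 * L * e + 6 * \<eta>"
proof -
 define \<delta> where "\<delta> = prob {q\<in>space M. real m * e \<le> \<bar>x' q\<bar>} + 8 * sqrt (2 * real m) * \<alpha>"
 obtain Q where Q: "coupling_measure G x' e \<delta> Q"
  using ex_coupling_measure[OF sub mix x'A e, of m] unfolding \<delta>_def by auto
 interpret Q: finite_measure Q by (rule coupling_facts[OF sub(2) Q])
 note [simp] = measurable_cong_sets[OF coupling_facts(2)[OF sub(2) Q] refl]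
 have [measurable]: "x' \<in> borel_measurable M" "y' \<in> borel_measurable M" "H \<in> borel_measurable M"
  using measurable_from_subalg[OF sub(1) x'A] measurable_from_subalg[OF sub(2) y'G] measurable_from_subalg[OF sub(2) HG] .
 have b: "\<bar>k p * H q\<bar> \<le> 1" if "q \<in> space M" for p q
  using Hb[OF that] k_nonneg[of p] k_le_1[of p] by (auto simp: abs_mult intro!: mult_le_one)
 have \<eta>: "0 \<le> \<eta>" using near(1) measure_nonneg order_trans by blast
 have spQ: "fst q \<in> space M" if "q \<in> space Q" for q using that by (auto simp: coupling_facts[OF sub(2) Q])
 let ?f1 = "\<lambda>q. k (y (fst q), x (fst q)) * H (fst q)"
 let ?f2 = "\<lambda>q. k (y' (fst q), x' (snd q)) * H (fst q)"
 let ?f3 = "\<lambda>q. k (y (fst q), x (snd q)) * H (fst q)"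
 have 1: "\<bar>expectation (\<lambda>q. k (y q, x q) * H q) - (\<integral>q. ?f1 q \<partial>Q)\<bar> \<le> \<delta>"
  by (rule coupling_fst_diff[OF sub(2) Q]) (use b in auto)
 have 2: "\<bar>(\<integral>q. ?f1 q \<partial>Q) - (\<integral>q. ?f2 q \<partial>Q)\<bar> \<le> 2 * L * (5 * e) + 4 * \<eta>"
 proof -
  have "\<bar>(\<integral>q. ?f1 q \<partial>Q) - (\<integral>q. ?f2 q \<partial>Q)\<bar> \<le> (\<integral>q. \<bar>?f1 q - ?f2 q\<bar> \<partial>Q)"
   using b spQ by (intro abs_integral_diff_le Q.integrable_const_bound[of _ 1]) auto
  also have "\<dots> \<le> (\<integral>q. \<bar>k (y (fst q), x (fst q)) - k (y' (fst q), x' (snd q))\<bar> \<partial>Q)"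
  proof (rule integral_mono)
   have le: "\<bar>?f1 q - ?f2 q\<bar> \<le> \<bar>k (y (fst q), x (fst q)) - k (y' (fst q), x' (snd q))\<bar>" if "q \<in> space Q" for q
    unfolding left_diff_distrib[symmetric] abs_mult using Hb[OF spQ[OF that]] by (intro mult_left_le) auto
   show i: "integrable Q (\<lambda>q. \<bar>k (y (fst q), x (fst q)) - k (y' (fst q), x' (snd q))\<bar>)"
    using k_diff by (intro Q.integrable_const_bound[of _ 1]) auto
   show "integrable Q (\<lambda>q. \<bar>?f1 q - ?f2 q\<bar>)"
    by (rule Bochner_Integration.integrable_bound[OF i]) (use le in auto)
   show "\<bar>?f1 q - ?f2 q\<bar> \<le> \<bar>k (y (fst q), x (fst q)) - k (y' (fst q), x' (snd q))\<bar>" if "q \<in> space Q" for q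
    using le[OF that] .
  qed
  also have "\<dots> \<le> 2 * L * (2 * e + 3 * e) + 2 * \<eta> + 2 * \<eta>"
   using e by (intro coupled_kernel_diff[OF _ _ _ _ _ sub(2) y'G law near near _ _ Q]) auto
  finally show ?thesis by simp
 qed
 have 3: "\<bar>(\<integral>q. ?f2 q \<partial>(M \<Otimes>\<^sub>M M)) - (\<integral>q. ?f2 q \<partial>Q)\<bar> \<le> \<delta>"
 proof (rule coupling_prod_diff[OF sub(2) Q])
  note y'G[measurable] HG[measurable]
  show "?f2 \<in> borel_measurable (G \<Otimes>\<^sub>M M)" by measurable
 qed (use b in auto)
 have 4: "\<bar>(\<integral>q. ?f2 q \<partial>(M \<Otimes>\<^sub>M M)) - (\<integral>q. ?f3 q \<partial>(M \<Otimes>\<^sub>M M))\<bar> \<le> 2 * L * e + 2 * \<eta>"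
 proof -
  have "\<bar>(\<integral>q. ?f2 q \<partial>(M \<Otimes>\<^sub>M M)) - (\<integral>q. ?f3 q \<partial>(M \<Otimes>\<^sub>M M))\<bar> \<le> (\<integral>q. \<bar>?f2 q - ?f3 q\<bar> \<partial>(M \<Otimes>\<^sub>M M))"
   using b by (intro abs_integral_diff_le MM.P.integrable_bounded[of _ 1]) (auto simp: space_pair_measure)
  also have "\<dots> \<le> (\<integral>q. \<bar>k (y' (fst q), x' (snd q)) - k (y (fst q), x (snd q))\<bar> \<partial>(M \<Otimes>\<^sub>M M))"
  proof (rule integral_mono)
   have le: "\<bar>?f2 q - ?f3 q\<bar> \<le> \<bar>k (y' (fst q), x' (snd q)) - k (y (fst q), x (snd q))\<bar>" if "q \<in> space (M \<Otimes>\<^sub>M M)" for q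
    unfolding left_diff_distrib[symmetric] abs_mult using Hb[of "fst q"] that
    by (intro mult_left_le) (auto simp: space_pair_measure)
   show i: "integrable (M \<Otimes>\<^sub>M M) (\<lambda>q. \<bar>k (y' (fst q), x' (snd q)) - k (y (fst q), x (snd q))\<bar>)"
    using k_diff by (intro MM.P.integrable_bounded[of _ 1]) auto
   show "integrable (M \<Otimes>\<^sub>M M) (\<lambda>q. \<bar>?f2 q - ?f3 q\<bar>)"
    by (rule Bochner_Integration.integrable_bound[OF i]) (use le in auto)
   show "\<bar>?f2 q - ?f3 q\<bar> \<le> \<bar>k (y' (fst q), x' (snd q)) - k (y (fst q), x (snd q))\<bar>" if "q \<in> space (M \<Otimes>\<^sub>M M)" for q
    using le[OF that] .
  qed
  also have "\<dots> \<le> 2 * L * e + 2 * \<eta>" using e by (intro kernel_diff_indep law near) auto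
  finally show ?thesis .
 qed
 have 5: "(\<integral>q. ?f3 q \<partial>(M \<Otimes>\<^sub>M M)) = expectation (\<lambda>q. proj (y q) * H q)"
  by (rule integral_kernel_indep) (use law Hb in auto)
 show ?thesis using 1 2 3 4 unfolding 5 \<delta>_def[symmetric] by linarith
qed

text \<open>Even at dependent arguments the kernel changes little when they are replaced by approximations.
The two sides are compared with the value at an independent copy.\<close>
lemma kernel_dependent_pair:
 assumes sub: "subalgebra M A" "subalgebra M G" and mix: "mixing_bound M A G \<alpha>"
  and [measurable]: "x \<in> borel_measurable M" "y \<in> borel_measurable M" "x'' \<in> borel_measurable M" "y'' \<in> borel_measurable M"
  and x'A: "x' \<in> borel_measurable A" and y'G: "y' \<in> borel_measurable G"
  and law: "distr M borel x = \<mu>" "distr M borel y = \<mu>"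
  and near: "prob {q\<in>space M. e < \<bar>x q - x' q\<bar>} \<le> \<eta>" "prob {q\<in>space M. e < \<bar>y q - y' q\<bar>} \<le> \<eta>"
  and near': "prob {q\<in>space M. c < \<bar>x q - x'' q\<bar>} \<le> \<eta>'" "prob {q\<in>space M. c < \<bar>y q - y'' q\<bar>} \<le> \<eta>'"
  and e: "0 < e" and c: "0 \<le> c"
 shows "expectation (\<lambda>q. \<bar>k (y q, x q) - k (y'' q, x'' q)\<bar>)
   \<le> prob {q\<in>space M. real m * e \<le> \<bar>x' q\<bar>} + 8 * sqrt (2 * real m) * \<alpha> + L * (20 * e + 4 * c) + 8 * \<eta> + 2 * \<eta>'"
proof -
 define \<delta> where "\<delta> = prob {q\<in>space M. real m * e \<le> \<bar>x' q\<bar>} + 8 * sqrt (2 * real m) * \<alpha>"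
 obtain Q where Q: "coupling_measure G x' e \<delta> Q"
  using ex_coupling_measure[OF sub mix x'A e, of m] unfolding \<delta>_def by auto
 interpret Q: finite_measure Q by (rule coupling_facts[OF sub(2) Q])
 note [simp] = measurable_cong_sets[OF coupling_facts(2)[OF sub(2) Q] refl]
 have [measurable]: "x' \<in> borel_measurable M" "y' \<in> borel_measurable M"
  using measurable_from_subalg[OF sub(1) x'A] measurable_from_subalg[OF sub(2) y'G] .
 let ?f = "\<lambda>q. \<bar>k (y q, x q) - k (y'' q, x'' q)\<bar>"
 have far: "prob {q\<in>space M. e + c < \<bar>z'' q - z' q\<bar>} \<le> \<eta> + \<eta>'"
  if [measurable]: "z \<in> borel_measurable M" "z' \<in> borel_measurable M" "z'' \<in> borel_measurable M"
   and "prob {q\<in>space M. e < \<bar>z q - z' q\<bar>} \<le> \<eta>" "prob {q\<in>space M. c < \<bar>z q - z'' q\<bar>} \<le> \<eta>'" for z z' z''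
 proof -
  have "prob {q\<in>space M. e + c < \<bar>z'' q - z' q\<bar>} \<le> prob ({q\<in>space M. e < \<bar>z q - z' q\<bar>} \<union> {q\<in>space M. c < \<bar>z q - z'' q\<bar>})"
   by (intro finite_measure_mono) auto
  also have "\<dots> \<le> prob {q\<in>space M. e < \<bar>z q - z' q\<bar>} + prob {q\<in>space M. c < \<bar>z q - z'' q\<bar>}"
   by (intro measure_Un_le) auto
  finally show ?thesis using that by linarith
 qed
 have 1: "\<bar>expectation ?f - (\<integral>q. ?f (fst q) \<partial>Q)\<bar> \<le> \<delta>"
  by (rule coupling_fst_diff[OF sub(2) Q]) (use k_diff in auto)
 let ?w = "\<lambda>q. k (y' (fst q), x' (snd q))"
 have i: "integrable Q (\<lambda>q. \<bar>k (f q) - k (g q)\<bar>)" if "(\<lambda>q. k (f q)) \<in> borel_measurable Q" "(\<lambda>q. k (g q)) \<in> borel_measurable Q" for f g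
  using that k_diff by (intro Q.integrable_const_bound[of _ 1]) auto
 have "(\<integral>q. ?f (fst q) \<partial>Q) \<le> (\<integral>q. \<bar>k (y (fst q), x (fst q)) - ?w q\<bar> + \<bar>k (y'' (fst q), x'' (fst q)) - ?w q\<bar> \<partial>Q)"
  by (intro integral_mono Bochner_Integration.integrable_add i) auto
 also have "\<dots> = (\<integral>q. \<bar>k (y (fst q), x (fst q)) - ?w q\<bar> \<partial>Q) + (\<integral>q. \<bar>k (y'' (fst q), x'' (fst q)) - ?w q\<bar> \<partial>Q)"
  by (intro Bochner_Integration.integral_add i) auto
 also have "\<dots> \<le> (2 * L * (2 * e + 3 * e) + 2 * \<eta> + 2 * \<eta>) + (2 * L * (2 * (e + c) + 3 * e) + 2 * \<eta> + 2 * (\<eta> + \<eta>'))"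
 proof (intro add_mono)
  show "(\<integral>q. \<bar>k (y (fst q), x (fst q)) - ?w q\<bar> \<partial>Q) \<le> 2 * L * (2 * e + 3 * e) + 2 * \<eta> + 2 * \<eta>"
   using e by (intro coupled_kernel_diff[OF _ _ _ _ _ sub(2) y'G law near near _ _ Q]) auto
  show "(\<integral>q. \<bar>k (y'' (fst q), x'' (fst q)) - ?w q\<bar> \<partial>Q) \<le> 2 * L * (2 * (e + c) + 3 * e) + 2 * \<eta> + 2 * (\<eta> + \<eta>')"
   using e c by (intro coupled_kernel_diff[OF _ _ _ _ _ sub(2) y'G law near _ _ _ _ Q] far[OF _ _ _ near(1) near'(1)] far[OF _ _ _ near(2) near'(2)]) auto
 qed
 finally show ?thesis using 1 unfolding \<delta>_def[symmetric] by (simp add: algebra_simps)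
qed

lemma degen_dependent_pair:
 assumes [measurable]: "x \<in> borel_measurable M" "y \<in> borel_measurable M" "x'' \<in> borel_measurable M" "y'' \<in> borel_measurable M"
  and law: "distr M borel x = \<mu>" "distr M borel y = \<mu>"
  and near': "prob {q\<in>space M. c < \<bar>x q - x'' q\<bar>} \<le> \<eta>'" "prob {q\<in>space M. c < \<bar>y q - y'' q\<bar>} \<le> \<eta>'"
  and c: "0 < c" and B: "expectation (\<lambda>q. \<bar>k (y q, x q) - k (y'' q, x'' q)\<bar>) \<le> B"
 shows "expectation (\<lambda>q. \<bar>degen (y q, x q) - degen (y'' q, x'' q)\<bar>) \<le> B + 4 * L * c + 4 * \<eta>'"
proof -
 have pd: "\<bar>proj a - proj b\<bar> \<le> 1" for a b
  using proj_nonneg[of a] proj_nonneg[of b] proj_le_1[of a] proj_le_1[of b] by linarith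
 have i1: "integrable M (\<lambda>q. \<bar>k (y q, x q) - k (y'' q, x'' q)\<bar>)"
  using k_diff by (intro integrable_bounded[of _ 1]) auto
 have i2: "integrable M (\<lambda>q. \<bar>proj (x'' q) - proj (x q)\<bar>)" "integrable M (\<lambda>q. \<bar>proj (y'' q) - proj (y q)\<bar>)"
  using pd by (intro integrable_bounded[of _ 1]; auto)+
 have dl: "\<bar>degen (y q, x q) - degen (y'' q, x'' q)\<bar>
   \<le> \<bar>k (y q, x q) - k (y'' q, x'' q)\<bar> + (\<bar>proj (x'' q) - proj (x q)\<bar> + \<bar>proj (y'' q) - proj (y q)\<bar>)" for q
  unfolding degen_def fst_conv snd_conv by linarith
 have i3: "integrable M (\<lambda>q. \<bar>k (y q, x q) - k (y'' q, x'' q)\<bar> + (\<bar>proj (x'' q) - proj (x q)\<bar> + \<bar>proj (y'' q) - proj (y q)\<bar>))"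
  using i1 i2 by (intro Bochner_Integration.integrable_add)
 have dm: "(\<lambda>q. degen (y q, x q)) \<in> borel_measurable M" "(\<lambda>q. degen (y'' q, x'' q)) \<in> borel_measurable M"
  unfolding degen_def by measurable
 have "expectation (\<lambda>q. \<bar>degen (y q, x q) - degen (y'' q, x'' q)\<bar>)
   \<le> expectation (\<lambda>q. \<bar>k (y q, x q) - k (y'' q, x'' q)\<bar> + (\<bar>proj (x'' q) - proj (x q)\<bar> + \<bar>proj (y'' q) - proj (y q)\<bar>))"
 proof (rule integral_mono[OF _ i3 dl])
  show "integrable M (\<lambda>q. \<bar>degen (y q, x q) - degen (y'' q, x'' q)\<bar>)"
   by (rule Bochner_Integration.integrable_bound[OF i3]) (use dl dm in \<open>auto intro!: AE_I2 order_trans[OF dl]\<close>)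
 qed
 also have "\<dots> = expectation (\<lambda>q. \<bar>k (y q, x q) - k (y'' q, x'' q)\<bar>) + (expectation (\<lambda>q. \<bar>proj (x'' q) - proj (x q)\<bar>) + expectation (\<lambda>q. \<bar>proj (y'' q) - proj (y q)\<bar>))"
  using i1 i2 by simp
 also have "\<dots> \<le> B + ((2 * L * c + 2 * \<eta>') + (2 * L * c + 2 * \<eta>'))"
  using c by (intro add_mono B proj_diff_le law near') auto
 finally show ?thesis by simp
qed

text \<open>If \<open>x\<close> is nearly independent of the three other variables, it can be decoupled from them, and the
integral of a degenerate kernel over one argument is 0. The \<open>G\<close>-measurable version of the second factor
plays the role of \<open>H\<close> in \<open>decouple\<close>; the terms in \<open>proj (x q)\<close> are covariances.\<close>
lemma degen_product_expectation:
 assumes sub: "subalgebra M A" "subalgebra M G" and mix: "mixing_bound M A G \<alpha>"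
  and [measurable]: "x \<in> borel_measurable M" "y \<in> borel_measurable M" "z \<in> borel_measurable M" "w \<in> borel_measurable M"
  and x'A: "x' \<in> borel_measurable A" and y'G: "y' \<in> borel_measurable G"
  and z'G: "z' \<in> borel_measurable G" and w'G: "w' \<in> borel_measurable G"
  and law: "distr M borel x = \<mu>" "distr M borel y = \<mu>"
  and near: "prob {q\<in>space M. e < \<bar>x q - x' q\<bar>} \<le> \<eta>" "prob {q\<in>space M. e < \<bar>y q - y' q\<bar>} \<le> \<eta>"
  and e: "0 < e"
  and \<zeta>: "expectation (\<lambda>q. \<bar>degen (z q, w q) - degen (z' q, w' q)\<bar>) \<le> \<zeta>"
 shows "\<bar>expectation (\<lambda>q. degen (y q, x q) * degen (z q, w q))\<bar>
   \<le> 2 * \<zeta> + 4 * (prob {q\<in>space M. real m * e \<le> \<bar>x' q\<bar>} + 8 * sqrt (2 * real m) * \<alpha>) + 32 * L * e + 20 * \<eta> + 8 * \<alpha>"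
proof -
 have [measurable]: "x' \<in> borel_measurable M" "y' \<in> borel_measurable M" "z' \<in> borel_measurable M" "w' \<in> borel_measurable M"
  using measurable_from_subalg[OF sub(1) x'A] measurable_from_subalg[OF sub(2) y'G]
   measurable_from_subalg[OF sub(2) z'G] measurable_from_subalg[OF sub(2) w'G] .
 have dm[measurable]: "(\<lambda>q. degen (f q, g q)) \<in> borel_measurable N"
  if [measurable]: "f \<in> borel_measurable N" "g \<in> borel_measurable N" for f g and N :: "'a measure"
  unfolding degen_def by measurable
 define H where "H q = degen (z' q, w' q) / 2" for q
 have HG: "H \<in> borel_measurable G"
 proof -
  note z'G[measurable] w'G[measurable]
  show ?thesis unfolding H_def[abs_def] by measurable
 qed
 have HM[measurable]: "H \<in> borel_measurable M" using measurable_from_subalg[OF sub(2) HG] .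
 have Hb: "\<bar>H q\<bar> \<le> 1" for q using abs_degen_le[of "(z' q, w' q)"] by (simp add: H_def)
 have pb: "\<bar>proj a\<bar> \<le> 1" for a using proj_nonneg[of a] proj_le_1[of a] by linarith
 have kb: "\<bar>k a\<bar> \<le> 1" for a using k_nonneg[of a] k_le_1[of a] by linarith
 have m1: "\<bar>a * b\<bar> \<le> 1" if "\<bar>a\<bar> \<le> 1" "\<bar>b\<bar> \<le> 1" for a b :: real
  using that by (auto simp: abs_mult intro: mult_le_one)
 have ib: "integrable M (\<lambda>q. f q * H q)" if "f \<in> borel_measurable M" "\<And>q. \<bar>f q\<bar> \<le> 1" for f
  using that Hb m1 by (intro integrable_bounded[of _ 1]) auto
 have i0: "integrable M (\<lambda>q. degen (a q, b q) * degen (c q, d q))"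
  if [measurable]: "a \<in> borel_measurable M" "b \<in> borel_measurable M" "c \<in> borel_measurable M" "d \<in> borel_measurable M" for a b c d
 proof (rule integrable_bounded[of _ 4])
  show "\<bar>degen (a q, b q) * degen (c q, d q)\<bar> \<le> 4" for q
   using mult_mono[OF abs_degen_le[of "(a q, b q)"] abs_degen_le[of "(c q, d q)"]] by (simp add: abs_mult)
 qed measurable
 have 1: "\<bar>expectation (\<lambda>q. degen (y q, x q) * degen (z q, w q)) - expectation (\<lambda>q. degen (y q, x q) * degen (z' q, w' q))\<bar> \<le> 2 * \<zeta>"
 proof -
  have "\<bar>expectation (\<lambda>q. degen (y q, x q) * degen (z q, w q)) - expectation (\<lambda>q. degen (y q, x q) * degen (z' q, w' q))\<bar>
    \<le> expectation (\<lambda>q. \<bar>degen (y q, x q) * degen (z q, w q) - degen (y q, x q) * degen (z' q, w' q)\<bar>)"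
   by (intro abs_integral_diff_le i0) auto
  also have "\<dots> \<le> expectation (\<lambda>q. 2 * \<bar>degen (z q, w q) - degen (z' q, w' q)\<bar>)"
  proof (rule integral_mono)
   show "integrable M (\<lambda>q. \<bar>degen (y q, x q) * degen (z q, w q) - degen (y q, x q) * degen (z' q, w' q)\<bar>)"
    by (intro integrable_abs Bochner_Integration.integrable_diff i0) auto
   have "\<bar>degen (z q, w q) - degen (z' q, w' q)\<bar> \<le> 4" for q
    using abs_degen_le[of "(z q, w q)"] abs_degen_le[of "(z' q, w' q)"] by linarith
   then show "integrable M (\<lambda>q. 2 * \<bar>degen (z q, w q) - degen (z' q, w' q)\<bar>)"
    by (intro integrable_mult_right integrable_bounded[of _ 4]) auto
   show "\<bar>degen (y q, x q) * degen (z q, w q) - degen (y q, x q) * degen (z' q, w' q)\<bar> \<le> 2 * \<bar>degen (z q, w q) - degen (z' q, w' q)\<bar>" for q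
    unfolding right_diff_distrib[symmetric] abs_mult by (intro mult_right_mono abs_degen_le) auto
  qed
  also have "\<dots> \<le> 2 * \<zeta>" using \<zeta> by simp
  finally show ?thesis .
 qed
 have 2: "expectation (\<lambda>q. degen (y q, x q) * degen (z' q, w' q))
   = 2 * (expectation (\<lambda>q. k (y q, x q) * H q) - expectation (\<lambda>q. proj (y q) * H q)) - 2 * (expectation (\<lambda>q. proj (x q) * H q) - mean * expectation H)"
 proof -
  have "expectation (\<lambda>q. degen (y q, x q) * degen (z' q, w' q))
    = expectation (\<lambda>q. 2 * (k (y q, x q) * H q - proj (y q) * H q) - 2 * (proj (x q) * H q - mean * H q))"
  proof (intro Bochner_Integration.integral_cong refl)
   fix q
   have a: "degen (y q, x q) = k (y q, x q) - proj (y q) - proj (x q) + mean" by (simp add: degen_def)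
   have b: "degen (z' q, w' q) = 2 * H q" by (simp add: H_def)
   show "degen (y q, x q) * degen (z' q, w' q) = 2 * (k (y q, x q) * H q - proj (y q) * H q) - 2 * (proj (x q) * H q - mean * H q)"
    unfolding a b by (simp add: algebra_simps)
  qed
  also have "\<dots> = 2 * (expectation (\<lambda>q. k (y q, x q) * H q) - expectation (\<lambda>q. proj (y q) * H q)) - 2 * (expectation (\<lambda>q. proj (x q) * H q) - mean * expectation H)"
   using ib[of "\<lambda>q. k (y q, x q)"] ib[of "\<lambda>q. proj (y q)"] ib[of "\<lambda>q. proj (x q)"] ib[of "\<lambda>q. 1"] kb pb by simp
  finally show ?thesis .
 qed
 have 3: "\<bar>expectation (\<lambda>q. k (y q, x q) * H q) - expectation (\<lambda>q. proj (y q) * H q)\<bar>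
   \<le> 2 * (prob {q\<in>space M. real m * e \<le> \<bar>x' q\<bar>} + 8 * sqrt (2 * real m) * \<alpha>) + 12 * L * e + 6 * \<eta>"
  by (rule decouple[OF sub mix _ _ x'A y'G HG law near e]) (use Hb in auto)
 have pa: "expectation (\<lambda>q. \<bar>proj (x' q) - proj (x q)\<bar>) \<le> 2 * L * e + 2 * \<eta>"
  by (rule proj_diff_le[OF _ _ law(1) near(1) e]) auto
 have pi: "integrable M (\<lambda>q. proj (f q))" if [measurable]: "f \<in> borel_measurable M" for f
  using pb by (intro integrable_bounded[of _ 1]) auto
 have 4: "\<bar>expectation (\<lambda>q. proj (x q) * H q) - expectation (\<lambda>q. proj (x' q) * H q)\<bar> \<le> 2 * L * e + 2 * \<eta>"
 proof -
  have "\<bar>expectation (\<lambda>q. proj (x q) * H q) - expectation (\<lambda>q. proj (x' q) * H q)\<bar>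
    \<le> expectation (\<lambda>q. \<bar>proj (x q) * H q - proj (x' q) * H q\<bar>)"
   using pb by (intro abs_integral_diff_le ib) auto
  also have "\<dots> \<le> expectation (\<lambda>q. \<bar>proj (x' q) - proj (x q)\<bar>)"
  proof (rule integral_mono)
   show "integrable M (\<lambda>q. \<bar>proj (x q) * H q - proj (x' q) * H q\<bar>)"
    using pb by (intro integrable_abs Bochner_Integration.integrable_diff ib) auto
   show "integrable M (\<lambda>q. \<bar>proj (x' q) - proj (x q)\<bar>)" using pi by (intro integrable_abs Bochner_Integration.integrable_diff) auto
   show "\<bar>proj (x q) * H q - proj (x' q) * H q\<bar> \<le> \<bar>proj (x' q) - proj (x q)\<bar>" for q
    unfolding left_diff_distrib[symmetric] abs_mult using Hb[of q]
    by (subst abs_minus_commute) (intro mult_left_le, auto)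
  qed
  finally show ?thesis using pa by linarith
 qed
 have pA: "(\<lambda>q. proj (x' q)) \<in> borel_measurable A"
 proof -
  note x'A[measurable]
  show ?thesis by measurable
 qed
 have 5: "\<bar>expectation (\<lambda>q. proj (x' q) * H q) - expectation (\<lambda>q. proj (x' q)) * expectation H\<bar> \<le> 4 * \<alpha>"
  by (rule covariance_le[OF sub mix pA _ HG]) (use pb Hb in auto)
 have 6: "\<bar>expectation (\<lambda>q. proj (x' q)) * expectation H - mean * expectation H\<bar> \<le> 2 * L * e + 2 * \<eta>"
 proof -
  have me: "mean = expectation (\<lambda>q. proj (x q))"
   by (rule mean_eq[OF _ law(1)]) simp
  have "\<bar>expectation (\<lambda>q. proj (x' q)) - mean\<bar> \<le> 2 * L * e + 2 * \<eta>"
   unfolding me using abs_integral_diff_le[of M "\<lambda>q. proj (x' q)" "\<lambda>q. proj (x q)"] pi pa by fastforce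
  moreover have "\<bar>expectation H\<bar> \<le> 1"
  proof -
   have "\<bar>expectation H\<bar> \<le> expectation (\<lambda>q. \<bar>H q\<bar>)" by (rule integral_abs_bound)
   also have "\<dots> \<le> expectation (\<lambda>q. 1)" using Hb ib[of "\<lambda>q. 1"] by (intro integral_mono) auto
   finally show ?thesis by (simp add: prob_space)
  qed
  ultimately show ?thesis unfolding left_diff_distrib[symmetric] abs_mult
   using mult_left_le[of "\<bar>expectation H\<bar>" "\<bar>expectation (\<lambda>q. proj (x' q)) - mean\<bar>"] by linarith
 qed
 show ?thesis using 1 2 3 4 5 6 by (simp add: algebra_simps abs_le_iff)
qed

end

section \<open>Dependent processes with approximations\<close>

lemma powr_minus_le_quarter:
 fixes x y b :: real
 assumes "1 \<le> x" "0 < y" "y \<le> 4 * x" "real N \<le> b"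
 shows "x powr - b \<le> 4 ^ N / y ^ N"
proof -
 have "x powr - b \<le> x powr - real N" using assms by (intro powr_mono) auto
 also have "\<dots> = 1 / x ^ N" using assms by (simp add: powr_minus powr_realpow inverse_eq_divide)
 also have "\<dots> \<le> 4 ^ N / y ^ N"
  using power_mono[OF assms(3), of N] assms by (simp add: field_simps power_mult_distrib)
 finally show ?thesis .
qed

text \<open>The fields \<open>past n\<close> and \<open>fut n\<close> are indexed by all integers because the approximating window may reach
beyond the index 1. Either the approximations are exact or the first moment type tail bound holds;
the latter permits the precision required for two dependent indices, for which the tail
exponent \<open>1/5\<close> is too weak.\<close>
locale dependent_process = prob_space M + law: prob_space \<mu>
 for M :: "'a measure" and \<mu> :: "real measure" +
 fixes X :: "nat \<Rightarrow> 'a \<Rightarrow> real" and V :: "nat \<Rightarrow> nat \<Rightarrow> 'a \<Rightarrow> real"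
  and past fut :: "int \<Rightarrow> 'a measure" and c0 \<theta> a A :: real
 assumes X_meas[measurable]: "1 \<le> i \<Longrightarrow> X i \<in> borel_measurable M"
  and X_law: "1 \<le> i \<Longrightarrow> distr M borel (X i) = \<mu>"
  and past_sub: "subalgebra M (past n)" and fut_sub: "subalgebra M (fut n)"
  and past_mono: "n \<le> n' \<Longrightarrow> sets (past n) \<subseteq> sets (past n')"
  and fut_mono: "n \<le> n' \<Longrightarrow> sets (fut n') \<subseteq> sets (fut n)"
  and V_past: "1 \<le> i \<Longrightarrow> V l i \<in> borel_measurable (past (int i + int l))"
  and V_fut: "1 \<le> i \<Longrightarrow> V l i \<in> borel_measurable (fut (int i - int l - 1))"
  and mix: "1 \<le> n \<Longrightarrow> mixing_bound M (past n) (fut (n + int r)) (c0 * (1 + real r) powr - \<theta>)"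
  and approx: "1 \<le> i \<Longrightarrow> 0 < e \<Longrightarrow> prob {w\<in>space M. e < \<bar>X i w - V l i w\<bar>} \<le> c0 * (1 + real l) powr - a / e"
  and tail: "1 \<le> T \<Longrightarrow> prob {w\<in>space M. T \<le> \<bar>X 1 w\<bar>} \<le> c0 * T powr (- 1 / 5)"
  and exact: "(\<forall>i\<ge>1. \<forall>l. V l i = X i) \<or> (\<forall>T\<ge>1. prob {w\<in>space M. T \<le> \<bar>X 1 w\<bar>} \<le> c0 / T)"
  and exps: "8 \<le> \<theta>" "12 \<le> a" "9 / 2 \<le> A" "A \<le> \<theta>" "A \<le> a / 2"
begin

lemma c0_nonneg: "0 \<le> c0"
proof -
 have "0 \<le> prob {w\<in>space M. 1 \<le> \<bar>X 1 w\<bar>}" by simp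
 also have "\<dots> \<le> c0 * 1 powr (- 1 / 5)" by (rule tail) simp
 finally show ?thesis by simp
qed

lemma measurable_past_mono: "n \<le> n' \<Longrightarrow> f \<in> borel_measurable (past n) \<Longrightarrow> f \<in> borel_measurable (past n')"
 using past_mono[of n n'] past_sub[of n] past_sub[of n'] by (auto simp: measurable_def subalgebra_def)

lemma measurable_fut_mono: "n \<le> n' \<Longrightarrow> f \<in> borel_measurable (fut n') \<Longrightarrow> f \<in> borel_measurable (fut n)"
 using fut_mono[of n n'] fut_sub[of n] fut_sub[of n'] by (auto simp: measurable_def subalgebra_def)

lemma V_meas[measurable]: "1 \<le> i \<Longrightarrow> V l i \<in> borel_measurable M"
 using measurable_from_subalg[OF past_sub V_past] .

lemma tail_X:
 assumes "1 \<le> i"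
 shows "prob {w\<in>space M. T \<le> \<bar>X i w\<bar>} = prob {w\<in>space M. T \<le> \<bar>X 1 w\<bar>}"
proof -
 have *: "prob {w\<in>space M. T \<le> \<bar>X j w\<bar>} = measure \<mu> {x. T \<le> \<bar>x\<bar>}" if "1 \<le> j" for j
 proof -
  have "measure (distr M borel (X j)) {x. T \<le> \<bar>x\<bar>} = prob (X j -` {x. T \<le> \<bar>x\<bar>} \<inter> space M)"
   using X_meas[OF that] by (intro measure_distr) auto
  then show ?thesis unfolding X_law[OF that] by (auto simp: vimage_def Int_def conj_commute)
 qed
 show ?thesis using *[OF assms] *[of 1] by simp
qed

lemma tail_V:
 assumes i: "1 \<le> i" and T: "2 \<le> T" and e: "0 < e" "e \<le> 1"
 shows "prob {w\<in>space M. T \<le> \<bar>V l i w\<bar>} \<le> prob {w\<in>space M. T / 2 \<le> \<bar>X 1 w\<bar>} + c0 * (1 + real l) powr - a / e"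
proof -
 note [measurable] = X_meas[OF i] V_meas[OF i]
 have "prob {w\<in>space M. T \<le> \<bar>V l i w\<bar>}
   \<le> prob ({w\<in>space M. T / 2 \<le> \<bar>X i w\<bar>} \<union> {w\<in>space M. e < \<bar>X i w - V l i w\<bar>})"
  using T e by (intro finite_measure_mono) auto
 also have "\<dots> \<le> prob {w\<in>space M. T / 2 \<le> \<bar>X i w\<bar>} + prob {w\<in>space M. e < \<bar>X i w - V l i w\<bar>}"
  by (intro measure_Un_le) auto
 finally show ?thesis using approx[OF i e(1), of l] tail_X[OF i, of "T / 2"] by linarith
qed

text \<open>A gap \<open>g\<close> is divided into two windows of length \<open>g div 4\<close> around the ends and a rest of at least \<open>g/2\<close>
that separates the fields.\<close>
lemma mixing_gap:
 assumes n: "1 \<le> n" and g: "1 \<le> g" and n': "n' = n + int g - 2 * int (g div 4) - 1"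
 shows "mixing_bound M (past n) (fut n') (c0 * (real (g - 2 * (g div 4))) powr - \<theta>)"
proof -
 have "2 * (g div 4) + 1 \<le> g" using g by linarith
 then have "n' = n + int (g - 2 * (g div 4) - 1)" "1 + real (g - 2 * (g div 4) - 1) = real (g - 2 * (g div 4))"
  using n' by (auto simp: of_nat_diff)
 then show ?thesis using mix[OF n, of "g - 2 * (g div 4) - 1"] by simp
qed

lemma gap_ineq: "1 \<le> (g::nat) \<Longrightarrow> 1 + real g \<le> 4 * real (g - 2 * (g div 4))" "1 + real g \<le> 4 * (1 + real (g div 4))"
 "1 \<le> (g::nat) \<Longrightarrow> 1 \<le> g - 2 * (g div 4)"
proof -
 assume "1 \<le> g"
 then have "1 + g \<le> 4 * (g - 2 * (g div 4))" by linarith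
 then show "1 + real g \<le> 4 * real (g - 2 * (g div 4))" by linarith
next
 have "1 + g \<le> 4 * (1 + g div 4)" by presburger
 then have "real (1 + g) \<le> real (4 * (1 + g div 4))" by (rule of_nat_le_iff[THEN iffD2])
 then show "1 + real g \<le> 4 * (1 + real (g div 4))" by (simp only: of_nat_add of_nat_mult of_nat_1 of_nat_numeral)
next
 assume "1 \<le> g" then show "1 \<le> g - 2 * (g div 4)" by linarith
qed

end

locale kernel_process = dependent_process M \<mu> X V past fut c0 \<theta> a A + regular_kernel \<mu> k L
 for M :: "'a measure" and \<mu> X V past fut c0 \<theta> a A k L
begin

sublocale kernel_on_space M \<mu> k L ..

definition D0 :: real where "D0 = 4 ^ 12 * c0"

lemma D0_nonneg: "0 \<le> D0" using c0_nonneg by (simp add: D0_def)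

lemma approx_small:
 assumes "1 \<le> i" "4 \<le> (N::nat)" "N \<le> 12" and g: "1 + real g \<le> 4 * (1 + real l)" and e: "e = 1 / (1 + real g) ^ (12 - N)"
 shows "c0 * (1 + real l) powr - a / e \<le> D0 / (1 + real g) ^ N"
proof -
 have "(1 + real l) powr - a \<le> 4 ^ 12 / (1 + real g) ^ 12"
  using g exps by (intro powr_minus_le_quarter) auto
 then have "c0 * (1 + real l) powr - a / e \<le> c0 * (4 ^ 12 / (1 + real g) ^ 12) / e"
  using c0_nonneg e by (intro divide_right_mono mult_left_mono) auto
 also have "\<dots> = D0 / (1 + real g) ^ N"
 proof -
  have "(1 + real g) ^ 12 = (1 + real g) ^ N * (1 + real g) ^ (12 - N)"
   using assms by (simp flip: power_add)
  then show ?thesis unfolding e D0_def by (simp add: field_simps)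
 qed
 finally show ?thesis .
qed

text \<open>For a dependent pair the coupling is used across its own gap \<open>s - r\<close>, with precision and truncation
adapted to that gap.\<close>
lemma degen_pair_approx:
 assumes r: "1 \<le> r" and s: "1 \<le> s" and rs: "r \<le> s"
  and g: "1 + real g \<le> 4 * (1 + real l)"
 shows "expectation (\<lambda>w. \<bar>degen (X s w, X r w) - degen (V l s w, V l r w)\<bar>)
   \<le> (11 * D0 + 20 * L + 4) / (1 + real (s - r)) ^ 4 + (8 * L + 6 * D0) / (1 + real g)\<^sup>2"
proof (cases "r = s")
 case True
 have "\<bar>degen p - degen q\<bar> \<le> 4" for p q using abs_degen_le[of p] abs_degen_le[of q] by linarith
 then have "expectation (\<lambda>w. \<bar>degen (X s w, X r w) - degen (V l s w, V l r w)\<bar>) \<le> expectation (\<lambda>w. 4)"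
  using X_meas[OF r] X_meas[OF s] V_meas[OF r] V_meas[OF s]
  by (intro integral_mono integrable_bounded[of _ 4]) (auto simp: degen_def)
 also have "\<dots> = 4" by (simp add: prob_space)
 also have "4 \<le> (11 * D0 + 20 * L + 4) / (1 + real (s - r)) ^ 4 + (8 * L + 6 * D0) / (1 + real g)\<^sup>2"
  using True D0_nonneg L_nonneg by simp
 finally show ?thesis .
next
 case False
 define d where "d = s - r"
 have d: "1 \<le> d" "s = r + d" using False rs by (auto simp: d_def)
 define y where "y = 1 + real d"
 have y: "2 \<le> y" using d by (simp add: y_def)
 have x: "1 \<le> 1 + real g" by simp
 show ?thesis
 proof (cases "\<forall>i\<ge>1. \<forall>l. V l i = X i")
  case True
  then show ?thesis using r s D0_nonneg L_nonneg by simp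
 next
  case F: False
  then have t1: "prob {w\<in>space M. T \<le> \<bar>X 1 w\<bar>} \<le> c0 / T" if "1 \<le> T" for T using exact that by blast
  note [measurable] = X_meas[OF r] X_meas[OF s] V_meas[OF r] V_meas[OF s]
  define l1 where "l1 = d div 4"
  define e where "e = 1 / y ^ 4"
  define c where "c = 1 / (1 + real g)\<^sup>2"
  \<comment> \<open>so that the truncation level \<open>real m * e\<close> is \<open>y ^ 4\<close>; the tail \<open>c0 / T\<close> then matches the precision\<close>
  define m where "m = (1 + d) ^ 8"
  have e: "0 < e" "e \<le> 1" using y by (auto simp: e_def divide_le_eq one_le_power)
  have c: "0 < c" by (simp add: c_def)
  have me: "real m * e = y ^ 4" using y by (simp add: m_def e_def y_def field_simps flip: power_add)
  define \<eta> where "\<eta> = D0 / y ^ 8"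
  define \<eta>' where "\<eta>' = D0 / (1 + real g) ^ 10"
  define \<alpha> where "\<alpha> = c0 * (real (d - 2 * (d div 4))) powr - \<theta>"
  have n1: "prob {w\<in>space M. e < \<bar>X i w - V l1 i w\<bar>} \<le> \<eta>" if "1 \<le> i" for i
   using approx[OF that e(1), of l1] approx_small[OF that, of 8 d l1 e] gap_ineq(2)[of d]
   by (simp add: \<eta>_def y_def l1_def e_def)
  have n2: "prob {w\<in>space M. c < \<bar>X i w - V l i w\<bar>} \<le> \<eta>'" if "1 \<le> i" for i
   using approx[OF that c, of l] approx_small[OF that, of 10 g l c] g by (simp add: \<eta>'_def c_def)
  have mixd: "mixing_bound M (past (int r + int l1)) (fut (int s - int l1 - 1)) \<alpha>"
   unfolding \<alpha>_def using r d by (intro mixing_gap) (auto simp: l1_def)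
  have \<alpha>: "\<alpha> \<le> 4 ^ 8 * c0 / y ^ 8"
  proof -
   have "(real (d - 2 * (d div 4))) powr - \<theta> \<le> 4 ^ 8 / y ^ 8"
    using gap_ineq(1,3)[OF d(1)] exps y by (intro powr_minus_le_quarter) (auto simp: y_def)
   from mult_left_mono[OF this c0_nonneg] show ?thesis by (simp add: \<alpha>_def mult.commute)
  qed
  have kd: "expectation (\<lambda>q. \<bar>k (X s q, X r q) - k (V l s q, V l r q)\<bar>)
    \<le> prob {q\<in>space M. real m * e \<le> \<bar>V l1 r q\<bar>} + 8 * sqrt (2 * real m) * \<alpha> + L * (20 * e + 4 * c) + 8 * \<eta> + 2 * \<eta>'"
   by (rule kernel_dependent_pair[OF past_sub fut_sub mixd _ _ _ _ V_past[OF r] V_fut[OF s] X_law[OF r] X_law[OF s]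
      n1[OF r] n1[OF s] n2[OF r] n2[OF s]]) (use e c in auto)
  have T: "prob {q\<in>space M. real m * e \<le> \<bar>V l1 r q\<bar>} \<le> 2 * D0 / y ^ 4"
  proof -
   have y4: "2 \<le> y ^ 4" using power_mono[OF y, of 4] by simp
   have "prob {q\<in>space M. real m * e \<le> \<bar>V l1 r q\<bar>} \<le> prob {q\<in>space M. y ^ 4 / 2 \<le> \<bar>X 1 q\<bar>} + c0 * (1 + real l1) powr - a / e"
    unfolding me using tail_V[OF r y4 e] .
   also have "\<dots> \<le> c0 / (y ^ 4 / 2) + D0 / y ^ 8"
    using t1[of "y ^ 4 / 2"] y4 approx_small[OF r, of 8 d l1 e] gap_ineq(2)[of d]
    by (intro add_mono) (auto simp: y_def l1_def e_def)
   also have "\<dots> \<le> D0 / y ^ 4 + D0 / y ^ 4"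
   proof (intro add_mono)
    show "c0 / (y ^ 4 / 2) \<le> D0 / y ^ 4" using c0_nonneg y by (simp add: D0_def divide_right_mono)
    show "D0 / y ^ 8 \<le> D0 / y ^ 4" using D0_nonneg y by (intro divide_left_mono power_increasing) auto
   qed
   finally show ?thesis by simp
  qed
  have S: "8 * sqrt (2 * real m) * \<alpha> \<le> D0 / y ^ 4"
  proof -
   have "sqrt (2 * real m) \<le> 2 * y ^ 4"
   proof (rule real_le_lsqrt)
    have "real m = (y ^ 4)\<^sup>2" by (simp add: m_def y_def flip: power_mult)
    then show "2 * real m \<le> (2 * y ^ 4)\<^sup>2" by (simp add: power_mult_distrib)
   qed (use y in auto)
   then have "8 * sqrt (2 * real m) * \<alpha> \<le> 8 * (2 * y ^ 4) * (4 ^ 8 * c0 / y ^ 8)"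
    using \<alpha> c0_nonneg y by (intro mult_mono mult_left_mono) (auto simp: \<alpha>_def)
   also have "\<dots> = 4 ^ 10 * c0 / y ^ 4"
   proof -
    have "y ^ 8 = y ^ 4 * y ^ 4" by (simp flip: power_add)
    then show ?thesis using y by (simp add: field_simps)
   qed
   also have "\<dots> \<le> D0 / y ^ 4" using c0_nonneg y by (intro divide_right_mono) (auto simp: D0_def)
   finally show ?thesis .
  qed
  have E8: "8 * \<eta> \<le> 8 * D0 / y ^ 4"
   unfolding \<eta>_def using D0_nonneg y divide_left_mono[OF power_increasing[of 4 8 y], of "8 * D0"] by auto
  have E2: "\<eta>' \<le> D0 * c"
   unfolding \<eta>'_def c_def using D0_nonneg divide_left_mono[OF power_increasing[of 2 10 "1 + real g"], of D0] by auto
  have B: "expectation (\<lambda>q. \<bar>k (X s q, X r q) - k (V l s q, V l r q)\<bar>) \<le> (11 * D0 + 20 * L) / y ^ 4 + (4 * L + 2 * D0) * c"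
  proof -
   define z where "z = 1 / y ^ 4"
   have ez: "e = z" by (simp add: e_def z_def)
   have "prob {q\<in>space M. real m * e \<le> \<bar>V l1 r q\<bar>} \<le> 2 * (D0 * z)" "8 * sqrt (2 * real m) * \<alpha> \<le> D0 * z" "8 * \<eta> \<le> 8 * (D0 * z)"
    using T S E8 by (simp_all add: z_def)
   moreover have "expectation (\<lambda>q. \<bar>k (X s q, X r q) - k (V l s q, V l r q)\<bar>)
     \<le> prob {q\<in>space M. real m * e \<le> \<bar>V l1 r q\<bar>} + 8 * sqrt (2 * real m) * \<alpha> + (20 * (L * z) + 4 * (L * c)) + 8 * \<eta> + 2 * \<eta>'"
    using kd unfolding ez by (simp add: distrib_left mult.left_commute)
   ultimately have "expectation (\<lambda>q. \<bar>k (X s q, X r q) - k (V l s q, V l r q)\<bar>) \<le> 11 * (D0 * z) + 20 * (L * z) + 4 * (L * c) + 2 * (D0 * c)"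
    using E2 by linarith
   also have "\<dots> = (11 * D0 + 20 * L) / y ^ 4 + (4 * L + 2 * D0) * c" by (simp add: z_def add_divide_distrib distrib_right)
   finally show ?thesis .
  qed
  have "expectation (\<lambda>q. \<bar>degen (X s q, X r q) - degen (V l s q, V l r q)\<bar>)
    \<le> ((11 * D0 + 20 * L) / y ^ 4 + (4 * L + 2 * D0) * c) + 4 * L * c + 4 * \<eta>'"
   by (rule degen_dependent_pair[OF _ _ _ _ X_law[OF r] X_law[OF s] n2[OF r] n2[OF s] c B]) auto
  also have "\<dots> \<le> (11 * D0 + 20 * L) / y ^ 4 + (8 * L + 6 * D0) * c"
   using E2 by (simp add: algebra_simps)
  also have "\<dots> \<le> (11 * D0 + 20 * L + 4) / y ^ 4 + (8 * L + 6 * D0) * c"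
   using y by (intro add_right_mono divide_right_mono) auto
  finally show ?thesis by (simp add: y_def d_def c_def)
 qed
qed

definition K2 :: real where "K2 = 52 * D0 + 48 * L + 8"

lemma K2_nonneg: "0 \<le> K2" using D0_nonneg L_nonneg by (simp add: K2_def)

text \<open>The index \<open>p\<close> is at distance \<open>g\<close> from the others. With \<open>y = 1 + g\<close> the coupling is taken with
precision \<open>y^-2\<close> and truncation at \<open>y^10\<close>: the tail exponent \<open>1/5\<close> turns the latter into
\<open>y^-2\<close>, and the root of the number \<open>y^12\<close> of cells is beaten by the mixing rate \<open>y^-8\<close>.\<close>
lemma degen_isolated_aux:
 assumes sub: "subalgebra M B" "subalgebra M G"
  and mx: "mixing_bound M B G (c0 * (real (g - 2 * (g div 4))) powr - \<theta>)"
  and g: "1 \<le> g" and idx: "1 \<le> p" "1 \<le> q" "1 \<le> r" "1 \<le> s" "r \<le> s"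
  and Vm: "V (g div 4) p \<in> borel_measurable B" "V (g div 4) q \<in> borel_measurable G"
   "V (g div 4) r \<in> borel_measurable G" "V (g div 4) s \<in> borel_measurable G"
 shows "\<bar>expectation (\<lambda>w. degen (X q w, X p w) * degen (X s w, X r w))\<bar> \<le> K2 * (1 / (1 + real g)\<^sup>2 + 1 / (1 + real (s - r)) ^ 4)"
proof -
 define l where "l = g div 4"
 define y where "y = 1 + real g"
 have y: "2 \<le> y" using g by (simp add: y_def)
 have gl: "1 + real g \<le> 4 * (1 + real l)" unfolding l_def by (rule gap_ineq)
 define e where "e = 1 / y\<^sup>2"
 \<comment> \<open>so that the truncation level \<open>real m * e\<close> is \<open>y ^ 10\<close>\<close>
 define m where "m = (1 + g) ^ 12"
 have e: "0 < e" "e \<le> 1" using y by (auto simp: e_def divide_le_eq one_le_power)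
 have me: "real m * e = y ^ 10" using y by (simp add: m_def e_def y_def field_simps flip: power_add)
 define \<eta> where "\<eta> = D0 / y ^ 10"
 define \<alpha> where "\<alpha> = c0 * (real (g - 2 * (g div 4))) powr - \<theta>"
 define \<zeta> where "\<zeta> = (11 * D0 + 20 * L + 4) / (1 + real (s - r)) ^ 4 + (8 * L + 6 * D0) / y\<^sup>2"
 have ap: "c0 * (1 + real l) powr - a / e \<le> \<eta>" 
  using approx_small[OF idx(1), of 10 g l e] gl by (simp add: \<eta>_def e_def y_def)
 have n1: "prob {w\<in>space M. e < \<bar>X i w - V l i w\<bar>} \<le> \<eta>" if "1 \<le> i" for i
  using approx[OF that e(1), of l] ap by linarith
 have \<alpha>: "\<alpha> \<le> 4 ^ 8 * c0 / y ^ 8"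
 proof -
  have "(real (g - 2 * (g div 4))) powr - \<theta> \<le> 4 ^ 8 / y ^ 8"
   using gap_ineq(1,3)[OF g] exps y by (intro powr_minus_le_quarter) (auto simp: y_def)
  from mult_left_mono[OF this c0_nonneg] show ?thesis by (simp add: \<alpha>_def mult.commute)
 qed
 have \<zeta>: "expectation (\<lambda>w. \<bar>degen (X s w, X r w) - degen (V l s w, V l r w)\<bar>) \<le> \<zeta>"
  unfolding \<zeta>_def y_def by (rule degen_pair_approx[OF idx(3-5) gl])
 have main: "\<bar>expectation (\<lambda>w. degen (X q w, X p w) * degen (X s w, X r w))\<bar>
   \<le> 2 * \<zeta> + 4 * (prob {q\<in>space M. real m * e \<le> \<bar>V l p q\<bar>} + 8 * sqrt (2 * real m) * \<alpha>) + 32 * L * e + 20 * \<eta> + 8 * \<alpha>"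
  unfolding l_def
  by (rule degen_product_expectation[OF sub mx[folded \<alpha>_def] X_meas X_meas X_meas X_meas Vm(1,2,4,3) X_law X_law
     n1[unfolded l_def] n1[unfolded l_def] e(1) \<zeta>[unfolded l_def]]) (use idx in auto)
 have T: "prob {q\<in>space M. real m * e \<le> \<bar>V l p q\<bar>} \<le> 2 * D0 / y\<^sup>2"
 proof -
  have y10: "2 \<le> y ^ 10" using power_mono[OF y, of 10] by simp
  have "prob {q\<in>space M. real m * e \<le> \<bar>V l p q\<bar>} \<le> prob {q\<in>space M. y ^ 10 / 2 \<le> \<bar>X 1 q\<bar>} + c0 * (1 + real l) powr - a / e"
   unfolding me using tail_V[OF idx(1) y10 e] .
  also have "\<dots> \<le> c0 * (y ^ 10 / 2) powr (- 1 / 5) + D0 / y ^ 10"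
   using tail[of "y ^ 10 / 2"] y10 ap by (intro add_mono) (auto simp: \<eta>_def)
  also have "\<dots> \<le> D0 / y\<^sup>2 + D0 / y\<^sup>2"
  proof (intro add_mono)
   have "(y ^ 10 / 2) powr (- 1 / 5) = (y ^ 10) powr (- 1 / 5) / 2 powr (- 1 / 5)"
    by (rule powr_divide)
   also have "(y ^ 10) powr (- 1 / 5) = 1 / y\<^sup>2"
   proof -
    have "(y ^ 10) powr (- 1 / 5) = (y powr 10) powr (- 1 / 5)" using y by simp
    also have "\<dots> = y powr (- 2)" by (simp add: powr_powr)
    finally show ?thesis using y by (simp add: powr_minus inverse_eq_divide)
   qed
   also have "1 / y\<^sup>2 / 2 powr (- 1 / 5) = 2 powr (1 / 5) / y\<^sup>2" by (simp add: powr_minus field_simps)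
   also have "\<dots> \<le> 2 / y\<^sup>2" using powr_mono[of "1/5" 1 2] by (intro divide_right_mono) auto
   finally have "c0 * (y ^ 10 / 2) powr (- 1 / 5) \<le> c0 * (2 / y\<^sup>2)" using c0_nonneg by (intro mult_left_mono)
   also have "\<dots> = 2 * c0 / y\<^sup>2" by simp
   also have "\<dots> \<le> D0 / y\<^sup>2" using c0_nonneg by (intro divide_right_mono) (auto simp: D0_def)
   finally show "c0 * (y ^ 10 / 2) powr (- 1 / 5) \<le> D0 / y\<^sup>2" .
   show "D0 / y ^ 10 \<le> D0 / y\<^sup>2" using D0_nonneg y by (intro divide_left_mono power_increasing) auto
  qed
  finally show ?thesis by simp
 qed
 have S: "8 * sqrt (2 * real m) * \<alpha> \<le> D0 / y\<^sup>2"
 proof -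
  have "sqrt (2 * real m) \<le> 2 * y ^ 6"
  proof (rule real_le_lsqrt)
   have "real m = (y ^ 6)\<^sup>2" by (simp add: m_def y_def flip: power_mult)
   then show "2 * real m \<le> (2 * y ^ 6)\<^sup>2" by (simp add: power_mult_distrib)
  qed (use y in auto)
  then have "8 * sqrt (2 * real m) * \<alpha> \<le> 8 * (2 * y ^ 6) * (4 ^ 8 * c0 / y ^ 8)"
   using \<alpha> c0_nonneg y by (intro mult_mono mult_left_mono) (auto simp: \<alpha>_def)
  also have "\<dots> = 4 ^ 10 * c0 / y\<^sup>2"
  proof -
   have "y ^ 8 = y ^ 6 * y\<^sup>2" by (simp flip: power_add)
   then show ?thesis using y by (simp add: field_simps)
  qed
  also have "\<dots> \<le> D0 / y\<^sup>2" using c0_nonneg y by (intro divide_right_mono) (auto simp: D0_def)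
  finally show ?thesis .
 qed
 have E1: "\<eta> \<le> D0 / y\<^sup>2"
  unfolding \<eta>_def using D0_nonneg y by (intro divide_left_mono power_increasing) auto
 have E2: "\<alpha> \<le> D0 / y\<^sup>2"
 proof -
  have "\<alpha> \<le> D0 / y ^ 8" using \<alpha> c0_nonneg y by (elim order_trans) (auto simp: D0_def intro!: divide_right_mono)
  also have "\<dots> \<le> D0 / y\<^sup>2" using D0_nonneg y by (intro divide_left_mono power_increasing) auto
  finally show ?thesis .
 qed
 have "\<bar>expectation (\<lambda>w. degen (X q w, X p w) * degen (X s w, X r w))\<bar>
   \<le> 2 * \<zeta> + 4 * (2 * D0 / y\<^sup>2 + D0 / y\<^sup>2) + 32 * L * e + 20 * (D0 / y\<^sup>2) + 8 * (D0 / y\<^sup>2)"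
  by (rule order_trans[OF main]) (intro add_mono mult_left_mono T S E1 E2 order_refl; simp)
 also have "\<dots> = (22 * D0 + 40 * L + 8) / (1 + real (s - r)) ^ 4 + (52 * D0 + 48 * L) / y\<^sup>2"
  unfolding \<zeta>_def e_def by (simp add: add_divide_distrib algebra_simps)
 also have "\<dots> \<le> K2 / (1 + real (s - r)) ^ 4 + K2 / y\<^sup>2"
  using D0_nonneg L_nonneg by (intro add_mono divide_right_mono) (auto simp: K2_def)
 finally show ?thesis by (simp add: y_def distrib_left)
qed

lemma degen_product_trivial:
 assumes idx: "1 \<le> p" "1 \<le> q" "1 \<le> r" "1 \<le> s" and z: "0 \<le> z"
 shows "\<bar>expectation (\<lambda>w. degen (X q w, X p w) * degen (X s w, X r w))\<bar> \<le> K2 * (1 / (1 + real 0)\<^sup>2 + z)"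
proof -
 have b: "\<bar>degen (X q w, X p w) * degen (X s w, X r w)\<bar> \<le> 4" for w
  using mult_mono[OF abs_degen_le[of "(X q w, X p w)"] abs_degen_le[of "(X s w, X r w)"]] by (simp add: abs_mult)
 note [measurable] = X_meas[OF idx(1)] X_meas[OF idx(2)] X_meas[OF idx(3)] X_meas[OF idx(4)]
 have "\<bar>expectation (\<lambda>w. degen (X q w, X p w) * degen (X s w, X r w))\<bar> \<le> expectation (\<lambda>w. \<bar>degen (X q w, X p w) * degen (X s w, X r w)\<bar>)"
  by (rule integral_abs_bound)
 also have "\<dots> \<le> expectation (\<lambda>w. 4)"
  using b by (intro integral_mono integrable_bounded[of _ 4]) (auto simp: degen_def)
 also have "\<dots> = 4" by (simp add: prob_space)
 also have "\<dots> \<le> K2 * 1" using D0_nonneg L_nonneg by (simp add: K2_def)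
 also have "\<dots> \<le> K2 * (1 + z)" using z K2_nonneg by (intro mult_left_mono) auto
 finally show ?thesis by simp
qed

lemma degen_isolated_min:
 assumes p: "1 \<le> p" and gap: "p + g \<le> q" "p + g \<le> r" "p + g \<le> s" and rs: "r \<le> s"
 shows "\<bar>expectation (\<lambda>w. degen (X q w, X p w) * degen (X s w, X r w))\<bar> \<le> K2 * (1 / (1 + real g)\<^sup>2 + 1 / (1 + real (s - r)) ^ 4)"
proof (cases "g = 0")
 case True
 then show ?thesis using degen_product_trivial[of p q r s "1 / (1 + real (s - r)) ^ 4"] assms by simp
next
 case False
 then have g: "1 \<le> g" by simp
 show ?thesis
 proof (rule degen_isolated_aux[OF past_sub fut_sub mixing_gap[OF _ g refl] g])
  show "1 \<le> int p + int (g div 4)" using p by simp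
  show "V (g div 4) p \<in> borel_measurable (past (int p + int (g div 4)))" by (rule V_past[OF p])
  show "V (g div 4) q \<in> borel_measurable (fut (int p + int (g div 4) + int g - 2 * int (g div 4) - 1))"
   "V (g div 4) r \<in> borel_measurable (fut (int p + int (g div 4) + int g - 2 * int (g div 4) - 1))"
   "V (g div 4) s \<in> borel_measurable (fut (int p + int (g div 4) + int g - 2 * int (g div 4) - 1))"
   using p gap by (intro measurable_fut_mono[OF _ V_fut]; simp)+
 qed (use assms in auto)
qed

lemma degen_isolated_max:
 assumes idx: "1 \<le> q" "1 \<le> r" and gap: "q + g \<le> p" "r + g \<le> p" "s + g \<le> p" and rs: "r \<le> s"
 shows "\<bar>expectation (\<lambda>w. degen (X q w, X p w) * degen (X s w, X r w))\<bar> \<le> K2 * (1 / (1 + real g)\<^sup>2 + 1 / (1 + real (s - r)) ^ 4)"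
proof (cases "g = 0")
 case True
 then show ?thesis using degen_product_trivial[of p q r s "1 / (1 + real (s - r)) ^ 4"] assms by simp
next
 case False
 then have g: "1 \<le> g" by simp
 show ?thesis
 proof (rule degen_isolated_aux[OF fut_sub past_sub mixing_gap[THEN mixing_bound_commute[THEN iffD1], OF _ g] g])
  show "1 \<le> int p - int g + int (g div 4)" using idx gap by simp
  show "int p - int (g div 4) - 1 = int p - int g + int (g div 4) + int g - 2 * int (g div 4) - 1" by simp
  show "V (g div 4) p \<in> borel_measurable (fut (int p - int (g div 4) - 1))" using idx gap by (intro V_fut) auto
  show "V (g div 4) q \<in> borel_measurable (past (int p - int g + int (g div 4)))"
   "V (g div 4) r \<in> borel_measurable (past (int p - int g + int (g div 4)))"
   "V (g div 4) s \<in> borel_measurable (past (int p - int g + int (g div 4)))"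
   using idx gap rs by (intro measurable_past_mono[OF _ V_past]; simp)+
 qed (use assms in auto)
qed

end

section \<open>Fourth moments of sums\<close>

lemma abs_prod_list_le_1:
 fixes f :: "'i \<Rightarrow> real"
 assumes "\<And>z. z \<in> set zs \<Longrightarrow> \<bar>f z\<bar> \<le> 1"
 shows "\<bar>prod_list (map f zs)\<bar> \<le> 1"
 using assms by (induction zs) (auto simp: abs_mult intro!: mult_le_one)

lemma prod_list_diff_le:
 fixes f g :: "'i \<Rightarrow> real"
 assumes "\<And>z. z \<in> set zs \<Longrightarrow> \<bar>f z\<bar> \<le> 1" "\<And>z. z \<in> set zs \<Longrightarrow> \<bar>g z\<bar> \<le> 1"
 shows "\<bar>prod_list (map f zs) - prod_list (map g zs)\<bar> \<le> (\<Sum>z\<leftarrow>zs. \<bar>f z - g z\<bar>)"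
 using assms
proof (induction zs)
 case (Cons z zs)
 let ?F = "prod_list (map f zs)" and ?G = "prod_list (map g zs)"
 have "\<bar>f z * ?F - g z * ?G\<bar> = \<bar>(f z - g z) * ?F + g z * (?F - ?G)\<bar>" by (simp add: algebra_simps)
 also have "\<dots> \<le> \<bar>f z - g z\<bar> * \<bar>?F\<bar> + \<bar>g z\<bar> * \<bar>?F - ?G\<bar>"
  using abs_triangle_ineq[of "(f z - g z) * ?F" "g z * (?F - ?G)"] by (simp add: abs_mult)
 also have "\<dots> \<le> \<bar>f z - g z\<bar> * 1 + 1 * \<bar>?F - ?G\<bar>"
  using Cons.prems by (intro add_mono mult_left_mono mult_right_mono abs_prod_list_le_1) auto
 also have "\<bar>?F - ?G\<bar> \<le> (\<Sum>z\<leftarrow>zs. \<bar>f z - g z\<bar>)" using Cons by auto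
 finally show ?case by simp
qed simp

lemma sum3_rotate:
 "(\<Sum>i\<in>I. \<Sum>j\<in>J. \<Sum>k\<in>K. F i j k) = (\<Sum>k\<in>K. \<Sum>i\<in>I. \<Sum>j\<in>J. F i j (k::'k) :: real)"
proof -
 have "(\<Sum>i\<in>I. \<Sum>j\<in>J. \<Sum>k\<in>K. F i j k) = (\<Sum>i\<in>I. \<Sum>k\<in>K. \<Sum>j\<in>J. F i j k)"
  by (intro sum.cong refl sum.swap)
 also have "\<dots> = (\<Sum>k\<in>K. \<Sum>i\<in>I. \<Sum>j\<in>J. F i j k)" by (rule sum.swap)
 finally show ?thesis .
qed

lemma sum4_rotate:
 "(\<Sum>i\<in>I. \<Sum>j\<in>J. \<Sum>k\<in>K. \<Sum>l\<in>L. F i j k l) = (\<Sum>l\<in>L. \<Sum>i\<in>I. \<Sum>j\<in>J. \<Sum>k\<in>K. F i j k (l::'k) :: real)"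
proof -
 have "(\<Sum>i\<in>I. \<Sum>j\<in>J. \<Sum>k\<in>K. \<Sum>l\<in>L. F i j k l) = (\<Sum>i\<in>I. \<Sum>l\<in>L. \<Sum>j\<in>J. \<Sum>k\<in>K. F i j k l)"
  by (intro sum.cong refl sum3_rotate)
 also have "\<dots> = (\<Sum>l\<in>L. \<Sum>i\<in>I. \<Sum>j\<in>J. \<Sum>k\<in>K. F i j k l)" by (rule sum.swap)
 finally show ?thesis .
qed

lemma sum2_sym_le:
 fixes f :: "nat \<Rightarrow> nat \<Rightarrow> real"
 assumes "\<And>i j. 0 \<le> f i j" "\<And>i j. f i j = f j i"
 shows "(\<Sum>i\<in>I. \<Sum>j\<in>I. f i j) \<le> 2 * (\<Sum>i\<in>I. \<Sum>j\<in>I. if i \<le> j then f i j else 0)"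
proof -
 let ?h = "\<lambda>i j. if i \<le> j then f i j else 0"
 have "(\<Sum>i\<in>I. \<Sum>j\<in>I. f i j) \<le> (\<Sum>i\<in>I. \<Sum>j\<in>I. ?h i j + ?h j i)"
  using assms by (intro sum_mono) auto
 also have "\<dots> = (\<Sum>i\<in>I. \<Sum>j\<in>I. ?h i j) + (\<Sum>i\<in>I. \<Sum>j\<in>I. ?h j i)" by (simp add: sum.distrib)
 also have "(\<Sum>i\<in>I. \<Sum>j\<in>I. ?h j i) = (\<Sum>i\<in>I. \<Sum>j\<in>I. ?h i j)" by (rule sum.swap)
 finally show ?thesis by simp
qed

lemma sum3_sym_le:
 fixes f :: "nat \<Rightarrow> nat \<Rightarrow> nat \<Rightarrow> real"
 assumes nn: "\<And>i j k. 0 \<le> f i j k" and s1: "\<And>i j k. f i j k = f j i k" and s2: "\<And>i j k. f i j k = f i k j"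
 shows "(\<Sum>i\<in>I. \<Sum>j\<in>I. \<Sum>k\<in>I. f i j k) \<le> 6 * (\<Sum>i\<in>I. \<Sum>j\<in>I. if i \<le> j then \<Sum>k\<in>I. if j \<le> k then f i j k else 0 else 0)"
proof -
 let ?h = "\<lambda>i j k. if i \<le> j \<and> i \<le> k then f i j k else 0"
 have "(\<Sum>i\<in>I. \<Sum>j\<in>I. \<Sum>k\<in>I. f i j k) \<le> (\<Sum>i\<in>I. \<Sum>j\<in>I. \<Sum>k\<in>I. ?h i j k + ?h j i k + ?h k i j)"
 proof (intro sum_mono)
  fix i j k
  have "f j i k = f i j k" by (rule s1)
  moreover have "f k i j = f i j k" by (rule trans[OF s1 s2])
  ultimately show "f i j k \<le> ?h i j k + ?h j i k + ?h k i j" using nn[of i j k] by auto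
 qed
 also have "\<dots> = (\<Sum>i\<in>I. \<Sum>j\<in>I. \<Sum>k\<in>I. ?h i j k) + (\<Sum>i\<in>I. \<Sum>j\<in>I. \<Sum>k\<in>I. ?h j i k) + (\<Sum>i\<in>I. \<Sum>j\<in>I. \<Sum>k\<in>I. ?h k i j)"
  by (simp only: sum.distrib)
 also have "(\<Sum>i\<in>I. \<Sum>j\<in>I. \<Sum>k\<in>I. ?h j i k) = (\<Sum>i\<in>I. \<Sum>j\<in>I. \<Sum>k\<in>I. ?h i j k)" by (rule sum.swap)
 also have "(\<Sum>i\<in>I. \<Sum>j\<in>I. \<Sum>k\<in>I. ?h k i j) = (\<Sum>i\<in>I. \<Sum>j\<in>I. \<Sum>k\<in>I. ?h i j k)" by (rule sum3_rotate)
 also have "(\<Sum>i\<in>I. \<Sum>j\<in>I. \<Sum>k\<in>I. ?h i j k) + (\<Sum>i\<in>I. \<Sum>j\<in>I. \<Sum>k\<in>I. ?h i j k) + (\<Sum>i\<in>I. \<Sum>j\<in>I. \<Sum>k\<in>I. ?h i j k)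
   = 3 * (\<Sum>i\<in>I. \<Sum>j\<in>I. \<Sum>k\<in>I. ?h i j k)" by simp
 also have "\<dots> \<le> 3 * (\<Sum>i\<in>I. 2 * (\<Sum>j\<in>I. \<Sum>k\<in>I. if j \<le> k then ?h i j k else 0))"
 proof (intro mult_left_mono sum_mono sum2_sym_le)
  fix i j k
  show "0 \<le> ?h i j k" using nn by auto
  have "f i j k = f i k j" by (rule s2)
  then show "?h i j k = ?h i k j" by auto
 qed simp
 also have "\<dots> = 6 * (\<Sum>i\<in>I. \<Sum>j\<in>I. \<Sum>k\<in>I. if j \<le> k then ?h i j k else 0)" by (simp add: sum_distrib_left)
 also have "(\<Sum>i\<in>I. \<Sum>j\<in>I. \<Sum>k\<in>I. if j \<le> k then ?h i j k else 0) = (\<Sum>i\<in>I. \<Sum>j\<in>I. if i \<le> j then \<Sum>k\<in>I. if j \<le> k then f i j k else 0 else 0)"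
  by (intro sum.cong refl) (auto intro!: sum.cong sum.neutral)
 finally show ?thesis .
qed

text \<open>Fixing the smallest index first reduces four indices to three, and likewise below; the factors are
\<open>4 \<cdot> 3 \<cdot> 2\<close>.\<close>
lemma sum4_sym_le:
 fixes f :: "nat \<Rightarrow> nat \<Rightarrow> nat \<Rightarrow> nat \<Rightarrow> real"
 assumes nn: "\<And>i j k l. 0 \<le> f i j k l" and s1: "\<And>i j k l. f i j k l = f j i k l"
  and s2: "\<And>i j k l. f i j k l = f i k j l" and s3: "\<And>i j k l. f i j k l = f i j l k"
 shows "(\<Sum>i\<in>I. \<Sum>j\<in>I. \<Sum>k\<in>I. \<Sum>l\<in>I. f i j k l)
  \<le> 24 * (\<Sum>i\<in>I. \<Sum>j\<in>I. if i \<le> j then \<Sum>k\<in>I. if j \<le> k then \<Sum>l\<in>I. if k \<le> l then f i j k l else 0 else 0 else 0)"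
proof -
 let ?h = "\<lambda>i j k l. if i \<le> j \<and> i \<le> k \<and> i \<le> l then f i j k l else 0"
 let ?S = "\<Sum>i\<in>I. \<Sum>j\<in>I. \<Sum>k\<in>I. \<Sum>l\<in>I. ?h i j k l"
 have e: "f j i k l = f i j k l" "f k i j l = f i j k l" "f l i j k = f i j k l" for i j k l
  by (rule s1, rule trans[OF s1 s2], rule trans[OF trans[OF s1 s2] s3])
 have "(\<Sum>i\<in>I. \<Sum>j\<in>I. \<Sum>k\<in>I. \<Sum>l\<in>I. f i j k l) \<le> (\<Sum>i\<in>I. \<Sum>j\<in>I. \<Sum>k\<in>I. \<Sum>l\<in>I. ?h i j k l + ?h j i k l + ?h k i j l + ?h l i j k)"
 proof (intro sum_mono)
  fix i j k l
  show "f i j k l \<le> ?h i j k l + ?h j i k l + ?h k i j l + ?h l i j k"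
   using e(1)[of j i k l] e(2)[of k i j l] e(3)[of l i j k] nn[of i j k l] by auto
 qed
 also have "\<dots> = ?S + (\<Sum>i\<in>I. \<Sum>j\<in>I. \<Sum>k\<in>I. \<Sum>l\<in>I. ?h j i k l) + (\<Sum>i\<in>I. \<Sum>j\<in>I. \<Sum>k\<in>I. \<Sum>l\<in>I. ?h k i j l)
   + (\<Sum>i\<in>I. \<Sum>j\<in>I. \<Sum>k\<in>I. \<Sum>l\<in>I. ?h l i j k)"
  by (simp only: sum.distrib)
 also have "(\<Sum>i\<in>I. \<Sum>j\<in>I. \<Sum>k\<in>I. \<Sum>l\<in>I. ?h j i k l) = ?S" by (rule sum.swap)
 also have "(\<Sum>i\<in>I. \<Sum>j\<in>I. \<Sum>k\<in>I. \<Sum>l\<in>I. ?h k i j l) = ?S" by (rule sum3_rotate)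
 also have "(\<Sum>i\<in>I. \<Sum>j\<in>I. \<Sum>k\<in>I. \<Sum>l\<in>I. ?h l i j k) = ?S" by (rule sum4_rotate)
 also have "?S + ?S + ?S + ?S = 4 * ?S" by simp
 also have "\<dots> \<le> 4 * (\<Sum>i\<in>I. 6 * (\<Sum>j\<in>I. \<Sum>k\<in>I. if j \<le> k then \<Sum>l\<in>I. if k \<le> l then ?h i j k l else 0 else 0))"
 proof (intro mult_left_mono sum_mono sum3_sym_le)
  fix i j k l
  show "0 \<le> ?h i j k l" using nn by auto
  show "?h i j k l = ?h i k j l" "?h i j k l = ?h i j l k" using s2[of i j k l] s3[of i j k l] by auto
 qed simp
 also have "\<dots> = 24 * (\<Sum>i\<in>I. \<Sum>j\<in>I. \<Sum>k\<in>I. if j \<le> k then \<Sum>l\<in>I. if k \<le> l then ?h i j k l else 0 else 0)"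
  by (simp add: sum_distrib_left)
 also have "(\<Sum>i\<in>I. \<Sum>j\<in>I. \<Sum>k\<in>I. if j \<le> k then \<Sum>l\<in>I. if k \<le> l then ?h i j k l else 0 else 0)
   = (\<Sum>i\<in>I. \<Sum>j\<in>I. if i \<le> j then \<Sum>k\<in>I. if j \<le> k then \<Sum>l\<in>I. if k \<le> l then f i j k l else 0 else 0 else 0)"
  by (intro sum.cong refl) (auto intro!: sum.cong sum.neutral)
 finally show ?thesis .
qed

lemma sum_gap_le:
 fixes F :: "nat \<Rightarrow> real"
 assumes F: "\<And>u. 0 \<le> F u" and k: "s \<le> k"
 shows "(\<Sum>l\<in>{s..<s+m}. if k \<le> l then F (l - k) else 0) \<le> (\<Sum>u<m. F u)"
proof -
 have "(\<Sum>l\<in>{s..<s+m}. if k \<le> l then F (l - k) else 0) = (\<Sum>l\<in>{k..<s+m}. F (l - k))"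
  using k by (intro sum.mono_neutral_cong_right) auto
 also have "\<dots> = (\<Sum>u\<in>(\<lambda>l. l - k) ` {k..<s+m}. F u)"
  by (subst sum.reindex) (auto simp: inj_on_def)
 also have "\<dots> \<le> (\<Sum>u<m. F u)" using k F by (intro sum_mono2) auto
 finally show ?thesis .
qed

text \<open>For \<open>i \<le> j \<le> k \<le> l\<close> the expectation of the product is bounded through the largest of the three gaps. The
condition \<open>c \<le> b q^3\<close>, with decreasing \<open>q\<close>, distributes the decay at the largest gap evenly
over all three, which makes the sum over the gaps a cube. The product term, which occurs only if the middle
gap is the largest, gives the main part of order \<open>m^2\<close>.\<close>
lemma (in prob_space) fourth_moment_le:
 fixes \<xi> :: "nat \<Rightarrow> 'a \<Rightarrow> real" and c q :: "nat \<Rightarrow> real"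
 assumes \<xi>[measurable]: "\<And>i. s \<le> i \<Longrightarrow> \<xi> i \<in> borel_measurable M"
  and b1: "\<And>i \<omega>. \<bar>\<xi> i \<omega>\<bar> \<le> 1"
  and c0: "\<And>r. 0 \<le> c r" and b0: "0 \<le> b" and q0: "\<And>r. 0 \<le> q r" and qdec: "\<And>r r'. r \<le> r' \<Longrightarrow> q r' \<le> q r"
  and cq: "\<And>r. c r \<le> b * (q r) ^ 3"
  and h1: "\<And>i j k l. s \<le> i \<Longrightarrow> i \<le> j \<Longrightarrow> j \<le> k \<Longrightarrow> k \<le> l \<Longrightarrow> \<bar>expectation (\<lambda>\<omega>. \<xi> i \<omega> * \<xi> j \<omega> * \<xi> k \<omega> * \<xi> l \<omega>)\<bar> \<le> c (j - i)"
  and h2: "\<And>i j k l. s \<le> i \<Longrightarrow> i \<le> j \<Longrightarrow> j \<le> k \<Longrightarrow> k \<le> l \<Longrightarrow> \<bar>expectation (\<lambda>\<omega>. \<xi> i \<omega> * \<xi> j \<omega> * \<xi> k \<omega> * \<xi> l \<omega>)\<bar> \<le> c (l - k)"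
  and h3: "\<And>i j k l. s \<le> i \<Longrightarrow> i \<le> j \<Longrightarrow> j \<le> k \<Longrightarrow> k \<le> l \<Longrightarrow> \<bar>expectation (\<lambda>\<omega>. \<xi> i \<omega> * \<xi> j \<omega> * \<xi> k \<omega> * \<xi> l \<omega>)\<bar> \<le> c (k - j) + c (j - i) * c (l - k)"
 shows "expectation (\<lambda>\<omega>. (\<Sum>i\<in>{s..<s+m}. \<xi> i \<omega>) ^ 4) \<le> 24 * (real m ^ 2 * (\<Sum>u<m. c u)\<^sup>2 + real m * (b * (\<Sum>u<m. q u) ^ 3))"
proof -
 let ?I = "{s..<s+m}"
 define e where "e i j k l = expectation (\<lambda>\<omega>. \<xi> i \<omega> * \<xi> j \<omega> * \<xi> k \<omega> * \<xi> l \<omega>)" for i j k l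
 have int: "integrable M (\<lambda>\<omega>. \<xi> i \<omega> * \<xi> j \<omega> * \<xi> k \<omega> * \<xi> l \<omega>)" if "i \<in> ?I" "j \<in> ?I" "k \<in> ?I" "l \<in> ?I" for i j k l
  using that b1 by (intro integrable_bounded[of _ 1]) (auto simp: abs_mult intro!: mult_le_one)
 have p4: "(\<Sum>i\<in>?I. \<xi> i \<omega>) ^ 4 = (\<Sum>i\<in>?I. \<Sum>j\<in>?I. \<Sum>k\<in>?I. \<Sum>l\<in>?I. \<xi> i \<omega> * \<xi> j \<omega> * \<xi> k \<omega> * \<xi> l \<omega>)" for \<omega>
  by (simp only: power4_eq_xxxx sum_distrib_left[symmetric] sum_distrib_right[symmetric])
 have "expectation (\<lambda>\<omega>. (\<Sum>i\<in>?I. \<xi> i \<omega>) ^ 4) = (\<Sum>i\<in>?I. \<Sum>j\<in>?I. \<Sum>k\<in>?I. \<Sum>l\<in>?I. e i j k l)"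
 proof -
  let ?F = "\<lambda>i j k l \<omega>. \<xi> i \<omega> * \<xi> j \<omega> * \<xi> k \<omega> * \<xi> l \<omega>"
  have "expectation (\<lambda>\<omega>. \<Sum>i\<in>?I. \<Sum>j\<in>?I. \<Sum>k\<in>?I. \<Sum>l\<in>?I. ?F i j k l \<omega>)
    = (\<Sum>i\<in>?I. expectation (\<lambda>\<omega>. \<Sum>j\<in>?I. \<Sum>k\<in>?I. \<Sum>l\<in>?I. ?F i j k l \<omega>))"
   by (intro Bochner_Integration.integral_sum Bochner_Integration.integrable_sum int)
  also have "\<dots> = (\<Sum>i\<in>?I. \<Sum>j\<in>?I. expectation (\<lambda>\<omega>. \<Sum>k\<in>?I. \<Sum>l\<in>?I. ?F i j k l \<omega>))"
   by (intro sum.cong refl Bochner_Integration.integral_sum Bochner_Integration.integrable_sum int)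
  also have "\<dots> = (\<Sum>i\<in>?I. \<Sum>j\<in>?I. \<Sum>k\<in>?I. expectation (\<lambda>\<omega>. \<Sum>l\<in>?I. ?F i j k l \<omega>))"
   by (intro sum.cong refl Bochner_Integration.integral_sum Bochner_Integration.integrable_sum int)
  also have "\<dots> = (\<Sum>i\<in>?I. \<Sum>j\<in>?I. \<Sum>k\<in>?I. \<Sum>l\<in>?I. e i j k l)"
   unfolding e_def by (intro sum.cong refl Bochner_Integration.integral_sum int)
  finally show ?thesis unfolding p4 .
 qed
 also have "\<dots> \<le> (\<Sum>i\<in>?I. \<Sum>j\<in>?I. \<Sum>k\<in>?I. \<Sum>l\<in>?I. \<bar>e i j k l\<bar>)" by (intro sum_mono) auto
 also have "\<dots> \<le> 24 * (\<Sum>i\<in>?I. \<Sum>j\<in>?I. if i \<le> j then \<Sum>k\<in>?I. if j \<le> k then \<Sum>l\<in>?I. if k \<le> l then \<bar>e i j k l\<bar> else 0 else 0 else 0)"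
 proof (rule sum4_sym_le)
  fix i j k l
  have "e i j k l = e j i k l" "e i j k l = e i k j l" "e i j k l = e i j l k"
   unfolding e_def by (simp_all add: mult_ac)
  then show "\<bar>e i j k l\<bar> = \<bar>e j i k l\<bar>" "\<bar>e i j k l\<bar> = \<bar>e i k j l\<bar>" "\<bar>e i j k l\<bar> = \<bar>e i j l k\<bar>" by simp_all
 qed simp
 also have "(\<Sum>i\<in>?I. \<Sum>j\<in>?I. if i \<le> j then \<Sum>k\<in>?I. if j \<le> k then \<Sum>l\<in>?I. if k \<le> l then \<bar>e i j k l\<bar> else 0 else 0 else 0)
   \<le> (\<Sum>i\<in>?I. \<Sum>u<m. \<Sum>v<m. \<Sum>w<m. b * (q u * q v * q w) + c u * c w)"
 proof (rule sum_mono)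
  fix i assume i: "i \<in> ?I"
  define B where "B u v w = b * (q u * q v * q w) + c u * c w" for u v w
  have B0: "0 \<le> B u v w" for u v w unfolding B_def using b0 q0 c0 by auto
  have eB: "\<bar>e i j k l\<bar> \<le> B (j - i) (k - j) (l - k)" if "i \<le> j" "j \<le> k" "k \<le> l" for j k l
  proof -
   let ?u = "j - i" and ?v = "k - j" and ?w = "l - k"
   have si: "s \<le> i" using i by simp
   have cm: "c r \<le> b * (q ?u * q ?v * q ?w)" if "?u \<le> r" "?v \<le> r" "?w \<le> r" for r
   proof -
    have "c r \<le> b * (q r * q r * q r)" using cq[of r] by (simp add: power3_eq_cube mult.assoc)
    also have "\<dots> \<le> b * (q ?u * q ?v * q ?w)"
     using b0 q0 qdec that by (intro mult_left_mono mult_mono) auto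
    finally show ?thesis .
   qed
   have cc: "0 \<le> c ?u * c ?w" using c0 by simp
   consider "?v \<le> ?u \<and> ?w \<le> ?u" | "?u \<le> ?w \<and> ?v \<le> ?w" | "?u \<le> ?v \<and> ?w \<le> ?v" by linarith
   then show ?thesis
   proof cases
    case 1
    then show ?thesis using h1[OF si that] cm[of ?u] cc by (simp add: B_def e_def)
   next
    case 2
    then show ?thesis using h2[OF si that] cm[of ?w] cc by (simp add: B_def e_def)
   next
    case 3
    then show ?thesis using h3[OF si that] cm[of ?v] by (simp add: B_def e_def)
   qed
  qed
  have "(\<Sum>j\<in>?I. if i \<le> j then \<Sum>k\<in>?I. if j \<le> k then \<Sum>l\<in>?I. if k \<le> l then \<bar>e i j k l\<bar> else 0 else 0 else 0)
    \<le> (\<Sum>j\<in>?I. if i \<le> j then (\<lambda>u. \<Sum>v<m. \<Sum>w<m. B u v w) (j - i) else 0)"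
  proof (intro sum_mono)
   fix j assume j: "j \<in> ?I"
   have "(\<Sum>k\<in>?I. if j \<le> k then \<Sum>l\<in>?I. if k \<le> l then \<bar>e i j k l\<bar> else 0 else 0)
     \<le> (\<Sum>k\<in>?I. if j \<le> k then (\<lambda>v. \<Sum>w<m. B (j - i) v w) (k - j) else 0)" if ij: "i \<le> j"
   proof (intro sum_mono)
    fix k assume k: "k \<in> ?I"
    have "(\<Sum>l\<in>?I. if k \<le> l then \<bar>e i j k l\<bar> else 0) \<le> (\<Sum>l\<in>?I. if k \<le> l then B (j - i) (k - j) (l - k) else 0)"
     if "j \<le> k" using eB ij that by (intro sum_mono) auto
    also have "\<dots> \<le> (\<Sum>w<m. B (j - i) (k - j) w)" using k B0 by (intro sum_gap_le) auto
    finally show "(if j \<le> k then \<Sum>l\<in>?I. if k \<le> l then \<bar>e i j k l\<bar> else 0 else 0)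
     \<le> (if j \<le> k then (\<lambda>v. \<Sum>w<m. B (j - i) v w) (k - j) else 0)" by auto
   qed
   also have "(\<Sum>k\<in>?I. if j \<le> k then (\<lambda>v. \<Sum>w<m. B (j - i) v w) (k - j) else 0) \<le> (\<Sum>v<m. \<Sum>w<m. B (j - i) v w)"
    using j B0 by (intro sum_gap_le) (auto intro!: sum_nonneg)
   finally show "(if i \<le> j then \<Sum>k\<in>?I. if j \<le> k then \<Sum>l\<in>?I. if k \<le> l then \<bar>e i j k l\<bar> else 0 else 0 else 0)
     \<le> (if i \<le> j then (\<lambda>u. \<Sum>v<m. \<Sum>w<m. B u v w) (j - i) else 0)" by auto
  qed
  also have "\<dots> \<le> (\<Sum>u<m. \<Sum>v<m. \<Sum>w<m. B u v w)"
   using i B0 by (intro sum_gap_le) (auto intro!: sum_nonneg)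
  finally show "(\<Sum>j\<in>?I. if i \<le> j then \<Sum>k\<in>?I. if j \<le> k then \<Sum>l\<in>?I. if k \<le> l then \<bar>e i j k l\<bar> else 0 else 0 else 0)
    \<le> (\<Sum>u<m. \<Sum>v<m. \<Sum>w<m. b * (q u * q v * q w) + c u * c w)" by (simp only: B_def)
 qed
 also have "(\<Sum>i\<in>?I. \<Sum>u<m. \<Sum>v<m. \<Sum>w<m. b * (q u * q v * q w) + c u * c w)
   = real m * (b * (\<Sum>u<m. q u) ^ 3 + real m * (\<Sum>u<m. c u)\<^sup>2)"
 proof -
  have 1: "(\<Sum>u<m. \<Sum>v<m. \<Sum>w<m. b * (q u * q v * q w)) = b * (\<Sum>u<m. q u) ^ 3"
   by (simp add: power3_eq_cube sum_distrib_left[symmetric] sum_distrib_right[symmetric])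
  have 2: "(\<Sum>u<m. \<Sum>v<m. \<Sum>w<m. c u * c w) = real m * (\<Sum>u<m. c u)\<^sup>2"
   by (simp add: power2_eq_square sum_distrib_left[symmetric] sum_distrib_right[symmetric])
  show ?thesis unfolding sum.distrib 1 2 by (simp add: distrib_left)
 qed
 finally have "expectation (\<lambda>\<omega>. (\<Sum>i\<in>?I. \<xi> i \<omega>) ^ 4) \<le> 24 * (real m * (b * (\<Sum>u<m. q u) ^ 3 + real m * (\<Sum>u<m. c u)\<^sup>2))"
  by simp
 also have "\<dots> = 24 * (real m ^ 2 * (\<Sum>u<m. c u)\<^sup>2 + real m * (b * (\<Sum>u<m. q u) ^ 3))"
  by (simp only: power2_eq_square distrib_left mult.assoc add.commute)
 finally show ?thesis .
qed

section \<open>Fourth moments of bounded observables\<close>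

text \<open>The two terms of the minimum cross at \<open>1 + u = \<delta>^(-1/A)\<close>.\<close>
lemma sum_min_powr_le:
 fixes \<delta> A :: real
 assumes d: "0 < \<delta>" "\<delta> \<le> 1" and A: "2 \<le> A"
 shows "(\<Sum>u<m. min \<delta> ((1 + real u) powr - A)) \<le> 3 * \<delta> powr (1 - 1 / A)"
proof -
 define z where "z = \<delta> powr (- 1 / A)"
 have z1: "1 \<le> z" unfolding z_def using d A powr_mono2'[of "- 1 / A" \<delta> 1] by simp
 define R where "R = nat \<lceil>z\<rceil>"
 have Rz: "z \<le> real R" and R2: "real R \<le> 2 * z" using z1 unfolding R_def by linarith+
 have R1: "1 \<le> R" using Rz z1 by linarith
 have tele: "(\<Sum>u\<in>{R..<R+n}. 1 / (1 + real u)\<^sup>2) \<le> 1 / real R - 1 / real (R + n)" for n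
 proof (induction n)
  case (Suc n)
  have pos: "0 < real (R + n)" using R1 by simp
  have "1 / (1 + real (R + n))\<^sup>2 \<le> 1 / real (R + n) - 1 / real (R + Suc n)"
  proof -
   have "1 / real (R + n) - 1 / real (R + Suc n) = 1 / (real (R + n) * (1 + real (R + n)))"
    using pos by (simp add: field_simps)
   also have "\<dots> \<ge> 1 / (1 + real (R + n))\<^sup>2"
    using pos by (intro divide_left_mono) (auto simp: power2_eq_square)
   finally show ?thesis .
  qed
  then show ?case using Suc by simp
 qed simp
 have tail: "(\<Sum>u\<in>{R..<m}. (1 + real u) powr - A) \<le> \<delta> powr (1 - 1 / A)"
 proof -
  have "(\<Sum>u\<in>{R..<m}. (1 + real u) powr - A) \<le> (\<Sum>u\<in>{R..<m}. z powr (2 - A) * (1 / (1 + real u)\<^sup>2))"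
  proof (intro sum_mono)
   fix u assume u: "u \<in> {R..<m}"
   have "(1 + real u) powr - A = (1 + real u) powr (2 - A) * (1 + real u) powr - 2" by (simp flip: powr_add)
   also have "(1 + real u) powr (2 - A) \<le> z powr (2 - A)"
    using u Rz z1 A by (intro powr_mono2') auto
   also have "(1 + real u) powr - 2 = 1 / (1 + real u)\<^sup>2" by (simp add: powr_minus inverse_eq_divide)
   finally show "(1 + real u) powr - A \<le> z powr (2 - A) * (1 / (1 + real u)\<^sup>2)"
    by (simp add: mult_right_mono)
  qed
  also have "\<dots> = z powr (2 - A) * (\<Sum>u\<in>{R..<m}. 1 / (1 + real u)\<^sup>2)" by (simp add: sum_distrib_left)
  also have "\<dots> \<le> z powr (2 - A) * (1 / z)"
  proof (intro mult_left_mono)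
   have "(\<Sum>u\<in>{R..<m}. 1 / (1 + real u)\<^sup>2) \<le> 1 / real R"
   proof (cases "R \<le> m")
    case True
    then show ?thesis using tele[of "m - R"] by (auto intro: order_trans)
   qed simp
   also have "\<dots> \<le> 1 / z" using Rz z1 by (intro divide_left_mono) auto
   finally show "(\<Sum>u\<in>{R..<m}. 1 / (1 + real u)\<^sup>2) \<le> 1 / z" .
  qed simp
  also have "\<dots> = z powr (1 - A)" using z1 by (simp add: powr_diff field_simps power2_eq_square)
  also have "\<dots> = \<delta> powr (1 - 1 / A)"
  proof -
   have "- 1 / A * (1 - A) = 1 - 1 / A" using A by (simp add: field_simps)
   then show ?thesis unfolding z_def by (simp only: powr_powr)
  qed
  finally show ?thesis .
 qed
 have "(\<Sum>u<m. min \<delta> ((1 + real u) powr - A)) \<le> (\<Sum>u\<in>{..<R} \<union> {R..<m}. min \<delta> ((1 + real u) powr - A))"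
  using d by (intro sum_mono2) auto
 also have "\<dots> = (\<Sum>u\<in>{..<R}. min \<delta> ((1 + real u) powr - A)) + (\<Sum>u\<in>{R..<m}. min \<delta> ((1 + real u) powr - A))"
  by (intro sum.union_disjoint) auto
 also have "\<dots> \<le> (\<Sum>u\<in>{..<R}. \<delta>) + (\<Sum>u\<in>{R..<m}. (1 + real u) powr - A)"
  by (intro add_mono sum_mono) auto
 also have "\<dots> \<le> 2 * (z * \<delta>) + \<delta> powr (1 - 1 / A)"
  using tail R2 d by (intro add_mono) (auto simp: mult.assoc[symmetric] intro!: mult_right_mono)
 also have "z * \<delta> = \<delta> powr (1 - 1 / A)"
 proof -
  have "z * \<delta> = \<delta> powr (- 1 / A) * \<delta> powr 1" using d by (simp add: z_def)
  also have "\<dots> = \<delta> powr (- 1 / A + 1)" by (simp only: powr_add)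
  also have "- 1 / A + 1 = 1 - 1 / A" by simp
  finally show ?thesis .
 qed
 finally show ?thesis by simp
qed

definition Q0 :: real where "Q0 = (\<Sum>u. (1 + real u) powr - (7 / 6))"

lemma summable_Q0: "summable (\<lambda>u. (1 + real u) powr - (7 / 6))"
proof -
 have "summable (\<lambda>u. real u powr - (7 / 6))" by (subst summable_real_powr_iff) simp
 then have "summable (\<lambda>u. real (Suc u) powr - (7 / 6))" by (subst summable_Suc_iff)
 then show ?thesis by (simp add: add.commute)
qed

lemma sum_le_Q0: "(\<Sum>u<m. (1 + real u) powr - (7 / 6)) \<le> Q0"
 unfolding Q0_def using summable_Q0 by (intro sum_le_suminf) auto

lemma Q0_nonneg: "0 \<le> Q0" using sum_le_Q0[of 0] by simp

context dependent_process
begin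

text \<open>The \<open>l\<close>-th approximation of \<open>X i\<close> reproduces the observable up to \<open>l^-A\<close> in mean.\<close>
definition observable :: "real \<Rightarrow> (real \<Rightarrow> real) \<Rightarrow> bool" where
 "observable C1 \<phi> \<longleftrightarrow> \<phi> \<in> borel_measurable borel \<and> (\<forall>x. 0 \<le> \<phi> x \<and> \<phi> x \<le> 1) \<and>
   (\<forall>i\<ge>1. \<forall>l. expectation (\<lambda>w. \<bar>\<phi> (X i w) - \<phi> (V l i w)\<bar>) \<le> C1 * (1 + real l) powr - A)"

text \<open>Approximations with windows of a quarter of the gap make the two groups of factors measurable
with respect to separated fields, and the covariance inequality applies.\<close>
lemma product_decorrelation:
 fixes \<psi> :: "real \<Rightarrow> real"
 assumes \<psi>[measurable]: "\<psi> \<in> borel_measurable borel" and b: "\<And>x. \<bar>\<psi> x\<bar> \<le> 1" and C1: "0 \<le> C1"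
  and ap: "\<And>i l. 1 \<le> i \<Longrightarrow> expectation (\<lambda>w. \<bar>\<psi> (X i w) - \<psi> (V l i w)\<bar>) \<le> C1 * (1 + real l) powr - A"
  and xs: "\<And>x. x \<in> set xs \<Longrightarrow> 1 \<le> x \<and> x \<le> p" and ys: "\<And>y. y \<in> set ys \<Longrightarrow> p + r \<le> y" and p: "1 \<le> p"
  and len: "length xs + length ys \<le> 4"
 defines "F \<equiv> \<lambda>zs w. prod_list (map (\<lambda>z. \<psi> (X z w)) zs)"
 shows "\<bar>expectation (\<lambda>w. F xs w * F ys w) - expectation (F xs) * expectation (F ys)\<bar>
   \<le> (8 * C1 + 4 * c0 + 2) * 4 powr A * (1 + real r) powr - A"
proof -
 have all1: "1 \<le> z" if "z \<in> set (xs @ ys)" for z using that xs ys p by fastforce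
 define Fh where "Fh l zs w = prod_list (map (\<lambda>z. \<psi> (V l z w)) zs)" for l zs w
 have Fb: "\<bar>F zs w\<bar> \<le> 1" "\<bar>Fh l zs w\<bar> \<le> 1" for zs l w
  unfolding F_def Fh_def using b by (auto intro!: abs_prod_list_le_1)
 have pm: "(\<lambda>w. prod_list (map (\<lambda>z. f z w) zs)) \<in> borel_measurable N"
  if "\<And>z. z \<in> set zs \<Longrightarrow> f z \<in> borel_measurable N" for f :: "nat \<Rightarrow> 'a \<Rightarrow> real" and zs and N :: "'a measure"
  using that by (induction zs) auto
 have Fm: "F zs \<in> borel_measurable M" if "\<And>z. z \<in> set zs \<Longrightarrow> 1 \<le> z" for zs
  unfolding F_def by (intro pm measurable_compose[OF X_meas \<psi>] that)
 have Fhm: "Fh l zs \<in> borel_measurable M" if "\<And>z. z \<in> set zs \<Longrightarrow> 1 \<le> z" for zs l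
  unfolding Fh_def by (intro pm measurable_compose[OF V_meas \<psi>] that)
 have mm: "\<bar>x * y\<bar> \<le> 1" if "\<bar>x\<bar> \<le> 1" "\<bar>y\<bar> \<le> 1" for x y :: real
  using that by (auto simp: abs_mult intro: mult_le_one)
 have ib: "integrable M f" if "f \<in> borel_measurable M" "\<And>w. \<bar>f w\<bar> \<le> 1" for f :: "'a \<Rightarrow> real"
  using that by (intro integrable_bounded[of _ 1]) auto
 have eb: "\<bar>expectation f\<bar> \<le> 1" if "f \<in> borel_measurable M" "\<And>w. \<bar>f w\<bar> \<le> 1" for f :: "'a \<Rightarrow> real"
 proof -
  have "\<bar>expectation f\<bar> \<le> expectation (\<lambda>w. \<bar>f w\<bar>)" by (rule integral_abs_bound)
  also have "\<dots> \<le> expectation (\<lambda>w. 1)" using that ib[OF that] by (intro integral_mono) auto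
  finally show ?thesis by (simp add: prob_space)
 qed
 have x1: "\<And>z. z \<in> set xs \<Longrightarrow> 1 \<le> z" and y1: "\<And>z. z \<in> set ys \<Longrightarrow> 1 \<le> z" using all1 by auto
 note xm = Fm[OF x1] Fhm[OF x1] Fm[OF y1] Fhm[OF y1]
 show ?thesis
 proof (cases "r = 0")
  case True
  have "\<bar>expectation (\<lambda>w. F xs w * F ys w)\<bar> \<le> 1" using xm Fb mm by (intro eb) auto
  moreover have "\<bar>expectation (F xs) * expectation (F ys)\<bar> \<le> 1" using xm Fb by (intro mm eb) auto
  ultimately have "\<bar>expectation (\<lambda>w. F xs w * F ys w) - expectation (F xs) * expectation (F ys)\<bar> \<le> 2" by linarith
  also have "\<dots> \<le> (8 * C1 + 4 * c0 + 2) * 1" using C1 c0_nonneg by simp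
  also have "\<dots> \<le> (8 * C1 + 4 * c0 + 2) * 4 powr A" using C1 c0_nonneg exps by (intro mult_left_mono ge_one_powr_ge_zero) auto
  finally show ?thesis using True by simp
 next
  case False
  then have r: "1 \<le> r" by simp
  define l where "l = r div 4"
  define err where "err = C1 * (1 + real l) powr - A"
  have err0: "0 \<le> err" using C1 by (simp add: err_def)
  have app: "expectation (\<lambda>w. \<bar>F zs w - Fh l zs w\<bar>) \<le> real (length zs) * err"
   if z1: "\<And>z. z \<in> set zs \<Longrightarrow> 1 \<le> z" for zs
  proof -
   have di: "integrable M (\<lambda>w. \<bar>\<psi> (X z w) - \<psi> (V l z w)\<bar>)" if "1 \<le> z" for z
    by (intro integrable_abs Bochner_Integration.integrable_diff ib measurable_compose[OF X_meas[OF that] \<psi>] measurable_compose[OF V_meas[OF that] \<psi>] b)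
   have si: "integrable M (\<lambda>w. \<Sum>z\<leftarrow>zs'. \<bar>\<psi> (X z w) - \<psi> (V l z w)\<bar>) \<and>
     expectation (\<lambda>w. \<Sum>z\<leftarrow>zs'. \<bar>\<psi> (X z w) - \<psi> (V l z w)\<bar>) \<le> real (length zs') * err"
    if "\<And>z. z \<in> set zs' \<Longrightarrow> 1 \<le> z" for zs'
    using that
   proof (induction zs')
    case (Cons z zs')
    have z1: "1 \<le> z" using Cons by simp
    have "integrable M (\<lambda>w. \<Sum>z\<leftarrow>zs'. \<bar>\<psi> (X z w) - \<psi> (V l z w)\<bar>)" and
     "expectation (\<lambda>w. \<Sum>z\<leftarrow>zs'. \<bar>\<psi> (X z w) - \<psi> (V l z w)\<bar>) \<le> real (length zs') * err"
     using Cons by auto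
    then show ?case using di[OF z1] ap[OF z1, of l] by (auto simp: err_def algebra_simps)
   qed simp
   have "expectation (\<lambda>w. \<bar>F zs w - Fh l zs w\<bar>) \<le> expectation (\<lambda>w. \<Sum>z\<leftarrow>zs. \<bar>\<psi> (X z w) - \<psi> (V l z w)\<bar>)"
   proof (rule integral_mono)
    show "integrable M (\<lambda>w. \<bar>F zs w - Fh l zs w\<bar>)"
     by (intro integrable_abs Bochner_Integration.integrable_diff ib Fm Fhm Fb z1)
    show "\<bar>F zs w - Fh l zs w\<bar> \<le> (\<Sum>z\<leftarrow>zs. \<bar>\<psi> (X z w) - \<psi> (V l z w)\<bar>)" for w
     unfolding F_def Fh_def by (intro prod_list_diff_le b)
   qed (use si z1 in auto)
   then show ?thesis using si[of zs] z1 by fastforce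
  qed
  have ax: "expectation (\<lambda>w. \<bar>F xs w - Fh l xs w\<bar>) \<le> real (length xs) * err"
   and ay: "expectation (\<lambda>w. \<bar>F ys w - Fh l ys w\<bar>) \<le> real (length ys) * err"
   using app x1 y1 by auto
  have dx: "integrable M (\<lambda>w. \<bar>F xs w - Fh l xs w\<bar>)" and dy: "integrable M (\<lambda>w. \<bar>F ys w - Fh l ys w\<bar>)"
   by (intro integrable_abs Bochner_Integration.integrable_diff ib xm Fb; simp)+
  have 1: "\<bar>expectation (\<lambda>w. F xs w * F ys w) - expectation (\<lambda>w. Fh l xs w * Fh l ys w)\<bar> \<le> 4 * err"
  proof -
   have pw: "\<bar>F xs w * F ys w - Fh l xs w * Fh l ys w\<bar> \<le> \<bar>F xs w - Fh l xs w\<bar> + \<bar>F ys w - Fh l ys w\<bar>" for w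
   proof -
    have "F xs w * F ys w - Fh l xs w * Fh l ys w = (F xs w - Fh l xs w) * F ys w + Fh l xs w * (F ys w - Fh l ys w)"
     by (simp add: algebra_simps)
    also have "\<bar>\<dots>\<bar> \<le> \<bar>F xs w - Fh l xs w\<bar> * \<bar>F ys w\<bar> + \<bar>Fh l xs w\<bar> * \<bar>F ys w - Fh l ys w\<bar>"
     using abs_triangle_ineq[of "(F xs w - Fh l xs w) * F ys w" "Fh l xs w * (F ys w - Fh l ys w)"] by (simp add: abs_mult)
    also have "\<dots> \<le> \<bar>F xs w - Fh l xs w\<bar> * 1 + 1 * \<bar>F ys w - Fh l ys w\<bar>"
     using Fb by (intro add_mono mult_left_mono mult_right_mono) auto
    finally show ?thesis by simp
   qed
   have ip: "integrable M (\<lambda>w. F xs w * F ys w)" "integrable M (\<lambda>w. Fh l xs w * Fh l ys w)"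
    using xm Fb mm by (intro ib; auto)+
   have "\<bar>expectation (\<lambda>w. F xs w * F ys w) - expectation (\<lambda>w. Fh l xs w * Fh l ys w)\<bar>
     \<le> expectation (\<lambda>w. \<bar>F xs w * F ys w - Fh l xs w * Fh l ys w\<bar>)"
    using integral_abs_bound[of M "\<lambda>w. F xs w * F ys w - Fh l xs w * Fh l ys w"] ip by simp
   also have "\<dots> \<le> expectation (\<lambda>w. \<bar>F xs w - Fh l xs w\<bar> + \<bar>F ys w - Fh l ys w\<bar>)"
    by (rule integral_mono[OF _ Bochner_Integration.integrable_add[OF dx dy] pw])
     (intro integrable_abs Bochner_Integration.integrable_diff ip)
   also have "\<dots> \<le> real (length xs) * err + real (length ys) * err" using dx dy ax ay by simp
   also have "\<dots> = real (length xs + length ys) * err" by (simp add: distrib_right)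
   also have "\<dots> \<le> 4 * err" using len err0 by (intro mult_right_mono) auto
   finally show ?thesis .
  qed
  have 2: "\<bar>expectation (F xs) * expectation (F ys) - expectation (Fh l xs) * expectation (Fh l ys)\<bar> \<le> 4 * err"
  proof -
   let ?a = "expectation (F xs)" and ?b = "expectation (F ys)" and ?c = "expectation (Fh l xs)" and ?d = "expectation (Fh l ys)"
   have 1: "\<bar>?a - ?c\<bar> \<le> real (length xs) * err"
    using integral_abs_bound[of M "\<lambda>w. F xs w - Fh l xs w"] ax ib[OF xm(1) Fb(1)] ib[OF xm(2) Fb(2)] by simp
   have 2: "\<bar>?b - ?d\<bar> \<le> real (length ys) * err"
    using integral_abs_bound[of M "\<lambda>w. F ys w - Fh l ys w"] ay ib[OF xm(3) Fb(1)] ib[OF xm(4) Fb(2)] by simp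
   have "?a * ?b - ?c * ?d = (?a - ?c) * ?b + ?c * (?b - ?d)" by (simp add: algebra_simps)
   also have "\<bar>\<dots>\<bar> \<le> \<bar>?a - ?c\<bar> * \<bar>?b\<bar> + \<bar>?c\<bar> * \<bar>?b - ?d\<bar>"
    using abs_triangle_ineq[of "(?a - ?c) * ?b" "?c * (?b - ?d)"] by (simp add: abs_mult)
   also have "\<dots> \<le> \<bar>?a - ?c\<bar> * 1 + 1 * \<bar>?b - ?d\<bar>"
    using eb[OF xm(3) Fb(1)] eb[OF xm(2) Fb(2)] by (intro add_mono mult_left_mono mult_right_mono) auto
   also have "\<dots> \<le> real (length xs + length ys) * err" using 1 2 by (simp add: distrib_right)
   also have "\<dots> \<le> 4 * err" using len err0 by (intro mult_right_mono) auto
   finally show ?thesis .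
  qed
  have 3: "\<bar>expectation (\<lambda>w. Fh l xs w * Fh l ys w) - expectation (Fh l xs) * expectation (Fh l ys)\<bar>
    \<le> 4 * (c0 * (real (r - 2 * (r div 4))) powr - \<theta>)"
  proof (rule covariance_le[OF past_sub fut_sub mixing_gap[OF _ r refl]])
   show "1 \<le> int p + int l" using p by simp
   show "Fh l xs \<in> borel_measurable (past (int p + int l))"
    unfolding Fh_def
   proof (intro pm measurable_compose[OF _ \<psi>])
    fix z assume "z \<in> set xs"
    then show "V l z \<in> borel_measurable (past (int p + int l))"
     using xs by (intro measurable_past_mono[OF _ V_past]) auto
   qed
   show "Fh l ys \<in> borel_measurable (fut (int p + int l + int r - 2 * int (r div 4) - 1))"
    unfolding Fh_def
   proof (intro pm measurable_compose[OF _ \<psi>])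
    fix z assume z: "z \<in> set ys"
    show "V l z \<in> borel_measurable (fut (int p + int l + int r - 2 * int (r div 4) - 1))"
     using ys[OF z] y1[OF z] by (intro measurable_fut_mono[OF _ V_fut]) (auto simp: l_def)
   qed
  qed (use Fb in auto)
  have half: "(1 + real r) powr - A * 4 powr A = ((1 + real r) / 4) powr - A"
  proof -
   have "((1 + real r) / 4) powr - A = (1 + real r) powr - A / 4 powr - A" by (rule powr_divide)
   also have "\<dots> = (1 + real r) powr - A * 4 powr A" using powr_minus[of 4 A] by (simp add: divide_inverse)
   finally show ?thesis by simp
  qed
  have e1: "err \<le> C1 * ((1 + real r) powr - A * 4 powr A)"
   unfolding err_def half using C1 gap_ineq(2)[of r] exps by (intro mult_left_mono powr_mono2') (auto simp: l_def)
  have e2: "c0 * (real (r - 2 * (r div 4))) powr - \<theta> \<le> c0 * ((1 + real r) powr - A * 4 powr A)"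
  proof (intro mult_left_mono c0_nonneg)
   have "(real (r - 2 * (r div 4))) powr - \<theta> \<le> (real (r - 2 * (r div 4))) powr - A"
    using gap_ineq(3)[OF r] exps by (intro powr_mono) auto
   also have "\<dots> \<le> ((1 + real r) / 4) powr - A"
    using gap_ineq(1)[OF r] exps by (intro powr_mono2') auto
   finally show "(real (r - 2 * (r div 4))) powr - \<theta> \<le> (1 + real r) powr - A * 4 powr A" unfolding half .
  qed
  have "\<bar>expectation (\<lambda>w. F xs w * F ys w) - expectation (F xs) * expectation (F ys)\<bar> \<le> 8 * err + 4 * (c0 * (real (r - 2 * (r div 4))) powr - \<theta>)"
   using 1 2 3 by linarith
  also have "\<dots> \<le> 8 * (C1 * ((1 + real r) powr - A * 4 powr A)) + 4 * (c0 * ((1 + real r) powr - A * 4 powr A))"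
   using e1 e2 by linarith
  also have "\<dots> \<le> (8 * C1 + 4 * c0 + 2) * ((1 + real r) powr - A * 4 powr A)" by (simp add: distrib_right)
  finally show ?thesis by (simp add: mult_ac)
 qed
qed

definition K4 :: "real \<Rightarrow> real \<Rightarrow> real" where
 "K4 C1 K = 24 * (9 * (4 * K + (8 * C1 + 4 * c0 + 2) * 4 powr A)\<^sup>2 + (4 * K + (8 * C1 + 4 * c0 + 2) * 4 powr A) * Q0 ^ 3)"

text \<open>A centred product has expectation of order \<open>\<delta>\<close> for trivial reasons and of order \<open>r^-A\<close> by
decorrelation. The minimum \<open>c\<close> of the two sums to \<open>\<delta>^(1-1/A)\<close>. Interpolating between
them, \<open>c \<le> C \<delta>^(1-\<sigma>) r^(-\<sigma> A)\<close> with \<open>\<sigma> A = 7/2\<close>, gives a \<open>q\<close> that decays like \<open>r^(-7/6)\<close> and is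
summable; this is the second term.\<close>
lemma fourth_moment_observable:
 assumes obs: "observable C1 \<phi>" and C1: "0 \<le> C1" and K: "0 \<le> K" and \<delta>: "0 < \<delta>" "\<delta> \<le> 1"
  and mean: "(\<integral>x. \<phi> x \<partial>\<mu>) \<le> K * \<delta>" and s: "1 \<le> s"
 shows "expectation (\<lambda>w. (\<Sum>i\<in>{s..<s+n}. \<phi> (X i w) - (\<integral>x. \<phi> x \<partial>\<mu>)) ^ 4)
  \<le> K4 C1 K * (real n ^ 2 * \<delta> powr (2 - 2 / A) + real n * \<delta> powr (1 - 7 / (2 * A)))"
proof -
 define m where "m = (\<integral>x. \<phi> x \<partial>\<mu>)"
 define C where "C = 4 * K + (8 * C1 + 4 * c0 + 2) * 4 powr A"
 define \<psi> where "\<psi> x = \<phi> x - m" for x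
 have [measurable]: "\<phi> \<in> borel_measurable borel" and \<phi>01: "0 \<le> \<phi> x" "\<phi> x \<le> 1"
  and ap: "1 \<le> i \<Longrightarrow> expectation (\<lambda>w. \<bar>\<phi> (X i w) - \<phi> (V l i w)\<bar>) \<le> C1 * (1 + real l) powr - A" for x i l
  using obs by (auto simp: observable_def)
 have me: "m = expectation (\<lambda>w. \<phi> (X i w))" if "1 \<le> i" for i
  unfolding m_def X_law[OF that, symmetric] using X_meas[OF that] by (subst integral_distr) auto
 have ii: "integrable M (\<lambda>w. \<phi> (X i w))" if "1 \<le> i" for i
  using \<phi>01 X_meas[OF that] by (intro integrable_bounded[of _ 1]) auto
 have m0: "0 \<le> m" unfolding me[OF order_refl] using \<phi>01 by (intro integral_nonneg_AE) auto
 have m1: "m \<le> 1"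
 proof -
  have "m \<le> expectation (\<lambda>w. 1)" unfolding me[OF order_refl] using \<phi>01 ii by (intro integral_mono) auto
  then show ?thesis by (simp add: prob_space)
 qed
 have mK: "m \<le> K * \<delta>" using mean by (simp add: m_def)
 have \<psi>m[measurable]: "\<psi> \<in> borel_measurable borel" unfolding \<psi>_def[abs_def] by measurable
 have \<psi>b: "\<bar>\<psi> x\<bar> \<le> 1" for x using \<phi>01[of x] m0 m1 by (simp add: \<psi>_def abs_le_iff)
 have \<psi>ap: "expectation (\<lambda>w. \<bar>\<psi> (X i w) - \<psi> (V l i w)\<bar>) \<le> C1 * (1 + real l) powr - A" if "1 \<le> i" for i l
  using ap[OF that] by (simp add: \<psi>_def)
 define \<xi> where "\<xi> i w = (if 1 \<le> i then \<psi> (X i w) else 0)" for i w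
 have \<xi>m: "\<xi> i \<in> borel_measurable M" for i
  unfolding \<xi>_def[abs_def] using X_meas[of i] by (cases "1 \<le> i") auto
 have \<xi>b: "\<bar>\<xi> i w\<bar> \<le> 1" for i w using \<psi>b by (simp add: \<xi>_def)
 have \<psi>E: "expectation (\<lambda>w. \<psi> (X i w)) = 0" if "1 \<le> i" for i
  unfolding \<psi>_def using ii[OF that] me[OF that] by (simp add: prob_space)
 have \<psi>A: "expectation (\<lambda>w. \<bar>\<psi> (X i w)\<bar>) \<le> 2 * K * \<delta>" if "1 \<le> i" for i
 proof -
  have "expectation (\<lambda>w. \<bar>\<psi> (X i w)\<bar>) \<le> expectation (\<lambda>w. \<phi> (X i w) + m)"
   unfolding \<psi>_def using ii[OF that] \<phi>01 m0 by (intro integral_mono) (auto simp: abs_le_iff add_increasing2)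
  also have "\<dots> = 2 * m" using ii[OF that] me[OF that] by (simp add: prob_space)
  finally show ?thesis using mK by linarith
 qed
 have eF: "expectation (\<lambda>w. \<psi> (X i w) * \<psi> (X j w) * \<psi> (X k w) * \<psi> (X l w)) = expectation (\<lambda>w. \<xi> i w * \<xi> j w * \<xi> k w * \<xi> l w)"
  if "1 \<le> i" "1 \<le> j" "1 \<le> k" "1 \<le> l" for i j k l using that by (simp add: \<xi>_def)
 have triv: "\<bar>expectation (\<lambda>w. \<psi> (X i w) * g w)\<bar> \<le> 2 * K * \<delta>"
  if i: "1 \<le> i" and g: "g \<in> borel_measurable M" "\<And>w. \<bar>g w\<bar> \<le> 1" for i g
 proof -
  have [measurable]: "X i \<in> borel_measurable M" "g \<in> borel_measurable M" using X_meas[OF i] g by auto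
  have "\<bar>expectation (\<lambda>w. \<psi> (X i w) * g w)\<bar> \<le> expectation (\<lambda>w. \<bar>\<psi> (X i w) * g w\<bar>)" by (rule integral_abs_bound)
  also have "\<dots> \<le> expectation (\<lambda>w. \<bar>\<psi> (X i w)\<bar>)"
  proof (rule integral_mono)
   show "integrable M (\<lambda>w. \<bar>\<psi> (X i w) * g w\<bar>)"
    using \<psi>b g by (intro integrable_bounded[of _ 1]) (auto simp: abs_mult intro!: mult_le_one)
   show "integrable M (\<lambda>w. \<bar>\<psi> (X i w)\<bar>)" using \<psi>b by (intro integrable_bounded[of _ 1]) auto
   show "\<bar>\<psi> (X i w) * g w\<bar> \<le> \<bar>\<psi> (X i w)\<bar>" for w using g(2)[of w] by (simp add: abs_mult mult_left_le)
  qed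
  finally show ?thesis using \<psi>A[OF i] by linarith
 qed
 have m2: "\<bar>x * y\<bar> \<le> 1" if "\<bar>x\<bar> \<le> 1" "\<bar>y\<bar> \<le> 1" for x y :: real
  using that by (auto simp: abs_mult intro: mult_le_one)
 define c where "c r = C * min \<delta> ((1 + real r) powr - A)" for r :: nat
 have Cpos: "0 \<le> C" using K C1 c0_nonneg by (simp add: C_def)
 have c_ge: "x \<le> c r" if "x \<le> 4 * K * \<delta>" "x \<le> (8 * C1 + 4 * c0 + 2) * 4 powr A * (1 + real r) powr - A" for x r
 proof -
  have "x \<le> C * \<delta>" using that(1) C1 c0_nonneg \<delta> by (simp add: C_def distrib_right add_increasing2)
  moreover have "x \<le> C * (1 + real r) powr - A" using that(2) K by (simp add: C_def distrib_right add_increasing)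
  ultimately show ?thesis unfolding c_def by (simp add: min_def)
 qed
 have pd: "\<bar>expectation (\<lambda>w. prod_list (map (\<lambda>z. \<psi> (X z w)) xs) * prod_list (map (\<lambda>z. \<psi> (X z w)) ys))
   - expectation (\<lambda>w. prod_list (map (\<lambda>z. \<psi> (X z w)) xs)) * expectation (\<lambda>w. prod_list (map (\<lambda>z. \<psi> (X z w)) ys))\<bar>
   \<le> (8 * C1 + 4 * c0 + 2) * 4 powr A * (1 + real r) powr - A"
  if "\<forall>x\<in>set xs. 1 \<le> x \<and> x \<le> p" "\<forall>y\<in>set ys. p + r \<le> y" "1 \<le> p" "length xs + length ys \<le> 4" for xs ys p r
  by (rule product_decorrelation[OF \<psi>m \<psi>b C1 \<psi>ap]) (use that in auto)
 have h: "\<bar>expectation (\<lambda>w. \<xi> i w * \<xi> j w * \<xi> k w * \<xi> l w)\<bar> \<le> c (j - i)"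
   "\<bar>expectation (\<lambda>w. \<xi> i w * \<xi> j w * \<xi> k w * \<xi> l w)\<bar> \<le> c (l - k)"
   "\<bar>expectation (\<lambda>w. \<xi> i w * \<xi> j w * \<xi> k w * \<xi> l w)\<bar> \<le> c (k - j) + c (j - i) * c (l - k)"
  if o: "s \<le> i" "i \<le> j" "j \<le> k" "k \<le> l" for i j k l
 proof -
  have p1: "1 \<le> i" "1 \<le> j" "1 \<le> k" "1 \<le> l" using o s by auto
  note [measurable] = X_meas[OF p1(1)] X_meas[OF p1(2)] X_meas[OF p1(3)] X_meas[OF p1(4)]
  let ?E = "expectation (\<lambda>w. \<psi> (X i w) * \<psi> (X j w) * \<psi> (X k w) * \<psi> (X l w))"
  have t: "\<bar>?E\<bar> \<le> 2 * K * \<delta>"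
   using triv[OF p1(1), of "\<lambda>w. \<psi> (X j w) * \<psi> (X k w) * \<psi> (X l w)"] \<psi>b m2 by (simp add: mult.assoc)
  have t4: "\<bar>?E\<bar> \<le> 4 * K * \<delta>" using t K \<delta> by (simp add: order_trans[OF t])
  show "\<bar>expectation (\<lambda>w. \<xi> i w * \<xi> j w * \<xi> k w * \<xi> l w)\<bar> \<le> c (j - i)"
   unfolding eF[OF p1, symmetric]
  proof (rule c_ge[OF t4])
   show "\<bar>?E\<bar> \<le> (8 * C1 + 4 * c0 + 2) * 4 powr A * (1 + real (j - i)) powr - A"
    using pd[of "[i]" i "[j, k, l]" "j - i"] o p1 \<psi>E[OF p1(1)] by (simp add: mult.assoc)
  qed
  show "\<bar>expectation (\<lambda>w. \<xi> i w * \<xi> j w * \<xi> k w * \<xi> l w)\<bar> \<le> c (l - k)"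
   unfolding eF[OF p1, symmetric]
  proof (rule c_ge[OF t4])
   show "\<bar>?E\<bar> \<le> (8 * C1 + 4 * c0 + 2) * 4 powr A * (1 + real (l - k)) powr - A"
    using pd[of "[i, j, k]" k "[l]" "l - k"] o p1 \<psi>E[OF p1(4)] by (simp add: mult.assoc)
  qed
  let ?A = "expectation (\<lambda>w. \<psi> (X i w) * \<psi> (X j w))" and ?B = "expectation (\<lambda>w. \<psi> (X k w) * \<psi> (X l w))"
  have A1: "\<bar>?A\<bar> \<le> 2 * K * \<delta>" using triv[OF p1(1), of "\<lambda>w. \<psi> (X j w)"] \<psi>b by simp
  have B1: "\<bar>?B\<bar> \<le> 2 * K * \<delta>" using triv[OF p1(3), of "\<lambda>w. \<psi> (X l w)"] \<psi>b by simp
  have pos: "0 \<le> K * \<delta>" using K \<delta> by simp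
  have Ac: "\<bar>?A\<bar> \<le> c (j - i)"
  proof (rule c_ge)
   show "\<bar>?A\<bar> \<le> 4 * K * \<delta>" using A1 pos by linarith
   show "\<bar>?A\<bar> \<le> (8 * C1 + 4 * c0 + 2) * 4 powr A * (1 + real (j - i)) powr - A"
    using pd[of "[i]" i "[j]" "j - i"] o p1 \<psi>E[OF p1(1)] by simp
  qed
  have Bc: "\<bar>?B\<bar> \<le> c (l - k)"
  proof (rule c_ge)
   show "\<bar>?B\<bar> \<le> 4 * K * \<delta>" using B1 pos by linarith
   show "\<bar>?B\<bar> \<le> (8 * C1 + 4 * c0 + 2) * 4 powr A * (1 + real (l - k)) powr - A"
    using pd[of "[k]" k "[l]" "l - k"] o p1 \<psi>E[OF p1(3)] by simp
  qed
  have B2: "\<bar>?B\<bar> \<le> 1"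
  proof -
   have "\<bar>?B\<bar> \<le> expectation (\<lambda>w. \<bar>\<psi> (X k w) * \<psi> (X l w)\<bar>)" by (rule integral_abs_bound)
   also have "\<dots> \<le> expectation (\<lambda>w. 1)"
    using \<psi>b m2 by (intro integral_mono integrable_abs integrable_bounded[of _ 1]) auto
   finally show ?thesis by (simp add: prob_space)
  qed
  have AB: "\<bar>?A * ?B\<bar> \<le> 2 * K * \<delta>"
   unfolding abs_mult using mult_mono[OF A1 B2] pos by simp
  have "\<bar>?E - ?A * ?B\<bar> \<le> c (k - j)"
  proof (rule c_ge)
   show "\<bar>?E - ?A * ?B\<bar> \<le> 4 * K * \<delta>" using t AB by linarith
   show "\<bar>?E - ?A * ?B\<bar> \<le> (8 * C1 + 4 * c0 + 2) * 4 powr A * (1 + real (k - j)) powr - A"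
    using pd[of "[i, j]" j "[k, l]" "k - j"] o p1 by (simp add: mult.assoc)
  qed
  moreover have "\<bar>?A * ?B\<bar> \<le> c (j - i) * c (l - k)"
   unfolding abs_mult using Ac Bc by (intro mult_mono) auto
  ultimately show "\<bar>expectation (\<lambda>w. \<xi> i w * \<xi> j w * \<xi> k w * \<xi> l w)\<bar> \<le> c (k - j) + c (j - i) * c (l - k)"
   unfolding eF[OF p1, symmetric] by linarith
 qed
 define b where "b = C * \<delta> powr (1 - 7 / (2 * A))"
 define q where "q r = (1 + real r) powr - (7 / 6)" for r :: nat
 have cq: "c r \<le> b * (q r) ^ 3" for r
 proof -
  define \<sigma> where "\<sigma> = 7 / (2 * A)"
  have \<sigma>: "0 \<le> \<sigma>" "\<sigma> \<le> 1" using exps by (auto simp: \<sigma>_def field_simps)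
  define x where "x = 1 + real r"
  have x: "1 \<le> x" by (simp add: x_def)
  define wt where "wt = min \<delta> (x powr - A)"
  have w0: "0 < wt" using \<delta> x by (simp add: wt_def)
  have "wt = wt powr (1 - \<sigma>) * wt powr \<sigma>" using w0 by (simp flip: powr_add)
  also have "\<dots> \<le> \<delta> powr (1 - \<sigma>) * (x powr - A) powr \<sigma>"
   using w0 \<sigma> by (intro mult_mono powr_mono2) (auto simp: wt_def)
  also have "(x powr - A) powr \<sigma> = x powr - (7 / 2)" using exps by (simp add: powr_powr \<sigma>_def)
  also have "x powr - (7 / 2) = (x powr - (7 / 6)) ^ 3" by (simp add: power3_eq_cube flip: powr_add)
  finally have "wt \<le> \<delta> powr (1 - \<sigma>) * (x powr - (7 / 6)) ^ 3" .
  from mult_left_mono[OF this Cpos] show ?thesis by (simp add: c_def b_def q_def wt_def x_def \<sigma>_def mult.assoc)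
 qed
 have "expectation (\<lambda>w. (\<Sum>i\<in>{s..<s+n}. \<xi> i w) ^ 4) \<le> 24 * (real n ^ 2 * (\<Sum>u<n. c u)\<^sup>2 + real n * (b * (\<Sum>u<n. q u) ^ 3))"
 proof (rule fourth_moment_le[where c = c and q = q and b = b])
  show "0 \<le> c r" for r using Cpos \<delta> by (simp add: c_def)
  show "0 \<le> b" using Cpos by (simp add: b_def)
  show "0 \<le> q r" for r by (simp add: q_def)
  show "q r' \<le> q r" if "r \<le> r'" for r r' using that unfolding q_def by (intro powr_mono2') auto
 qed (use \<xi>m \<xi>b cq h in auto)
 also have "(\<Sum>u<n. c u)\<^sup>2 \<le> (C * (3 * \<delta> powr (1 - 1 / A)))\<^sup>2"
 proof (rule power_mono)
  have "(\<Sum>u<n. c u) = C * (\<Sum>u<n. min \<delta> ((1 + real u) powr - A))" by (simp add: c_def sum_distrib_left)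
  also have "\<dots> \<le> C * (3 * \<delta> powr (1 - 1 / A))"
   using \<delta> exps Cpos by (intro mult_left_mono sum_min_powr_le) auto
  finally show "(\<Sum>u<n. c u) \<le> C * (3 * \<delta> powr (1 - 1 / A))" .
  show "0 \<le> (\<Sum>u<n. c u)" using Cpos \<delta> by (auto simp: c_def intro!: sum_nonneg)
 qed
 also have "(C * (3 * \<delta> powr (1 - 1 / A)))\<^sup>2 = 9 * C\<^sup>2 * \<delta> powr (2 - 2 / A)"
 proof -
  have "(\<delta> powr (1 - 1 / A))\<^sup>2 = \<delta> powr (2 - 2 / A)" by (simp add: power2_eq_square flip: powr_add)
  then show ?thesis by (simp add: power_mult_distrib)
 qed
 also have "b * (\<Sum>u<n. q u) ^ 3 \<le> b * Q0 ^ 3"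
  using Cpos sum_le_Q0[of n] by (intro mult_left_mono power_mono sum_nonneg) (auto simp: b_def q_def)
 finally have "expectation (\<lambda>w. (\<Sum>i\<in>{s..<s+n}. \<xi> i w) ^ 4)
   \<le> 24 * (real n ^ 2 * (9 * C\<^sup>2 * \<delta> powr (2 - 2 / A)) + real n * (b * Q0 ^ 3))"
  by (simp add: mult_left_mono add_mono)
 also have "\<dots> = (24 * 9 * C\<^sup>2) * (real n ^ 2 * \<delta> powr (2 - 2 / A)) + (24 * C * Q0 ^ 3) * (real n * \<delta> powr (1 - 7 / (2 * A)))"
  by (simp add: b_def algebra_simps)
 also have "\<dots> \<le> K4 C1 K * (real n ^ 2 * \<delta> powr (2 - 2 / A)) + K4 C1 K * (real n * \<delta> powr (1 - 7 / (2 * A)))"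
 proof -
  have "K4 C1 K = 24 * 9 * C\<^sup>2 + 24 * C * Q0 ^ 3" by (simp add: K4_def C_def)
  moreover have "0 \<le> 24 * C * Q0 ^ 3" "0 \<le> 24 * 9 * C\<^sup>2" using Cpos Q0_nonneg by auto
  ultimately show ?thesis by (intro add_mono mult_right_mono) auto
 qed
 finally have "expectation (\<lambda>w. (\<Sum>i\<in>{s..<s+n}. \<xi> i w) ^ 4)
   \<le> K4 C1 K * (real n ^ 2 * \<delta> powr (2 - 2 / A) + real n * \<delta> powr (1 - 7 / (2 * A)))" by (simp add: distrib_left)
 moreover have "(\<Sum>i\<in>{s..<s+n}. \<xi> i w) = (\<Sum>i\<in>{s..<s+n}. \<phi> (X i w) - (\<integral>x. \<phi> x \<partial>\<mu>))" for w
  using s by (intro sum.cong) (auto simp: \<xi>_def \<psi>_def m_def)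
 ultimately show ?thesis by simp
qed

end

section \<open>Maximal inequalities\<close>

text \<open>The binary expansion of \<open>m\<close> writes the partial sum with at most one aligned dyadic block of each length.\<close>
lemma dyadic_partial_sum_le:
 fixes a :: "nat \<Rightarrow> real"
 assumes "\<And>j k. j < l \<Longrightarrow> k < 2 ^ (l - j) \<Longrightarrow> \<bar>\<Sum>i\<in>{s + k * 2 ^ j..<s + k * 2 ^ j + 2 ^ j}. a i\<bar> \<le> y j"
  and "m < 2 ^ l"
 shows "\<bar>\<Sum>i\<in>{s..<s+m}. a i\<bar> \<le> (\<Sum>j<l. y j)"
 using assms
proof (induction l arbitrary: s m)
 case (Suc l)
 have y0: "0 \<le> y l" using Suc.prems(1)[of l 0] by auto
 have blk: "\<bar>\<Sum>i\<in>{s + k * 2 ^ j..<s + k * 2 ^ j + 2 ^ j}. a i\<bar> \<le> y j" if "j < l" "k < 2 ^ (l - j)" for j k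
 proof -
  have "(2::nat) ^ (l - j) \<le> 2 ^ (Suc l - j)" by (intro power_increasing) auto
  then have "k < 2 ^ (Suc l - j)" using that(2) by (rule less_le_trans[rotated])
  then show ?thesis using Suc.prems(1)[of j k] that by auto
 qed
 show ?case
 proof (cases "m < 2 ^ l")
  case True
  then have "\<bar>\<Sum>i\<in>{s..<s+m}. a i\<bar> \<le> (\<Sum>j<l. y j)" using Suc.IH blk by blast
  then show ?thesis using y0 by simp
 next
  case False
  define m' where "m' = m - 2 ^ l"
  have m: "m = 2 ^ l + m'" "m' < 2 ^ l" using False Suc.prems(2) by (auto simp: m'_def)
  have "\<bar>\<Sum>i\<in>{s + 2 ^ l..<s + 2 ^ l + m'}. a i\<bar> \<le> (\<Sum>j<l. y j)"
  proof (rule Suc.IH[OF _ m(2)])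
   fix j k :: nat assume j: "j < l" and k: "k < 2 ^ (l - j)"
   have e: "(2::nat) ^ (l - j) * 2 ^ j = 2 ^ l" using j by (simp flip: power_add)
   have "(2::nat) ^ (Suc l - j) = 2 ^ (l - j) + 2 ^ (l - j)" using j by (simp add: Suc_diff_le)
   then have "k + 2 ^ (l - j) < 2 ^ (Suc l - j)" using k by simp
   from Suc.prems(1)[OF _ this] j
   have "\<bar>\<Sum>i\<in>{s + (k + 2 ^ (l - j)) * 2 ^ j..<s + (k + 2 ^ (l - j)) * 2 ^ j + 2 ^ j}. a i\<bar> \<le> y j" by simp
   moreover have "s + (k + 2 ^ (l - j)) * 2 ^ j = s + 2 ^ l + k * 2 ^ j" using e by (simp add: distrib_right)
   ultimately show "\<bar>\<Sum>i\<in>{s + 2 ^ l + k * 2 ^ j..<s + 2 ^ l + k * 2 ^ j + 2 ^ j}. a i\<bar> \<le> y j" by (simp only:)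
  qed
  moreover have "\<bar>\<Sum>i\<in>{s..<s + 2 ^ l}. a i\<bar> \<le> y l" using Suc.prems(1)[of l 0] by simp
  moreover have "(\<Sum>i\<in>{s..<s+m}. a i) = (\<Sum>i\<in>{s..<s + 2 ^ l}. a i) + (\<Sum>i\<in>{s + 2 ^ l..<s + 2 ^ l + m'}. a i)"
   unfolding m by (subst sum.atLeastLessThan_concat) (auto simp: add.assoc)
  ultimately show ?thesis by simp
 qed
qed simp

text \<open>The thresholds for blocks of length \<open>2^j\<close> are weighted geometrically by this ratio, which is
so close to 1 that the surplus exponent \<open>1/8\<close> of the moment bound absorbs its fourth power.\<close>
definition \<theta>M :: real where "\<theta>M = 2 powr (- 1 / 64)"
definition CM :: real where "CM = 1 / (1 - \<theta>M) ^ 5"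

lemma \<theta>M: "0 < \<theta>M" "\<theta>M < 1"
 unfolding \<theta>M_def using powr_less_mono[of "- 1 / 64" 0 2] by auto

lemma sum_\<theta>M_le: "(\<Sum>j<l. \<theta>M ^ (l - j)) \<le> 1 / (1 - \<theta>M)"
proof -
 have "(\<Sum>j<l. \<theta>M ^ (l - j)) = (\<Sum>i\<in>{1..l}. \<theta>M ^ i)"
  by (rule sum.reindex_bij_witness[of _ "\<lambda>i. l - i" "\<lambda>j. l - j"]) auto
 also have "\<dots> \<le> (\<Sum>i<Suc l. \<theta>M ^ i)" using \<theta>M by (intro sum_mono2) auto
 also have "\<dots> = (1 - \<theta>M ^ Suc l) / (1 - \<theta>M)" using \<theta>M by (subst sum_gp_strict) auto
 also have "\<dots> \<le> 1 / (1 - \<theta>M)" using \<theta>M by (intro divide_right_mono) auto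
 finally show ?thesis .
qed

context prob_space
begin

lemma markov_le:
 fixes g :: "'a \<Rightarrow> real"
 assumes [measurable]: "E \<in> events" and c: "0 < c" and g: "integrable M g" "\<And>w. 0 \<le> g w" "\<And>w. w \<in> E \<Longrightarrow> c \<le> g w"
 shows "prob E \<le> expectation g / c"
proof -
 have "c * prob E = expectation (\<lambda>w. c * indicator E w)"
  using sets.sets_into_space[OF assms(1)] by (simp add: Int_absorb2)
 also have "\<dots> \<le> expectation g"
 proof (rule integral_mono[OF _ g(1)])
  show "integrable M (\<lambda>w. c * indicator E w)" by (intro integrable_bounded[of _ c]) (use c in \<open>auto simp: indicator_def\<close>)
 qed (use g in \<open>auto simp: indicator_def\<close>)
 finally show ?thesis using c by (simp add: field_simps)
qed

lemma prob_dyadic_union_le: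
 fixes a :: "nat \<Rightarrow> 'a \<Rightarrow> real" and y :: "nat \<Rightarrow> real"
 assumes [measurable]: "\<And>i. 1 \<le> i \<Longrightarrow> a i \<in> borel_measurable M"
  and yx: "(\<Sum>j<l. y j) \<le> x"
  and P: "\<And>j k. j < l \<Longrightarrow> k < 2 ^ (l - j) \<Longrightarrow>
    prob {w\<in>space M. y j < \<bar>\<Sum>i\<in>{1 + k * 2 ^ j..<1 + k * 2 ^ j + 2 ^ j}. a i w\<bar>} \<le> p j"
 shows "prob {w\<in>space M. \<exists>m<2 ^ l. x < \<bar>\<Sum>i\<in>{1..<1+m}. a i w\<bar>} \<le> (\<Sum>j<l. 2 ^ (l - j) * p j)"
proof -
 let ?B = "\<lambda>j k. {w\<in>space M. y j < \<bar>\<Sum>i\<in>{1 + k * 2 ^ j..<1 + k * 2 ^ j + 2 ^ j}. a i w\<bar>}"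
 have Bm: "?B j k \<in> events" for j k
 proof -
  have "(\<lambda>w. \<Sum>i\<in>{1 + k * 2 ^ j..<1 + k * 2 ^ j + 2 ^ j}. a i w) \<in> borel_measurable M"
   by (intro borel_measurable_sum) auto
  then show ?thesis by measurable
 qed
 have "prob {w\<in>space M. \<exists>m<2 ^ l. x < \<bar>\<Sum>i\<in>{1..<1+m}. a i w\<bar>} \<le> prob (\<Union>j\<in>{..<l}. \<Union>k\<in>{..<2 ^ (l - j)}. ?B j k)"
 proof (rule finite_measure_mono)
  show "{w\<in>space M. \<exists>m<2 ^ l. x < \<bar>\<Sum>i\<in>{1..<1+m}. a i w\<bar>} \<subseteq> (\<Union>j\<in>{..<l}. \<Union>k\<in>{..<2 ^ (l - j)}. ?B j k)"
  proof (safe, rule ccontr)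
   fix w m assume w: "w \<in> space M" and m: "m < 2 ^ l" "x < \<bar>\<Sum>i\<in>{1..<1+m}. a i w\<bar>"
    and n: "w \<notin> (\<Union>j\<in>{..<l}. \<Union>k\<in>{..<2 ^ (l - j)}. ?B j k)"
   have "\<bar>\<Sum>i\<in>{1..<1+m}. a i w\<bar> \<le> (\<Sum>j<l. y j)"
    using n w m(1) by (intro dyadic_partial_sum_le) (auto simp: not_less)
   then show False using m(2) yx by linarith
  qed
  show "(\<Union>j\<in>{..<l}. \<Union>k\<in>{..<2 ^ (l - j)}. ?B j k) \<in> events" using Bm by (intro sets.finite_UN) auto
 qed
 also have "\<dots> \<le> (\<Sum>j<l. prob (\<Union>k\<in>{..<2 ^ (l - j)}. ?B j k))"
  using Bm by (intro finite_measure_subadditive_finite) (auto intro!: sets.finite_UN)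
 also have "\<dots> \<le> (\<Sum>j<l. \<Sum>k\<in>{..<2 ^ (l - j)}. prob (?B j k))"
  using Bm by (intro sum_mono finite_measure_subadditive_finite) auto
 also have "\<dots> \<le> (\<Sum>j<l. \<Sum>k\<in>{..<(2::nat) ^ (l - j)}. p j)" using P by (intro sum_mono) auto
 finally show ?thesis by simp
qed

text \<open>There are \<open>2^(l-j)\<close> blocks of length \<open>2^j\<close>, each with fourth moment \<open>D 2^(9j/8) 2^(7l/8)\<close>. As the
exponent of the block length exceeds 1, the sum over \<open>j\<close> is dominated by \<open>j\<close> near \<open>l\<close>
and no logarithm is lost.\<close>
lemma prob_max_le_fourth:
 fixes a :: "nat \<Rightarrow> 'a \<Rightarrow> real"
 assumes a[measurable]: "\<And>i. 1 \<le> i \<Longrightarrow> a i \<in> borel_measurable M" and b: "\<And>i w. 1 \<le> i \<Longrightarrow> \<bar>a i w\<bar> \<le> 1"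
  and D: "0 \<le> D" and x: "0 < x"
  and mom: "\<And>s m. 1 \<le> s \<Longrightarrow> 1 \<le> m \<Longrightarrow> m \<le> 2 ^ l \<Longrightarrow>
    expectation (\<lambda>w. (\<Sum>i\<in>{s..<s+m}. a i w) ^ 4) \<le> D * (real m powr (9 / 8) * (2 ^ l) powr (7 / 8))"
 shows "prob {w\<in>space M. \<exists>m<2 ^ l. x < \<bar>\<Sum>i\<in>{1..<1+m}. a i w\<bar>} \<le> CM * D * (2 ^ l)\<^sup>2 / x ^ 4"
proof -
 define y where "y j = x * (1 - \<theta>M) * \<theta>M ^ (l - j)" for j
 have y0: "0 < y j" for j using x \<theta>M by (simp add: y_def)
 define p where "p j = D * (real (2 ^ j) powr (9 / 8) * (2 ^ l) powr (7 / 8)) / (y j) ^ 4" for j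
 have "prob {w\<in>space M. \<exists>m<2 ^ l. x < \<bar>\<Sum>i\<in>{1..<1+m}. a i w\<bar>} \<le> (\<Sum>j<l. 2 ^ (l - j) * p j)"
 proof (rule prob_dyadic_union_le)
  have "(\<Sum>j<l. y j) = x * (1 - \<theta>M) * (\<Sum>j<l. \<theta>M ^ (l - j))" by (simp add: y_def sum_distrib_left)
  also have "\<dots> \<le> x * (1 - \<theta>M) * (1 / (1 - \<theta>M))" using x \<theta>M sum_\<theta>M_le by (intro mult_left_mono) auto
  also have "\<dots> = x" using \<theta>M by simp
  finally show "(\<Sum>j<l. y j) \<le> x" .
  fix j k :: nat assume j: "j < l" and "k < 2 ^ (l - j)"
  define S where "S w = (\<Sum>i\<in>{1 + k * 2 ^ j..<1 + k * 2 ^ j + 2 ^ j}. a i w)" for w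
  have Sm[measurable]: "S \<in> borel_measurable M" unfolding S_def[abs_def] by (intro borel_measurable_sum) auto
  have Sb: "\<bar>S w\<bar> \<le> 2 ^ j" for w
  proof -
   have "\<bar>S w\<bar> \<le> (\<Sum>i\<in>{1 + k * 2 ^ j..<1 + k * 2 ^ j + 2 ^ j}. \<bar>a i w\<bar>)" unfolding S_def by (rule sum_abs)
   also have "\<dots> \<le> (\<Sum>i\<in>{1 + k * 2 ^ j..<1 + k * 2 ^ j + 2 ^ j}. 1)" using b by (intro sum_mono) auto
   finally show ?thesis by simp
  qed
  have "prob {w\<in>space M. y j < \<bar>S w\<bar>} \<le> expectation (\<lambda>w. (S w) ^ 4) / (y j) ^ 4"
  proof (rule markov_le)
   show "integrable M (\<lambda>w. (S w) ^ 4)"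
    using Sb power_mono[OF Sb abs_ge_zero, where n = 4] by (intro integrable_bounded[of _ "(2 ^ j) ^ 4"]) (auto simp: power_abs)
   show "(y j) ^ 4 \<le> (S w) ^ 4" if "w \<in> {w\<in>space M. y j < \<bar>S w\<bar>}" for w
    using that power_mono[of "y j" "\<bar>S w\<bar>" 4] y0[of j] by (simp add: power_abs)
  qed (use y0[of j] in auto)
  also have "\<dots> \<le> p j"
   unfolding p_def S_def using mom[of "1 + k * 2 ^ j" "2 ^ j"] j y0[of j] by (intro divide_right_mono) auto
  finally show "prob {w\<in>space M. y j < \<bar>\<Sum>i\<in>{1 + k * 2 ^ j..<1 + k * 2 ^ j + 2 ^ j}. a i w\<bar>} \<le> p j"
   unfolding S_def .
 qed (rule a)
 also have "\<dots> \<le> (\<Sum>j<l. D * (2 ^ l)\<^sup>2 / (x ^ 4 * (1 - \<theta>M) ^ 4) * \<theta>M ^ (l - j))"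
 proof (intro sum_mono)
  fix j assume "j \<in> {..<l}"
  then have j: "j < l" by simp
  define i where "i = l - j"
  have li: "l = j + i" using j by (simp add: i_def)
  have pw: "(2::real) ^ n = 2 powr real n" for n by (simp add: powr_realpow)
  have \<theta>i: "\<theta>M ^ i = 2 powr (- real i / 64)" for i unfolding \<theta>M_def by (simp add: powr_powr flip: powr_realpow)
  have "2 ^ i * (real (2 ^ j) powr (9 / 8) * (2 ^ l) powr (7 / 8)) = (2 ^ l)\<^sup>2 * 2 powr (- real i / 8)"
   unfolding li by (simp add: pw powr_powr power2_eq_square field_simps flip: powr_add)
  also have "2 powr (- real i / 8) = \<theta>M ^ i * \<theta>M ^ (7 * i)" unfolding \<theta>i by (simp add: field_simps flip: powr_add)
  also have "\<theta>M ^ (7 * i) \<le> \<theta>M ^ (4 * i)" using \<theta>M by (intro power_decreasing) auto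
  finally have "2 ^ i * (real (2 ^ j) powr (9 / 8) * (2 ^ l) powr (7 / 8)) \<le> (2 ^ l)\<^sup>2 * (\<theta>M ^ i * (\<theta>M ^ i) ^ 4)"
   using \<theta>M by (simp add: mult_left_mono power_mult mult.commute)
  then have "D * (2 ^ i * (real (2 ^ j) powr (9 / 8) * (2 ^ l) powr (7 / 8))) / (y j) ^ 4 \<le> D * ((2 ^ l)\<^sup>2 * (\<theta>M ^ i * (\<theta>M ^ i) ^ 4)) / (y j) ^ 4"
   using D y0[of j] by (intro divide_right_mono mult_left_mono) auto
  also have "\<dots> = D * (2 ^ l)\<^sup>2 / (x ^ 4 * (1 - \<theta>M) ^ 4) * \<theta>M ^ i"
  proof -
   have "(y j) ^ 4 = x ^ 4 * (1 - \<theta>M) ^ 4 * (\<theta>M ^ i) ^ 4" by (simp add: y_def i_def power_mult_distrib)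
   then show ?thesis using \<theta>M x by (simp add: field_simps)
  qed
  finally have "D * (2 ^ i * (real (2 ^ j) powr (9 / 8) * (2 ^ l) powr (7 / 8))) / (y j) ^ 4 \<le> D * (2 ^ l)\<^sup>2 / (x ^ 4 * (1 - \<theta>M) ^ 4) * \<theta>M ^ i" .
  then show "2 ^ (l - j) * p j \<le> D * (2 ^ l)\<^sup>2 / (x ^ 4 * (1 - \<theta>M) ^ 4) * \<theta>M ^ (l - j)"
   by (simp add: p_def i_def mult_ac)
 qed
 also have "\<dots> = D * (2 ^ l)\<^sup>2 / (x ^ 4 * (1 - \<theta>M) ^ 4) * (\<Sum>j<l. \<theta>M ^ (l - j))" by (simp add: sum_distrib_left)
 also have "\<dots> \<le> D * (2 ^ l)\<^sup>2 / (x ^ 4 * (1 - \<theta>M) ^ 4) * (1 / (1 - \<theta>M))"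
  using D x \<theta>M sum_\<theta>M_le by (intro mult_left_mono) auto
 also have "\<dots> = CM * D * (2 ^ l)\<^sup>2 / x ^ 4" by (simp add: CM_def power_numeral_reduce mult_ac)
 finally show ?thesis .
qed

text \<open>Here the moment bound is only linear in the block length, so all dyadic scales contribute equally. With
equal thresholds \<open>x / l\<close> this costs \<open>l^3\<close>.\<close>
lemma prob_max_le_second:
 fixes a :: "nat \<Rightarrow> 'a \<Rightarrow> real"
 assumes a[measurable]: "\<And>i. 1 \<le> i \<Longrightarrow> a i \<in> borel_measurable M" and b: "\<And>i w. 1 \<le> i \<Longrightarrow> \<bar>a i w\<bar> \<le> B i"
  and x: "0 < x" and l: "1 \<le> l"
  and mom: "\<And>s m. 1 \<le> s \<Longrightarrow> s + m \<le> 2 ^ l + 1 \<Longrightarrow> expectation (\<lambda>w. (\<Sum>i\<in>{s..<s+m}. a i w)\<^sup>2) \<le> D * real m"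
 shows "prob {w\<in>space M. \<exists>m<2 ^ l. x < \<bar>\<Sum>i\<in>{1..<1+m}. a i w\<bar>} \<le> D * real l ^ 3 * 2 ^ l / x\<^sup>2"
proof -
 define y where "y j = x / real l" for j :: nat
 have y0: "0 < y j" for j using x l by (simp add: y_def)
 define p where "p j = D * real (2 ^ j) / (y j)\<^sup>2" for j
 have "prob {w\<in>space M. \<exists>m<2 ^ l. x < \<bar>\<Sum>i\<in>{1..<1+m}. a i w\<bar>} \<le> (\<Sum>j<l. 2 ^ (l - j) * p j)"
 proof (rule prob_dyadic_union_le)
  show "(\<Sum>j<l. y j) \<le> x" using l by (simp add: y_def)
  fix j k :: nat assume j: "j < l" and k: "k < 2 ^ (l - j)"
  define S where "S w = (\<Sum>i\<in>{1 + k * 2 ^ j..<1 + k * 2 ^ j + 2 ^ j}. a i w)" for w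
  define c where "c = (\<Sum>i\<in>{1 + k * 2 ^ j..<1 + k * 2 ^ j + 2 ^ j}. B i)"
  have Sm[measurable]: "S \<in> borel_measurable M" unfolding S_def[abs_def] by (intro borel_measurable_sum) auto
  have Sb: "\<bar>S w\<bar> \<le> c" for w
  proof -
   have "\<bar>S w\<bar> \<le> (\<Sum>i\<in>{1 + k * 2 ^ j..<1 + k * 2 ^ j + 2 ^ j}. \<bar>a i w\<bar>)" unfolding S_def by (rule sum_abs)
   also have "\<dots> \<le> c" unfolding c_def using b by (intro sum_mono) auto
   finally show ?thesis .
  qed
  have end_le: "1 + k * 2 ^ j + 2 ^ j \<le> 2 ^ l + 1"
  proof -
   have "Suc k * 2 ^ j \<le> 2 ^ (l - j) * 2 ^ j" using k by (intro mult_right_mono) auto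
   also have "\<dots> = 2 ^ l" using j by (simp flip: power_add)
   finally show ?thesis by simp
  qed
  have "prob {w\<in>space M. y j < \<bar>S w\<bar>} \<le> expectation (\<lambda>w. (S w)\<^sup>2) / (y j)\<^sup>2"
  proof (rule markov_le)
   show "integrable M (\<lambda>w. (S w)\<^sup>2)"
    using power_mono[OF Sb abs_ge_zero, where n = 2] by (intro integrable_bounded[of _ "c\<^sup>2"]) (auto simp: power_abs)
   show "(y j)\<^sup>2 \<le> (S w)\<^sup>2" if "w \<in> {w\<in>space M. y j < \<bar>S w\<bar>}" for w
    using that power_mono[of "y j" "\<bar>S w\<bar>" 2] y0[of j] by simp
  qed (use y0[of j] in auto)
  also have "\<dots> \<le> p j"
   unfolding p_def S_def using mom[OF _ end_le] y0[of j] by (intro divide_right_mono) auto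
  finally show "prob {w\<in>space M. y j < \<bar>\<Sum>i\<in>{1 + k * 2 ^ j..<1 + k * 2 ^ j + 2 ^ j}. a i w\<bar>} \<le> p j"
   unfolding S_def .
 qed (rule a)
 also have "\<dots> = (\<Sum>j<l. D * real l ^ 2 * 2 ^ l / x\<^sup>2)"
 proof (intro sum.cong refl)
  fix j assume "j \<in> {..<l}"
  then have "(2::real) ^ (l - j) * 2 ^ j = 2 ^ l" by (simp flip: power_add)
  moreover have "2 ^ (l - j) * p j = D * real l ^ 2 * (2 ^ (l - j) * 2 ^ j) / x\<^sup>2"
   by (simp add: p_def y_def power_divide field_simps)
  ultimately show "2 ^ (l - j) * p j = D * real l ^ 2 * 2 ^ l / x\<^sup>2" by (simp only:)
 qed
 also have "\<dots> = D * real l ^ 3 * 2 ^ l / x\<^sup>2" by (simp add: power3_eq_cube power2_eq_square)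
 finally show ?thesis .
qed

end

context dependent_process
begin

text \<open>For \<open>\<delta> \<ge> n^(-5/8) / 2\<close> and \<open>m \<le> n\<close> the lower order term of the fourth moment is at most
\<open>m^(9/8) n^(7/8) \<delta>^(2-2/A)\<close> up to a constant; so the maximal inequality applies.\<close>
lemma prob_max_observable:
 assumes obs: "observable C1 \<phi>" and C1: "0 \<le> C1" and K: "0 \<le> K" and \<delta>: "2 powr (- 5 / 8 * real l) / 2 \<le> \<delta>" "\<delta> \<le> 1"
  and mean: "(\<integral>x. \<phi> x \<partial>\<mu>) \<le> K * \<delta>" and x: "0 < x"
 shows "prob {w\<in>space M. \<exists>m<2 ^ l. x < \<bar>\<Sum>i\<in>{1..<1+m}. \<phi> (X i w) - (\<integral>x. \<phi> x \<partial>\<mu>)\<bar>}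
  \<le> CM * (5 * K4 C1 K * \<delta> powr (2 - 2 / A)) * (2 ^ l)\<^sup>2 / x ^ 4"
proof -
 define n :: real where "n = 2 ^ l"
 have n1: "1 \<le> n" by (simp add: n_def)
 have np: "2 powr (c * real l) = n powr c" for c
  by (simp add: n_def powr_powr mult.commute flip: powr_realpow)
 have \<delta>0: "0 < \<delta>" using \<delta>(1) by (smt (verit) divide_pos_pos powr_gt_zero)
 have \<phi>m[measurable]: "\<phi> \<in> borel_measurable borel" and \<phi>01: "0 \<le> \<phi> x" "\<phi> x \<le> 1" for x
  using obs by (auto simp: observable_def)
 have K40: "0 \<le> K4 C1 K" using K C1 c0_nonneg Q0_nonneg by (simp add: K4_def)
 show ?thesis
 proof (rule prob_max_le_fourth)
  show "(\<lambda>w. \<phi> (X i w) - (\<integral>x. \<phi> x \<partial>\<mu>)) \<in> borel_measurable M" if "1 \<le> i" for i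
   using X_meas[OF that] by measurable
  have "integrable \<mu> \<phi>"
  proof (rule law.integrable_const_bound[of _ 1])
   have "sets \<mu> = sets borel" using X_law[of 1, symmetric] by simp
   then show "\<phi> \<in> borel_measurable \<mu>" by (simp cong: measurable_cong_sets)
  qed (use \<phi>01 in auto)
  then have "(\<integral>x. \<phi> x \<partial>\<mu>) \<le> (\<integral>x. 1 \<partial>\<mu>)" by (rule integral_mono) (use \<phi>01 in auto)
  moreover have "0 \<le> (\<integral>x. \<phi> x \<partial>\<mu>)" using \<phi>01 by (intro integral_nonneg_AE) auto
  ultimately have "0 \<le> (\<integral>x. \<phi> x \<partial>\<mu>)" "(\<integral>x. \<phi> x \<partial>\<mu>) \<le> 1" using law.prob_space by auto
  then show "\<bar>\<phi> (X i w) - (\<integral>x. \<phi> x \<partial>\<mu>)\<bar> \<le> 1" for i w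
   using \<phi>01[of "X i w"] by (simp add: abs_le_iff)
  show "0 \<le> 5 * K4 C1 K * \<delta> powr (2 - 2 / A)" using K40 by simp
  fix s m :: nat assume s: "1 \<le> s" and m: "1 \<le> m" "m \<le> 2 ^ l"
  have mn: "real m \<le> n" using m(2) by (simp add: n_def)
  have m1: "1 \<le> real m" using m by simp
  have "expectation (\<lambda>w. (\<Sum>i\<in>{s..<s+m}. \<phi> (X i w) - (\<integral>x. \<phi> x \<partial>\<mu>)) ^ 4)
    \<le> K4 C1 K * (real m ^ 2 * \<delta> powr (2 - 2 / A) + real m * \<delta> powr (1 - 7 / (2 * A)))"
   by (rule fourth_moment_observable[OF obs C1 K \<delta>0 \<delta>(2) mean s])
  also have "\<dots> \<le> K4 C1 K * ((real m powr (9 / 8) * n powr (7 / 8)) * \<delta> powr (2 - 2 / A) + (real m powr (9 / 8) * n powr (7 / 8)) * (4 * \<delta> powr (2 - 2 / A)))"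
  proof (intro mult_left_mono add_mono K40)
   have "real m ^ 2 = real m powr (9 / 8) * real m powr (7 / 8)" using m1 by (simp flip: powr_add)
   also have "\<dots> \<le> real m powr (9 / 8) * n powr (7 / 8)" using mn by (intro mult_left_mono powr_mono2) auto
   finally show "real m ^ 2 * \<delta> powr (2 - 2 / A) \<le> (real m powr (9 / 8) * n powr (7 / 8)) * \<delta> powr (2 - 2 / A)"
    by (intro mult_right_mono) auto
   have e: "\<delta> powr (1 - 7 / (2 * A)) = \<delta> powr (2 - 2 / A) * \<delta> powr (- (1 + 3 / (2 * A)))"
   proof -
    have "1 - 7 / (2 * A) = (2 - 2 / A) + (- (1 + 3 / (2 * A)))" using exps by (simp add: field_simps)
    then show ?thesis by (simp only: powr_add)
   qed
   have A3: "3 / (2 * A) \<le> 1 / 3" "0 \<le> 3 / (2 * A)" using exps by (auto simp: field_simps)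
   have "\<delta> powr (- (1 + 3 / (2 * A))) \<le> \<delta> powr (- (4 / 3))"
    using \<delta>0 \<delta> A3 by (intro powr_mono') auto
   also have "\<dots> \<le> (n powr (- 5 / 8) / 2) powr (- (4 / 3))"
    using \<delta>(1) n1 unfolding np by (intro powr_mono2') auto
   also have "\<dots> = n powr (5 / 6) * 2 powr (4 / 3)"
   proof -
    have "(n powr (- 5 / 8) / 2) powr (- (4 / 3)) = (n powr (- 5 / 8)) powr (- (4 / 3)) / 2 powr (- (4 / 3))" by (rule powr_divide)
    also have "(n powr (- 5 / 8)) powr (- (4 / 3)) = n powr (- 5 / 8 * - (4 / 3))" by (rule powr_powr)
    also have "- 5 / 8 * - (4 / 3) = (5 / 6 :: real)" by simp
    also have "n powr (5 / 6) / 2 powr (- (4 / 3)) = n powr (5 / 6) * 2 powr (4 / 3)"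
     by (simp only: powr_minus divide_inverse inverse_inverse_eq)
    finally show ?thesis .
   qed
   also have "\<dots> \<le> n powr (7 / 8) * 2 powr 2"
    using n1 by (intro mult_mono powr_mono) auto
   finally have "\<delta> powr (- (1 + 3 / (2 * A))) \<le> 4 * n powr (7 / 8)" by simp
   moreover have "real m \<le> real m powr (9 / 8)" using m1 powr_mono[of 1 "9 / 8" "real m"] by simp
   ultimately have "real m * \<delta> powr (- (1 + 3 / (2 * A))) \<le> real m powr (9 / 8) * (4 * n powr (7 / 8))"
    by (intro mult_mono) auto
   then have "real m * \<delta> powr (- (1 + 3 / (2 * A))) * \<delta> powr (2 - 2 / A) \<le> real m powr (9 / 8) * (4 * n powr (7 / 8)) * \<delta> powr (2 - 2 / A)"
    by (intro mult_right_mono) auto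
   then show "real m * \<delta> powr (1 - 7 / (2 * A)) \<le> (real m powr (9 / 8) * n powr (7 / 8)) * (4 * \<delta> powr (2 - 2 / A))"
    unfolding e by (simp add: mult_ac)
  qed
  also have "\<dots> = 5 * K4 C1 K * \<delta> powr (2 - 2 / A) * (real m powr (9 / 8) * (2 ^ l) powr (7 / 8))"
   by (simp add: n_def algebra_simps)
  finally show "expectation (\<lambda>w. (\<Sum>i\<in>{s..<s+m}. \<phi> (X i w) - (\<integral>x. \<phi> x \<partial>\<mu>)) ^ 4)
    \<le> 5 * K4 C1 K * \<delta> powr (2 - 2 / A) * (real m powr (9 / 8) * (2 ^ l) powr (7 / 8))" .
 qed (rule x)
qed

end

section \<open>Second moments of degenerate sums\<close>

lemma min_square_le:
 fixes a b x :: real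
 assumes "0 < a" "0 < b" "x \<le> K * (1 / a\<^sup>2 + c)" "x \<le> K * (1 / b\<^sup>2 + c)" "0 \<le> K"
 shows "x \<le> K * (1 / (a * b) + c)"
proof (cases "a \<le> b")
 case True
 then have "1 / b\<^sup>2 \<le> 1 / (a * b)" using assms by (intro divide_left_mono) (auto simp: power2_eq_square intro!: mult_right_mono)
 then have "K * (1 / b\<^sup>2 + c) \<le> K * (1 / (a * b) + c)" using assms by (intro mult_left_mono) auto
 then show ?thesis using assms by linarith
next
 case False
 then have "1 / a\<^sup>2 \<le> 1 / (a * b)" using assms by (intro divide_left_mono) (auto simp: power2_eq_square intro!: mult_left_mono)
 then have "K * (1 / a\<^sup>2 + c) \<le> K * (1 / (a * b) + c)" using assms by (intro mult_left_mono) auto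
 then show ?thesis using assms by linarith
qed

context kernel_process
begin

lemma degen_cross_low:
 assumes "1 \<le> i" "i \<le> i'" "i' \<le> j" "i' < j'"
 shows "\<bar>expectation (\<lambda>w. degen (X j w, X i w) * degen (X j' w, X i' w))\<bar>
   \<le> K2 * (1 / (1 + real (i' - i))\<^sup>2 + 1 / (1 + real (j' - i')) ^ 4)"
 using degen_isolated_min[of i "i' - i" j i' j'] assms by simp

lemma degen_cross_high:
 assumes "1 \<le> i" "1 \<le> i'" "i \<le> j'" "j' \<le> j" "i < j" "i' < j'"
 shows "\<bar>expectation (\<lambda>w. degen (X j w, X i w) * degen (X j' w, X i' w))\<bar>
   \<le> K2 * (1 / (1 + real (j - j'))\<^sup>2 + 1 / (1 + real (j' - i')) ^ 4)"
 using degen_isolated_max[of i i' "j - j'" j j'] assms by (simp add: degen_sym)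

text \<open>Either the two index pairs do not interlace, and then an extreme index is isolated by the length of its own
pair on both sides, or the smallest index is at distance \<open>|i - i'|\<close> and the largest at
distance \<open>|j - j'|\<close> from the rest. A bound by each of two inverse squares implies one by the inverse product.\<close>
lemma degen_cross_le:
 assumes i: "1 \<le> i" "i < j" and i': "1 \<le> i'" "i' < j'"
 shows "\<bar>expectation (\<lambda>w. degen (X j w, X i w) * degen (X j' w, X i' w))\<bar>
   \<le> K2 * (1 / ((1 + \<bar>real i - real i'\<bar>) * (1 + \<bar>real j - real j'\<bar>)) + 1 / ((1 + real (j - i)) * (1 + real (j' - i')))
    + 1 / (1 + real (j - i)) ^ 4 + 1 / (1 + real (j' - i')) ^ 4)"
proof -
 let ?E = "\<bar>expectation (\<lambda>w. degen (X j w, X i w) * degen (X j' w, X i' w))\<bar>"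
 let ?p = "1 / (1 + real (j - i)) ^ 4" and ?q = "1 / (1 + real (j' - i')) ^ 4"
 let ?A = "1 / ((1 + \<bar>real i - real i'\<bar>) * (1 + \<bar>real j - real j'\<bar>))" and ?B = "1 / ((1 + real (j - i)) * (1 + real (j' - i')))"
 have swap: "?E = \<bar>expectation (\<lambda>w. degen (X j' w, X i' w) * degen (X j w, X i w))\<bar>" by (simp add: mult.commute)
 have p0: "0 \<le> ?p" "0 \<le> ?q" "0 \<le> ?A" "0 \<le> ?B" by auto
 have up: "x \<le> K2 * (y + (?p + ?q))" if "x \<le> K2 * (y + ?q) \<or> x \<le> K2 * (y + ?p)" for x y
 proof -
  have "K2 * (y + ?q) \<le> K2 * (y + (?p + ?q))" "K2 * (y + ?p) \<le> K2 * (y + (?p + ?q))"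
   using K2_nonneg p0 by (intro mult_left_mono; simp)+
  then show ?thesis using that by linarith
 qed
 have "?E \<le> K2 * (?A + (?p + ?q)) \<or> ?E \<le> K2 * (?B + (?p + ?q))"
 proof (cases "j < i' \<or> j' < i")
  case True
  have "?E \<le> K2 * (1 / (1 + real (j - i))\<^sup>2 + (?p + ?q))" "?E \<le> K2 * (1 / (1 + real (j' - i'))\<^sup>2 + (?p + ?q))"
  proof -
   show "?E \<le> K2 * (1 / (1 + real (j - i))\<^sup>2 + (?p + ?q))"
   proof (cases "j < i'")
    case True
    then show ?thesis using degen_isolated_min[of i "j - i" j i' j'] i i' by (intro up) auto
   next
    case False
    then have "j' < i" using \<open>j < i' \<or> j' < i\<close> by simp
    then show ?thesis using degen_isolated_max[of i i' "j - i" j j'] i i' by (intro up) (auto simp: degen_sym)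
   qed
   show "?E \<le> K2 * (1 / (1 + real (j' - i'))\<^sup>2 + (?p + ?q))"
   proof (cases "j < i'")
    case True
    then show ?thesis unfolding swap using degen_isolated_max[of i' i "j' - i'" j' j] i i' by (intro up) (auto simp: degen_sym)
   next
    case False
    then have "j' < i" using \<open>j < i' \<or> j' < i\<close> by simp
    then show ?thesis unfolding swap using degen_isolated_min[of i' "j' - i'" j' i j] i i' by (intro up) auto
   qed
  qed
  then have "?E \<le> K2 * (?B + (?p + ?q))" using K2_nonneg by (intro min_square_le) auto
  then show ?thesis ..
 next
  case False
  have 1: "?E \<le> K2 * (1 / (1 + \<bar>real i - real i'\<bar>)\<^sup>2 + (?p + ?q))"
  proof (cases "i \<le> i'")
   case True
   then show ?thesis using degen_cross_low[of i i' j j'] False i i' by (intro up) (auto simp: of_nat_diff)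
  next
   case F: False
   then show ?thesis unfolding swap using degen_cross_low[of i' i j' j] False i i' by (intro up) (auto simp: of_nat_diff)
  qed
  have 2: "?E \<le> K2 * (1 / (1 + \<bar>real j - real j'\<bar>)\<^sup>2 + (?p + ?q))"
  proof (cases "j' \<le> j")
   case True
   then show ?thesis using degen_cross_high[of i i' j' j] False i i' by (intro up) (auto simp: of_nat_diff)
  next
   case F: False
   then show ?thesis unfolding swap using degen_cross_high[of i' i j j'] False i i' by (intro up) (auto simp: of_nat_diff)
  qed
  have "?E \<le> K2 * (?A + (?p + ?q))" using 1 2 K2_nonneg by (intro min_square_le) auto
  then show ?thesis ..
 qed
 moreover have "K2 * (?A + (?p + ?q)) \<le> K2 * (?A + ?B + ?p + ?q)" "K2 * (?B + (?p + ?q)) \<le> K2 * (?A + ?B + ?p + ?q)"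
  using K2_nonneg p0 by (intro mult_left_mono; simp)+
 ultimately show ?thesis by linarith
qed

text \<open>Partners closer than \<open>b\<close> are left out, since the fourth powers in \<open>degen_cross_le\<close> do not decay for them.\<close>
definition far_sum :: "nat \<Rightarrow> nat \<Rightarrow> 'a \<Rightarrow> real" where
 "far_sum b j w = (\<Sum>i | 1 \<le> i \<and> i + b < j. degen (X j w, X i w))"

end

definition hsum :: "nat \<Rightarrow> real" where "hsum n = (\<Sum>u<n. 1 / (1 + real u))"

lemma hsum_nonneg: "0 \<le> hsum n" unfolding hsum_def by (intro sum_nonneg) auto

lemma hsum_pow2: "hsum (2 ^ l) \<le> 1 + real l"
proof (induction l)
 case (Suc l)
 have "hsum (2 ^ Suc l) = hsum (2 ^ l) + (\<Sum>u\<in>{2 ^ l..<2 ^ Suc l}. 1 / (1 + real u))"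
 proof -
  have "(2::nat) ^ l \<le> 2 ^ Suc l" by simp
  then show ?thesis unfolding hsum_def lessThan_atLeast0 by (intro sum.atLeastLessThan_concat[symmetric]) simp_all
 qed
 also have "(\<Sum>u\<in>{2 ^ l..<2 ^ Suc l}. 1 / (1 + real u)) \<le> (\<Sum>u\<in>{(2::nat) ^ l..<2 ^ Suc l}. 1 / 2 ^ l)"
 proof (intro sum_mono divide_left_mono)
  fix u :: nat assume "u \<in> {2 ^ l..<2 ^ Suc l}"
  then have "2 ^ l \<le> u" by simp
  then have "real (2 ^ l) \<le> real u" by (rule of_nat_mono)
  then have "real (2 ^ l) \<le> 1 + real u" by linarith
  then show "2 ^ l \<le> 1 + real u" by (simp only: of_nat_power of_nat_numeral)
 qed auto
 also have "\<dots> = 1" by simp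
 finally show ?case using Suc by simp
qed (simp add: hsum_def)

lemma sum_inv_abs_le:
 assumes "I \<subseteq> {..n}" "i \<le> n"
 shows "(\<Sum>i'\<in>I. 1 / (1 + \<bar>real i - real i'\<bar>)) \<le> 2 * hsum (Suc n)"
proof -
 have "(\<Sum>i'\<in>I. 1 / (1 + \<bar>real i - real i'\<bar>)) \<le> (\<Sum>i'\<in>{..i} \<union> {i..n}. 1 / (1 + \<bar>real i - real i'\<bar>))"
  using assms by (intro sum_mono2) auto
 also have "\<dots> \<le> (\<Sum>i'\<in>{..i}. 1 / (1 + \<bar>real i - real i'\<bar>)) + (\<Sum>i'\<in>{i..n}. 1 / (1 + \<bar>real i - real i'\<bar>))"
  by (subst sum_Un) (auto intro!: sum_nonneg)
 also have "(\<Sum>i'\<in>{..i}. 1 / (1 + \<bar>real i - real i'\<bar>)) = (\<Sum>u\<in>{..i}. 1 / (1 + real u))"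
  by (rule sum.reindex_bij_witness[of _ "\<lambda>u. i - u" "\<lambda>u. i - u"]) (auto simp: of_nat_diff)
 also have "\<dots> \<le> hsum (Suc n)" unfolding hsum_def using assms by (intro sum_mono2) auto
 also have "(\<Sum>i'\<in>{i..n}. 1 / (1 + \<bar>real i - real i'\<bar>)) = (\<Sum>u\<in>{..n - i}. 1 / (1 + real u))"
  using assms by (intro sum.reindex_bij_witness[of _ "\<lambda>u. i + u" "\<lambda>u. u - i"]) (auto simp: of_nat_diff)
 also have "\<dots> \<le> hsum (Suc n)" unfolding hsum_def using assms by (intro sum_mono2) auto
 finally show ?thesis by simp
qed

lemma sum_inv_gap_le: "j \<le> n \<Longrightarrow> (\<Sum>i | 1 \<le> i \<and> i + b < j. 1 / (1 + real (j - i))) \<le> hsum (Suc n)"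
proof -
 assume j: "j \<le> n"
 have "(\<Sum>i | 1 \<le> i \<and> i + b < j. 1 / (1 + real (j - i))) \<le> (\<Sum>i\<in>{..j}. 1 / (1 + real (j - i)))"
  by (intro sum_mono2) auto
 also have "\<dots> = (\<Sum>u\<in>{..j}. 1 / (1 + real u))"
  by (rule sum.reindex_bij_witness[of _ "\<lambda>u. j - u" "\<lambda>u. j - u"]) (auto simp: of_nat_diff)
 also have "\<dots> \<le> hsum (Suc n)" unfolding hsum_def using j by (intro sum_mono2) auto
 finally show ?thesis .
qed

lemma sum_quartic_gap_le: "(\<Sum>i | 1 \<le> i \<and> i + b < j. 1 / (1 + real (j - i)) ^ 4) \<le> 1 / (1 + real b) ^ 3"
proof -
 have tele: "(\<Sum>u\<in>{c..<c+n}. 1 / (1 + real u)\<^sup>2) \<le> 1 / real c - 1 / real (c + n)" if "1 \<le> c" for c n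
 proof (induction n)
  case (Suc n)
  have pos: "0 < real (c + n)" using that by simp
  have "1 / (1 + real (c + n))\<^sup>2 \<le> 1 / (real (c + n) * (1 + real (c + n)))"
   using pos by (intro divide_left_mono) (auto simp: power2_eq_square)
  also have "\<dots> = 1 / real (c + n) - 1 / real (c + Suc n)" using pos by (simp add: field_simps)
  finally show ?case using Suc by simp
 qed simp
 have "(\<Sum>i | 1 \<le> i \<and> i + b < j. 1 / (1 + real (j - i)) ^ 4) \<le> (\<Sum>i | 1 \<le> i \<and> i + b < j. 1 / (1 + real b)\<^sup>2 * (1 / (1 + real (j - i))\<^sup>2))"
 proof (intro sum_mono)
  fix i assume i: "i \<in> {i. 1 \<le> i \<and> i + b < j}"
  have "1 / (1 + real (j - i)) ^ 4 = 1 / (1 + real (j - i))\<^sup>2 * (1 / (1 + real (j - i))\<^sup>2)" by (simp flip: power_add)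
  also have "\<dots> \<le> 1 / (1 + real b)\<^sup>2 * (1 / (1 + real (j - i))\<^sup>2)"
   using i by (intro mult_right_mono divide_left_mono power_mono) auto
  finally show "1 / (1 + real (j - i)) ^ 4 \<le> 1 / (1 + real b)\<^sup>2 * (1 / (1 + real (j - i))\<^sup>2)" .
 qed
 also have "\<dots> = 1 / (1 + real b)\<^sup>2 * (\<Sum>i | 1 \<le> i \<and> i + b < j. 1 / (1 + real (j - i))\<^sup>2)" by (simp add: sum_distrib_left)
 also have "\<dots> \<le> 1 / (1 + real b)\<^sup>2 * (1 / (1 + real b))"
 proof (intro mult_left_mono)
  have "(\<Sum>i | 1 \<le> i \<and> i + b < j. 1 / (1 + real (j - i))\<^sup>2) = (\<Sum>u\<in>{Suc b..<j}. 1 / (1 + real u)\<^sup>2)"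
   by (rule sum.reindex_bij_witness[of _ "\<lambda>u. j - u" "\<lambda>u. j - u"]) auto
  also have "\<dots> \<le> (\<Sum>u\<in>{Suc b..<Suc b + j}. 1 / (1 + real u)\<^sup>2)" by (intro sum_mono2) auto
  also have "\<dots> \<le> 1 / real (Suc b) - 1 / real (Suc b + j)" by (rule tele) simp
  also have "\<dots> \<le> 1 / (1 + real b)" by simp
  finally show "(\<Sum>i | 1 \<le> i \<and> i + b < j. 1 / (1 + real (j - i))\<^sup>2) \<le> 1 / (1 + real b)" .
 qed simp
 also have "\<dots> = 1 / (1 + real b) ^ 3" by (simp add: power3_eq_cube power2_eq_square)
 finally show ?thesis .
qed

context kernel_process
begin

lemma far_sum_meas [measurable]: "1 \<le> j \<Longrightarrow> far_sum b j \<in> borel_measurable M"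
 unfolding far_sum_def[abs_def] degen_def fst_conv snd_conv by (intro borel_measurable_sum) auto

lemma abs_far_sum_le: "\<bar>far_sum b j w\<bar> \<le> 2 * real j"
proof -
 have "\<bar>far_sum b j w\<bar> \<le> (\<Sum>i | 1 \<le> i \<and> i + b < j. \<bar>degen (X j w, X i w)\<bar>)" unfolding far_sum_def by (rule sum_abs)
 also have "\<dots> \<le> (\<Sum>i | 1 \<le> i \<and> i + b < j. 2)" by (intro sum_mono abs_degen_le)
 also have "\<dots> \<le> (\<Sum>i<j. 2)" by (intro sum_mono2) auto
 finally show ?thesis by simp
qed

text \<open>Summing \<open>degen_cross_le\<close>: the two product terms give squares of harmonic sums, and the quartic terms
a factor \<open>b^-3\<close> because all pairs are longer than \<open>b\<close>.\<close>
lemma second_moment_far_sum: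
 assumes s: "1 \<le> s" and sm: "s + m \<le> n + 1"
 shows "expectation (\<lambda>w. (\<Sum>j\<in>{s..<s+m}. far_sum b j w)\<^sup>2)
   \<le> K2 * (5 * (hsum (Suc n))\<^sup>2 * real n + 2 * (real n)\<^sup>2 / (1 + real b) ^ 3) * real m"
proof -
 let ?J = "{s..<s+m}"
 let ?I = "\<lambda>j. {i. 1 \<le> i \<and> i + b < j}"
 let ?H = "hsum (Suc n)"
 have fI: "finite (?I j)" for j by (rule finite_subset[of _ "{..j}"]) auto
 have Jn: "j \<le> n" "1 \<le> j" if "j \<in> ?J" for j using that s sm by auto
 have In: "?I j \<subseteq> {1..n}" if "j \<in> ?J" for j using Jn[OF that] by auto
 have cI: "real (card (?I j)) \<le> real n" if "j \<in> ?J" for j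
  using card_mono[OF _ In[OF that]] by simp
 have nm: "real m \<le> real n" using s sm by simp
 let ?d = "\<lambda>j i w. degen (X j w, X i w)"
 define e where "e j i j' i' = expectation (\<lambda>w. ?d j i w * ?d j' i' w)" for j i j' i'
 have int: "integrable M (\<lambda>w. ?d j i w * ?d j' i' w)" if "1 \<le> i" "1 \<le> j" "1 \<le> i'" "1 \<le> j'" for i j i' j'
 proof (rule integrable_bounded[of _ 4])
  note [measurable] = X_meas[OF that(1)] X_meas[OF that(2)] X_meas[OF that(3)] X_meas[OF that(4)]
  show "(\<lambda>w. ?d j i w * ?d j' i' w) \<in> borel_measurable M" unfolding degen_def fst_conv snd_conv by measurable
  show "\<bar>?d j i w * ?d j' i' w\<bar> \<le> 4" for w
   using mult_mono[OF abs_degen_le[of "(X j w, X i w)"] abs_degen_le[of "(X j' w, X i' w)"]] by (simp add: abs_mult)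
 qed
 have sq: "(\<Sum>j\<in>?J. far_sum b j w)\<^sup>2 = (\<Sum>j\<in>?J. \<Sum>j'\<in>?J. \<Sum>i\<in>?I j. \<Sum>i'\<in>?I j'. ?d j i w * ?d j' i' w)" for w
  unfolding power2_eq_square far_sum_def by (simp only: sum_product)
 have "expectation (\<lambda>w. (\<Sum>j\<in>?J. far_sum b j w)\<^sup>2) = (\<Sum>j\<in>?J. \<Sum>j'\<in>?J. \<Sum>i\<in>?I j. \<Sum>i'\<in>?I j'. e j i j' i')"
 proof -
  have i1: "integrable M (\<lambda>w. \<Sum>i'\<in>?I j'. ?d j i w * ?d j' i' w)" if "j \<in> ?J" "j' \<in> ?J" "i \<in> ?I j" for j j' i
   using that s by (intro Bochner_Integration.integrable_sum int) auto
  have i2: "integrable M (\<lambda>w. \<Sum>i\<in>?I j. \<Sum>i'\<in>?I j'. ?d j i w * ?d j' i' w)" if "j \<in> ?J" "j' \<in> ?J" for j j'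
   using that by (intro Bochner_Integration.integrable_sum i1)
  have "expectation (\<lambda>w. (\<Sum>j\<in>?J. \<Sum>j'\<in>?J. \<Sum>i\<in>?I j. \<Sum>i'\<in>?I j'. ?d j i w * ?d j' i' w))
    = (\<Sum>j\<in>?J. expectation (\<lambda>w. \<Sum>j'\<in>?J. \<Sum>i\<in>?I j. \<Sum>i'\<in>?I j'. ?d j i w * ?d j' i' w))"
   by (intro Bochner_Integration.integral_sum Bochner_Integration.integrable_sum i2)
  also have "\<dots> = (\<Sum>j\<in>?J. \<Sum>j'\<in>?J. expectation (\<lambda>w. \<Sum>i\<in>?I j. \<Sum>i'\<in>?I j'. ?d j i w * ?d j' i' w))"
   by (intro sum.cong refl Bochner_Integration.integral_sum i2)
  also have "\<dots> = (\<Sum>j\<in>?J. \<Sum>j'\<in>?J. \<Sum>i\<in>?I j. expectation (\<lambda>w. \<Sum>i'\<in>?I j'. ?d j i w * ?d j' i' w))"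
   by (intro sum.cong refl Bochner_Integration.integral_sum i1)
  also have "\<dots> = (\<Sum>j\<in>?J. \<Sum>j'\<in>?J. \<Sum>i\<in>?I j. \<Sum>i'\<in>?I j'. e j i j' i')"
   unfolding e_def using s by (intro sum.cong refl Bochner_Integration.integral_sum int) auto
  finally show ?thesis unfolding sq .
 qed
 also have "\<dots> \<le> (\<Sum>j\<in>?J. \<Sum>j'\<in>?J. \<Sum>i\<in>?I j. \<Sum>i'\<in>?I j'.
    K2 * (1 / (1 + \<bar>real i - real i'\<bar>) * (1 / (1 + \<bar>real j - real j'\<bar>)) + 1 / (1 + real (j - i)) * (1 / (1 + real (j' - i')))
    + 1 / (1 + real (j - i)) ^ 4 + 1 / (1 + real (j' - i')) ^ 4))"
 proof (intro sum_mono)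
  fix j j' i i' assume "i \<in> ?I j" "i' \<in> ?I j'"
  then have "\<bar>e j i j' i'\<bar> \<le> K2 * (1 / ((1 + \<bar>real i - real i'\<bar>) * (1 + \<bar>real j - real j'\<bar>)) + 1 / ((1 + real (j - i)) * (1 + real (j' - i')))
    + 1 / (1 + real (j - i)) ^ 4 + 1 / (1 + real (j' - i')) ^ 4)"
   unfolding e_def by (intro degen_cross_le) auto
  from abs_le_D1[OF this] show "e j i j' i' \<le> K2 * (1 / (1 + \<bar>real i - real i'\<bar>) * (1 / (1 + \<bar>real j - real j'\<bar>)) + 1 / (1 + real (j - i)) * (1 / (1 + real (j' - i')))
    + 1 / (1 + real (j - i)) ^ 4 + 1 / (1 + real (j' - i')) ^ 4)" by simp
 qed
 also have "\<dots> = K2 * ((\<Sum>j\<in>?J. \<Sum>j'\<in>?J. \<Sum>i\<in>?I j. \<Sum>i'\<in>?I j'. 1 / (1 + \<bar>real i - real i'\<bar>) * (1 / (1 + \<bar>real j - real j'\<bar>)))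
   + (\<Sum>j\<in>?J. \<Sum>j'\<in>?J. \<Sum>i\<in>?I j. \<Sum>i'\<in>?I j'. 1 / (1 + real (j - i)) * (1 / (1 + real (j' - i'))))
   + (\<Sum>j\<in>?J. \<Sum>j'\<in>?J. \<Sum>i\<in>?I j. \<Sum>i'\<in>?I j'. 1 / (1 + real (j - i)) ^ 4)
   + (\<Sum>j\<in>?J. \<Sum>j'\<in>?J. \<Sum>i\<in>?I j. \<Sum>i'\<in>?I j'. 1 / (1 + real (j' - i')) ^ 4))"
  by (simp only: sum_distrib_left[symmetric] sum.distrib)
 also have "\<dots> \<le> K2 * (real m * (2 * ?H) * (real n * (2 * ?H)) + real m * real m * (?H * ?H)
   + real m * real m * (real n * (1 / (1 + real b) ^ 3)) + real m * real m * (real n * (1 / (1 + real b) ^ 3)))"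
 proof (intro mult_left_mono add_mono K2_nonneg)
  have H0: "0 \<le> ?H" by (rule hsum_nonneg)
  have "(\<Sum>i\<in>?I j. \<Sum>i'\<in>?I j'. 1 / (1 + \<bar>real i - real i'\<bar>) * (1 / (1 + \<bar>real j - real j'\<bar>))) \<le> real n * (2 * ?H) * (1 / (1 + \<bar>real j - real j'\<bar>))"
   if "j \<in> ?J" "j' \<in> ?J" for j j'
  proof -
   have "(\<Sum>i\<in>?I j. \<Sum>i'\<in>?I j'. 1 / (1 + \<bar>real i - real i'\<bar>)) \<le> (\<Sum>i\<in>?I j. 2 * ?H)"
   proof (rule sum_mono)
    fix i assume i: "i \<in> ?I j"
    show "(\<Sum>i'\<in>?I j'. 1 / (1 + \<bar>real i - real i'\<bar>)) \<le> 2 * ?H"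
     using In[OF that(2)] In[OF that(1)] i by (intro sum_inv_abs_le) auto
   qed
   also have "\<dots> \<le> real n * (2 * ?H)" using cI[OF that(1)] H0 by (simp add: mult_right_mono)
   finally have "(\<Sum>i\<in>?I j. \<Sum>i'\<in>?I j'. 1 / (1 + \<bar>real i - real i'\<bar>)) * (1 / (1 + \<bar>real j - real j'\<bar>)) \<le> real n * (2 * ?H) * (1 / (1 + \<bar>real j - real j'\<bar>))"
    by (intro mult_right_mono) auto
   then show ?thesis by (simp only: sum_distrib_right)
  qed
  then have "(\<Sum>j\<in>?J. \<Sum>j'\<in>?J. \<Sum>i\<in>?I j. \<Sum>i'\<in>?I j'. 1 / (1 + \<bar>real i - real i'\<bar>) * (1 / (1 + \<bar>real j - real j'\<bar>)))
    \<le> (\<Sum>j\<in>?J. \<Sum>j'\<in>?J. real n * (2 * ?H) * (1 / (1 + \<bar>real j - real j'\<bar>)))" by (intro sum_mono)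
  also have "\<dots> = (\<Sum>j\<in>?J. real n * (2 * ?H) * (\<Sum>j'\<in>?J. 1 / (1 + \<bar>real j - real j'\<bar>)))" by (simp only: sum_distrib_left)
  also have "\<dots> \<le> (\<Sum>j\<in>?J. real n * (2 * ?H) * (2 * ?H))"
  proof (intro sum_mono mult_left_mono)
   fix j assume "j \<in> ?J"
   then show "(\<Sum>j'\<in>?J. 1 / (1 + \<bar>real j - real j'\<bar>)) \<le> 2 * ?H" using Jn by (intro sum_inv_abs_le) auto
  qed (use H0 in auto)
  also have "\<dots> = real m * (2 * ?H) * (real n * (2 * ?H))" by simp
  finally show "(\<Sum>j\<in>?J. \<Sum>j'\<in>?J. \<Sum>i\<in>?I j. \<Sum>i'\<in>?I j'. 1 / (1 + \<bar>real i - real i'\<bar>) * (1 / (1 + \<bar>real j - real j'\<bar>)))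
    \<le> real m * (2 * ?H) * (real n * (2 * ?H))" .
  have "(\<Sum>j\<in>?J. \<Sum>j'\<in>?J. \<Sum>i\<in>?I j. \<Sum>i'\<in>?I j'. 1 / (1 + real (j - i)) * (1 / (1 + real (j' - i'))))
    = (\<Sum>j\<in>?J. \<Sum>j'\<in>?J. (\<Sum>i\<in>?I j. 1 / (1 + real (j - i))) * (\<Sum>i'\<in>?I j'. 1 / (1 + real (j' - i'))))"
   by (simp only: sum_product)
  also have "\<dots> \<le> (\<Sum>j\<in>?J. \<Sum>j'\<in>?J. ?H * ?H)"
   using Jn H0 by (intro sum_mono mult_mono sum_inv_gap_le sum_nonneg) auto
  also have "\<dots> = real m * real m * (?H * ?H)" by simp
  finally show "(\<Sum>j\<in>?J. \<Sum>j'\<in>?J. \<Sum>i\<in>?I j. \<Sum>i'\<in>?I j'. 1 / (1 + real (j - i)) * (1 / (1 + real (j' - i')))) \<le> real m * real m * (?H * ?H)" .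
  have "(\<Sum>j\<in>?J. \<Sum>j'\<in>?J. \<Sum>i\<in>?I j. \<Sum>i'\<in>?I j'. 1 / (1 + real (j - i)) ^ 4)
    = (\<Sum>j\<in>?J. \<Sum>j'\<in>?J. real (card (?I j')) * (\<Sum>i\<in>?I j. 1 / (1 + real (j - i)) ^ 4))"
   by (simp only: sum_constant sum_distrib_left)
  also have "\<dots> \<le> (\<Sum>j\<in>?J. \<Sum>j'\<in>?J. real n * (1 / (1 + real b) ^ 3))"
   using cI by (intro sum_mono mult_mono sum_quartic_gap_le sum_nonneg) auto
  also have "\<dots> = real m * real m * (real n * (1 / (1 + real b) ^ 3))" by simp
  finally show "(\<Sum>j\<in>?J. \<Sum>j'\<in>?J. \<Sum>i\<in>?I j. \<Sum>i'\<in>?I j'. 1 / (1 + real (j - i)) ^ 4) \<le> real m * real m * (real n * (1 / (1 + real b) ^ 3))" .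
  have "(\<Sum>j\<in>?J. \<Sum>j'\<in>?J. \<Sum>i\<in>?I j. \<Sum>i'\<in>?I j'. 1 / (1 + real (j' - i')) ^ 4)
    = (\<Sum>j\<in>?J. \<Sum>j'\<in>?J. real (card (?I j)) * (\<Sum>i'\<in>?I j'. 1 / (1 + real (j' - i')) ^ 4))"
   by (simp only: sum_constant)
  also have "\<dots> \<le> (\<Sum>j\<in>?J. \<Sum>j'\<in>?J. real n * (1 / (1 + real b) ^ 3))"
   using cI by (intro sum_mono mult_mono sum_quartic_gap_le sum_nonneg) auto
  also have "\<dots> = real m * real m * (real n * (1 / (1 + real b) ^ 3))" by simp
  finally show "(\<Sum>j\<in>?J. \<Sum>j'\<in>?J. \<Sum>i\<in>?I j. \<Sum>i'\<in>?I j'. 1 / (1 + real (j' - i')) ^ 4) \<le> real m * real m * (real n * (1 / (1 + real b) ^ 3))" .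
 qed
 also have "\<dots> \<le> K2 * (real m * (2 * ?H) * (real n * (2 * ?H)) + real m * real n * (?H * ?H)
   + real m * real n * (real n * (1 / (1 + real b) ^ 3)) + real m * real n * (real n * (1 / (1 + real b) ^ 3)))"
  using nm hsum_nonneg[of "Suc n"] by (intro mult_left_mono add_mono K2_nonneg mult_right_mono order_refl) auto
 also have "\<dots> = K2 * (5 * (hsum (Suc n))\<^sup>2 * real n + 2 * (real n)\<^sup>2 / (1 + real b) ^ 3) * real m"
  by (simp add: power2_eq_square algebra_simps)
 finally show ?thesis .
qed

end

section \<open>Chaining in the level\<close>

text \<open>Each grid point is joined to the point below it of the next coarser grid; at most one increment is
used per level.\<close>
lemma dyadic_chain_le:
 fixes F :: "nat \<Rightarrow> nat \<Rightarrow> real"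
 assumes dbl: "\<And>j q. F (Suc j) (2 * q) = F j q"
  and inc: "\<And>j q. j0 < j \<Longrightarrow> j \<le> J \<Longrightarrow> q < 2 ^ j \<Longrightarrow> \<bar>F j (Suc q) - F j q\<bar> \<le> y j"
  and J: "j0 \<le> J" and q: "q \<le> 2 ^ J"
 shows "\<bar>F J q - F j0 (q div 2 ^ (J - j0))\<bar> \<le> (\<Sum>j\<in>{j0<..J}. y j)"
 using J inc q
proof (induction J arbitrary: q rule: dec_induct)
 case (step J)
 have y0: "0 \<le> y (Suc J)" using step.prems(1)[of "Suc J" 0] step.hyps by fastforce
 have 1: "\<bar>F (Suc J) q - F J (q div 2)\<bar> \<le> y (Suc J)"
 proof (cases "even q")
  case True
  then have "F (Suc J) q = F J (q div 2)" using dbl[of J "q div 2"] by simp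
  then show ?thesis using y0 by simp
 next
  case False
  define r where "r = q div 2"
  have q: "q = Suc (2 * r)" using False by (simp add: r_def)
  have "2 * r < 2 ^ Suc J" using step.prems(2) q by simp
  then show ?thesis using step.prems(1)[of "Suc J" "2 * r"] step.hyps dbl[of J r] q by simp
 qed
 have "q div 2 \<le> 2 ^ J" using step.prems(2) by simp
 then have 2: "\<bar>F J (q div 2) - F j0 (q div 2 div 2 ^ (J - j0))\<bar> \<le> (\<Sum>j\<in>{j0<..J}. y j)"
  using step.prems(1) by (intro step.IH) auto
 have D: "q div 2 div 2 ^ (J - j0) = q div 2 ^ (Suc J - j0)"
  using step.hyps by (simp add: Suc_diff_le div_mult2_eq)
 have S: "(\<Sum>j\<in>{j0<..Suc J}. y j) = (\<Sum>j\<in>{j0<..J}. y j) + y (Suc J)"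
 proof -
  have "{j0<..Suc J} = insert (Suc J) {j0<..J}" using step.hyps by auto
  then show ?thesis by simp
 qed
 have gen: "\<bar>u - wt\<bar> \<le> s + z" if "\<bar>u - v\<bar> \<le> z" "\<bar>v - wt\<bar> \<le> s" for u v wt s z :: real
  using that by linarith
 show ?case unfolding S by (rule gen[OF 1 2[unfolded D]])
qed simp

lemma powr_pow: "0 < x \<Longrightarrow> (x powr a) ^ n = x powr (a * real n)" for x a :: real
proof -
 assume "0 < x"
 then have "(x powr a) ^ n = (x powr a) powr real n" by (simp add: powr_realpow)
 then show ?thesis by (simp only: powr_powr)
qed

lemma geometric_sixteenth: "(\<Sum>j\<in>{j0..J}. 2 powr (- real (j - j0) / 16)) \<le> 24"
proof -
 define r :: real where "r = 2 powr (- 1 / 16)"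
 have r16: "r ^ 16 = 1 / 2" unfolding r_def by (subst powr_pow) (simp_all add: powr_minus)
 have r0: "0 < r" by (simp add: r_def)
 have r1: "r \<le> 23 / 24"
 proof (rule ccontr)
  assume "\<not> r \<le> 23 / 24"
  then have "(23 / 24) ^ 16 < r ^ 16" by (intro power_strict_mono) auto
  then show False unfolding r16 by (simp add: power_divide)
 qed
 have e: "2 powr (- real i / 16) = r ^ i" for i
  unfolding r_def by (subst powr_pow) simp_all
 have "(\<Sum>j\<in>{j0..J}. 2 powr (- real (j - j0) / 16)) = (\<Sum>j\<in>{j0..J}. r ^ (j - j0))" by (simp only: e)
 also have "\<dots> = (\<Sum>i\<in>(\<lambda>j. j - j0) ` {j0..J}. r ^ i)" by (subst sum.reindex) (auto simp: inj_on_def)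
 also have "\<dots> \<le> (\<Sum>i<Suc J. r ^ i)" using r0 by (intro sum_mono2) auto
 also have "\<dots> = (1 - r ^ Suc J) / (1 - r)" using r1 by (subst sum_gp_strict) auto
 also have "\<dots> \<le> 1 / (1 - r)" using r0 r1 by (intro divide_right_mono) auto
 also have "\<dots> \<le> 24" using r1 by (simp add: field_simps)
 finally show ?thesis .
qed

locale u_process = dependent_process M \<mu> X V past fut c0 \<theta> a A
 for M :: "'a measure" and \<mu> X V past fut c0 \<theta> a A +
 fixes h :: "real \<Rightarrow> real \<Rightarrow> real \<Rightarrow> real" and L K lo hi :: real
 assumes kern: "\<And>t. regular_kernel \<mu> (\<lambda>p. h (fst p) (snd p) t) L"
  and h_mono: "\<And>x y t t'. t \<le> t' \<Longrightarrow> h x y t \<le> h x y t'"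
  and lohi: "lo < hi" and K: "0 \<le> K"
  and lip: "\<And>t t'. lo \<le> t \<Longrightarrow> t \<le> t' \<Longrightarrow> t' \<le> hi \<Longrightarrow>
    regular_kernel.mean \<mu> (\<lambda>p. h (fst p) (snd p) t') - regular_kernel.mean \<mu> (\<lambda>p. h (fst p) (snd p) t) \<le> K * (t' - t)"
begin

definition kernel_at :: "real \<Rightarrow> real \<times> real \<Rightarrow> real" where "kernel_at t = (\<lambda>p. h (fst p) (snd p) t)"
definition proj_at :: "real \<Rightarrow> real \<Rightarrow> real" where "proj_at t = regular_kernel.proj \<mu> (kernel_at t)"
definition Umean :: "real \<Rightarrow> real" where "Umean t = regular_kernel.mean \<mu> (kernel_at t)"
definition degen_at :: "real \<Rightarrow> real \<times> real \<Rightarrow> real" where "degen_at t = regular_kernel.degen \<mu> (kernel_at t)"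

lemma regular_at: "regular_kernel \<mu> (kernel_at t) L" using kern by (simp add: kernel_at_def)
lemma KP: "kernel_process M \<mu> X V past fut c0 \<theta> a A (kernel_at t) L"
 using regular_at dependent_process_axioms by (intro kernel_process.intro)
lemma KS: "kernel_on_space M \<mu> (kernel_at t) L"
 using regular_at prob_space_axioms by (intro kernel_on_space.intro)

lemma L_nonneg: "0 \<le> L" using regular_kernel.L_nonneg[OF regular_at] .

lemma proj_at_meas[measurable]: "proj_at t \<in> borel_measurable borel"
 unfolding proj_at_def by (rule regular_kernel.proj_meas[OF regular_at])

lemma proj_at_01: "0 \<le> proj_at t x" "proj_at t x \<le> 1"
 unfolding proj_at_def using regular_kernel.proj_nonneg[OF regular_at] regular_kernel.proj_le_1[OF regular_at] by auto

lemma proj_at_mono: "t \<le> t' \<Longrightarrow> proj_at t x \<le> proj_at t' x"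
 unfolding proj_at_def regular_kernel.proj_def[OF regular_at]
 using regular_kernel.integrable_k[OF regular_at] by (intro integral_mono) (auto simp: kernel_at_def h_mono)

lemma integrable_proj_at: "integrable \<mu> (proj_at t)"
 unfolding proj_at_def by (rule regular_kernel.integrable_proj[OF regular_at])

lemma Umean_eq: "Umean t = (\<integral>x. proj_at t x \<partial>\<mu>)"
 unfolding Umean_def proj_at_def by (rule regular_kernel.mean_def[OF regular_at])

lemma Umean_01: "0 \<le> Umean t" "Umean t \<le> 1"
 unfolding Umean_def using regular_kernel.mean_nonneg[OF regular_at] regular_kernel.mean_le_1[OF regular_at] by auto

lemma Umean_lip: "lo \<le> t \<Longrightarrow> t \<le> t' \<Longrightarrow> t' \<le> hi \<Longrightarrow> Umean t' - Umean t \<le> K * (t' - t)"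
 using lip by (simp add: Umean_def kernel_at_def)

lemma degen_at_eq: "degen_at t (x, y) = h x y t - proj_at t x - proj_at t y + Umean t"
 unfolding degen_at_def proj_at_def Umean_def regular_kernel.degen_def[OF regular_at] by (simp add: kernel_at_def)

lemma abs_degen_at_le: "\<bar>degen_at t p\<bar> \<le> 2"
 unfolding degen_at_def by (rule regular_kernel.abs_degen_le[OF regular_at])

definition Kobs :: real where "Kobs = 4 * (L + c0)"

lemma Kobs_nonneg: "0 \<le> Kobs" using L_nonneg c0_nonneg by (simp add: Kobs_def)

lemma proj_at_approx:
 assumes i: "1 \<le> i"
 shows "expectation (\<lambda>w. \<bar>proj_at t (X i w) - proj_at t (V l i w)\<bar>) \<le> 2 * (L + c0) * (1 + real l) powr - A"
proof -
 define e where "e = (1 + real l) powr - (a / 2)"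
 have e0: "0 < e" by (simp add: e_def)
 have "c0 * (1 + real l) powr - a / e = c0 * e"
  unfolding e_def by (simp add: field_simps powr_diff flip: powr_add)
 then have ap: "prob {w\<in>space M. e < \<bar>X i w - V l i w\<bar>} \<le> c0 * e" using approx[OF i e0, of l] by simp
 have "expectation (\<lambda>w. \<bar>proj_at t (V l i w) - proj_at t (X i w)\<bar>) \<le> 2 * L * e + 2 * (c0 * e)"
  unfolding proj_at_def using i by (intro kernel_on_space.proj_diff_le[OF KS _ _ X_law[OF i] ap e0]) auto
 also have "\<dots> = 2 * (L + c0) * e" by (simp add: algebra_simps)
 also have "\<dots> \<le> 2 * (L + c0) * (1 + real l) powr - A"
  unfolding e_def using L_nonneg c0_nonneg exps by (intro mult_left_mono powr_mono) auto
 finally show ?thesis by (simp add: abs_minus_commute)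
qed

lemma observable_proj_at: "observable Kobs (proj_at t)"
 unfolding observable_def
proof (intro conjI allI impI)
 fix i l :: nat assume "1 \<le> i"
 from proj_at_approx[OF this, of t l]
 show "expectation (\<lambda>w. \<bar>proj_at t (X i w) - proj_at t (V l i w)\<bar>) \<le> Kobs * (1 + real l) powr - A"
  using L_nonneg c0_nonneg by (elim order_trans) (auto simp: Kobs_def intro!: mult_right_mono)
qed (auto simp: proj_at_01)

lemma observable_proj_at_diff:
 assumes t: "t \<le> t'"
 shows "observable Kobs (\<lambda>x. proj_at t' x - proj_at t x)"
 unfolding observable_def
proof (intro conjI allI impI)
 show "0 \<le> proj_at t' x - proj_at t x" for x using proj_at_mono[OF t] by simp
 show "proj_at t' x - proj_at t x \<le> 1" for x using proj_at_01[of t x] proj_at_01[of t' x] by linarith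
 fix i l :: nat assume i: "1 \<le> i"
 note [measurable] = X_meas[OF i] V_meas[OF i]
 have gd: "\<bar>proj_at t x - proj_at t y\<bar> \<le> 1" for t x y using proj_at_01[of t x] proj_at_01[of t y] by linarith
 have int: "integrable M (\<lambda>w. \<bar>proj_at t (X i w) - proj_at t (V l i w)\<bar>)" for t
  using gd by (intro integrable_bounded[of _ 1]) auto
 have gint: "integrable M (\<lambda>w. proj_at t (X i w))" "integrable M (\<lambda>w. proj_at t (V l i w))" for t
  using proj_at_01 by (intro integrable_bounded[of _ 1]; auto)+
 have "expectation (\<lambda>w. \<bar>(proj_at t' (X i w) - proj_at t (X i w)) - (proj_at t' (V l i w) - proj_at t (V l i w))\<bar>)
   \<le> expectation (\<lambda>w. \<bar>proj_at t' (X i w) - proj_at t' (V l i w)\<bar> + \<bar>proj_at t (X i w) - proj_at t (V l i w)\<bar>)"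
  using gint by (intro integral_mono integrable_abs Bochner_Integration.integrable_diff Bochner_Integration.integrable_add) auto
 also have "\<dots> = expectation (\<lambda>w. \<bar>proj_at t' (X i w) - proj_at t' (V l i w)\<bar>) + expectation (\<lambda>w. \<bar>proj_at t (X i w) - proj_at t (V l i w)\<bar>)"
  using int by simp
 also have "\<dots> \<le> 2 * (L + c0) * (1 + real l) powr - A + 2 * (L + c0) * (1 + real l) powr - A"
  by (intro add_mono proj_at_approx i)
 also have "\<dots> = Kobs * (1 + real l) powr - A" by (simp add: Kobs_def algebra_simps)
 finally show "expectation (\<lambda>w. \<bar>(proj_at t' (X i w) - proj_at t (X i w)) - (proj_at t' (V l i w) - proj_at t (V l i w))\<bar>) \<le> Kobs * (1 + real l) powr - A" .
qed auto

definition lin_sum :: "nat \<Rightarrow> real \<Rightarrow> 'a \<Rightarrow> real" where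
 "lin_sum m t w = (\<Sum>i\<in>{1..<1+m}. proj_at t (X i w) - Umean t)"

lemma lin_sum_meas[measurable]: "lin_sum m t \<in> borel_measurable M"
 unfolding lin_sum_def[abs_def] by (intro borel_measurable_sum borel_measurable_diff measurable_compose[OF X_meas proj_at_meas]) auto

definition \<gamma> :: real where "\<gamma> = 1 - 2 / A"

lemma \<gamma>: "5 / 9 \<le> \<gamma>" "\<gamma> < 1" using exps by (auto simp: \<gamma>_def field_simps)

definition Kp :: real where "Kp = K * (hi - lo) + 1"
definition CB :: real where "CB = CM * (5 * K4 Kobs Kp)"

lemma Kp_pos: "1 \<le> Kp" using K lohi by (simp add: Kp_def)

lemma CB_nonneg: "0 \<le> CB"
proof -
 have "0 \<le> K4 Kobs Kp" using Kobs_nonneg Kp_pos c0_nonneg Q0_nonneg by (simp add: K4_def)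
 then show ?thesis using \<theta>M by (simp add: CB_def CM_def)
qed

lemma prob_lin_sum_lo:
 assumes x: "0 < x"
 shows "prob {w\<in>space M. \<exists>m<2 ^ l. x < \<bar>lin_sum m t w\<bar>} \<le> CB * (2 ^ l)\<^sup>2 / x ^ 4"
proof -
 have le1: "2 powr (- 5 / 8 * real l) / 2 \<le> 1"
  using powr_mono[of "- 5 / 8 * real l" 0 2] by simp
 have "prob {w\<in>space M. \<exists>m<2 ^ l. x < \<bar>\<Sum>i\<in>{1..<1+m}. proj_at t (X i w) - (\<integral>x. proj_at t x \<partial>\<mu>)\<bar>}
  \<le> CM * (5 * K4 Kobs Kp * 1 powr (2 - 2 / A)) * (2 ^ l)\<^sup>2 / x ^ 4"
  using Kp_pos Umean_01(2)[of t] by (intro prob_max_observable observable_proj_at Kobs_nonneg le1 x) (auto simp: Umean_eq[symmetric])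
 then show ?thesis by (simp add: lin_sum_def Umean_eq CB_def mult.assoc)
qed

lemma prob_lin_sum_diff:
 assumes x: "0 < x" and t: "lo \<le> t" "t \<le> t'" "t' \<le> hi" "t' - t \<le> (hi - lo) * \<delta>"
  and \<delta>: "2 powr (- 5 / 8 * real l) / 2 \<le> \<delta>" "\<delta> \<le> 1"
 shows "prob {w\<in>space M. \<exists>m<2 ^ l. x < \<bar>lin_sum m t' w - lin_sum m t w\<bar>} \<le> CB * \<delta> powr (1 + \<gamma>) * (2 ^ l)\<^sup>2 / x ^ 4"
proof -
 have \<delta>0: "0 < \<delta>" using \<delta>(1) by (smt (verit) divide_pos_pos powr_gt_zero)
 have md: "(\<integral>x. proj_at t' x - proj_at t x \<partial>\<mu>) = Umean t' - Umean t"
  using integrable_proj_at by (simp add: Umean_eq)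
 have "Umean t' - Umean t \<le> K * (t' - t)" by (rule Umean_lip[OF t(1-3)])
 also have "\<dots> \<le> K * ((hi - lo) * \<delta>)" using K t by (intro mult_left_mono)
 also have "\<dots> \<le> Kp * \<delta>" using \<delta>0 by (simp add: Kp_def algebra_simps)
 finally have "prob {w\<in>space M. \<exists>m<2 ^ l. x < \<bar>\<Sum>i\<in>{1..<1+m}. (proj_at t' (X i w) - proj_at t (X i w)) - (\<integral>x. proj_at t' x - proj_at t x \<partial>\<mu>)\<bar>}
  \<le> CM * (5 * K4 Kobs Kp * \<delta> powr (2 - 2 / A)) * (2 ^ l)\<^sup>2 / x ^ 4"
  using Kp_pos by (intro prob_max_observable[OF observable_proj_at_diff[OF t(2)]] Kobs_nonneg \<delta> x) (auto simp: md)
 moreover have "(\<Sum>i\<in>{1..<1+m}. (proj_at t' (X i w) - proj_at t (X i w)) - (\<integral>x. proj_at t' x - proj_at t x \<partial>\<mu>)) = lin_sum m t' w - lin_sum m t w" for m w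
  unfolding md lin_sum_def sum_subtractf[symmetric] by (intro sum.cong refl) simp
 moreover have "2 - 2 / A = 1 + \<gamma>" by (simp add: \<gamma>_def)
 ultimately show ?thesis by (simp add: CB_def mult.assoc)
qed

definition grid :: "nat \<Rightarrow> nat \<Rightarrow> real" where "grid j q = lo + (hi - lo) * real q / 2 ^ j"

lemma grid_double: "grid (Suc j) (2 * q) = grid j q" by (simp add: grid_def)

lemma grid_range: "q \<le> 2 ^ j \<Longrightarrow> lo \<le> grid j q \<and> grid j q \<le> hi"
proof -
 assume q: "q \<le> 2 ^ j"
 then have "real q \<le> real (2 ^ j)" by (rule of_nat_mono)
 then have "real q / 2 ^ j \<le> 1" by simp
 then have "(hi - lo) * (real q / 2 ^ j) \<le> (hi - lo) * 1" using lohi by (intro mult_left_mono) auto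
 then show ?thesis using lohi by (simp add: grid_def)
qed

lemma grid_Suc: "grid j (Suc q) - grid j q = (hi - lo) / 2 ^ j" by (simp add: grid_def field_simps)

text \<open>Level \<open>j\<close> has \<open>2^j\<close> increments of mean about \<open>2^-j\<close>, each exceeding its threshold with probability of order
\<open>2^(-(1+\<gamma>) j)\<close>. The remaining factor \<open>2^(-\<gamma> j)\<close> absorbs the decreasing thresholds (their fourth powers
contribute \<open>2^(j/4)\<close> and \<open>\<gamma> \<ge> 5/9\<close>), so that the sum is dominated by the coarsest level \<open>j0\<close>.\<close>
lemma prob_chain:
 assumes x: "0 < x" and J: "2 powr (- 5 / 8 * real l) / 2 \<le> 1 / 2 ^ J"
 shows "prob {w\<in>space M. \<exists>j\<in>{j0..J}. \<exists>q<2 ^ j. \<exists>m<2 ^ l. x * 2 powr (- real (j - j0) / 16) < \<bar>lin_sum m (grid j (Suc q)) w - lin_sum m (grid j q) w\<bar>}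
  \<le> 7 * CB * 2 powr (- \<gamma> * real j0) * (2 ^ l)\<^sup>2 / x ^ 4"
proof -
 let ?y = "\<lambda>j. x * 2 powr (- real (j - j0) / 16)"
 let ?B = "\<lambda>j q. {w\<in>space M. \<exists>m<2 ^ l. ?y j < \<bar>lin_sum m (grid j (Suc q)) w - lin_sum m (grid j q) w\<bar>}"
 have Bm[measurable]: "?B j q \<in> events" for j q by measurable
 have pB: "prob (?B j q) \<le> CB * 2 powr (- (1 + \<gamma>) * real j) * (2 ^ l)\<^sup>2 / (?y j) ^ 4"
  if j: "j \<in> {j0..J}" and q: "q < 2 ^ j" for j q
 proof -
  have "prob (?B j q) \<le> CB * (1 / 2 ^ j) powr (1 + \<gamma>) * (2 ^ l)\<^sup>2 / (?y j) ^ 4"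
  proof (rule prob_lin_sum_diff)
   show "0 < ?y j" using x by simp
   show "lo \<le> grid j q" "grid j (Suc q) \<le> hi" using grid_range[of q j] grid_range[of "Suc q" j] q by auto
   have "0 \<le> (hi - lo) / 2 ^ j" using lohi by simp
   then show "grid j q \<le> grid j (Suc q)" using grid_Suc[of j q] by linarith
   show "grid j (Suc q) - grid j q \<le> (hi - lo) * (1 / 2 ^ j)" using grid_Suc[of j q] by simp
   have "1 / 2 ^ J \<le> (1 / 2 ^ j :: real)" using j by (intro divide_left_mono power_increasing) auto
   then show "2 powr (- 5 / 8 * real l) / 2 \<le> 1 / 2 ^ j" using J by linarith
   show "1 / 2 ^ j \<le> (1::real)" by simp
  qed
  also have "(1 / 2 ^ j :: real) powr (1 + \<gamma>) = 2 powr (- (1 + \<gamma>) * real j)"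
  proof -
   have "(1 / 2 ^ j :: real) = 2 powr (- real j)" by (simp add: powr_minus powr_realpow inverse_eq_divide)
   then have "(1 / 2 ^ j :: real) powr (1 + \<gamma>) = 2 powr (- real j * (1 + \<gamma>))" by (simp only: powr_powr)
   also have "- real j * (1 + \<gamma>) = - (1 + \<gamma>) * real j" by (simp add: algebra_simps)
   finally show ?thesis .
  qed
  finally show ?thesis .
 qed
 have "prob {w\<in>space M. \<exists>j\<in>{j0..J}. \<exists>q<2 ^ j. \<exists>m<2 ^ l. ?y j < \<bar>lin_sum m (grid j (Suc q)) w - lin_sum m (grid j q) w\<bar>}
   \<le> prob (\<Union>j\<in>{j0..J}. \<Union>q\<in>{..<2 ^ j}. ?B j q)"
  by (intro finite_measure_mono) (auto intro!: sets.finite_UN)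
 also have "\<dots> \<le> (\<Sum>j\<in>{j0..J}. prob (\<Union>q\<in>{..<2 ^ j}. ?B j q))"
  by (intro finite_measure_subadditive_finite) (auto intro!: sets.finite_UN)
 also have "\<dots> \<le> (\<Sum>j\<in>{j0..J}. \<Sum>q\<in>{..<2 ^ j}. prob (?B j q))"
  by (intro sum_mono finite_measure_subadditive_finite) auto
 also have "\<dots> \<le> (\<Sum>j\<in>{j0..J}. \<Sum>q\<in>{..<(2::nat) ^ j}. CB * 2 powr (- (1 + \<gamma>) * real j) * (2 ^ l)\<^sup>2 / (?y j) ^ 4)"
  using pB by (intro sum_mono) auto
 also have "\<dots> = (\<Sum>j\<in>{j0..J}. CB * 2 powr (- \<gamma> * real j) * (2 ^ l)\<^sup>2 / (?y j) ^ 4)"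
 proof (intro sum.cong refl)
  fix j
  have "2 powr (- \<gamma> * real j) = 2 powr (real j + - (1 + \<gamma>) * real j)" by (simp add: algebra_simps)
  also have "\<dots> = 2 ^ j * 2 powr (- (1 + \<gamma>) * real j)" unfolding powr_add by (simp add: powr_realpow)
  finally have "2 powr (- \<gamma> * real j) = 2 ^ j * 2 powr (- (1 + \<gamma>) * real j)" .
  then show "(\<Sum>q\<in>{..<(2::nat) ^ j}. CB * 2 powr (- (1 + \<gamma>) * real j) * (2 ^ l)\<^sup>2 / (?y j) ^ 4) = CB * 2 powr (- \<gamma> * real j) * (2 ^ l)\<^sup>2 / (?y j) ^ 4"
   by simp
 qed
 also have "\<dots> \<le> (\<Sum>j\<in>{j0..J}. CB * 2 powr (- \<gamma> * real j0) * (2 ^ l)\<^sup>2 / x ^ 4 * (2 powr (- 1 / 4)) ^ (j - j0))"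
 proof (intro sum_mono)
  fix j assume j: "j \<in> {j0..J}"
  define i where "i = j - j0"
  have ji: "real j = real j0 + real i" using j by (simp add: i_def)
  have y4: "(?y j) ^ 4 = x ^ 4 * 2 powr (- real i / 4)"
   unfolding power_mult_distrib i_def[symmetric] by (subst powr_pow) simp_all
  have "2 powr (- \<gamma> * real j) = 2 powr (- \<gamma> * real j0) * 2 powr (- \<gamma> * real i)"
   unfolding ji by (simp add: algebra_simps flip: powr_add)
  also have "2 powr (- \<gamma> * real i) \<le> 2 powr (- (1 / 2) * real i)"
   using \<gamma> by (intro powr_mono mult_right_mono) auto
  also have "2 powr (- (1 / 2) * real i) = 2 powr (- real i / 4) * (2 powr (- 1 / 4)) ^ i"
  proof -
   have "(2 powr (- 1 / 4)) ^ i = 2 powr (- 1 / 4 * real i)" by (rule powr_pow) simp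
   then show ?thesis by (simp flip: powr_add)
  qed
  finally have g: "2 powr (- \<gamma> * real j) \<le> 2 powr (- \<gamma> * real j0) * (2 powr (- real i / 4) * (2 powr (- 1 / 4)) ^ i)"
   by simp
  have "CB * 2 powr (- \<gamma> * real j) * (2 ^ l)\<^sup>2 / (?y j) ^ 4
    \<le> CB * (2 powr (- \<gamma> * real j0) * (2 powr (- real i / 4) * (2 powr (- 1 / 4)) ^ i)) * (2 ^ l)\<^sup>2 / (x ^ 4 * 2 powr (- real i / 4))"
   unfolding y4 using g CB_nonneg x by (intro divide_right_mono mult_right_mono mult_left_mono) auto
  also have "\<dots> = CB * 2 powr (- \<gamma> * real j0) * (2 ^ l)\<^sup>2 / x ^ 4 * (2 powr (- 1 / 4)) ^ i"
   by simp
  finally show "CB * 2 powr (- \<gamma> * real j) * (2 ^ l)\<^sup>2 / (?y j) ^ 4 \<le> CB * 2 powr (- \<gamma> * real j0) * (2 ^ l)\<^sup>2 / x ^ 4 * (2 powr (- 1 / 4)) ^ (j - j0)"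
   by (simp add: i_def)
 qed
 also have "\<dots> = CB * 2 powr (- \<gamma> * real j0) * (2 ^ l)\<^sup>2 / x ^ 4 * (\<Sum>j\<in>{j0..J}. (2 powr (- 1 / 4)) ^ (j - j0))"
  by (simp add: sum_distrib_left)
 also have "\<dots> \<le> CB * 2 powr (- \<gamma> * real j0) * (2 ^ l)\<^sup>2 / x ^ 4 * 7"
 proof (rule mult_left_mono)
  define r :: real where "r = 2 powr (- 1 / 4)"
  have r4: "r ^ 4 = 1 / 2" unfolding r_def by (subst powr_pow) (simp_all add: powr_minus)
  have r0: "0 < r" by (simp add: r_def)
  have r1: "r \<le> 6 / 7"
  proof (rule ccontr)
   assume "\<not> r \<le> 6 / 7"
   then have "(6 / 7) ^ 4 < r ^ 4" by (intro power_strict_mono) auto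
   then show False unfolding r4 by (simp add: power_divide)
  qed
  have "(\<Sum>j\<in>{j0..J}. r ^ (j - j0)) = (\<Sum>i\<in>(\<lambda>j. j - j0) ` {j0..J}. r ^ i)" by (subst sum.reindex) (auto simp: inj_on_def)
  also have "\<dots> \<le> (\<Sum>i<Suc J. r ^ i)" using r0 by (intro sum_mono2) auto
  also have "\<dots> = (1 - r ^ Suc J) / (1 - r)" using r1 by (subst sum_gp_strict) auto
  also have "\<dots> \<le> 1 / (1 - r)" using r0 r1 by (intro divide_right_mono) auto
  also have "\<dots> \<le> 7" using r1 by (simp add: field_simps)
  finally show "(\<Sum>j\<in>{j0..J}. (2 powr (- 1 / 4)) ^ (j - j0)) \<le> (7::real)" by (simp add: r_def)
 qed (use CB_nonneg x in auto)
 finally show ?thesis by (simp add: mult_ac)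
qed

end

section \<open>Good events\<close>

lemma sum_pairs_swap:
 fixes F :: "nat \<Rightarrow> nat \<Rightarrow> real"
 shows "(\<Sum>i=1..m. \<Sum>j=i+1..m. F i j) = (\<Sum>j\<in>{1..<1+m}. \<Sum>i\<in>{1..<j}. F i j)"
proof -
 have "(\<Sum>i=1..m. \<Sum>j=i+1..m. F i j) = (\<Sum>i\<in>{1..m}. \<Sum>j | j \<in> {1..m} \<and> i < j. F i j)"
  by (intro sum.cong) auto
 also have "\<dots> = (\<Sum>j\<in>{1..m}. \<Sum>i | i \<in> {1..m} \<and> i < j. F i j)"
  by (rule sum.swap_restrict) auto
 also have "\<dots> = (\<Sum>j\<in>{1..<1+m}. \<Sum>i\<in>{1..<j}. F i j)"
  by (intro sum.cong) auto
 finally show ?thesis .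
qed

lemma sum_pairs_additive:
 fixes a :: "nat \<Rightarrow> real"
 shows "(\<Sum>j\<in>{1..<1+m}. \<Sum>i\<in>{1..<j}. a i + a j) = (real m - 1) * (\<Sum>i\<in>{1..<1+m}. a i)"
proof (induction m)
 case (Suc m)
 have "(\<Sum>i\<in>{1..<Suc m}. a i + a (Suc m)) = (\<Sum>i\<in>{1..<1+m}. a i) + real m * a (Suc m)"
  by (simp add: sum.distrib)
 then show ?case using Suc by (simp add: algebra_simps)
qed simp

context u_process
begin

definition far_total :: "nat \<Rightarrow> nat \<Rightarrow> real \<Rightarrow> 'a \<Rightarrow> real" where
 "far_total b m t w = (\<Sum>j\<in>{1..<1+m}. \<Sum>i | 1 \<le> i \<and> i + b < j. degen_at t (X j w, X i w))"

definition K2q :: real where "K2q = 52 * (4 ^ 12 * c0) + 48 * L + 8"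

lemma K2q_nonneg: "0 \<le> K2q" using c0_nonneg L_nonneg by (simp add: K2q_def)

lemma far_total_meas[measurable]: "far_total b m t \<in> borel_measurable M"
proof -
 interpret kp: kernel_process M \<mu> X V past fut c0 \<theta> a A "kernel_at t" L by (rule KP)
 have "far_total b m t = (\<lambda>w. \<Sum>j\<in>{1..<1+m}. kp.far_sum b j w)"
  by (rule ext) (simp add: far_total_def kp.far_sum_def degen_at_def)
 then show ?thesis by (simp only:) (intro borel_measurable_sum kp.far_sum_meas, auto)
qed

lemma prob_far_total:
 assumes x: "0 < x" and l: "1 \<le> l"
 shows "prob {w\<in>space M. \<exists>m<2 ^ l. x < \<bar>far_total b m t w\<bar>}
   \<le> K2q * (5 * (hsum (Suc (2 ^ l)))\<^sup>2 * 2 ^ l + 2 * (2 ^ l)\<^sup>2 / (1 + real b) ^ 3) * real l ^ 3 * 2 ^ l / x\<^sup>2"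
proof -
 interpret kp: kernel_process M \<mu> X V past fut c0 \<theta> a A "kernel_at t" L by (rule KP)
 have K2: "kp.K2 = K2q" unfolding kp.K2_def kp.D0_def K2q_def ..
 have "prob {w\<in>space M. \<exists>m<2 ^ l. x < \<bar>\<Sum>j\<in>{1..<1+m}. kp.far_sum b j w\<bar>}
   \<le> (K2q * (5 * (hsum (Suc (2 ^ l)))\<^sup>2 * 2 ^ l + 2 * (2 ^ l)\<^sup>2 / (1 + real b) ^ 3)) * real l ^ 3 * 2 ^ l / x\<^sup>2"
 proof (rule prob_max_le_second[OF kp.far_sum_meas kp.abs_far_sum_le x l])
  fix s m :: nat assume "1 \<le> s" "s + m \<le> 2 ^ l + 1"
  from kp.second_moment_far_sum[OF this, of b]
  show "expectation (\<lambda>w. (\<Sum>i\<in>{s..<s+m}. kp.far_sum b i w)\<^sup>2)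
    \<le> K2q * (5 * (hsum (Suc (2 ^ l)))\<^sup>2 * 2 ^ l + 2 * (2 ^ l)\<^sup>2 / (1 + real b) ^ 3) * real m"
   by (simp add: K2)
 qed
 then show ?thesis by (simp add: far_total_def kp.far_sum_def degen_at_def)
qed

text \<open>Sample sizes below \<open>n = 2^l\<close> use a grid of mesh about \<open>n^(-5/8)\<close>, which is below the target rate, and
chain the oscillations from the mesh \<open>2^-jmin\<close> of about \<open>l n^(-1/2)\<close>, which exceeds the
uniform error. The levels \<open>x1\<close>, \<open>x2\<close>, \<open>x3\<close> are, up to the factor \<open>n\<close> or \<open>n^2\<close>, the rates for the uniform error, the
oscillation and the degenerate part.\<close>
definition jmax :: "nat \<Rightarrow> nat" where "jmax l = nat \<lceil>5 / 8 * real l\<rceil>"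
definition jmin :: "nat \<Rightarrow> nat" where "jmin l = nat \<lfloor>real l / 2 - log 2 (real l)\<rfloor>"
definition min_gap :: "nat \<Rightarrow> nat" where "min_gap l = nat \<lfloor>2 powr (3 / 8 * real l)\<rfloor>"
definition x1 :: "nat \<Rightarrow> real" where "x1 l = sqrt (real l) * 2 powr (real l / 2)"
definition x2 :: "nat \<Rightarrow> real" where "x2 l = real l powr (3 / 4) * 2 powr ((1 / 2 - \<gamma> / 8) * real l)"
definition x3 :: "nat \<Rightarrow> real" where "x3 l = 2 powr (11 / 8 * real l)"

definition good :: "nat \<Rightarrow> 'a \<Rightarrow> bool" where
 "good l w \<longleftrightarrow> (\<forall>m<2 ^ l. \<bar>lin_sum m lo w\<bar> \<le> x1 l)
   \<and> (\<forall>j\<in>{0..jmax l}. \<forall>q<2 ^ j. \<forall>m<2 ^ l. \<bar>lin_sum m (grid j (Suc q)) w - lin_sum m (grid j q) w\<bar> \<le> x1 l * 2 powr (- real (j - 0) / 16))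
   \<and> (\<forall>j\<in>{jmin l..jmax l}. \<forall>q<2 ^ j. \<forall>m<2 ^ l. \<bar>lin_sum m (grid j (Suc q)) w - lin_sum m (grid j q) w\<bar> \<le> x2 l * 2 powr (- real (j - jmin l) / 16))
   \<and> (\<forall>q\<le>2 ^ jmax l. \<forall>m<2 ^ l. \<bar>far_total (min_gap l) m (grid (jmax l) q) w\<bar> \<le> x3 l)"

lemma jmax_bounds: "2 powr (5 / 8 * real l) \<le> 2 ^ jmax l" "(2::real) ^ jmax l \<le> 2 * 2 powr (5 / 8 * real l)"
proof -
 have 1: "5 / 8 * real l \<le> real (jmax l)" "real (jmax l) \<le> 5 / 8 * real l + 1" unfolding jmax_def by linarith+
 have e: "(2::real) ^ jmax l = 2 powr real (jmax l)" by (simp add: powr_realpow)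
 show "2 powr (5 / 8 * real l) \<le> 2 ^ jmax l" unfolding e using 1 by (intro powr_mono) auto
 have "(2::real) ^ jmax l \<le> 2 powr (5 / 8 * real l + 1)" unfolding e using 1 by (intro powr_mono) auto
 then show "(2::real) ^ jmax l \<le> 2 * 2 powr (5 / 8 * real l)" by (simp add: powr_add)
qed

lemma jmax_small: "2 powr (- 5 / 8 * real l) / 2 \<le> 1 / 2 ^ jmax l"
proof -
 have "1 / (2 * 2 powr (5 / 8 * real l)) \<le> (1 / 2 ^ jmax l :: real)"
  using jmax_bounds(2)[of l] by (intro divide_left_mono) auto
 moreover have "2 powr (- 5 / 8 * real l) = 1 / 2 powr (5 / 8 * real l)"
  using powr_minus_divide[of 2 "5 / 8 * real l"] by simp
 ultimately show ?thesis by simp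
qed

lemma jmin_bound: "real l / 2 - log 2 (real l) \<le> real (jmin l) + 1"
 unfolding jmin_def by linarith

lemma jmin_le: "1 \<le> l \<Longrightarrow> jmin l \<le> jmax l"
proof -
 assume "1 \<le> l"
 then have "0 \<le> log 2 (real l)" by simp
 then have "real l / 2 - log 2 (real l) \<le> 5 / 8 * real l" by linarith
 then show ?thesis unfolding jmin_def jmax_def by linarith
qed

text \<open>The thresholds make the three chaining bounds of order \<open>l^-2\<close>: the fourth power of \<open>x1\<close> is
\<open>l^2 n^2\<close>, and that of \<open>x2\<close> exactly compensates the gain \<open>2^(-\<gamma> jmin)\<close>, up to the same \<open>l^2\<close>. For the degenerate part the
\<open>n^(5/8)\<close> grid points are affordable, since the bound at one point is \<open>n^(-3/4)\<close> up to powers of \<open>l\<close>.\<close>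
lemma prob_not_good:
 assumes l: "1 \<le> l"
 shows "prob {w\<in>space M. \<not> good l w} \<le> 22 * CB / (real l)\<^sup>2 + 28 * K2q * (real l + 2) ^ 5 * 2 powr (- real l / 8)"
proof -
 have l0: "0 < real l" using l by simp
 have pw: "(2::real) ^ n = 2 powr real n" for n by (simp add: powr_realpow)
 have x1: "0 < x1 l" using l by (simp add: x1_def)
 have x2: "0 < x2 l" using l by (simp add: x2_def)
 have x3: "0 < x3 l" by (simp add: x3_def)
 have x14: "(x1 l) ^ 4 = (real l)\<^sup>2 * (2 ^ l)\<^sup>2"
 proof -
  have "(sqrt (real l)) ^ (2 * 2) = ((sqrt (real l))\<^sup>2)\<^sup>2" by (rule power_mult)
  then have "(sqrt (real l)) ^ 4 = (real l)\<^sup>2" by simp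
  moreover have "(2 powr (real l / 2)) ^ 4 = (2 ^ l :: real)\<^sup>2"
   by (subst powr_pow) (auto simp: pw power2_eq_square simp flip: powr_add)
  ultimately show ?thesis by (simp add: x1_def power_mult_distrib)
 qed
 let ?B1 = "{w\<in>space M. \<exists>m<2 ^ l. x1 l < \<bar>lin_sum m lo w\<bar>}"
 let ?B2 = "{w\<in>space M. \<exists>j\<in>{0..jmax l}. \<exists>q<2 ^ j. \<exists>m<2 ^ l. x1 l * 2 powr (- real (j - 0) / 16) < \<bar>lin_sum m (grid j (Suc q)) w - lin_sum m (grid j q) w\<bar>}"
 let ?B3 = "{w\<in>space M. \<exists>j\<in>{jmin l..jmax l}. \<exists>q<2 ^ j. \<exists>m<2 ^ l. x2 l * 2 powr (- real (j - jmin l) / 16) < \<bar>lin_sum m (grid j (Suc q)) w - lin_sum m (grid j q) w\<bar>}"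
 let ?C = "\<lambda>q. {w\<in>space M. \<exists>m<2 ^ l. x3 l < \<bar>far_total (min_gap l) m (grid (jmax l) q) w\<bar>}"
 have ev[measurable]: "?B1 \<in> events" "?B2 \<in> events" "?B3 \<in> events" "?C q \<in> events" for q by measurable
 have p1: "prob ?B1 \<le> CB / (real l)\<^sup>2"
  using prob_lin_sum_lo[OF x1, of l lo] unfolding x14 by simp
 have p2: "prob ?B2 \<le> 7 * CB / (real l)\<^sup>2"
  using prob_chain[OF x1 jmax_small, of 0 l] unfolding x14 by simp
 have p3: "prob ?B3 \<le> 14 * CB / (real l)\<^sup>2"
 proof -
  have x24: "(x2 l) ^ 4 = real l ^ 3 * (2 powr (- \<gamma> / 2 * real l) * (2 ^ l)\<^sup>2)"
  proof -
   have "(real l powr (3 / 4)) ^ 4 = real l powr 3" using l0 by (subst powr_pow) auto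
   also have "\<dots> = real l ^ 3" using l0 by simp
   finally have 1: "(real l powr (3 / 4)) ^ 4 = real l ^ 3" .
   have "(2 powr ((1 / 2 - \<gamma> / 8) * real l)) ^ 4 = 2 powr ((1 / 2 - \<gamma> / 8) * real l * real 4)" by (rule powr_pow) simp
   also have "(1 / 2 - \<gamma> / 8) * real l * real 4 = - \<gamma> / 2 * real l + (real l + real l)" by (simp add: algebra_simps)
   also have "2 powr \<dots> = 2 powr (- \<gamma> / 2 * real l) * (2 ^ l)\<^sup>2" unfolding pw power2_eq_square by (simp only: powr_add)
   finally show ?thesis using 1 by (simp add: x2_def power_mult_distrib)
  qed
  have k: "2 powr (- \<gamma> * real (jmin l)) \<le> 2 * real l * 2 powr (- \<gamma> / 2 * real l)"
  proof -
   have "- \<gamma> * real (jmin l) \<le> \<gamma> * (log 2 (real l) + 1) + (- \<gamma> / 2 * real l)"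
   proof -
    have "\<gamma> * (real l / 2 - log 2 (real l)) \<le> \<gamma> * (real (jmin l) + 1)" using \<gamma> jmin_bound by (intro mult_left_mono) auto
    then show ?thesis by (simp add: algebra_simps)
   qed
   also have "\<gamma> * (log 2 (real l) + 1) \<le> 1 * (log 2 (real l) + 1)"
    using \<gamma> l by (intro mult_right_mono) (auto intro!: add_nonneg_nonneg)
   finally have "2 powr (- \<gamma> * real (jmin l)) \<le> 2 powr ((log 2 (real l) + 1) + (- \<gamma> / 2 * real l))" by (intro powr_mono) auto
   also have "\<dots> = 2 powr (log 2 (real l)) * 2 powr 1 * 2 powr (- \<gamma> / 2 * real l)" by (simp only: powr_add)
   also have "2 powr (log 2 (real l)) = real l" using l0 by simp
   finally show ?thesis by (simp add: mult.commute)
  qed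
  have "prob ?B3 \<le> 7 * CB * 2 powr (- \<gamma> * real (jmin l)) * (2 ^ l)\<^sup>2 / (x2 l) ^ 4"
   by (rule prob_chain[OF x2 jmax_small])
  also have "\<dots> \<le> 7 * CB * (2 * real l * 2 powr (- \<gamma> / 2 * real l)) * (2 ^ l)\<^sup>2 / (x2 l) ^ 4"
   using k CB_nonneg x2 by (intro divide_right_mono mult_right_mono mult_left_mono) auto
  also have "\<dots> = 14 * CB / (real l)\<^sup>2"
   unfolding x24 using l0 by (simp add: field_simps power2_eq_square power3_eq_cube)
  finally show ?thesis .
 qed
 have p4: "prob (\<Union>q\<in>{..2 ^ jmax l}. ?C q) \<le> 28 * K2q * (real l + 2) ^ 5 * 2 powr (- real l / 8)"
 proof -
  define D where "D = K2q * (7 * (real l + 2)\<^sup>2 * 2 ^ l) * real l ^ 3 * 2 ^ l / (x3 l)\<^sup>2"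
  have hs: "hsum (Suc (2 ^ l)) \<le> real l + 2"
  proof -
   have "hsum (Suc (2 ^ l)) \<le> hsum (2 ^ Suc l)"
    unfolding hsum_def by (intro sum_mono2) auto
   then show ?thesis using hsum_pow2[of "Suc l"] by simp
  qed
  have bb: "2 * (2 ^ l)\<^sup>2 / (1 + real (min_gap l)) ^ 3 \<le> 2 * 2 ^ l"
  proof -
   have "2 powr (3 / 8 * real l) \<le> 1 + real (min_gap l)" unfolding min_gap_def by linarith
   then have "(2 powr (3 / 8 * real l)) ^ 3 \<le> (1 + real (min_gap l)) ^ 3" by (intro power_mono) auto
   also have "(2 powr (3 / 8 * real l)) ^ 3 = 2 powr (9 / 8 * real l)" by (subst powr_pow) auto
   finally have "2 powr (9 / 8 * real l) \<le> (1 + real (min_gap l)) ^ 3" .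
   moreover have "2 ^ l \<le> 2 powr (9 / 8 * real l)" unfolding pw by (intro powr_mono) auto
   ultimately have "(2 ^ l :: real) \<le> (1 + real (min_gap l)) ^ 3" by linarith
   then have "2 * (2 ^ l)\<^sup>2 / (1 + real (min_gap l)) ^ 3 \<le> 2 * (2 ^ l)\<^sup>2 / 2 ^ l" by (intro divide_left_mono) auto
   then show ?thesis by (simp add: power2_eq_square)
  qed
  have pC: "prob (?C q) \<le> D" for q
  proof -
   have "prob (?C q) \<le> K2q * (5 * (hsum (Suc (2 ^ l)))\<^sup>2 * 2 ^ l + 2 * (2 ^ l)\<^sup>2 / (1 + real (min_gap l)) ^ 3) * real l ^ 3 * 2 ^ l / (x3 l)\<^sup>2"
    by (rule prob_far_total[OF x3 l])
   also have "\<dots> \<le> D"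
    unfolding D_def
   proof (intro divide_right_mono mult_right_mono mult_left_mono K2q_nonneg)
    have "(hsum (Suc (2 ^ l)))\<^sup>2 \<le> (real l + 2)\<^sup>2" using hs hsum_nonneg by (intro power_mono)
    then have "5 * (hsum (Suc (2 ^ l)))\<^sup>2 * 2 ^ l \<le> 5 * (real l + 2)\<^sup>2 * 2 ^ l" by (intro mult_right_mono mult_left_mono) auto
    moreover have "2 * 2 ^ l \<le> 2 * (real l + 2)\<^sup>2 * 2 ^ l" by (simp add: power2_eq_square algebra_simps)
    ultimately show "5 * (hsum (Suc (2 ^ l)))\<^sup>2 * 2 ^ l + 2 * (2 ^ l)\<^sup>2 / (1 + real (min_gap l)) ^ 3 \<le> 7 * (real l + 2)\<^sup>2 * 2 ^ l"
     using bb by linarith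
   qed auto
   finally show ?thesis .
  qed
  have "prob (\<Union>q\<in>{..2 ^ jmax l}. ?C q) \<le> (\<Sum>q\<in>{..2 ^ jmax l}. prob (?C q))"
   by (intro finite_measure_subadditive_finite) auto
  also have "\<dots> \<le> (\<Sum>q\<in>{..(2::nat) ^ jmax l}. D)" using pC by (intro sum_mono)
  also have "\<dots> = (2 ^ jmax l + 1) * D" by simp
  also have "\<dots> \<le> (4 * 2 powr (5 / 8 * real l)) * D"
  proof (intro mult_right_mono)
   have "1 \<le> 2 powr (5 / 8 * real l)" by (intro ge_one_powr_ge_zero) auto
   then show "(2 ^ jmax l + 1 :: real) \<le> 4 * 2 powr (5 / 8 * real l)" using jmax_bounds(2)[of l] by linarith
   show "0 \<le> D" using K2q_nonneg by (simp add: D_def)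
  qed
  also have "\<dots> = 28 * K2q * ((real l + 2)\<^sup>2 * real l ^ 3) * (2 powr (5 / 8 * real l) * (2 ^ l * 2 ^ l) / (x3 l)\<^sup>2)"
   by (simp add: D_def)
  also have "2 powr (5 / 8 * real l) * (2 ^ l * 2 ^ l) / (x3 l)\<^sup>2 = 2 powr (- real l / 8)"
  proof -
   have "(x3 l)\<^sup>2 = 2 powr (22 / 8 * real l)" unfolding x3_def by (subst powr_pow) auto
   then have "2 powr (5 / 8 * real l) * (2 ^ l * 2 ^ l) / (x3 l)\<^sup>2 = 2 powr (5 / 8 * real l + (real l + real l) - 22 / 8 * real l)"
    unfolding pw by (simp only: powr_add powr_diff)
   also have "5 / 8 * real l + (real l + real l) - 22 / 8 * real l = - real l / 8" by simp
   finally show ?thesis .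
  qed
  also have "28 * K2q * ((real l + 2)\<^sup>2 * real l ^ 3) * 2 powr (- real l / 8) \<le> 28 * K2q * (real l + 2) ^ 5 * 2 powr (- real l / 8)"
  proof (intro mult_right_mono mult_left_mono)
   have "(real l + 2)\<^sup>2 * real l ^ 3 \<le> (real l + 2)\<^sup>2 * (real l + 2) ^ 3" by (intro mult_left_mono power_mono) auto
   also have "\<dots> = (real l + 2) ^ 5" by (simp flip: power_add)
   finally show "(real l + 2)\<^sup>2 * real l ^ 3 \<le> (real l + 2) ^ 5" .
  qed (use K2q_nonneg in auto)
  finally show ?thesis .
 qed
 have Cm[measurable]: "(\<Union>q\<in>{..2 ^ jmax l}. ?C q) \<in> events" by (intro sets.finite_UN) auto
 have "prob {w\<in>space M. \<not> good l w} \<le> prob ((?B1 \<union> ?B2) \<union> (?B3 \<union> (\<Union>q\<in>{..2 ^ jmax l}. ?C q)))"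
 proof (intro finite_measure_mono subsetI)
  fix w assume w: "w \<in> {w\<in>space M. \<not> good l w}"
  show "w \<in> (?B1 \<union> ?B2) \<union> (?B3 \<union> (\<Union>q\<in>{..2 ^ jmax l}. ?C q))"
  proof (rule ccontr)
   assume n: "w \<notin> (?B1 \<union> ?B2) \<union> (?B3 \<union> (\<Union>q\<in>{..2 ^ jmax l}. ?C q))"
   have sp: "w \<in> space M" using w by simp
   have n1: "w \<notin> ?B1" and n2: "w \<notin> ?B2" and n3: "w \<notin> ?B3" and n4: "\<And>q. q \<le> 2 ^ jmax l \<Longrightarrow> w \<notin> ?C q"
    using n by simp_all
   have "good l w" unfolding good_def
   proof (intro conjI ballI allI impI)
    show "\<bar>lin_sum m lo w\<bar> \<le> x1 l" if "m < 2 ^ l" for m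
     using n1 sp that by (simp only: mem_Collect_eq) (meson not_less)
    show "\<bar>lin_sum m (grid j (Suc q)) w - lin_sum m (grid j q) w\<bar> \<le> x1 l * 2 powr (- real (j - 0) / 16)"
     if "j \<in> {0..jmax l}" "q < 2 ^ j" "m < 2 ^ l" for j q m
     using n2 sp that by (simp only: mem_Collect_eq) (meson not_less)
    show "\<bar>lin_sum m (grid j (Suc q)) w - lin_sum m (grid j q) w\<bar> \<le> x2 l * 2 powr (- real (j - jmin l) / 16)"
     if "j \<in> {jmin l..jmax l}" "q < 2 ^ j" "m < 2 ^ l" for j q m
     using n3 sp that by (simp only: mem_Collect_eq) (meson not_less)
    show "\<bar>far_total (min_gap l) m (grid (jmax l) q) w\<bar> \<le> x3 l" if "q \<le> 2 ^ jmax l" "m < 2 ^ l" for q m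
     using n4[OF that(1)] sp that(2) by (simp only: mem_Collect_eq) (meson not_less)
   qed
   then show False using w by simp
  qed
 qed (intro sets.Un ev Cm)
 also have "\<dots> \<le> (prob ?B1 + prob ?B2) + (prob ?B3 + prob (\<Union>q\<in>{..2 ^ jmax l}. ?C q))"
  by (rule order_trans[OF measure_Un_le[OF sets.Un[OF ev(1,2)] sets.Un[OF ev(3) Cm]]])
   (rule add_mono[OF measure_Un_le[OF ev(1,2)] measure_Un_le[OF ev(3) Cm]])
 also have "\<dots> \<le> (CB / (real l)\<^sup>2 + 7 * CB / (real l)\<^sup>2) + (14 * CB / (real l)\<^sup>2 + 28 * K2q * (real l + 2) ^ 5 * 2 powr (- real l / 8))"
  by (intro add_mono p1 p2 p3 p4)
 also have "\<dots> = 22 * CB / (real l)\<^sup>2 + 28 * K2q * (real l + 2) ^ 5 * 2 powr (- real l / 8)"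
  by (simp add: field_simps)
 finally show ?thesis .
qed

lemma AE_good: "AE w in M. \<forall>\<^sub>F l in sequentially. good l w"
proof -
 define B where "B l = {w\<in>space M. \<not> good l w}" for l
 have Bm: "B l \<in> events" for l unfolding B_def good_def by measurable
 have "summable (\<lambda>l. prob (B l))"
 proof (rule summable_comparison_test_ev)
  show "\<forall>\<^sub>F l in sequentially. norm (prob (B l)) \<le> 22 * CB * (1 / (real l)\<^sup>2) + 28 * K2q * ((real l + 2) ^ 5 * 2 powr (- real l / 8))"
   using eventually_ge_at_top[of 1]
  proof eventually_elim
   case (elim l)
   show ?case using prob_not_good[OF elim] unfolding B_def[symmetric] by (simp add: mult.assoc)
  qed
  have s2: "summable (\<lambda>l. 1 / (real l)\<^sup>2)" using inverse_power_summable[of 2, where 'a = real] by (simp add: inverse_eq_divide)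
  then have sn: "summable (\<lambda>l. norm (1 / (real l)\<^sup>2))" by simp
  have "(\<lambda>l. (real l + 2) ^ 5 * 2 powr (- real l / 8)) \<in> O(\<lambda>l. 1 / (real l)\<^sup>2)" by real_asymp
  from summable_comparison_test_bigo[OF sn this]
  show "summable (\<lambda>l. 22 * CB * (1 / (real l)\<^sup>2) + 28 * K2q * ((real l + 2) ^ 5 * 2 powr (- real l / 8)))"
   using s2 by (intro summable_add summable_mult)
 qed
 then have "AE w in M. \<forall>\<^sub>F l in sequentially. w \<in> space M - B l"
  by (intro borel_cantelli_AE1[OF Bm]) (auto simp: emeasure_eq_measure)
 then show ?thesis
 proof (rule AE_mp, intro AE_I2 impI)
  fix w assume "\<forall>\<^sub>F l in sequentially. w \<in> space M - B l"
  then show "\<forall>\<^sub>F l in sequentially. good l w" by eventually_elim (simp add: B_def)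
 qed
qed

text \<open>Hoeffding decomposition; the pairs at distance at most \<open>b\<close>, of which there are at most
\<open>m b\<close>, are separated from the degenerate part and bounded by 2 each.\<close>
lemma emp_U_decomposition:
 assumes m: "2 \<le> m"
 shows "\<bar>emp_U h X m t w - Umean t - 2 / real m * lin_sum m t w\<bar> \<le> 2 / (real m * (real m - 1)) * (\<bar>far_total b m t w\<bar> + 2 * real m * real b)"
proof -
 let ?p = "\<lambda>F. \<Sum>j\<in>{1..<1+m}. \<Sum>i\<in>{1..<j}. F i j"
 have sym: "h x y t = h y x t" for x y using regular_kernel.k_sym[OF regular_at, of t x y] by (simp add: kernel_at_def)
 have m0: "0 < real m" "0 < real m - 1" using m by auto
 have "(\<Sum>i=1..m. \<Sum>j=i+1..m. h (X i w) (X j w) t) = ?p (\<lambda>i j. h (X i w) (X j w) t)" by (rule sum_pairs_swap)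
 also have "\<dots> = ?p (\<lambda>i j. degen_at t (X j w, X i w) + ((proj_at t (X i w) - Umean t / 2) + (proj_at t (X j w) - Umean t / 2)))"
  by (intro sum.cong refl) (simp add: degen_at_eq sym)
 also have "\<dots> = ?p (\<lambda>i j. degen_at t (X j w, X i w)) + (real m - 1) * (\<Sum>i\<in>{1..<1+m}. proj_at t (X i w) - Umean t / 2)"
  by (simp only: sum.distrib[of _ "\<lambda>i. (proj_at t (X i w) - Umean t / 2) + (proj_at t (X _ w) - Umean t / 2)"] sum.distrib sum_pairs_additive[of "\<lambda>i. proj_at t (X i w) - Umean t / 2" m, unfolded sum.distrib])
 also have "(\<Sum>i\<in>{1..<1+m}. proj_at t (X i w) - Umean t / 2) = lin_sum m t w + real m * Umean t / 2"
  by (simp add: lin_sum_def sum_subtractf)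
 finally have s: "(\<Sum>i=1..m. \<Sum>j=i+1..m. h (X i w) (X j w) t) = ?p (\<lambda>i j. degen_at t (X j w, X i w)) + (real m - 1) * (lin_sum m t w + real m * Umean t / 2)" .
 have "\<bar>?p (\<lambda>i j. degen_at t (X j w, X i w)) - far_total b m t w\<bar> \<le> 2 * real m * real b"
 proof -
  have fin: "finite {i. 1 \<le> i \<and> i + b < j}" for j :: nat by (rule finite_subset[of _ "{..j}"]) auto
  have "?p (\<lambda>i j. degen_at t (X j w, X i w)) - far_total b m t w = (\<Sum>j\<in>{1..<1+m}. \<Sum>i\<in>{1..<j} - {i. 1 \<le> i \<and> i + b < j}. degen_at t (X j w, X i w))"
   unfolding far_total_def sum_subtractf[symmetric] by (intro sum.cong refl sum_diff[symmetric]) auto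
  also have "\<bar>\<dots>\<bar> \<le> (\<Sum>j\<in>{1..<1+m}. \<bar>\<Sum>i\<in>{1..<j} - {i. 1 \<le> i \<and> i + b < j}. degen_at t (X j w, X i w)\<bar>)" by (rule sum_abs)
  also have "\<dots> \<le> (\<Sum>j\<in>{1..<1+m}. 2 * real b)"
  proof (intro sum_mono)
   fix j
   have "\<bar>\<Sum>i\<in>{1..<j} - {i. 1 \<le> i \<and> i + b < j}. degen_at t (X j w, X i w)\<bar> \<le> (\<Sum>i\<in>{1..<j} - {i. 1 \<le> i \<and> i + b < j}. \<bar>degen_at t (X j w, X i w)\<bar>)" by (rule sum_abs)
   also have "\<dots> \<le> (\<Sum>i\<in>{1..<j} - {i. 1 \<le> i \<and> i + b < j}. 2)" by (intro sum_mono abs_degen_at_le)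
   also have "\<dots> \<le> (\<Sum>i\<in>{j - b..<j}. 2)" by (intro sum_mono2) auto
   also have "\<dots> \<le> 2 * real b" by simp
   finally show "\<bar>\<Sum>i\<in>{1..<j} - {i. 1 \<le> i \<and> i + b < j}. degen_at t (X j w, X i w)\<bar> \<le> 2 * real b" .
  qed
  also have "\<dots> = 2 * real m * real b" by simp
  finally show ?thesis .
 qed
 then have pb: "\<bar>?p (\<lambda>i j. degen_at t (X j w, X i w))\<bar> \<le> \<bar>far_total b m t w\<bar> + 2 * real m * real b" by linarith
 define P where "P = ?p (\<lambda>i j. degen_at t (X j w, X i w))"
 have "emp_U h X m t w = 2 / (real m * (real m - 1)) * (P + (real m - 1) * (lin_sum m t w + real m * Umean t / 2))"
  unfolding emp_U_def s P_def using m by simp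
 also have "\<dots> = 2 / (real m * (real m - 1)) * P + (2 / real m * lin_sum m t w + Umean t)"
  using m0 by (simp add: field_simps)
 finally have "emp_U h X m t w - Umean t - 2 / real m * lin_sum m t w = 2 / (real m * (real m - 1)) * P" by simp
 then have "\<bar>emp_U h X m t w - Umean t - 2 / real m * lin_sum m t w\<bar> = 2 / (real m * (real m - 1)) * \<bar>P\<bar>"
  using m0 by (simp add: abs_mult)
 also have "\<dots> \<le> 2 / (real m * (real m - 1)) * (\<bar>far_total b m t w\<bar> + 2 * real m * real b)"
  using pb m0 unfolding P_def by (intro mult_left_mono) auto
 finally show ?thesis .
qed

end

section \<open>The argument of Bahadur\<close>

text \<open>Evaluating \<open>p \<le> Um\<close> just above the empirical quantile and \<open>Um < p\<close> just below it, and
replacing \<open>Um t\<close> by \<open>Um tp + v (t - tp)\<close> up to \<open>b + E\<close>, gives bounds for the quantile from both sides.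
The slack \<open>\<eta>\<close> tends to 0; \<open>Um\<close> may jump at the quantile itself.\<close>
lemma bahadur_bound_at_point:
 fixes Um U :: "real \<Rightarrow> real" and v p tp d b E \<kappa> :: real
 assumes Um: "mono Um" and \<kappa>: "0 < \<kappa>" "\<kappa> \<le> v" and d: "0 < d" and tp: "U tp = p"
  and low: "Um (tp - d) < p" and high: "p \<le> Um (tp + d)"
  and inc: "\<And>t. \<bar>t - tp\<bar> \<le> 2 * d \<Longrightarrow> \<bar>(Um t - U t) - (Um tp - U tp)\<bar> \<le> b"
  and expd: "\<And>t. \<bar>t - tp\<bar> \<le> 2 * d \<Longrightarrow> \<bar>U t - p - v * (t - tp)\<bar> \<le> E"
 shows "\<bar>Inf {t. p \<le> Um t} - tp - (p - Um tp) / v\<bar> \<le> (b + E) / \<kappa>"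
proof -
 define T where "T = {t. p \<le> Um t}"
 define th where "th = Inf T"
 have v: "0 < v" using \<kappa> by linarith
 have lb: "tp - d \<le> t" if "t \<in> T" for t
 proof (rule ccontr)
  assume "\<not> tp - d \<le> t"
  then have "Um t \<le> Um (tp - d)" using Um by (auto simp: mono_def)
  then show False using low that by (simp add: T_def)
 qed
 have bdd: "bdd_below T" using lb by (auto simp: bdd_below_def)
 have ne: "tp + d \<in> T" using high by (simp add: T_def)
 have th: "tp - d \<le> th" "th \<le> tp + d"
  unfolding th_def using lb ne by (auto intro!: cInf_greatest cInf_lower bdd)
 have b0: "0 \<le> b" using inc[of tp] d by simp
 have E0: "0 \<le> E" using expd[of tp] d tp by simp
 have main: "\<bar>th - tp - (p - Um tp) / v\<bar> \<le> (b + E) / v + \<eta>" if \<eta>: "0 < \<eta>" "\<eta> \<le> d" for \<eta>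
 proof -
  have 1: "p \<le> Um (th + \<eta>)"
  proof -
   obtain t where t: "t \<in> T" "t < th + \<eta>" using cInf_lessD[of T "th + \<eta>"] ne \<eta> unfolding th_def by auto
   then have "Um t \<le> Um (th + \<eta>)" using Um by (auto simp: mono_def)
   then show ?thesis using t by (simp add: T_def)
  qed
  have 2: "Um (th - \<eta>) < p"
  proof (rule ccontr)
   assume "\<not> Um (th - \<eta>) < p"
   then have "th - \<eta> \<in> T" by (simp add: T_def)
   then have "th \<le> th - \<eta>" unfolding th_def using bdd by (intro cInf_lower)
   then show False using \<eta> by simp
  qed
  have n1: "\<bar>(th + \<eta>) - tp\<bar> \<le> 2 * d" and n2: "\<bar>(th - \<eta>) - tp\<bar> \<le> 2 * d" using th \<eta> by linarith+
  have "(p - Um tp) - (b + E) \<le> v * ((th + \<eta>) - tp)" using 1 inc[OF n1] expd[OF n1] tp by linarith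
  then have "((p - Um tp) - (b + E)) / v \<le> (th + \<eta>) - tp" using v by (simp add: field_simps)
  then have A: "(p - Um tp) / v - (b + E) / v \<le> (th + \<eta>) - tp" by (simp add: diff_divide_distrib)
  have "v * ((th - \<eta>) - tp) \<le> (p - Um tp) + (b + E)" using 2 inc[OF n2] expd[OF n2] tp by linarith
  then have "(th - \<eta>) - tp \<le> ((p - Um tp) + (b + E)) / v" using v by (simp add: field_simps)
  then have B: "(th - \<eta>) - tp \<le> (p - Um tp) / v + (b + E) / v" by (simp add: add_divide_distrib)
  show ?thesis using A B by linarith
 qed
 have "\<bar>th - tp - (p - Um tp) / v\<bar> \<le> (b + E) / v"
 proof (rule field_le_epsilon)
  fix e :: real assume e: "0 < e"
  have "0 < min e d" "min e d \<le> d" using e d by auto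
  from main[OF this] have "\<bar>th - tp - (p - Um tp) / v\<bar> \<le> (b + E) / v + min e d" .
  also have "\<dots> \<le> (b + E) / v + e" by simp
  finally show "\<bar>th - tp - (p - Um tp) / v\<bar> \<le> (b + E) / v + e" .
 qed
 also have "\<dots> \<le> (b + E) / \<kappa>" using \<kappa> b0 E0 by (intro divide_left_mono) auto
 finally show ?thesis by (simp add: th_def T_def)
qed

context u_process
begin

text \<open>On a good event the chaining inequalities bound the linear part. The second bound holds
for points within one cell of the coarse grid, whose ancestors there are equal or adjacent.\<close>
lemma good_grid:
 assumes g: "good l w" and l: "2 \<le> l" and m: "2 ^ (l - 1) \<le> m" "m < 2 ^ l"
 defines "Dv \<equiv> \<lambda>q. emp_U h X m (grid (jmax l) q) w - Umean (grid (jmax l) q)"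
 shows "q \<le> 2 ^ jmax l \<Longrightarrow> \<bar>Dv q\<bar> \<le> 150 * (sqrt (real l) * 2 powr (- real l / 2))"
  and "q \<le> 2 ^ jmax l \<Longrightarrow> q' \<le> q \<Longrightarrow> q \<le> q' + 2 ^ (jmax l - jmin l) \<Longrightarrow>
   \<bar>Dv q - Dv q'\<bar> \<le> 300 * (real l powr (3 / 4) * 2 powr (- (1 / 2 + \<gamma> / 8) * real l))"
proof -
 define n :: real where "n = 2 ^ l"
 have n0: "0 < n" by (simp add: n_def)
 have pw: "n = 2 powr real l" by (simp add: n_def powr_realpow)
 have l1: "1 \<le> sqrt (real l)" "1 \<le> real l powr (3 / 4)" using l by (auto intro: ge_one_powr_ge_zero)
 have m2: "2 \<le> m"
 proof -
  have "(2::nat) ^ 1 \<le> 2 ^ (l - 1)" using l by (intro power_increasing) auto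
  then show ?thesis using m(1) by simp
 qed
 have mn: "n / 2 \<le> real m" "real m \<le> n"
 proof -
  have "real (2 ^ (l - 1)) \<le> real m" using m(1) by (rule of_nat_mono)
  moreover have "(2::real) ^ l = 2 * 2 ^ (l - 1)" using l by (cases l) auto
  ultimately show "n / 2 \<le> real m" by (simp add: n_def)
  have "real m \<le> real (2 ^ l)" using m(2) by (intro of_nat_mono) simp
  then show "real m \<le> n" by (simp add: n_def)
 qed
 let ?S = "\<lambda>q. lin_sum m (grid (jmax l) q) w"
 let ?y = "\<lambda>j0 x j. x * 2 powr (- real (j - j0) / 16)"
 have gS: "\<bar>lin_sum m lo w\<bar> \<le> x1 l" using g m by (auto simp: good_def)
 have gC1: "\<bar>lin_sum m (grid j (Suc q)) w - lin_sum m (grid j q) w\<bar> \<le> ?y 0 (x1 l) j" if "j \<le> jmax l" "q < 2 ^ j" for j q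
  using g m that unfolding good_def by auto
 have gC2: "\<bar>lin_sum m (grid j (Suc q)) w - lin_sum m (grid j q) w\<bar> \<le> ?y (jmin l) (x2 l) j" if "jmin l \<le> j" "j \<le> jmax l" "q < 2 ^ j" for j q
  using g m that unfolding good_def by auto
 have gQ: "\<bar>far_total (min_gap l) m (grid (jmax l) q) w\<bar> \<le> x3 l" if "q \<le> 2 ^ jmax l" for q
  using g m that by (auto simp: good_def)
 have x10: "0 \<le> x1 l" and x20: "0 \<le> x2 l" by (auto simp: x1_def x2_def)
 have geo: "(\<Sum>j\<in>{j0..jmax l}. ?y j0 x j) \<le> 24 * x" if "0 \<le> x" for j0 x
 proof -
  have "(\<Sum>j\<in>{j0..jmax l}. ?y j0 x j) = x * (\<Sum>j\<in>{j0..jmax l}. 2 powr (- real (j - j0) / 16))" by (simp only: sum_distrib_left)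
  also have "\<dots> \<le> x * 24" using that geometric_sixteenth by (intro mult_left_mono)
  finally show ?thesis by simp
 qed
 have split: "(\<Sum>j\<in>{j0..jmax l}. ?y j0 x j) = x + (\<Sum>j\<in>{j0<..jmax l}. ?y j0 x j)" if "j0 \<le> jmax l" for j0 x
 proof -
  have a: "{j0..jmax l} = insert j0 {j0<..jmax l}" using that by auto
  have b: "(\<Sum>j\<in>insert j0 {j0<..jmax l}. ?y j0 x j) = ?y j0 x j0 + (\<Sum>j\<in>{j0<..jmax l}. ?y j0 x j)" by (rule sum.insert) auto
  have c: "?y j0 x j0 = x" by simp
  show ?thesis unfolding a b c ..
 qed
 have Sb: "\<bar>?S q\<bar> \<le> 25 * x1 l" if q: "q \<le> 2 ^ jmax l" for q
 proof -
  have "\<bar>?S q - lin_sum m (grid 0 (q div 2 ^ (jmax l - 0))) w\<bar> \<le> (\<Sum>j\<in>{0<..jmax l}. ?y 0 (x1 l) j)"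
   by (rule dyadic_chain_le[where F = "\<lambda>j q. lin_sum m (grid j q) w", OF _ _ _ q]) (use gC1 in \<open>auto simp: grid_double\<close>)
  moreover have "\<bar>lin_sum m (grid 0 (q div 2 ^ (jmax l - 0))) w\<bar> \<le> x1 l + x1 l"
  proof -
   have "q div 2 ^ jmax l \<le> 1" using q by (simp add: div_le_mono[of q "2 ^ jmax l" "2 ^ jmax l", simplified])
   then consider "q div 2 ^ jmax l = 0" | "q div 2 ^ jmax l = 1" by linarith
   then show ?thesis
   proof cases
    case 1
    then show ?thesis using gS x10 by (simp add: grid_def)
   next
    case 2
    then show ?thesis using gS gC1[of 0 0] by (simp add: grid_def)
   qed
  qed
  moreover have "x1 l + (\<Sum>j\<in>{0<..jmax l}. ?y 0 (x1 l) j) \<le> 24 * x1 l" using split[of 0 "x1 l"] geo[OF x10, of 0] by simp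
  ultimately show ?thesis by linarith
 qed
 have Sd: "\<bar>?S q - ?S q'\<bar> \<le> 48 * x2 l" if q: "q \<le> 2 ^ jmax l" "q' \<le> q" "q \<le> q' + 2 ^ (jmax l - jmin l)" for q q'
 proof -
  let ?D = "2 ^ (jmax l - jmin l) :: nat"
  have jmin: "jmin l \<le> jmax l" using l by (intro jmin_le) simp
  have ch: "\<bar>?S r - lin_sum m (grid (jmin l) (r div ?D)) w\<bar> \<le> (\<Sum>j\<in>{jmin l<..jmax l}. ?y (jmin l) (x2 l) j)" if "r \<le> 2 ^ jmax l" for r
   by (rule dyadic_chain_le[where F = "\<lambda>j q. lin_sum m (grid j q) w", OF _ _ jmin that]) (use gC2 in \<open>auto simp: grid_double\<close>)
  have adj: "\<bar>lin_sum m (grid (jmin l) (q div ?D)) w - lin_sum m (grid (jmin l) (q' div ?D)) w\<bar> \<le> x2 l"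
  proof -
   have le: "q' div ?D \<le> q div ?D" using q by (intro div_le_mono)
   have "q div ?D \<le> (q' + ?D) div ?D" using q by (intro div_le_mono)
   then have "q div ?D \<le> Suc (q' div ?D)" by simp
   then consider "q div ?D = q' div ?D" | "q div ?D = Suc (q' div ?D)" using le by linarith
   then show ?thesis
   proof cases
    case 1
    then show ?thesis using x20 by simp
   next
    case 2
    have "q div ?D \<le> 2 ^ jmax l div ?D" using q by (intro div_le_mono)
    also have "(2::nat) ^ jmax l div ?D = 2 ^ jmin l" using jmin by (simp add: power_diff[symmetric])
    finally have "q' div ?D < 2 ^ jmin l" using 2 by linarith
    then show ?thesis using gC2[of "jmin l" "q' div ?D"] jmin 2 by simp
   qed
  qed
  have q'l: "q' \<le> 2 ^ jmax l" using q by linarith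
  have "x2 l + (\<Sum>j\<in>{jmin l<..jmax l}. ?y (jmin l) (x2 l) j) \<le> 24 * x2 l" using split[OF jmin, of "x2 l"] geo[OF x20, of "jmin l"] by simp
  then show ?thesis using ch[OF q(1)] ch[OF q'l] adj x20 by linarith
 qed
 define e where "e = n powr (- 5 / 8)"
 have err: "\<bar>Dv q - 2 / real m * ?S q\<bar> \<le> 48 * e" if q: "q \<le> 2 ^ jmax l" for q
 proof -
  have "\<bar>Dv q - 2 / real m * ?S q\<bar> \<le> 2 / (real m * (real m - 1)) * (\<bar>far_total (min_gap l) m (grid (jmax l) q) w\<bar> + 2 * real m * real (min_gap l))"
   unfolding Dv_def by (rule emp_U_decomposition[OF m2])
  also have "\<dots> \<le> 16 / n\<^sup>2 * (3 * n powr (11 / 8))"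
  proof (rule mult_mono)
   have "n\<^sup>2 / 8 = (n / 2) * (n / 4)" by (simp add: power2_eq_square)
   also have "\<dots> \<le> real m * (real m - 1)"
    using mn m2 n0 by (intro mult_mono) auto
   finally have "2 / (real m * (real m - 1)) \<le> 2 / (n\<^sup>2 / 8)" using n0 m2 by (intro divide_left_mono) auto
   then show "2 / (real m * (real m - 1)) \<le> 16 / n\<^sup>2" by simp
   have b: "real (min_gap l) \<le> n powr (3 / 8)" unfolding min_gap_def pw powr_powr by (simp add: mult.commute)
   have "2 * real m * real (min_gap l) \<le> 2 * n * n powr (3 / 8)" using mn b n0 by (intro mult_mono) auto
   also have "\<dots> = 2 * n powr (11 / 8)" using n0 powr_add[of n 1 "3 / 8"] by simp
   finally have "2 * real m * real (min_gap l) \<le> 2 * n powr (11 / 8)" .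
   moreover have "x3 l = n powr (11 / 8)" unfolding x3_def pw powr_powr by (simp add: mult.commute)
   ultimately show "\<bar>far_total (min_gap l) m (grid (jmax l) q) w\<bar> + 2 * real m * real (min_gap l) \<le> 3 * n powr (11 / 8)"
    using gQ[OF q] by linarith
  qed (use n0 in auto)
  also have "\<dots> = 48 * e"
  proof -
   have "n powr (11 / 8) = n powr (- 5 / 8) * n powr 2" by (simp flip: powr_add)
   then show ?thesis using n0 by (simp add: e_def)
  qed
  finally show ?thesis .
 qed
 have m4: "2 / real m \<le> 4 / n" using mn n0 m2 by (simp add: field_simps)
 have x1e: "x1 l / n = sqrt (real l) * 2 powr (- real l / 2)"
 proof -
  have "2 powr (real l / 2) / n = 2 powr (real l / 2 - real l)" unfolding pw by (simp only: powr_diff)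
  also have "real l / 2 - real l = - real l / 2" by simp
  finally have "2 powr (real l / 2) / n = 2 powr (- real l / 2)" .
  then show ?thesis unfolding x1_def times_divide_eq_right[symmetric] by (simp only:)
 qed
 have x2e: "x2 l / n = real l powr (3 / 4) * 2 powr (- (1 / 2 + \<gamma> / 8) * real l)"
 proof -
  have "2 powr ((1 / 2 - \<gamma> / 8) * real l) / n = 2 powr ((1 / 2 - \<gamma> / 8) * real l - real l)" unfolding pw by (simp only: powr_diff)
  also have "(1 / 2 - \<gamma> / 8) * real l - real l = - (1 / 2 + \<gamma> / 8) * real l" by (simp add: algebra_simps)
  finally have "2 powr ((1 / 2 - \<gamma> / 8) * real l) / n = 2 powr (- (1 / 2 + \<gamma> / 8) * real l)" .
  then show ?thesis unfolding x2_def times_divide_eq_right[symmetric] by (simp only:)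
 qed
 have e2: "e = 2 powr (- 5 / 8 * real l)" unfolding e_def pw powr_powr by (simp add: mult.commute)
 have ea: "e \<le> sqrt (real l) * 2 powr (- real l / 2)"
 proof -
  have "e \<le> 1 * 2 powr (- real l / 2)" unfolding e2 by simp
  also have "\<dots> \<le> sqrt (real l) * 2 powr (- real l / 2)" using l1 by (intro mult_right_mono) auto
  finally show ?thesis .
 qed
 have eb: "e \<le> real l powr (3 / 4) * 2 powr (- (1 / 2 + \<gamma> / 8) * real l)"
 proof -
  have "- 5 / 8 * real l \<le> - (1 / 2 + \<gamma> / 8) * real l" using \<gamma> by (intro mult_right_mono) auto
  then have "e \<le> 1 * 2 powr (- (1 / 2 + \<gamma> / 8) * real l)" unfolding e2 by simp
  also have "\<dots> \<le> real l powr (3 / 4) * 2 powr (- (1 / 2 + \<gamma> / 8) * real l)" using l1 by (intro mult_right_mono) auto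
  finally show ?thesis .
 qed
 {
  assume q: "q \<le> 2 ^ jmax l"
  have "\<bar>2 / real m * ?S q\<bar> = 2 / real m * \<bar>?S q\<bar>" by (simp add: abs_mult)
  also have "\<dots> \<le> 4 / n * (25 * x1 l)" using m4 Sb[OF q] n0 by (intro mult_mono) auto
  also have "\<dots> = 100 * (x1 l / n)" by simp
  finally have "\<bar>Dv q\<bar> \<le> 100 * (x1 l / n) + 48 * e" using err[OF q] by linarith
  moreover have "0 \<le> sqrt (real l) * 2 powr (- real l / 2)" by simp
  ultimately show "\<bar>Dv q\<bar> \<le> 150 * (sqrt (real l) * 2 powr (- real l / 2))" using ea unfolding x1e by linarith
 next
  assume q: "q \<le> 2 ^ jmax l" "q' \<le> q" "q \<le> q' + 2 ^ (jmax l - jmin l)"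
  have q'l: "q' \<le> 2 ^ jmax l" using q by linarith
  have "\<bar>2 / real m * ?S q - 2 / real m * ?S q'\<bar> = 2 / real m * \<bar>?S q - ?S q'\<bar>"
   by (simp only: right_diff_distrib[symmetric] abs_mult) simp
  also have "\<dots> \<le> 4 / n * (48 * x2 l)" using m4 Sd[OF q] n0 by (intro mult_mono) auto
  also have "\<dots> = 192 * (x2 l / n)" by simp
  finally have "\<bar>Dv q - Dv q'\<bar> \<le> 192 * (x2 l / n) + 96 * e" using err[OF q(1)] err[OF q'l] by linarith
  moreover have "0 \<le> real l powr (3 / 4) * 2 powr (- (1 / 2 + \<gamma> / 8) * real l)" by simp
  ultimately show "\<bar>Dv q - Dv q'\<bar> \<le> 300 * (real l powr (3 / 4) * 2 powr (- (1 / 2 + \<gamma> / 8) * real l))" using eb unfolding x2e by linarith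
 }
qed

lemma emp_U_mono: "mono (\<lambda>t. emp_U h X m t w)"
proof (cases "m < 2")
 case False
 show ?thesis
 proof (rule monoI)
  fix s t :: real assume st: "s \<le> t"
  have "2 / (real m * (real m - 1)) * (\<Sum>i=1..m. \<Sum>j=i+1..m. h (X i w) (X j w) s)
    \<le> 2 / (real m * (real m - 1)) * (\<Sum>i=1..m. \<Sum>j=i+1..m. h (X i w) (X j w) t)"
   using False by (intro mult_left_mono sum_mono h_mono st) auto
  then show "emp_U h X m s w \<le> emp_U h X m t w" using False by (simp only: emp_U_def if_False)
 qed
qed (simp add: emp_U_def mono_def)

lemma Umean_mono: "t \<le> t' \<Longrightarrow> Umean t \<le> Umean t'"
 unfolding Umean_eq using integrable_proj_at proj_at_mono by (intro integral_mono) auto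

text \<open>Monotonicity of both functions extends the bounds from the grid to all \<open>t\<close>, at the price of the
increment of \<open>U\<close> over one cell. The 2 subtracted from the number of cells allows for rounding
both points outwards.\<close>
lemma good_interval:
 assumes g: "good l w" and l: "2 \<le> l" and m: "2 ^ (l - 1) \<le> m" "m < 2 ^ l"
 defines "Dt \<equiv> \<lambda>t. emp_U h X m t w - Umean t"
 shows "lo \<le> t \<Longrightarrow> t \<le> hi \<Longrightarrow> \<bar>Dt t\<bar> \<le> 150 * (sqrt (real l) * 2 powr (- real l / 2)) + K * (hi - lo) / 2 ^ jmax l"
  and "lo \<le> t \<Longrightarrow> t \<le> hi \<Longrightarrow> lo \<le> t' \<Longrightarrow> t' \<le> hi \<Longrightarrow> \<bar>t - t'\<bar> \<le> (2 ^ (jmax l - jmin l) - 2) * ((hi - lo) / 2 ^ jmax l) \<Longrightarrow>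
   \<bar>Dt t - Dt t'\<bar> \<le> 300 * (real l powr (3 / 4) * 2 powr (- (1 / 2 + \<gamma> / 8) * real l)) + 2 * (K * (hi - lo) / 2 ^ jmax l)"
proof -
 define s where "s = (hi - lo) / 2 ^ jmax l"
 have s0: "0 < s" using lohi by (simp add: s_def)
 have grs: "grid (jmax l) q = lo + s * real q" for q by (simp add: grid_def s_def)
 have ends: "hi = lo + s * 2 ^ jmax l" by (simp add: s_def)
 define ix where "ix t = (if t = hi then 2 ^ jmax l - 1 else nat \<lfloor>(t - lo) / s\<rfloor>)" for t
 have ix: "grid (jmax l) (ix t) \<le> t \<and> t \<le> grid (jmax l) (Suc (ix t)) \<and> Suc (ix t) \<le> 2 ^ jmax l \<and> (t - lo) / s - 1 \<le> real (ix t) \<and> real (ix t) \<le> (t - lo) / s"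
  if t: "lo \<le> t" "t \<le> hi" for t
 proof (cases "t = hi")
  case True
  have "(1::nat) \<le> 2 ^ jmax l" by simp
  then have r: "real (2 ^ jmax l - 1) = 2 ^ jmax l - 1" by (simp add: of_nat_diff)
  have hs: "(hi - lo) / s = 2 ^ jmax l" using s0 ends by (simp add: field_simps)
  have i: "ix t = 2 ^ jmax l - 1" using True by (simp add: ix_def)
  have Si: "Suc (ix t) = 2 ^ jmax l" unfolding i by simp
  show ?thesis using True s0 hs ends unfolding Si unfolding i grs r by (auto simp: algebra_simps)
 next
  case False
  define z where "z = (t - lo) / s"
  have z0: "0 \<le> z" using t s0 by (simp add: z_def)
  have z1: "z < 2 ^ jmax l" using False t ends s0 by (simp add: z_def field_simps)
  have i: "ix t = nat \<lfloor>z\<rfloor>" using False by (simp add: ix_def z_def)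
  have r: "real (ix t) \<le> z" "z < real (ix t) + 1" using z0 unfolding i by linarith+
  have "real (ix t) < 2 ^ jmax l" using r z1 by linarith
  then have "real (ix t) < real (2 ^ jmax l)" by simp
  then have "ix t < 2 ^ jmax l" by (simp only: of_nat_less_iff)
  moreover have tz: "t = lo + s * z" using s0 by (simp add: z_def)
  moreover have sz: "s * real (ix t) \<le> s * z" "s * z \<le> s * real (Suc (ix t))" using r s0 by (auto intro!: mult_left_mono)
  moreover have "grid (jmax l) (ix t) \<le> t" unfolding grs using tz sz by linarith
  moreover have "t \<le> grid (jmax l) (Suc (ix t))" unfolding grs using tz sz by linarith
  ultimately show ?thesis using r unfolding z_def[symmetric] by (intro conjI) linarith+
 qed
 let ?G = "\<lambda>q. emp_U h X m (grid (jmax l) q) w - Umean (grid (jmax l) q)"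
 have UK: "Umean (grid (jmax l) (Suc q)) - Umean (grid (jmax l) q) \<le> K * s" if "Suc q \<le> 2 ^ jmax l" for q
 proof -
  have "Umean (grid (jmax l) (Suc q)) - Umean (grid (jmax l) q) \<le> K * (grid (jmax l) (Suc q) - grid (jmax l) q)"
   using grid_range[of q "jmax l"] grid_range[of "Suc q" "jmax l"] that s0 by (intro Umean_lip) (auto simp: grs algebra_simps)
  then show ?thesis by (simp add: grid_Suc s_def)
 qed
 have up: "Dt t \<le> ?G (Suc (ix t)) + K * s" and dn: "?G (ix t) - K * s \<le> Dt t" if t: "lo \<le> t" "t \<le> hi" for t
 proof -
  note i = ix[OF t]
  have "emp_U h X m t w \<le> emp_U h X m (grid (jmax l) (Suc (ix t))) w" "emp_U h X m (grid (jmax l) (ix t)) w \<le> emp_U h X m t w"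
   using emp_U_mono[of m w] i by (auto simp: mono_def)
  moreover have "Umean (grid (jmax l) (ix t)) \<le> Umean t" "Umean t \<le> Umean (grid (jmax l) (Suc (ix t)))" using i by (auto intro: Umean_mono)
  ultimately show "Dt t \<le> ?G (Suc (ix t)) + K * s" "?G (ix t) - K * s \<le> Dt t"
   using UK[of "ix t"] i unfolding Dt_def by linarith+
 qed
 have Ks: "K * (hi - lo) / 2 ^ jmax l = K * s" by (simp add: s_def)
 {
  assume t: "lo \<le> t" "t \<le> hi"
  note i = ix[OF t]
  show "\<bar>Dt t\<bar> \<le> 150 * (sqrt (real l) * 2 powr (- real l / 2)) + K * (hi - lo) / 2 ^ jmax l"
   using up[OF t] dn[OF t] good_grid(1)[OF g l m, of "Suc (ix t)"] good_grid(1)[OF g l m, of "ix t"] i unfolding Ks by auto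
 next
  assume t: "lo \<le> t" "t \<le> hi" and t': "lo \<le> t'" "t' \<le> hi"
   and dist: "\<bar>t - t'\<bar> \<le> (2 ^ (jmax l - jmin l) - 2) * ((hi - lo) / 2 ^ jmax l)"
  let ?B = "300 * (real l powr (3 / 4) * 2 powr (- (1 / 2 + \<gamma> / 8) * real l))"
  have dz: "\<bar>(t - lo) / s - (t' - lo) / s\<bar> \<le> 2 ^ (jmax l - jmin l) - 2"
  proof -
   have "(t - lo) / s - (t' - lo) / s = (t - t') / s" by (simp add: diff_divide_distrib)
   then have "\<bar>(t - lo) / s - (t' - lo) / s\<bar> = \<bar>t - t'\<bar> / s" using s0 by (simp add: abs_divide)
   then show ?thesis using dist s0 by (simp add: s_def[symmetric] field_simps)
  qed
  have close: "q \<le> q' + 2 ^ (jmax l - jmin l)" if "q \<le> Suc (ix a)" "ix b \<le> q'" "lo \<le> a" "a \<le> hi" "lo \<le> b" "b \<le> hi" "\<bar>(a - lo) / s - (b - lo) / s\<bar> \<le> 2 ^ (jmax l - jmin l) - 2" for a b q q'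
  proof -
   have "real q \<le> real (ix a) + 1" "real (ix b) \<le> real q'" using that by linarith+
   then have "real q \<le> real q' + 2 ^ (jmax l - jmin l)" using ix[OF that(3,4)] ix[OF that(5,6)] that(7) by linarith
   then have "real q \<le> real (q' + 2 ^ (jmax l - jmin l))" by simp
   then show ?thesis by (simp only: of_nat_le_iff)
  qed
  have gd: "\<bar>?G q - ?G q'\<bar> \<le> ?B" if "q \<le> 2 ^ jmax l" "q' \<le> 2 ^ jmax l" "q \<le> q' + 2 ^ (jmax l - jmin l)" "q' \<le> q + 2 ^ (jmax l - jmin l)" for q q'
  proof (cases "q' \<le> q")
   case True
   then show ?thesis using good_grid(2)[OF g l m, of q q'] that by auto
  next
   case False
   then show ?thesis using good_grid(2)[OF g l m, of q' q] that by (subst abs_minus_commute) auto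
  qed
  note i = ix[OF t] and i' = ix[OF t']
  have dz': "\<bar>(t' - lo) / s - (t - lo) / s\<bar> \<le> 2 ^ (jmax l - jmin l) - 2" using dz by linarith
  have 1: "\<bar>?G (Suc (ix t)) - ?G (ix t')\<bar> \<le> ?B"
   using i i' close[OF _ _ t t' dz, of "Suc (ix t)" "ix t'"] close[OF _ _ t' t dz', of "ix t'" "Suc (ix t)"] by (intro gd) auto
  have 2: "\<bar>?G (Suc (ix t')) - ?G (ix t)\<bar> \<le> ?B"
   using i i' close[OF _ _ t t' dz, of "ix t" "Suc (ix t')"] close[OF _ _ t' t dz', of "Suc (ix t')" "ix t"] by (intro gd) auto
  show "\<bar>Dt t - Dt t'\<bar> \<le> ?B + 2 * (K * (hi - lo) / 2 ^ jmax l)"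
   using up[OF t] dn[OF t] up[OF t'] dn[OF t'] 1 2 unfolding Ks by linarith
 }
qed

end

section \<open>The remainder along the sequence\<close>

text \<open>The lower Lipschitz bound makes \<open>U\<close> invertible on \<open>[lo, hi]\<close>, and the strict inequalities
keep the quantiles away from its ends.\<close>
locale u_quantile_process = u_process M \<mu> X V past fut c0 \<theta> a A h L K lo hi
 for M :: "'a measure" and \<mu> X V past fut c0 \<theta> a A h L K lo hi +
 fixes u :: "real \<Rightarrow> real" and \<kappa> Ce x0 D1 D2 :: real
 assumes \<kappa>: "0 < \<kappa>" and u_ge: "\<And>t. lo \<le> t \<Longrightarrow> t \<le> hi \<Longrightarrow> \<kappa> \<le> u t"
  and Umean_lower: "\<And>t t'. lo \<le> t \<Longrightarrow> t \<le> t' \<Longrightarrow> t' \<le> hi \<Longrightarrow> \<kappa> * (t' - t) \<le> Umean t' - Umean t"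
  and x0: "0 < x0" and Ce: "0 \<le> Ce"
  and expansion: "\<And>t t'. lo \<le> t \<Longrightarrow> t \<le> hi \<Longrightarrow> lo \<le> t' \<Longrightarrow> t' \<le> hi \<Longrightarrow> \<bar>t - t'\<bar> \<le> x0 \<Longrightarrow>
    \<bar>Umean t - Umean t' - u t * (t - t')\<bar> \<le> Ce * \<bar>t - t'\<bar> powr (5 / 4)"
  and D12: "Umean lo < D1" "D1 \<le> D2" "D2 < Umean hi"
  and h_top: "\<And>x y. ((\<lambda>t. h x y t) \<longlongrightarrow> 1) at_top" and h_bot: "\<And>x y. ((\<lambda>t. h x y t) \<longlongrightarrow> 0) at_bot"
begin

definition quant :: "real \<Rightarrow> real" where "quant p = U_quantile Umean lo hi p"
definition margin :: real where "margin = min (D1 - Umean lo) (Umean hi - D2) / (K + 1)"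

lemma margin_pos: "0 < margin" using K D12 by (simp add: margin_def)

lemma quantile_exists:
 assumes p: "D1 \<le> p" "p \<le> D2"
 shows "lo + margin \<le> quant p" "quant p \<le> hi - margin" "Umean (quant p) = p"
proof -
 have cont: "continuous_on {lo..hi} Umean"
 proof (rule continuous_on_subset[OF lipschitz_on_continuous_on])
  have "\<bar>Umean t - Umean t'\<bar> \<le> K * \<bar>t - t'\<bar>" if "t \<in> {lo..hi}" "t' \<in> {lo..hi}" for t t'
  proof (cases "t \<le> t'")
   case True
   then show ?thesis using Umean_lip[of t t'] Umean_mono[of t t'] that by auto
  next
   case False
   then show ?thesis using Umean_lip[of t' t] Umean_mono[of t' t] that by auto
  qed
  then show "K-lipschitz_on {lo..hi} Umean" using K by (intro lipschitz_onI) (auto simp: dist_real_def)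
 qed simp
 have "\<exists>t\<ge>lo. t \<le> hi \<and> Umean t = p" using p D12 lohi cont by (intro IVT') auto
 then obtain t where t: "lo \<le> t" "t \<le> hi" "Umean t = p" by auto
 have uniq: "t' = t" if t': "t' \<in> {lo..hi} \<and> Umean t' = p" for t'
 proof (rule antisym)
  show "t' \<le> t"
  proof (rule ccontr)
   assume n: "\<not> t' \<le> t"
   then have "0 < \<kappa> * (t' - t)" using \<kappa> by simp
   then show False using Umean_lower[of t t'] n t t' by auto
  qed
  show "t \<le> t'"
  proof (rule ccontr)
   assume n: "\<not> t \<le> t'"
   then have "0 < \<kappa> * (t - t')" using \<kappa> by simp
   then show False using Umean_lower[of t' t] n t t' by auto
  qed
 qed
 have quant: "quant p = t" unfolding quant_def U_quantile_def
  by (rule the_equality[OF _ uniq]) (use t in simp_all)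
 have K1: "0 < K + 1" using K by simp
 show "Umean (quant p) = p" using quant t by simp
 have "min (D1 - Umean lo) (Umean hi - D2) \<le> Umean t - Umean lo" using t p by auto
 also have "\<dots> \<le> K * (t - lo)" using t by (intro Umean_lip) auto
 also have "\<dots> \<le> (K + 1) * (t - lo)" using t by (intro mult_right_mono) auto
 finally have "margin \<le> t - lo" unfolding margin_def using K1 by (simp add: divide_le_eq mult.commute)
 then show "lo + margin \<le> quant p" using quant by simp
 have "min (D1 - Umean lo) (Umean hi - D2) \<le> Umean hi - Umean t" using t p by auto
 also have "\<dots> \<le> K * (hi - t)" using t by (intro Umean_lip) auto
 also have "\<dots> \<le> (K + 1) * (hi - t)" using t by (intro mult_right_mono) auto
 finally have "margin \<le> hi - t" unfolding margin_def using K1 by (simp add: divide_le_eq mult.commute)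
 then show "quant p \<le> hi - margin" using quant by simp
qed

definition c1 :: real where "c1 = 150 + K * (hi - lo)"
definition radius :: "nat \<Rightarrow> real" where "radius l = 2 * c1 * (sqrt (real l) * 2 powr (- real l / 2)) / \<kappa>"
definition rate :: "nat \<Rightarrow> real" where "rate l = real l powr (3 / 4) * 2 powr (- (1 / 2 + \<gamma> / 8) * real l)"
definition C5 :: real where "C5 = (300 + 2 * (K * (hi - lo)) + Ce * (4 * c1 / \<kappa>) powr (5 / 4)) / \<kappa>"

lemma c1_ge: "150 \<le> c1" using K lohi by (simp add: c1_def)

lemma C5_nonneg: "0 \<le> C5" using K lohi Ce \<kappa> by (simp add: C5_def)

definition scale_ok :: "nat \<Rightarrow> bool" where
 "scale_ok l \<longleftrightarrow> 2 \<le> l \<and> 2 * radius l \<le> x0 \<and> 2 * radius l \<le> margin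
   \<and> 2 * radius l \<le> (2 ^ (jmax l - jmin l) - 2) * ((hi - lo) / 2 ^ jmax l)"

lemma inverse_two_power: "1 / 2 ^ jmax l \<le> 2 powr (- 5 / 8 * real l)"
proof -
 have "1 / 2 ^ jmax l \<le> 1 / (2 powr (5 / 8 * real l) :: real)" using jmax_bounds(1)[of l] by (intro divide_left_mono) auto
 also have "\<dots> = 2 powr (- 5 / 8 * real l)" using powr_minus_divide[of 2 "5 / 8 * real l"] by simp
 finally show ?thesis .
qed

text \<open>The radius \<open>l^(1/2) 2^(-l/2)\<close> is eventually smaller than one coarse cell, of length about
\<open>l 2^(-l/2)\<close>.\<close>
lemma eventually_scale_ok: "\<forall>\<^sub>F l in sequentially. scale_ok l"
proof -
 let ?s = "\<lambda>l. sqrt (real l) * 2 powr (- real l / 2)"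
 have rad: "2 * radius l = 4 * c1 / \<kappa> * ?s l" for l by (simp add: radius_def)
 have "?s \<longlonglongrightarrow> 0" by real_asymp
 then have lim: "(\<lambda>l. 2 * radius l) \<longlonglongrightarrow> 0" unfolding rad using tendsto_mult_left[of ?s 0 sequentially "4 * c1 / \<kappa>"] by simp
 have e1: "\<forall>\<^sub>F l in sequentially. 2 * radius l < x0" using order_tendstoD(2)[OF lim x0] .
 have e2: "\<forall>\<^sub>F l in sequentially. 2 * radius l < margin" using order_tendstoD(2)[OF lim margin_pos] .
 let ?r = "\<lambda>l. real l * 2 powr (- real l / 2) - 2 * 2 powr (- 5 / 8 * real l)"
 have so: "?s \<in> o(?r)" by real_asymp
 have pos: "\<forall>\<^sub>F l in sequentially. 0 < ?r l" by real_asymp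
 have lg: "\<forall>\<^sub>F l in sequentially. 0 \<le> real l / 2 - log 2 (real l)" by real_asymp
 have c: "0 < \<kappa> * (hi - lo) / (4 * c1)" using \<kappa> lohi c1_ge by simp
 have "\<forall>\<^sub>F l in sequentially. norm (?s l) \<le> \<kappa> * (hi - lo) / (4 * c1) * norm (?r l)"
  using landau_o.smallD[OF so c] .
 then have e3: "\<forall>\<^sub>F l in sequentially. 2 * radius l \<le> (2 ^ (jmax l - jmin l) - 2) * ((hi - lo) / 2 ^ jmax l)"
  using pos lg eventually_ge_at_top[of 1]
 proof eventually_elim
  case (elim l)
  have A: "?s l \<le> \<kappa> * (hi - lo) / (4 * c1) * ?r l" using elim by simp
  have B: "?r l \<le> 1 / 2 ^ jmin l - 2 * (1 / 2 ^ jmax l)"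
  proof -
   have "real (jmin l) \<le> real l / 2 - log 2 (real l)" unfolding jmin_def using elim by linarith
   then have "2 powr (- (real l / 2 - log 2 (real l))) \<le> 2 powr (- real (jmin l))" by (intro powr_mono) auto
   also have "2 powr (- real (jmin l)) = 1 / 2 ^ jmin l" by (simp add: powr_minus_divide powr_realpow)
   also have "2 powr (- (real l / 2 - log 2 (real l))) = 2 powr (log 2 (real l) + (- real l / 2))" by simp
   also have "\<dots> = real l * 2 powr (- real l / 2)" using elim by (subst powr_add) simp
   finally show ?thesis using inverse_two_power[of l] by linarith
  qed
  have "2 * radius l = 4 * c1 / \<kappa> * ?s l" by (rule rad)
  also have "\<dots> \<le> 4 * c1 / \<kappa> * (\<kappa> * (hi - lo) / (4 * c1) * ?r l)"
   using \<kappa> c1_ge by (intro mult_left_mono[OF A]) auto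
  also have "\<dots> = (hi - lo) * ?r l" using \<kappa> c1_ge by simp
  also have "\<dots> \<le> (hi - lo) * (1 / 2 ^ jmin l - 2 * (1 / 2 ^ jmax l))"
   using lohi by (intro mult_left_mono[OF B]) auto
  also have "\<dots> = (2 ^ (jmax l - jmin l) - 2) * ((hi - lo) / 2 ^ jmax l)"
  proof -
   have "(2::real) ^ jmax l = 2 ^ (jmax l - jmin l) * 2 ^ jmin l" using jmin_le[of l] elim by (simp flip: power_add)
   then show ?thesis by (simp add: field_simps)
  qed
  finally show ?case .
 qed
 show ?thesis
  using e1 e2 e3 eventually_ge_at_top[of 2] by eventually_elim (simp add: scale_ok_def)
qed

lemma bahadur_remainder_le:
 assumes g: "good l w" and ok: "scale_ok l" and m: "2 ^ (l - 1) \<le> m" "m < 2 ^ l" and p: "D1 \<le> p" "p \<le> D2"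
 shows "\<bar>bahadur_remainder h X Umean u lo hi m p w\<bar> \<le> C5 * rate l"
proof -
 have l: "2 \<le> l" and r1: "2 * radius l \<le> x0" and r2: "2 * radius l \<le> margin"
  and r3: "2 * radius l \<le> (2 ^ (jmax l - jmin l) - 2) * ((hi - lo) / 2 ^ jmax l)"
  using ok by (auto simp: scale_ok_def)
 have m2: "2 \<le> m"
 proof -
  have "(2::nat) ^ 1 \<le> 2 ^ (l - 1)" using l by (intro power_increasing) auto
  then show ?thesis using m(1) by simp
 qed
 note q = quantile_exists[OF p]
 let ?s = "sqrt (real l) * 2 powr (- real l / 2)"
 have l1: "1 \<le> sqrt (real l)" "1 \<le> real l powr (3 / 4)" using l by (auto intro: ge_one_powr_ge_zero)
 have s0: "0 < ?s" using l by simp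
 have d0: "0 < radius l" 
 proof -
  have "radius l = 2 * c1 / \<kappa> * ?s" by (simp add: radius_def)
  also have "0 < \<dots>" using \<kappa> c1_ge by (intro mult_pos_pos[OF _ s0]) auto
  finally show ?thesis .
 qed
 have KK: "0 \<le> K * (hi - lo)" using K lohi by simp
 have D: "\<bar>emp_U h X m t w - Umean t\<bar> \<le> c1 * ?s" if "lo \<le> t" "t \<le> hi" for t
 proof -
  have "K * (hi - lo) / 2 ^ jmax l \<le> K * (hi - lo) * ?s"
  proof -
   have "2 powr (- 5 / 8 * real l) \<le> 1 * 2 powr (- real l / 2)" by simp
   also have "\<dots> \<le> ?s" using l1 by (intro mult_right_mono) auto
   finally have "1 / 2 ^ jmax l \<le> ?s" using inverse_two_power[of l] by linarith
   from mult_left_mono[OF this KK] show ?thesis by simp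
  qed
  then show ?thesis using good_interval(1)[OF g l m that] by (simp add: c1_def algebra_simps)
 qed
 have near: "lo \<le> t \<and> t \<le> hi" if "\<bar>t - quant p\<bar> \<le> 2 * radius l" for t
  using that q r2 by linarith
 have kr: "\<kappa> * radius l = 2 * (c1 * ?s)" using \<kappa> by (simp add: radius_def)
 have cs: "0 < c1 * ?s" using s0 c1_ge by (intro mult_pos_pos[OF _ s0]) auto
 have "\<bar>Inf {t. p \<le> emp_U h X m t w} - quant p - (p - emp_U h X m (quant p) w) / u (quant p)\<bar>
   \<le> ((300 * rate l + 2 * (K * (hi - lo) / 2 ^ jmax l)) + Ce * (2 * radius l) powr (5 / 4)) / \<kappa>"
 proof (rule bahadur_bound_at_point[where U = Umean and d = "radius l"])
  show "mono (\<lambda>t. emp_U h X m t w)" by (rule emp_U_mono)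
  show "\<kappa> \<le> u (quant p)" using q margin_pos by (intro u_ge) auto
  show "Umean (quant p) = p" by (rule q)
  have n: "lo \<le> quant p - radius l" "quant p - radius l \<le> hi" using near[of "quant p - radius l"] d0 by auto
  have "\<kappa> * radius l \<le> Umean (quant p) - Umean (quant p - radius l)"
   using Umean_lower[of "quant p - radius l" "quant p"] n d0 q margin_pos by simp
  then show "emp_U h X m (quant p - radius l) w < p"
   using D[OF n] kr cs q(3) by linarith
  have n': "lo \<le> quant p + radius l" "quant p + radius l \<le> hi" using near[of "quant p + radius l"] d0 by auto
  have "\<kappa> * radius l \<le> Umean (quant p + radius l) - Umean (quant p)"
   using Umean_lower[of "quant p" "quant p + radius l"] n' d0 q margin_pos by simp
  then show "p \<le> emp_U h X m (quant p + radius l) w"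
   using D[OF n'] kr cs q(3) by linarith
 next
  fix t assume t: "\<bar>t - quant p\<bar> \<le> 2 * radius l"
  show "\<bar>emp_U h X m t w - Umean t - (emp_U h X m (quant p) w - Umean (quant p))\<bar> \<le> 300 * rate l + 2 * (K * (hi - lo) / 2 ^ jmax l)"
   unfolding rate_def using near[OF t] near[of "quant p"] d0 t r3
   by (intro good_interval(2)[OF g l m]) auto
  have "\<bar>Umean (quant p) - Umean t - u (quant p) * (quant p - t)\<bar> \<le> Ce * \<bar>quant p - t\<bar> powr (5 / 4)"
   using near[OF t] near[of "quant p"] d0 t r1 by (intro expansion) auto
  also have "\<dots> \<le> Ce * (2 * radius l) powr (5 / 4)" using t Ce by (intro mult_left_mono powr_mono2) auto
  also have "Umean (quant p) - Umean t - u (quant p) * (quant p - t) = - (Umean t - p - u (quant p) * (t - quant p))"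
   using q(3) by (simp add: algebra_simps)
  finally show "\<bar>Umean t - p - u (quant p) * (t - quant p)\<bar> \<le> Ce * (2 * radius l) powr (5 / 4)" by (simp only: abs_minus)
 qed (use \<kappa> d0 in auto)
 also have "\<dots> \<le> ((300 * rate l + 2 * (K * (hi - lo) * rate l)) + Ce * ((4 * c1 / \<kappa>) powr (5 / 4) * rate l)) / \<kappa>"
 proof (rule divide_right_mono[OF add_mono[OF add_left_mono[OF mult_left_mono] mult_left_mono]])
  have a: "2 powr (- 5 / 8 * real l) \<le> 2 powr (- (1 / 2 + \<gamma> / 8) * real l)"
   using \<gamma> by (intro powr_mono mult_right_mono) auto
  also have "1 * 2 powr (- (1 / 2 + \<gamma> / 8) * real l) \<le> rate l" unfolding rate_def using l1 by (intro mult_right_mono) auto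
  finally have "1 / 2 ^ jmax l \<le> rate l" using inverse_two_power[of l] by simp
  from mult_left_mono[OF this KK] show "K * (hi - lo) / 2 ^ jmax l \<le> K * (hi - lo) * rate l" by simp
  have "(2 * radius l) powr (5 / 4) = (4 * c1 / \<kappa> * ?s) powr (5 / 4)"
  proof -
   have "2 * radius l = 4 * c1 / \<kappa> * ?s" by (simp add: radius_def)
   then show ?thesis by (simp only:)
  qed
  also have "\<dots> = (4 * c1 / \<kappa>) powr (5 / 4) * ?s powr (5 / 4)" by (rule powr_mult)
  also have "?s powr (5 / 4) = sqrt (real l) powr (5 / 4) * (2 powr (- real l / 2)) powr (5 / 4)" by (rule powr_mult)
  also have "sqrt (real l) powr (5 / 4) = real l powr (5 / 8)" using l by (simp add: powr_half_sqrt[symmetric] powr_powr)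
  also have "(2 powr (- real l / 2)) powr (5 / 4) = 2 powr (- 5 / 8 * real l)" by (simp add: powr_powr mult.commute)
  also have "real l powr (5 / 8) * 2 powr (- 5 / 8 * real l) \<le> rate l"
   unfolding rate_def by (rule mult_mono[OF powr_mono a]) (use l in auto)
  finally show "(2 * radius l) powr (5 / 4) \<le> (4 * c1 / \<kappa>) powr (5 / 4) * rate l" by (simp add: mult_left_mono)
 qed (use Ce \<kappa> in auto)
 also have "\<dots> = C5 * rate l" by (simp add: C5_def field_simps)
 finally show ?thesis using m2 by (simp add: bahadur_remainder_def quant_def Let_def emp_U_quantile_def)
qed

lemma emp_U_tendsto:
 assumes m: "2 \<le> m"
 shows "((\<lambda>t. emp_U h X m t w) \<longlongrightarrow> 1) at_top" "((\<lambda>t. emp_U h X m t w) \<longlongrightarrow> 0) at_bot"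
proof -
 have E: "emp_U h X m t w = 2 / (real m * (real m - 1)) * (\<Sum>i=1..m. \<Sum>j=i+1..m. h (X i w) (X j w) t)" for t
  using m by (simp add: emp_U_def)
 have "((\<lambda>t. emp_U h X m t w) \<longlongrightarrow> 2 / (real m * (real m - 1)) * (\<Sum>i=1..m. \<Sum>j=i+1..m. 1)) at_top"
  unfolding E by (intro tendsto_intros h_top)
 moreover have "2 / (real m * (real m - 1)) * (\<Sum>i=1..m. \<Sum>j=i+1..m. 1::real) = 1"
 proof -
  have "(\<Sum>i=1..m. \<Sum>j=i+1..m. 1::real) = real m * (real m - 1) / 2"
   using sum_pairs_swap[of "\<lambda>_ _. 1" m] sum_pairs_additive[of "\<lambda>_. 1 / 2" m] by simp
  then show ?thesis using m by (simp only:) simp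
 qed
 ultimately show "((\<lambda>t. emp_U h X m t w) \<longlongrightarrow> 1) at_top" by (simp only:)
 have "((\<lambda>t. emp_U h X m t w) \<longlongrightarrow> 2 / (real m * (real m - 1)) * (\<Sum>i=1..m. \<Sum>j=i+1..m. 0)) at_bot"
  unfolding E by (intro tendsto_intros h_bot)
 then show "((\<lambda>t. emp_U h X m t w) \<longlongrightarrow> 0) at_bot" by simp
qed

text \<open>For a fixed sample the empirical quantile is monotone in \<open>p\<close>, hence lies between those at \<open>D1\<close> and \<open>D2\<close>.
These are finite because the empirical function tends to 0 and 1.\<close>
lemma bahadur_remainder_bounded:
 "\<exists>B\<ge>0. \<forall>p. D1 \<le> p \<longrightarrow> p \<le> D2 \<longrightarrow> \<bar>bahadur_remainder h X Umean u lo hi m p w\<bar> \<le> B"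
proof -
 let ?Um = "\<lambda>t. emp_U h X m t w"
 let ?T = "\<lambda>p. {t. p \<le> ?Um t}"
 have D01: "0 < D1" "D2 < 1" using D12 Umean_01[of lo] Umean_01[of hi] by linarith+
 have emq: "\<bar>emp_U_quantile h X m p w\<bar> \<le> \<bar>Inf (?T D1)\<bar> + \<bar>Inf (?T D2)\<bar>" if p: "D1 \<le> p" "p \<le> D2" for p
 proof (cases "m < 2")
  case False
  then have m: "2 \<le> m" by simp
  have ne: "?T D2 \<noteq> {}"
  proof -
   have "\<forall>\<^sub>F t in at_top. D2 < ?Um t" using order_tendstoD(1)[OF emp_U_tendsto(1)[OF m] D01(2)] .
   then obtain t where "D2 < ?Um t" using eventually_happens trivial_limit_at_top_linorder by blast
   then show ?thesis by (auto intro: less_imp_le)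
  qed
  have bd: "bdd_below (?T D1)"
  proof -
   have "\<forall>\<^sub>F t in at_bot. ?Um t < D1" using order_tendstoD(2)[OF emp_U_tendsto(2)[OF m] D01(1)] .
   then obtain s where s: "?Um s < D1" using eventually_happens trivial_limit_at_bot_linorder by blast
   have "s \<le> t" if "t \<in> ?T D1" for t
   proof (rule ccontr)
    assume "\<not> s \<le> t"
    then have "?Um t \<le> ?Um s" using emp_U_mono[of m w] by (auto simp: mono_def)
    then show False using s that by simp
   qed
   then show ?thesis by (auto simp: bdd_below_def)
  qed
  have sub: "?T D2 \<subseteq> ?T p" "?T p \<subseteq> ?T D1" using p by auto
  have "Inf (?T D1) \<le> Inf (?T p)" using sub ne bd by (intro cInf_superset_mono) auto
  moreover have "Inf (?T p) \<le> Inf (?T D2)" using sub ne bd by (intro cInf_superset_mono) (auto intro: bdd_below_mono)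
  ultimately show ?thesis using False by (simp add: emp_U_quantile_def)
 qed (simp add: emp_U_quantile_def)
 define B where "B = (\<bar>Inf (?T D1)\<bar> + \<bar>Inf (?T D2)\<bar>) + (\<bar>lo\<bar> + \<bar>hi\<bar>) + (1 + \<bar>?Um lo\<bar> + \<bar>?Um hi\<bar>) / \<kappa>"
 have "\<bar>bahadur_remainder h X Umean u lo hi m p w\<bar> \<le> B" if p: "D1 \<le> p" "p \<le> D2" for p
 proof -
  note q = quantile_exists[OF p]
  have q': "lo \<le> quant p" "quant p \<le> hi" using q margin_pos by linarith+
  have u: "\<kappa> \<le> u (quant p)" using q' by (rule u_ge)
  have "?Um lo \<le> ?Um (quant p)" "?Um (quant p) \<le> ?Um hi" using emp_U_mono[of m w] q' by (auto simp: mono_def)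
  then have n: "\<bar>p - ?Um (quant p)\<bar> \<le> 1 + \<bar>?Um lo\<bar> + \<bar>?Um hi\<bar>" using p D01 by linarith
  have "\<bar>(p - ?Um (quant p)) / u (quant p)\<bar> = \<bar>p - ?Um (quant p)\<bar> / u (quant p)" using u \<kappa> by (simp add: abs_divide)
  also have "\<dots> \<le> (1 + \<bar>?Um lo\<bar> + \<bar>?Um hi\<bar>) / \<kappa>" using n u \<kappa> by (intro frac_le) auto
  finally have "\<bar>(p - ?Um (quant p)) / u (quant p)\<bar> \<le> (1 + \<bar>?Um lo\<bar> + \<bar>?Um hi\<bar>) / \<kappa>" .
  moreover have "\<bar>quant p\<bar> \<le> \<bar>lo\<bar> + \<bar>hi\<bar>" using q' by linarith
  ultimately show ?thesis using emq[OF p] unfolding B_def bahadur_remainder_def Let_def quant_def[symmetric] by linarith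
 qed
 moreover have "0 \<le> B" using \<kappa> by (simp add: B_def)
 ultimately show ?thesis by blast
qed

lemma two_power_bracket:
 fixes m :: nat
 assumes "1 \<le> m"
 obtains l where "1 \<le> l" "2 ^ (l - 1) \<le> m" "m < 2 ^ l"
proof -
 define l where "l = (LEAST l. m < 2 ^ l)"
 have ex: "m < 2 ^ m" by simp
 have 1: "m < 2 ^ l" unfolding l_def by (rule LeastI[of "\<lambda>l. m < 2 ^ l", OF ex])
 have l: "1 \<le> l" using 1 assms by (cases l) auto
 have "\<not> m < 2 ^ (l - 1)" using l unfolding l_def by (intro not_less_Least) simp
 then show ?thesis using that[OF l _ 1] by simp
qed

text \<open>The rate in terms of \<open>l\<close> is increasing once it is multiplied by \<open>m\<close>, so the bound holds with any
\<open>n \<ge> m\<close> on the right.\<close>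
lemma scaled_remainder_le:
 assumes l: "1 \<le> l" and m: "2 ^ (l - 1) \<le> m" "m < 2 ^ l" and mn: "m \<le> n"
 shows "real m * rate l \<le> (log 2 (real n) + 1) powr (3 / 4) * real n powr (1 / 2 - \<gamma> / 8)"
proof -
 have m1: "1 \<le> real m"
 proof -
  have "(1::nat) \<le> 2 ^ (l - 1)" by simp
  then show ?thesis using m(1) by linarith
 qed
 have "real (2 ^ (l - 1)) \<le> real m" using m(1) by (rule of_nat_mono)
 then have "2 powr (real l - 1) \<le> real m" using l by (simp add: powr_realpow[symmetric] of_nat_diff)
 then have "real l - 1 \<le> log 2 (real m)" using m1 by (simp add: le_log_iff)
 also have "\<dots> \<le> log 2 (real n)" using m1 mn by (intro log_mono) auto
 finally have A: "real l powr (3 / 4) \<le> (log 2 (real n) + 1) powr (3 / 4)" by (intro powr_mono2) auto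
 have "real m \<le> real (2 ^ l)" using m(2) by (intro of_nat_mono) simp
 then have m2l: "real m \<le> 2 powr real l" by (simp add: powr_realpow)
 have "2 powr (- (1 / 2 + \<gamma> / 8) * real l) = (2 powr real l) powr (- (1 / 2 + \<gamma> / 8))" by (simp only: powr_powr mult.commute)
 also have "\<dots> \<le> real m powr (- (1 / 2 + \<gamma> / 8))" using m2l m1 \<gamma> by (intro powr_mono2') auto
 finally have "real m * 2 powr (- (1 / 2 + \<gamma> / 8) * real l) \<le> real m * real m powr (- (1 / 2 + \<gamma> / 8))"
  by (intro mult_left_mono) auto
 also have "\<dots> = real m powr 1 * real m powr (- (1 / 2 + \<gamma> / 8))" using m1 by simp
 also have "\<dots> = real m powr (1 / 2 - \<gamma> / 8)" unfolding powr_add[symmetric] by simp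
 also have "\<dots> \<le> real n powr (1 / 2 - \<gamma> / 8)" using mn m1 \<gamma> by (intro powr_mono2) auto
 finally have B: "real m * 2 powr (- (1 / 2 + \<gamma> / 8) * real l) \<le> real n powr (1 / 2 - \<gamma> / 8)" .
 have "real m * rate l = real l powr (3 / 4) * (real m * 2 powr (- (1 / 2 + \<gamma> / 8) * real l))"
  unfolding rate_def by (simp only: mult.left_commute)
 also have "\<dots> \<le> (log 2 (real n) + 1) powr (3 / 4) * real n powr (1 / 2 - \<gamma> / 8)"
  using A B by (intro mult_mono) auto
 finally show ?thesis .
qed

text \<open>Sample sizes below \<open>2^l0\<close>, where the random \<open>l0\<close> is the onset of the good events, contribute a finite constant,
which the factor \<open>n^(-1/2)\<close> removes.\<close>
theorem AE_sup_remainder_smallo: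
 "AE w in M.
  (\<lambda>n::nat. SUP (p, s)\<in>{D1..D2} \<times> {0..1::real}.
    real (nat \<lfloor>real n * s\<rfloor>) / sqrt (real n) *
    \<bar>bahadur_remainder h X Umean u lo hi (nat \<lfloor>real n * s\<rfloor>) p w\<bar>)
  \<in> o(\<lambda>n. real n powr (- (\<gamma> / 8)) * ln (real n))"
 using AE_good
proof (rule AE_mp, intro AE_I2 impI)
 fix w assume "\<forall>\<^sub>F l in sequentially. good l w"
 then have "\<forall>\<^sub>F l in sequentially. good l w \<and> scale_ok l" using eventually_scale_ok by (rule eventually_conj)
 then obtain l0 where l0: "\<And>l. l0 \<le> l \<Longrightarrow> good l w \<and> scale_ok l" by (auto simp: eventually_sequentially)
 define R where "R m p = \<bar>bahadur_remainder h X Umean u lo hi m p w\<bar>" for m p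
 have "\<forall>m. \<exists>B\<ge>0. \<forall>p. D1 \<le> p \<longrightarrow> p \<le> D2 \<longrightarrow> R m p \<le> B" unfolding R_def using bahadur_remainder_bounded by blast
 then obtain B where B: "\<And>m. 0 \<le> B m" "\<And>m p. D1 \<le> p \<Longrightarrow> p \<le> D2 \<Longrightarrow> R m p \<le> B m" by metis
 define c where "c = (\<Sum>m<2 ^ l0. real m * B m)"
 have c0: "0 \<le> c" unfolding c_def using B by (intro sum_nonneg) auto
 let ?lg = "\<lambda>n. (log 2 (real n) + 1) powr (3 / 4)"
 let ?b = "\<lambda>n. real n powr (- (\<gamma> / 8)) * (c + C5 * ?lg n)"
 have each: "real m * R m p \<le> c + C5 * (?lg n * real n powr (1 / 2 - \<gamma> / 8))" if p: "D1 \<le> p" "p \<le> D2" and mn: "m \<le> n" for m n p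
 proof (cases "m < 2 ^ l0")
  case True
  have "real m * R m p \<le> real m * B m" using B p by (intro mult_left_mono) auto
  also have "\<dots> \<le> c" unfolding c_def using True B by (intro member_le_sum) auto
  also have "\<dots> \<le> c + C5 * (?lg n * real n powr (1 / 2 - \<gamma> / 8))" using C5_nonneg by simp
  finally show ?thesis .
 next
  case False
  have "(1::nat) \<le> 2 ^ l0" by simp
  then have "1 \<le> m" using False by linarith
  then obtain l where l: "1 \<le> l" "2 ^ (l - 1) \<le> m" "m < 2 ^ l" by (rule two_power_bracket)
  have "l0 \<le> l"
  proof (rule ccontr)
   assume "\<not> l0 \<le> l"
   then have "(2::nat) ^ l \<le> 2 ^ l0" by (intro power_increasing) auto
   then show False using l(3) False by linarith
  qed
  then have "R m p \<le> C5 * rate l" unfolding R_def using l0 l p by (intro bahadur_remainder_le) auto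
  then have "real m * R m p \<le> real m * (C5 * rate l)" by (intro mult_left_mono) auto
  also have "\<dots> = C5 * (real m * rate l)" by simp
  also have "\<dots> \<le> C5 * (?lg n * real n powr (1 / 2 - \<gamma> / 8))"
   using scaled_remainder_le[OF l mn] C5_nonneg by (intro mult_left_mono)
  finally show ?thesis using c0 by linarith
 qed
 define F where "F n ps = (case ps of (p, s) \<Rightarrow> real (nat \<lfloor>real n * s\<rfloor>) / sqrt (real n) * R (nat \<lfloor>real n * s\<rfloor>) p)" for n :: nat and ps :: "real \<times> real"
 have Fb: "0 \<le> F n ps \<and> F n ps \<le> ?b n" if n: "1 \<le> n" and ps: "ps \<in> {D1..D2} \<times> {0..1}" for n ps
 proof -
  obtain p s where [simp]: "ps = (p, s)" by (cases ps)
  have p: "D1 \<le> p" "p \<le> D2" and s: "0 \<le> s" "s \<le> 1" using ps by auto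
  define m where "m = nat \<lfloor>real n * s\<rfloor>"
  have "real n * s \<le> real n * 1" using s by (intro mult_left_mono) auto
  then have mn: "m \<le> n" unfolding m_def by linarith
  have n0: "0 < sqrt (real n)" using n by simp
  have F: "F n ps = (real m * R m p) / sqrt (real n)" by (simp add: F_def m_def)
  have hs: "sqrt (real n) = real n powr (1 / 2)" using n by (simp add: powr_half_sqrt)
  have "F n ps \<le> (c + C5 * (?lg n * real n powr (1 / 2 - \<gamma> / 8))) / sqrt (real n)"
   unfolding F using each[OF p mn] n0 by (intro divide_right_mono) auto
  also have "\<dots> = c * real n powr (- 1 / 2) + C5 * (?lg n * (real n powr (1 / 2 - \<gamma> / 8 - 1 / 2)))"
   unfolding hs powr_diff using n by (simp add: add_divide_distrib powr_minus_divide)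
  also have "\<dots> \<le> c * real n powr (- (\<gamma> / 8)) + C5 * (?lg n * (real n powr (- (\<gamma> / 8))))"
   using C5_nonneg c0 \<gamma> n by (intro add_mono mult_left_mono powr_mono) auto
  also have "\<dots> = ?b n" by (simp add: algebra_simps)
  finally show ?thesis unfolding F using n0 by (auto simp: R_def)
 qed
 let ?S = "\<lambda>n. SUP ps\<in>{D1..D2} \<times> {0..1::real}. F n ps"
 have ne: "(D1, 0) \<in> {D1..D2} \<times> {0..1::real}" using D12 by simp
 have Sb: "norm (?S n) \<le> 1 * norm (?b n)" if n: "1 \<le> n" for n
 proof -
  have up: "?S n \<le> ?b n" using ne Fb[OF n] by (intro cSUP_least) auto
  have bd: "bdd_above (F n ` ({D1..D2} \<times> {0..1}))" using Fb[OF n] by (intro bdd_aboveI[of _ "?b n"]) auto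
  have "0 \<le> F n (D1, 0)" using Fb[OF n ne] by simp
  also have "\<dots> \<le> ?S n" by (rule cSUP_upper[OF ne bd])
  finally show ?thesis using up by simp
 qed
 have "?S \<in> O(?b)" using Sb by (intro bigoI[where c = 1]) (auto simp: eventually_sequentially)
 moreover have "?b \<in> o(\<lambda>n. real n powr (- (\<gamma> / 8)) * ln (real n))"
 proof (rule landau_o.big_small_mult)
  have "(\<lambda>n. c) \<in> o(\<lambda>n::nat. ln (real n))" by real_asymp
  moreover have "(\<lambda>n. C5 * ?lg n) \<in> o(\<lambda>n. ln (real n))"
  proof -
   have "?lg \<in> o(\<lambda>n. ln (real n))" by real_asymp
   then show ?thesis by (cases "C5 = 0") auto
  qed
  ultimately show "(\<lambda>n. c + C5 * ?lg n) \<in> o(\<lambda>n. ln (real n))" by (rule sum_in_smallo)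
 qed simp
 ultimately have "?S \<in> o(\<lambda>n. real n powr (- (\<gamma> / 8)) * ln (real n))" by (rule landau_o.big_small_trans)
 moreover have "?S n = (SUP (p, s)\<in>{D1..D2} \<times> {0..1::real}. real (nat \<lfloor>real n * s\<rfloor>) / sqrt (real n) * \<bar>bahadur_remainder h X Umean u lo hi (nat \<lfloor>real n * s\<rfloor>) p w\<bar>)" for n
  unfolding F_def R_def ..
 ultimately show "(\<lambda>n::nat. SUP (p, s)\<in>{D1..D2} \<times> {0..1::real}.
    real (nat \<lfloor>real n * s\<rfloor>) / sqrt (real n) * \<bar>bahadur_remainder h X Umean u lo hi (nat \<lfloor>real n * s\<rfloor>) p w\<bar>)
  \<in> o(\<lambda>n. real n powr (- (\<gamma> / 8)) * ln (real n))" by simp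
qed

end

section \<open>Verification of the dependence conditions\<close>

lemma space_generated_field: "space (generated_field M S X I) = space M"
 unfolding generated_field_def by (simp add: space_measure_of_conv)

lemma sets_generated_field:
 "sets (generated_field M S X I) = sigma_sets (space M) (\<Union>i\<in>I. {X i -` A \<inter> space M | A. A \<in> sets S})"
 unfolding generated_field_def by (rule sets_measure_of) auto

lemma subalgebra_generated_field:
 assumes "\<And>i. i \<in> I \<Longrightarrow> X i \<in> measurable M S"
 shows "subalgebra M (generated_field M S X I)"
 unfolding subalgebra_def space_generated_field sets_generated_field
 using assms by (intro conjI refl sets.sigma_sets_subset) (auto intro: measurable_sets)

lemma generated_field_mono:
 "I \<subseteq> J \<Longrightarrow> sets (generated_field M S X I) \<subseteq> sets (generated_field M S X J)"
 unfolding sets_generated_field by (intro sigma_sets_mono') auto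

lemma measurable_generated_field:
 assumes "i \<in> I" and "X i \<in> measurable M S"
 shows "X i \<in> measurable (generated_field M S X I) S"
proof (rule measurableI)
 fix w assume "w \<in> space (generated_field M S X I)"
 then show "X i w \<in> space S" using measurable_space[OF assms(2)] by (simp add: space_generated_field)
next
 fix B assume "B \<in> sets S"
 then show "X i -` B \<inter> space (generated_field M S X I) \<in> sets (generated_field M S X I)"
  unfolding space_generated_field sets_generated_field using assms(1) by (intro sigma_sets.Basic) auto
qed

text \<open>Doob--Dynkin factorisation. A rational cut \<open>{q < f}\<close> is the preimage of a set \<open>A q\<close> in the product
space, and \<open>\<phi>\<close> is the supremum of the rationals \<open>q\<close> whose \<open>A q\<close> contains the point.\<close>
lemma measurable_generated_field_factor:
 fixes f :: "'a \<Rightarrow> real"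
 assumes Z: "\<And>i. i \<in> I \<Longrightarrow> Z i \<in> measurable M S" and f: "f \<in> borel_measurable (generated_field M S Z I)"
 obtains \<phi> where "\<phi> \<in> borel_measurable (\<Pi>\<^sub>M i\<in>I. S)" "\<And>w. w \<in> space M \<Longrightarrow> f w = \<phi> (\<lambda>i\<in>I. Z i w)"
proof -
 define P where "P = (\<Pi>\<^sub>M i\<in>I. S)"
 define g where "g w = (\<lambda>i\<in>I. Z i w)" for w
 have g: "g \<in> measurable M P" unfolding g_def P_def using Z by (intro measurable_restrict)
 have gsp: "g \<in> space M \<rightarrow> space P" using measurable_space[OF g] by auto
 have "sets (generated_field M S Z I) \<subseteq> sets (vimage_algebra (space M) g P)"
  unfolding sets_generated_field
 proof (rule sets.sigma_sets_subset[of _ "vimage_algebra (space M) g P", simplified])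
  show "(\<Union>i\<in>I. {Z i -` A \<inter> space M |A. A \<in> sets S}) \<subseteq> sets (vimage_algebra (space M) g P)"
  proof (intro UN_least subsetI)
   fix i B assume i: "i \<in> I" and "B \<in> {Z i -` A \<inter> space M |A. A \<in> sets S}"
   then obtain A where A: "A \<in> sets S" "B = Z i -` A \<inter> space M" by auto
   have "(\<lambda>z. z i) \<in> measurable P S" unfolding P_def using i by (rule measurable_component_singleton)
   then have m: "(\<lambda>z. z i) -` A \<inter> space P \<in> sets P" using A(1) by (rule measurable_sets)
   have "B = g -` ((\<lambda>z. z i) -` A \<inter> space P) \<inter> space M"
    using i gsp unfolding A(2) by (auto simp: g_def)
   then show "B \<in> sets (vimage_algebra (space M) g P)" using in_vimage_algebra[OF m] by simp
  qed
 qed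
 then have pre: "\<exists>A\<in>sets P. B = g -` A \<inter> space M" if "B \<in> sets (generated_field M S Z I)" for B
  using that unfolding sets_vimage_algebra2[OF gsp] by blast
 have "\<forall>q::rat. \<exists>A\<in>sets P. {w\<in>space M. real_of_rat q < f w} = g -` A \<inter> space M"
 proof
  fix q :: rat
  have "{w\<in>space (generated_field M S Z I). real_of_rat q < f w} \<in> sets (generated_field M S Z I)"
   using f by measurable
  then show "\<exists>A\<in>sets P. {w\<in>space M. real_of_rat q < f w} = g -` A \<inter> space M"
   unfolding space_generated_field by (rule pre)
 qed
 then obtain A where A: "\<And>q. A q \<in> sets P" "\<And>q. {w\<in>space M. real_of_rat q < f w} = g -` A q \<inter> space M" by metis
 define \<psi> where "\<psi> z = (SUP q. if z \<in> A q then ereal (real_of_rat q) else -\<infinity>)" for z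
 have m: "(\<lambda>z. real_of_ereal (\<psi> z)) \<in> borel_measurable P"
  unfolding \<psi>_def using A(1) by (intro borel_measurable_real_of_ereal borel_measurable_SUP measurable_If_set) auto
 have "f w = real_of_ereal (\<psi> (g w))" if w: "w \<in> space M" for w
 proof -
  have mem: "g w \<in> A q \<longleftrightarrow> real_of_rat q < f w" for q using A(2)[of q] w by blast
  have "\<psi> (g w) = ereal (f w)"
  proof (rule antisym)
   show "\<psi> (g w) \<le> ereal (f w)" unfolding \<psi>_def by (rule SUP_least) (auto simp: mem)
   show "ereal (f w) \<le> \<psi> (g w)"
   proof (rule ccontr)
    assume "\<not> ereal (f w) \<le> \<psi> (g w)"
    then obtain y where y: "\<psi> (g w) < ereal y" "ereal y < ereal (f w)"
     using ereal_dense2[of "\<psi> (g w)" "ereal (f w)"] unfolding not_le by blast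
    obtain q where q: "y < real_of_rat q" "real_of_rat q < f w" using of_rat_dense[of y "f w"] y(2) by auto
    have "ereal (real_of_rat q) \<le> \<psi> (g w)" unfolding \<psi>_def using q(2) by (intro SUP_upper2[of q]) (auto simp: mem)
    also have "\<dots> < ereal y" by (rule y)
    finally show False using q(1) by simp
   qed
  qed
  then show ?thesis by simp
 qed
 then show ?thesis using that[of "\<lambda>z. real_of_ereal (\<psi> z)"] m unfolding P_def g_def by blast
qed

lemma powr_bound_of_bigo:
 fixes f :: "nat \<Rightarrow> real"
 assumes f: "f \<in> O(\<lambda>n. real n powr (- a))" and a: "0 \<le> a"
 shows "\<exists>c\<ge>0. \<forall>n. f n \<le> c * (1 + real n) powr (- a)"
proof -
 obtain c N where c: "0 < c" and N: "\<And>n. N \<le> n \<Longrightarrow> \<bar>f n\<bar> \<le> c * \<bar>real n powr (- a)\<bar>"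
  using landau_o.bigE[OF f] unfolding eventually_sequentially real_norm_def by blast
 \<comment> \<open>at \<open>n = 0\<close> the power \<open>real n powr (- a)\<close> is 0 and bounds nothing\<close>
 define N' where "N' = max N 1"
 define d where "d = (\<Sum>n<N'. \<bar>f n\<bar> * (1 + real n) powr a)"
 have d0: "0 \<le> d" unfolding d_def by (intro sum_nonneg) auto
 have "f n \<le> (c * 2 powr a + d) * (1 + real n) powr (- a)" for n
 proof (cases "n < N'")
  case True
  have "\<bar>f n\<bar> * (1 + real n) powr a \<le> d" unfolding d_def using True by (intro member_le_sum) auto
  then have "\<bar>f n\<bar> * (1 + real n) powr a * (1 + real n) powr (- a) \<le> d * (1 + real n) powr (- a)" by (intro mult_right_mono) auto
  also have "\<bar>f n\<bar> * (1 + real n) powr a * (1 + real n) powr (- a) = \<bar>f n\<bar>"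
   using powr_add[of "1 + real n" a "- a"] by (simp add: mult.assoc)
  finally have "f n \<le> d * (1 + real n) powr (- a)" by linarith
  also have "\<dots> \<le> (c * 2 powr a + d) * (1 + real n) powr (- a)" using c by (intro mult_right_mono) auto
  finally show ?thesis .
 next
  case False
  then have n: "N \<le> n" "1 \<le> n" by (auto simp: N'_def)
  have "(2 * real n) powr (- a) \<le> (1 + real n) powr (- a)" using n a by (intro powr_mono2') auto
  then have "2 powr a * (2 * real n) powr (- a) \<le> 2 powr a * (1 + real n) powr (- a)" by (intro mult_left_mono) auto
  also have "2 powr a * (2 * real n) powr (- a) = (2 powr a * 2 powr (- a)) * real n powr (- a)" by (subst powr_mult) simp
  also have "2 powr a * 2 powr (- a) = (1::real)" using powr_add[of 2 a "- a"] by simp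
  finally have "c * real n powr (- a) \<le> c * (2 powr a * (1 + real n) powr (- a))" using c by (intro mult_left_mono) auto
  moreover have "f n \<le> c * real n powr (- a)" using N[OF n(1)] by simp
  moreover have "0 \<le> d * (1 + real n) powr (- a)" using d0 by simp
  ultimately show ?thesis by (simp add: algebra_simps)
 qed
 then show ?thesis using c d0 by (intro exI[of _ "c * 2 powr a + d"]) auto
qed

lemma stationary_law:
 assumes X: "\<And>n. 1 \<le> n \<Longrightarrow> X n \<in> borel_measurable M" and st: "stationary M X" and i: "1 \<le> i"
 shows "distr M borel (X i) = distr M borel (X 1)"
proof -
 let ?P = "\<Pi>\<^sub>M n\<in>{1::nat..}. (borel :: real measure)"
 have one: "(\<lambda>x. x 1) \<in> measurable ?P borel" by (rule measurable_component_singleton) simp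
 have *: "distr (distr M ?P (\<lambda>w. \<lambda>n\<in>{1..}. X (n + j) w)) borel (\<lambda>x. x 1) = distr M borel (X (1 + j))" for j
 proof (subst distr_distr[OF one])
  show "(\<lambda>w. \<lambda>n\<in>{1..}. X (n + j) w) \<in> measurable M ?P" by (intro measurable_restrict X) simp
 qed (simp add: comp_def)
 from st have "distr M ?P (\<lambda>w. \<lambda>n\<in>{1..}. X (n + (i - 1)) w) = distr M ?P (\<lambda>w. \<lambda>n\<in>{1..}. X (n + 0) w)"
  by (simp add: stationary_def)
 from arg_cong[OF this, of "\<lambda>m. distr m borel (\<lambda>x. x 1)"] show ?thesis unfolding * using i by simp
qed

context prob_space
begin

lemma Markov_ge:
 fixes f :: "'a \<Rightarrow> real"
 assumes "integrable M f" "\<And>w. 0 \<le> f w" "0 < c"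
 shows "prob {w\<in>space M. c \<le> f w} \<le> expectation f / c"
 using assms by (intro integral_Markov_inequality_measure[where A = "{}"]) auto

lemma mixing_bound_alpha_coeff:
 assumes X: "\<And>n. 1 \<le> n \<Longrightarrow> X n \<in> borel_measurable M" and n: "1 \<le> n"
 shows "mixing_bound M (generated_field M borel X {1..n}) (generated_field M borel X {n + k..}) (alpha_coeff M X k)"
 unfolding mixing_bound_def
proof (intro ballI)
 fix a b assume a: "a \<in> sets (generated_field M borel X {1..n})" and b: "b \<in> sets (generated_field M borel X {n + k..})"
 let ?I = "{(n, A, B). 1 \<le> n \<and> A \<in> sets (generated_field M borel X {1..n}) \<and> B \<in> sets (generated_field M borel X {n + k..})}"
 let ?f = "\<lambda>(n :: nat, A, B). \<bar>prob (A \<inter> B) - prob A * prob B\<bar>"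
 have le1: "\<bar>prob (A \<inter> B) - prob A * prob B\<bar> \<le> 1" for A B
 proof -
  have "0 \<le> prob A * prob B" "prob A * prob B \<le> 1" by (auto intro: mult_le_one)
  then show ?thesis using prob_le_1[of "A \<inter> B"] measure_nonneg[of M "A \<inter> B"] by linarith
 qed
 have "bdd_above (?f ` ?I)" using le1 by (intro bdd_aboveI[of _ 1]) auto
 moreover have "(n, a, b) \<in> ?I" using a b n by simp
 ultimately have "?f (n, a, b) \<le> (SUP p\<in>?I. ?f p)" by (intro cSUP_upper)
 then show "\<bar>prob (a \<inter> b) - prob a * prob b\<bar> \<le> alpha_coeff M X k" by (simp add: alpha_coeff_def)
qed

lemma dependent_process_strong_mixing:
 assumes X: "\<And>n. 1 \<le> n \<Longrightarrow> X n \<in> borel_measurable M" and st: "stationary M X"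
  and \<alpha>: "8 \<le> \<alpha>" and mixO: "alpha_coeff M X \<in> O(\<lambda>n. real n powr (- \<alpha>))"
  and r: "1 / 5 < r" and int: "integrable M (\<lambda>w. \<bar>X 1 w\<bar> powr r)"
 shows "\<exists>V past fut c0. dependent_process M (distr M borel (X 1)) X V past fut c0 \<alpha> (max 12 (2 * \<alpha>)) \<alpha>"
proof -
 obtain c where c: "0 \<le> c" "\<And>n. alpha_coeff M X n \<le> c * (1 + real n) powr (- \<alpha>)"
  using powr_bound_of_bigo[OF mixO] \<alpha> by auto
 define E where "E = expectation (\<lambda>w. \<bar>X 1 w\<bar> powr r)"
 define c0 where "c0 = c + E"
 have E0: "0 \<le> E" unfolding E_def by (intro integral_nonneg_AE) auto
 define past where "past n = generated_field M borel X {k. 1 \<le> k \<and> int k \<le> n}" for n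
 define fut where "fut n = generated_field M borel X {k. 1 \<le> k \<and> n \<le> int k}" for n
 have "dependent_process M (distr M borel (X 1)) X (\<lambda>l i. X i) past fut c0 \<alpha> (max 12 (2 * \<alpha>)) \<alpha>"
 proof (intro dependent_process.intro dependent_process_axioms.intro)
  show "prob_space M" by (rule prob_space_axioms)
  show "prob_space (distr M borel (X 1))" using X[of 1] by (intro prob_space_distr) simp
  show "X i \<in> borel_measurable M" if "1 \<le> i" for i using X that .
  show "distr M borel (X i) = distr M borel (X 1)" if "1 \<le> i" for i by (rule stationary_law[OF X st that])
  show "subalgebra M (past n)" "subalgebra M (fut n)" for n
   unfolding past_def fut_def by (rule subalgebra_generated_field, rule X, simp)+
  show "sets (past n) \<subseteq> sets (past n')" "sets (fut n') \<subseteq> sets (fut n)" if "n \<le> n'" for n n'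
   unfolding past_def fut_def by (rule generated_field_mono, use that in force)+
  show "X i \<in> borel_measurable (past (int i + int l))" "X i \<in> borel_measurable (fut (int i - int l - 1))" if "1 \<le> i" for l i
   unfolding past_def fut_def using that by (intro measurable_generated_field X, simp_all)+
  show "mixing_bound M (past n) (fut (n + int r')) (c0 * (1 + real r') powr - \<alpha>)" if n: "1 \<le> n" for n r'
  proof -
   define n' where "n' = nat n"
   have n': "n = int n'" "1 \<le> n'" using n by (auto simp: n'_def)
   have s: "{k. 1 \<le> k \<and> int k \<le> n} = {1..n'}" "{k. 1 \<le> k \<and> n + int r' \<le> int k} = {n' + r'..}" using n' by auto
   have "alpha_coeff M X r' \<le> c0 * (1 + real r') powr - \<alpha>"
    using c(2)[of r'] E0 unfolding c0_def distrib_right by (auto intro: add_increasing2)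
   then show ?thesis using mixing_bound_alpha_coeff[of X n' r', OF X n'(2)]
    unfolding past_def fut_def s mixing_bound_def by (meson order_trans)
  qed
  show "prob {w\<in>space M. e < \<bar>X i w - X i w\<bar>} \<le> c0 * (1 + real l) powr - max 12 (2 * \<alpha>) / e" if "0 < e" for i l e
  proof -
   have "{w\<in>space M. e < \<bar>X i w - X i w\<bar>} = {}" using that by auto
   then show ?thesis using that c(1) E0 by (simp add: c0_def)
  qed
  show "prob {w\<in>space M. T \<le> \<bar>X 1 w\<bar>} \<le> c0 * T powr (- 1 / 5)" if T: "1 \<le> T" for T
  proof -
   have "prob {w\<in>space M. T \<le> \<bar>X 1 w\<bar>} \<le> prob {w\<in>space M. T powr r \<le> \<bar>X 1 w\<bar> powr r}"
   proof (rule finite_measure_mono)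
    show "{w\<in>space M. T powr r \<le> \<bar>X 1 w\<bar> powr r} \<in> events" using X[of 1] by measurable
   qed (use T r in \<open>auto intro: powr_mono2\<close>)
   also have "\<dots> \<le> E / T powr r" unfolding E_def using T by (intro Markov_ge int) auto
   also have "\<dots> = E * T powr (- r)" by (simp add: powr_minus_divide)
   also have "\<dots> \<le> c0 * T powr (- 1 / 5)" using T r E0 c(1) by (intro mult_mono powr_mono) (auto simp: c0_def)
   finally show ?thesis .
  qed
  show "(\<forall>i\<ge>1. \<forall>l::nat. X i = X i) \<or> (\<forall>T\<ge>1. prob {w\<in>space M. T \<le> \<bar>X 1 w\<bar>} \<le> c0 / T)" by simp
 qed (use \<alpha> in auto)
 then show ?thesis by blast
qed

text \<open>The strong mixing coefficient is at most the coefficient of absolute regularity: the covariance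
of two events is the integral over the first of the deviation of the conditional probability of the second,
and this deviation is almost surely below the essential supremum.\<close>
lemma mixing_bound_beta_coeff:
 assumes Z: "\<And>n. Z n \<in> measurable M S" and n: "1 \<le> n"
 shows "mixing_bound M (generated_field M S Z {..int n}) (generated_field M S Z {int n + int k..}) (beta_coeff M S Z k)"
 unfolding mixing_bound_def
proof (intro ballI)
 fix a b assume a: "a \<in> sets (generated_field M S Z {..int n})" and b: "b \<in> sets (generated_field M S Z {int n + int k..})"
 define D where "D n A w = \<bar>real_cond_exp M (generated_field M S Z {..int n}) (indicator A) w - prob A\<bar>" for n :: nat and A w
 define F where "F n = (\<lambda>A w. ennreal (D n A w)) ` sets (generated_field M S Z {int n + int k..})" for n :: nat
 have sub: "subalgebra M (generated_field M S Z I)" for I using Z by (intro subalgebra_generated_field)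
 have ev: "A \<in> events" if "A \<in> sets (generated_field M S Z I)" for A I using sub[of I] that by (auto simp: subalgebra_def)
 have ii: "integrable M (indicator A :: 'a \<Rightarrow> real)" if "A \<in> events" for A using that by (simp add: emeasure_eq_measure)
 have meas: "F n \<subseteq> borel_measurable M" for n
  unfolding F_def D_def by auto
 have bound: "AE w in M. f w \<le> ennreal 1" if f: "f \<in> F n" for f n
 proof -
  interpret G: finite_measure_subalgebra M "generated_field M S Z {..int n}" by unfold_locales (rule sub)
  obtain A where A: "A \<in> sets (generated_field M S Z {int n + int k..})" "f = (\<lambda>w. ennreal (D n A w))"
   using f by (auto simp: F_def)
  have "AE w in M. 0 \<le> real_cond_exp M (generated_field M S Z {..int n}) (indicator A) w"
   by (rule G.real_cond_exp_ge_c[OF ii[OF ev[OF A(1)]]]) auto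
  moreover have "AE w in M. real_cond_exp M (generated_field M S Z {..int n}) (indicator A) w \<le> 1"
   by (rule G.real_cond_exp_le_c[OF ii[OF ev[OF A(1)]]]) (auto simp: indicator_def)
  ultimately show ?thesis
  proof eventually_elim
   case (elim w)
   then have "D n A w \<le> 1" using prob_le_1[of A] measure_nonneg[of M A] unfolding D_def by linarith
   then show ?case unfolding A(2) by (rule ennreal_leI)
  qed
 qed
 have ess: "is_family_esssup M (F n) (family_esssup M (F n))" for n
  by (rule is_family_esssup_family_esssup[OF meas bound])
 have ess1: "(\<integral>\<^sup>+w. family_esssup M (F n) w \<partial>M) \<le> 1" for n
 proof -
  have "AE w in M. family_esssup M (F n) w \<le> ennreal 1"
   using ess[of n] bound[of _ n] unfolding is_family_esssup_def by (auto intro!: bspec[of _ _ "\<lambda>_. ennreal 1", rule_format])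
  then have "(\<integral>\<^sup>+w. family_esssup M (F n) w \<partial>M) \<le> (\<integral>\<^sup>+w. ennreal 1 \<partial>M)" by (rule nn_integral_mono_AE)
  then show ?thesis by (simp add: emeasure_space_1)
 qed
 let ?sup = "SUP n\<in>{1::nat..}. \<integral>\<^sup>+w. family_esssup M (F n) w \<partial>M"
 have "?sup \<le> 1" using ess1 by (intro SUP_least)
 then have fin: "?sup < top" by (rule le_less_trans) simp
 have beta: "beta_coeff M S Z k = enn2real ?sup" by (simp add: beta_coeff_def F_def D_def)
 interpret G: finite_measure_subalgebra M "generated_field M S Z {..int n}" by unfold_locales (rule sub)
 have aM: "a \<in> events" and bM: "b \<in> events" using a b ev by auto
 have Di: "integrable M (\<lambda>w. real_cond_exp M (generated_field M S Z {..int n}) (indicator b) w - prob b)"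
  using ii[OF bM] by (intro Bochner_Integration.integrable_diff G.real_cond_exp_int) auto
 have "prob (a \<inter> b) - prob a * prob b = (\<integral>w\<in>a. (indicator b w - prob b) \<partial>M)"
 proof -
  have "(\<integral>w\<in>a. (indicator b w - prob b) \<partial>M) = (\<integral>w. indicator (a \<inter> b) w - prob b * indicator a w \<partial>M)"
   unfolding set_lebesgue_integral_def by (intro Bochner_Integration.integral_cong) (auto simp: indicator_def)
  also have "\<dots> = prob (a \<inter> b) - prob b * prob a"
   using aM bM ii by (subst Bochner_Integration.integral_diff) (auto simp: measure_def)
  finally show ?thesis by simp
 qed
 also have "\<dots> = (\<integral>w\<in>a. (real_cond_exp M (generated_field M S Z {..int n}) (indicator b) w - prob b) \<partial>M)"
 proof -
  have s: "set_integrable M a f" if "integrable M f" for f :: "'a \<Rightarrow> real"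
   unfolding set_integrable_def using that aM by (simp add: integrable_mult_indicator[of a M f, simplified])
  show ?thesis using G.real_cond_exp_intA[OF ii[OF bM] a] ii[OF bM]
   by (subst (1 2) set_integral_diff) (auto intro!: s)
 qed
 finally have "\<bar>prob (a \<inter> b) - prob a * prob b\<bar> = \<bar>\<integral>w\<in>a. (real_cond_exp M (generated_field M S Z {..int n}) (indicator b) w - prob b) \<partial>M\<bar>" by simp
 also have "\<dots> \<le> (\<integral>w. D n b w \<partial>M)"
  unfolding set_lebesgue_integral_def D_def
  by (rule order_trans[OF integral_abs_bound], rule integral_mono[OF integrable_abs[OF integrable_mult_indicator[OF aM Di]] integrable_abs[OF Di]])
   (auto simp: indicator_def)
 also have "ennreal \<dots> = (\<integral>\<^sup>+w. ennreal (D n b w) \<partial>M)"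
  unfolding D_def using Di by (intro nn_integral_eq_integral[symmetric]) auto
 finally have "ennreal \<bar>prob (a \<inter> b) - prob a * prob b\<bar> \<le> (\<integral>\<^sup>+w. ennreal (D n b w) \<partial>M)" by (simp add: ennreal_leI)
 also have "\<dots> \<le> (\<integral>\<^sup>+w. family_esssup M (F n) w \<partial>M)"
 proof (rule nn_integral_mono_AE)
  have "(\<lambda>w. ennreal (D n b w)) \<in> F n" unfolding F_def using b by auto
  then show "AE w in M. ennreal (D n b w) \<le> family_esssup M (F n) w" using ess[of n] by (auto simp: is_family_esssup_def)
 qed
 also have "\<dots> \<le> ?sup" using n by (intro SUP_upper) auto
 also have "?sup = ennreal (beta_coeff M S Z k)" unfolding beta using fin by simp
 finally show "\<bar>prob (a \<inter> b) - prob a * prob b\<bar> \<le> beta_coeff M S Z k"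
  by (subst (asm) ennreal_le_iff) (auto simp: beta_coeff_def)
qed

text \<open>The conditional expectation of \<open>X 1\<close> given a window of \<open>Z\<close> is a function of the window; applying
this function to the shifted windows gives approximations of all \<open>X i\<close>, whose errors have the
same law by joint stationarity.\<close>
lemma dependent_process_near_epoch:
 fixes S :: "'b measure"
 assumes X: "\<And>n. 1 \<le> n \<Longrightarrow> X n \<in> borel_measurable M" and st: "stationary M X"
  and Z: "\<And>n. Z n \<in> measurable M S" and \<beta>: "8 \<le> \<beta>"
  and mixO: "beta_coeff M S Z \<in> O(\<lambda>n. real n powr (- \<beta>))"
  and ned: "near_epoch_dependent M X S Z a" and aO: "a \<in> O(\<lambda>n. real n powr (- max (\<beta> + 3) 12))"
 shows "\<exists>V past fut c0. dependent_process M (distr M borel (X 1)) X V past fut c0 \<beta> (max (\<beta> + 3) 12) ((\<beta> + 1) / 2)"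
proof -
 obtain c where c: "0 \<le> c" "\<And>n. beta_coeff M S Z n \<le> c * (1 + real n) powr (- \<beta>)"
  using powr_bound_of_bigo[OF mixO] \<beta> by auto
 obtain c' where c': "0 \<le> c'" "\<And>l. a l \<le> c' * (1 + real l) powr (- max (\<beta> + 3) 12)"
  using powr_bound_of_bigo[OF aO] \<beta> by (auto simp: le_max_iff_disj)
 have js: "jointly_stationary M X S Z" and int: "integrable M (X 1)"
  and al: "\<And>l. expectation (\<lambda>w. \<bar>X 1 w - real_cond_exp M (generated_field M S Z {- int l..int l}) (X 1) w\<bar>) \<le> a l"
  using ned by (auto simp: near_epoch_dependent_def)
 define E where "E = expectation (\<lambda>w. \<bar>X 1 w\<bar>)"
 define c0 where "c0 = c + c' + E"
 have E0: "0 \<le> E" unfolding E_def by (intro integral_nonneg_AE) auto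
 define past where "past n = generated_field M S Z {..n}" for n
 define fut where "fut n = generated_field M S Z {n..}" for n
 let ?I = "\<lambda>l. {- int l..int l}"
 let ?P = "\<lambda>l. \<Pi>\<^sub>M k\<in>?I l. S"
 have sub: "subalgebra M (generated_field M S Z I)" for I using Z by (intro subalgebra_generated_field)
 have "\<exists>\<phi>\<in>borel_measurable (?P l). \<forall>w\<in>space M. real_cond_exp M (generated_field M S Z (?I l)) (X 1) w = \<phi> (\<lambda>k\<in>?I l. Z k w)" for l
 proof -
  have "real_cond_exp M (generated_field M S Z (?I l)) (X 1) \<in> borel_measurable (generated_field M S Z (?I l))" by simp
  from measurable_generated_field_factor[OF Z this] show ?thesis by metis
 qed
 then obtain \<phi> where \<phi>: "\<And>l. \<phi> l \<in> borel_measurable (?P l)"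
  "\<And>l w. w \<in> space M \<Longrightarrow> real_cond_exp M (generated_field M S Z (?I l)) (X 1) w = \<phi> l (\<lambda>k\<in>?I l. Z k w)" by metis
 define V where "V l i w = \<phi> l (\<lambda>k\<in>?I l. Z (k + int (i - 1)) w)" for l i w
 have V_gen: "V l i \<in> borel_measurable (generated_field M S Z J)" if i: "1 \<le> i" and J: "{int i - int l - 1..int i + int l - 1} \<subseteq> J" for l i J
  unfolding V_def
 proof (rule measurable_compose[OF measurable_restrict \<phi>(1)])
  fix k assume "k \<in> ?I l"
  then have "k + int (i - 1) \<in> J" using J i by (auto simp: of_nat_diff)
  then show "Z (k + int (i - 1)) \<in> measurable (generated_field M S Z J) S" by (intro measurable_generated_field Z)
 qed
 have VM: "V l i \<in> borel_measurable M" if "1 \<le> i" for l i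
  using measurable_from_subalg[OF sub V_gen[OF that subset_refl]] .
 have V1: "V l 1 w = real_cond_exp M (generated_field M S Z (?I l)) (X 1) w" if "w \<in> space M" for l w
  using \<phi>(2)[OF that, of l] by (simp add: V_def)
 have shift: "prob {w\<in>space M. e < \<bar>X i w - V l i w\<bar>} = prob {w\<in>space M. e < \<bar>X 1 w - V l 1 w\<bar>}" if i: "1 \<le> i" for e l i
 proof -
  let ?Q = "(\<Pi>\<^sub>M n\<in>{1::nat..}. (borel :: real measure)) \<Otimes>\<^sub>M (\<Pi>\<^sub>M n\<in>(UNIV :: int set). S)"
  define T where "T j w = (\<lambda>n\<in>{1..}. X (n + j) w, \<lambda>n. Z (n + int j) w)" for j w
  define \<Psi> where "\<Psi> = (\<lambda>(x :: nat \<Rightarrow> real, z). \<bar>x 1 - \<phi> l (\<lambda>k\<in>?I l. z k)\<bar>)"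
  have "(\<lambda>w. \<lambda>n\<in>UNIV. Z (n + int j) w) \<in> measurable M (\<Pi>\<^sub>M n\<in>(UNIV :: int set). S)" for j
   by (intro measurable_restrict Z)
  then have Zm: "(\<lambda>w n. Z (n + int j) w) \<in> measurable M (\<Pi>\<^sub>M n\<in>(UNIV :: int set). S)" for j
   by (simp add: restrict_def)
  have T: "T j \<in> measurable M ?Q" for j
   unfolding T_def by (intro measurable_Pair[OF measurable_restrict[OF X] Zm]) simp
  have x1: "(\<lambda>p. fst p 1) \<in> borel_measurable ?Q"
   by (rule measurable_compose[OF measurable_fst measurable_component_singleton]) simp
  have "(\<lambda>p. \<lambda>k\<in>?I l. snd p k) \<in> measurable ?Q (?P l)"
   by (intro measurable_restrict measurable_compose[OF measurable_snd measurable_component_singleton]) simp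
  from measurable_compose[OF this \<phi>(1)] have z1: "(\<lambda>p. \<phi> l (\<lambda>k\<in>?I l. snd p k)) \<in> borel_measurable ?Q" .
  have \<Psi>: "\<Psi> \<in> borel_measurable ?Q" unfolding \<Psi>_def case_prod_beta using x1 z1 by measurable
  have set: "{p\<in>space ?Q. e < \<Psi> p} \<in> sets ?Q" using \<Psi> by measurable
  have eq: "measure (distr M ?Q (T j)) {p\<in>space ?Q. e < \<Psi> p} = prob {w\<in>space M. e < \<bar>X (1 + j) w - V l (1 + j) w\<bar>}" for j
  proof -
   have "measure (distr M ?Q (T j)) {p\<in>space ?Q. e < \<Psi> p} = prob (T j -` {p\<in>space ?Q. e < \<Psi> p} \<inter> space M)"
    by (rule measure_distr[OF T set])
   also have "T j -` {p\<in>space ?Q. e < \<Psi> p} \<inter> space M = {w\<in>space M. e < \<bar>X (1 + j) w - V l (1 + j) w\<bar>}"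
    using measurable_space[OF T[of j]] by (auto simp: T_def \<Psi>_def V_def)
   finally show ?thesis .
  qed
  have "distr M ?Q (T (i - 1)) = distr M ?Q (T 0)"
   using js unfolding jointly_stationary_def T_def by simp
  then show ?thesis using eq[of "i - 1"] eq[of 0] i by simp
 qed
 have "dependent_process M (distr M borel (X 1)) X V past fut c0 \<beta> (max (\<beta> + 3) 12) ((\<beta> + 1) / 2)"
 proof (intro dependent_process.intro dependent_process_axioms.intro)
  show "prob_space M" by (rule prob_space_axioms)
  show "prob_space (distr M borel (X 1))" using X[of 1] by (intro prob_space_distr) simp
  show "X i \<in> borel_measurable M" if "1 \<le> i" for i using X that .
  show "distr M borel (X i) = distr M borel (X 1)" if "1 \<le> i" for i by (rule stationary_law[OF X st that])
  show "subalgebra M (past n)" "subalgebra M (fut n)" for n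
   unfolding past_def fut_def by (rule sub)+
  show "sets (past n) \<subseteq> sets (past n')" "sets (fut n') \<subseteq> sets (fut n)" if "n \<le> n'" for n n'
   unfolding past_def fut_def by (rule generated_field_mono, use that in force)+
  show "V l i \<in> borel_measurable (past (int i + int l))" "V l i \<in> borel_measurable (fut (int i - int l - 1))" if "1 \<le> i" for l i
   unfolding past_def fut_def using that by (auto intro!: V_gen)
  show "mixing_bound M (past n) (fut (n + int r)) (c0 * (1 + real r) powr - \<beta>)" if n: "1 \<le> n" for n r
  proof -
   define n' where "n' = nat n"
   have n': "n = int n'" "1 \<le> n'" using n by (auto simp: n'_def)
   have "c * (1 + real r) powr - \<beta> \<le> c0 * (1 + real r) powr - \<beta>"
    using c' E0 by (intro mult_right_mono) (auto simp: c0_def)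
   then have "beta_coeff M S Z r \<le> c0 * (1 + real r) powr - \<beta>" using c(2)[of r] by linarith
   then show ?thesis using mixing_bound_beta_coeff[of Z S n' r, OF Z n'(2)]
    unfolding past_def fut_def n'(1) mixing_bound_def by (meson order_trans)
  qed
  show "prob {w\<in>space M. e < \<bar>X i w - V l i w\<bar>} \<le> c0 * (1 + real l) powr - max (\<beta> + 3) 12 / e" if i: "1 \<le> i" and e: "0 < e" for i l e
  proof -
   interpret G: finite_measure_subalgebra M "generated_field M S Z (?I l)" by unfold_locales (rule sub)
   let ?d = "\<lambda>w. \<bar>X 1 w - real_cond_exp M (generated_field M S Z (?I l)) (X 1) w\<bar>"
   have d: "integrable M ?d" using int by (intro integrable_abs Bochner_Integration.integrable_diff G.real_cond_exp_int)
   have "prob {w\<in>space M. e < \<bar>X i w - V l i w\<bar>} = prob {w\<in>space M. e < ?d w}"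
    unfolding shift[OF i] using V1 by (intro arg_cong[of _ _ prob]) auto
   also have "\<dots> \<le> prob {w\<in>space M. e \<le> ?d w}"
    using borel_measurable_integrable[OF d] by (intro finite_measure_mono) auto
   also have "\<dots> \<le> expectation ?d / e" using e by (intro Markov_ge d) auto
   also have "\<dots> \<le> a l / e" using al[of l] e by (intro divide_right_mono) auto
   also have "\<dots> \<le> c0 * (1 + real l) powr - max (\<beta> + 3) 12 / e"
   proof (rule divide_right_mono)
    have "c' * (1 + real l) powr - max (\<beta> + 3) 12 \<le> c0 * (1 + real l) powr - max (\<beta> + 3) 12"
     using c E0 by (intro mult_right_mono) (auto simp: c0_def)
    then show "a l \<le> c0 * (1 + real l) powr - max (\<beta> + 3) 12" using c'(2)[of l] by linarith
   qed (use e in simp)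
   finally show ?thesis .
  qed
  have Ec: "E \<le> c0" using c(1) c'(1) by (simp add: c0_def)
  have tl: "prob {w\<in>space M. T \<le> \<bar>X 1 w\<bar>} \<le> c0 / T" if "1 \<le> T" for T
  proof -
   have "prob {w\<in>space M. T \<le> \<bar>X 1 w\<bar>} \<le> E / T" unfolding E_def using that int by (intro Markov_ge) auto
   also have "\<dots> \<le> c0 / T" using that Ec by (intro divide_right_mono) auto
   finally show ?thesis .
  qed
  then show "(\<forall>i\<ge>1. \<forall>l. V l i = X i) \<or> (\<forall>T\<ge>1. prob {w\<in>space M. T \<le> \<bar>X 1 w\<bar>} \<le> c0 / T)" by blast
  show "prob {w\<in>space M. T \<le> \<bar>X 1 w\<bar>} \<le> c0 * T powr (- 1 / 5)" if T: "1 \<le> T" for T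
  proof -
   have "prob {w\<in>space M. T \<le> \<bar>X 1 w\<bar>} \<le> c0 * T powr (- 1)" using tl[OF T] T by (simp add: powr_minus_divide)
   also have "\<dots> \<le> c0 * T powr (- 1 / 5)" using T Ec E0 by (intro mult_left_mono powr_mono) auto
   finally show ?thesis .
  qed
 qed (use \<beta> in \<open>auto simp: max_def\<close>)
 then show ?thesis by blast
qed

end

section \<open>The theorem\<close>

lemma kernel_between_0_1:
 fixes g :: "real \<Rightarrow> real"
 assumes "mono g" "(g \<longlongrightarrow> 1) at_top" "(g \<longlongrightarrow> 0) at_bot"
 shows "0 \<le> g t" "g t \<le> 1"
proof -
 have m: "s \<le> s' \<Longrightarrow> g s \<le> g s'" for s s' using assms(1) by (rule monoD)
 have "\<forall>\<^sub>F s in at_top. g t \<le> g s" using eventually_ge_at_top[of t] by (rule eventually_mono) (rule m)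
 then show "g t \<le> 1" by (intro tendsto_lowerbound[OF assms(2)]) simp_all
 have "\<forall>\<^sub>F s in at_bot. g s \<le> g t" using eventually_le_at_bot[of t] by (rule eventually_mono) (rule m)
 then show "0 \<le> g t" by (intro tendsto_upperbound[OF assms(3)]) simp_all
qed

lemma regular_kernel_of_variation:
 fixes h :: "real \<Rightarrow> real \<Rightarrow> real \<Rightarrow> real"
 assumes N: "prob_space N" and ind: "prob_space.indep_var N borel X' borel Y'"
  and law: "distr N borel X' = \<mu>" "distr N borel Y' = \<mu>"
  and meas: "(\<lambda>(x, y, t). h x y t) \<in> borel_measurable borel"
  and sym: "\<And>x y. h x y t = h y x t" and h01: "\<And>x y. 0 \<le> h x y t" "\<And>x y. h x y t \<le> 1"
  and L: "0 \<le> L"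
  and var: "\<And>e. 0 < e \<Longrightarrow> (\<integral>\<^sup>+\<omega>. (SUP (x, y)\<in>{(x, y). norm ((x, y) - (X' \<omega>, Y' \<omega>)) \<le> e}.
       ennreal \<bar>h x y t - h (X' \<omega>) (Y' \<omega>) t\<bar>) \<partial>N) \<le> ennreal (L * e)"
 shows "regular_kernel \<mu> (\<lambda>p. h (fst p) (snd p) t) L"
  and "regular_kernel.mean \<mu> (\<lambda>p. h (fst p) (snd p) t) = U_distribution N X' Y' h t"
proof -
 interpret N: prob_space N by fact
 have rv[measurable]: "X' \<in> borel_measurable N" "Y' \<in> borel_measurable N"
  and pair: "\<mu> \<Otimes>\<^sub>M \<mu> = distr N (borel \<Otimes>\<^sub>M borel) (\<lambda>\<omega>. (X' \<omega>, Y' \<omega>))"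
  using ind law unfolding N.indep_var_distribution_eq by auto
 have XY: "(\<lambda>\<omega>. (X' \<omega>, Y' \<omega>)) \<in> measurable N (borel \<Otimes>\<^sub>M borel)" by measurable
 let ?k = "\<lambda>p. h (fst p) (snd p) t"
 have k: "?k \<in> borel_measurable borel"
 proof -
  have "(\<lambda>p. (fst p, snd p, t)) \<in> borel_measurable (borel :: (real \<times> real) measure)" by measurable
  from measurable_compose[OF this meas] show ?thesis by simp
 qed
 have osc_eq: "osc ?k e (X' \<omega>, Y' \<omega>) = (SUP (x, y)\<in>{(x, y). norm ((x, y) - (X' \<omega>, Y' \<omega>)) \<le> e}.
       ennreal \<bar>h x y t - h (X' \<omega>) (Y' \<omega>) t\<bar>)" for e \<omega>
  unfolding osc_def by (intro SUP_cong) auto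
 show regular_at: "regular_kernel \<mu> ?k L"
 proof (intro regular_kernel.intro regular_kernel_axioms.intro)
  show "prob_space \<mu>" unfolding law(1)[symmetric] by (intro N.prob_space_distr rv)
  show "sets \<mu> = sets borel" unfolding law(1)[symmetric] by simp
  fix e :: real assume e: "0 < e"
  have "(\<integral>\<^sup>+p. osc ?k e p \<partial>(\<mu> \<Otimes>\<^sub>M \<mu>)) \<le> (\<integral>\<^sup>+\<omega>. osc ?k e (X' \<omega>, Y' \<omega>) \<partial>N)"
   unfolding pair by (rule nn_integral_distr_le[OF XY])
  also have "\<dots> \<le> ennreal (L * e)" unfolding osc_eq by (rule var[OF e])
  finally show "(\<integral>\<^sup>+p. osc ?k e p \<partial>(\<mu> \<Otimes>\<^sub>M \<mu>)) \<le> ennreal (L * e)" .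
 qed (use k h01 sym L in auto)
 interpret R: regular_kernel \<mu> ?k L by (rule regular_at)
 interpret P: pair_prob_space \<mu> \<mu> ..
 have kb: "?k \<in> borel_measurable (borel \<Otimes>\<^sub>M borel)" using k by (simp add: borel_prod)
 have km: "?k \<in> borel_measurable (\<mu> \<Otimes>\<^sub>M \<mu>)" unfolding pair using kb by simp
 have "R.mean = (\<integral>x. (\<integral>y. ?k (x, y) \<partial>\<mu>) \<partial>\<mu>)" by (simp add: R.mean_def R.proj_def)
 also have "\<dots> = (\<integral>p. ?k p \<partial>(\<mu> \<Otimes>\<^sub>M \<mu>))"
  using km h01 by (intro P.integral_fst' P.P.integrable_const_bound[of _ 1]) auto
 also have "\<dots> = (\<integral>\<omega>. h (X' \<omega>) (Y' \<omega>) t \<partial>N)"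
  unfolding pair using kb by (subst integral_distr[OF XY]) auto
 finally show "R.mean = U_distribution N X' Y' h t" by (simp add: U_distribution_def)
qed

text \<open>Choosing the scale \<open>x = |t - t'|\<close> in the supremum gives a bound for each pair.\<close>
lemma expansion_bound_of_bigo:
 fixes U u :: "real \<Rightarrow> real"
 assumes U01: "\<And>t. 0 \<le> U t" "\<And>t. U t \<le> 1" and u: "\<And>t. C1 \<le> t \<Longrightarrow> t \<le> C2 \<Longrightarrow> \<bar>u t\<bar> \<le> K"
  and O: "(\<lambda>x. SUP (t, t')\<in>{(t, t'). t \<in> {C1..C2} \<and> t' \<in> {C1..C2} \<and> \<bar>t - t'\<bar> \<le> x}.
       \<bar>U t - U t' - u t * (t - t')\<bar>) \<in> O[at_right 0](\<lambda>x. x powr (5/4))"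
 obtains x0 Ce where "0 < x0" "0 \<le> Ce"
  "\<And>t t'. C1 \<le> t \<Longrightarrow> t \<le> C2 \<Longrightarrow> C1 \<le> t' \<Longrightarrow> t' \<le> C2 \<Longrightarrow> \<bar>t - t'\<bar> \<le> x0 \<Longrightarrow>
    \<bar>U t - U t' - u t * (t - t')\<bar> \<le> Ce * \<bar>t - t'\<bar> powr (5/4)"
proof -
 let ?I = "\<lambda>x. {(t, t'). t \<in> {C1..C2} \<and> t' \<in> {C1..C2} \<and> \<bar>t - t'\<bar> \<le> x}"
 let ?f = "\<lambda>(t, t'). \<bar>U t - U t' - u t * (t - t')\<bar>"
 let ?s = "\<lambda>x. SUP p\<in>?I x. ?f p"
 from landau_o.bigE[OF O] obtain c where c: "0 < c" and ev: "\<forall>\<^sub>F x in at_right 0. norm (?s x) \<le> c * norm (x powr (5/4))" by blast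
 obtain b where b: "0 < b" "\<And>x. 0 < x \<Longrightarrow> x < b \<Longrightarrow> norm (?s x) \<le> c * norm (x powr (5/4))"
  using ev unfolding eventually_at_right_field by blast
 have "\<bar>U t - U t' - u t * (t - t')\<bar> \<le> c * \<bar>t - t'\<bar> powr (5/4)"
  if t: "C1 \<le> t" "t \<le> C2" "C1 \<le> t'" "t' \<le> C2" and d: "\<bar>t - t'\<bar> \<le> b / 2" for t t'
 proof (cases "t = t'")
  case False
  define x where "x = \<bar>t - t'\<bar>"
  have x: "0 < x" "x < b" using False d b(1) by (auto simp: x_def)
  have "?f p \<le> 1 + K * x" if p: "p \<in> ?I x" for p
  proof -
   obtain r r' where r: "p = (r, r')" "C1 \<le> r" "r \<le> C2" "\<bar>r - r'\<bar> \<le> x" using p by auto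
   have "\<bar>u r * (r - r')\<bar> \<le> K * x" unfolding abs_mult using r u[OF r(2,3)] by (intro mult_mono) auto
   moreover have "\<bar>U r - U r'\<bar> \<le> 1" using U01[of r] U01[of r'] by linarith
   ultimately show ?thesis unfolding r(1) by simp
  qed
  then have "bdd_above (?f ` ?I x)" by (intro bdd_aboveI[of _ "1 + K * x"]) auto
  moreover have "(t, t') \<in> ?I x" using t by (simp add: x_def)
  ultimately have "?f (t, t') \<le> ?s x" by (intro cSUP_upper)
  also have "\<dots> \<le> c * x powr (5/4)" using b(2)[OF x] by simp
  finally show ?thesis by (simp add: x_def)
 qed simp
 then show ?thesis using that[of "b / 2" c] b(1) c by simp
qed

theorem theorem2:
 fixes M :: "'a measure" and X :: "nat \<Rightarrow> 'a \<Rightarrow> real"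
  and N :: "'c measure" and X' Y' :: "'c \<Rightarrow> real"
  and S :: "'b measure" and Z :: "int \<Rightarrow> 'a \<Rightarrow> 'b"
  and h :: "real \<Rightarrow> real \<Rightarrow> real \<Rightarrow> real" and U u :: "real \<Rightarrow> real"
  and C1 C2 D1 D2 \<gamma> :: real
 assumes M: "prob_space M"
  and X_meas: "\<And>n. 1 \<le> n \<Longrightarrow> X n \<in> borel_measurable M"
  and X_stationary: "stationary M X"
  and N: "prob_space N"
  and XY_indep: "prob_space.indep_var N borel X' borel Y'"
  and X'_distr: "distr N borel X' = distr M borel (X 1)"
  and Y'_distr: "distr N borel Y' = distr M borel (X 1)"
  and h_meas: "(\<lambda>(x, y, t). h x y t) \<in> borel_measurable borel"
  and h_sym: "\<And>x y t. h x y t = h y x t"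
  and U_def: "U = U_distribution N X' Y' h"
  and h_bounded: "\<exists>B. \<forall>x y t. \<bar>h x y t\<bar> \<le> B"
  and h_mono: "\<And>x y. mono (h x y)"
  and U_cont: "continuous_on UNIV U"
  and h_top: "\<And>x y. (h x y \<longlongrightarrow> 1) at_top"
  and h_bot: "\<And>x y. (h x y \<longlongrightarrow> 0) at_bot"
  and h_variation: "variation_condition N X' Y' h"
  and U_deriv: "\<And>t. t \<in> {C1..C2} \<Longrightarrow> (U has_real_derivative u t) (at t within {C1..C2})"
  and u_inf: "0 < (INF t\<in>{C1..C2}. ereal (u t))"
  and u_sup: "(SUP t\<in>{C1..C2}. ereal (u t)) < \<infinity>"
  and U_expansion:
   "(\<lambda>x. SUP (t, t')\<in>{(t, t'). t \<in> {C1..C2} \<and> t' \<in> {C1..C2} \<and> \<bar>t - t'\<bar> \<le> x}.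
       \<bar>U t - U t' - u t * (t - t')\<bar>) \<in> O[at_right 0](\<lambda>x. x powr (5/4))"
  and dependence:
   "(\<exists>\<alpha>\<ge>8. strongly_mixing M X \<and>
     alpha_coeff M X \<in> O(\<lambda>n. real n powr (- \<alpha>)) \<and>
     (\<exists>r>1/5. integrable M (\<lambda>\<omega>. \<bar>X 1 \<omega>\<bar> powr r)) \<and>
     \<gamma> = (\<alpha> - 2) / \<alpha>)
    \<or>
    (\<exists>\<beta>\<ge>8. (\<forall>n. Z n \<in> measurable M S) \<and>
     absolutely_regular M S Z \<and>
     beta_coeff M S Z \<in> O(\<lambda>n. real n powr (- \<beta>)) \<and>
     (\<exists>a. near_epoch_dependent M X S Z a \<and>
        a \<in> O(\<lambda>n. real n powr (- max (\<beta> + 3) 12))) \<and>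
     \<gamma> = (\<beta> - 3) / (\<beta> + 1))"
  and D: "U C1 < D1" "D1 < D2" "D2 < U C2"
 shows "AE \<omega> in M.
  (\<lambda>n::nat. SUP (p, s)\<in>{D1..D2} \<times> {0..1::real}.
    real (nat \<lfloor>real n * s\<rfloor>) / sqrt (real n) *
    \<bar>bahadur_remainder h X U u C1 C2 (nat \<lfloor>real n * s\<rfloor>) p \<omega>\<bar>)
  \<in> o(\<lambda>n. real n powr (- (\<gamma> / 8)) * ln (real n))"
proof -
 interpret M: prob_space M by (rule M)
 define \<mu> where "\<mu> = distr M borel (X 1)"
 obtain L where L: "\<And>t e. 0 < e \<Longrightarrow> (\<integral>\<^sup>+\<omega>. (SUP (x, y)\<in>{(x, y). norm ((x, y) - (X' \<omega>, Y' \<omega>)) \<le> e}.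
       ennreal \<bar>h x y t - h (X' \<omega>) (Y' \<omega>) t\<bar>) \<partial>N) \<le> ennreal (L * e)"
  using h_variation unfolding variation_condition_def by blast
 \<comment> \<open>a negative constant is possible in the hypothesis, where \<open>ennreal\<close> would truncate it to 0\<close>
 define L' where "L' = max L 0"
 have L': "(\<integral>\<^sup>+\<omega>. (SUP (x, y)\<in>{(x, y). norm ((x, y) - (X' \<omega>, Y' \<omega>)) \<le> e}.
       ennreal \<bar>h x y t - h (X' \<omega>) (Y' \<omega>) t\<bar>) \<partial>N) \<le> ennreal (L' * e)" if "0 < e" for t e
  by (rule order_trans[OF L[OF that]]) (use that in \<open>auto simp: L'_def intro!: ennreal_leI mult_right_mono\<close>)
 have h01: "0 \<le> h x y t" "h x y t \<le> 1" for x y t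
  using kernel_between_0_1[OF h_mono h_top h_bot] by blast+
 have L'0: "0 \<le> L'" by (simp add: L'_def)
 note rk0 = regular_kernel_of_variation[OF N XY_indep X'_distr[folded \<mu>_def] Y'_distr[folded \<mu>_def] h_meas h_sym h01 L'0 L']
 have rk: "regular_kernel \<mu> (\<lambda>p. h (fst p) (snd p) t) L'"
  "regular_kernel.mean \<mu> (\<lambda>p. h (fst p) (snd p) t) = U_distribution N X' Y' h t" for t
  by (rule rk0(1), assumption) (rule rk0(2), assumption)
 have mean: "regular_kernel.mean \<mu> (\<lambda>p. h (fst p) (snd p) t) = U t" for t
  using rk(2) by (simp add: U_def)
 have U01: "0 \<le> U t" "U t \<le> 1" for t
  using regular_kernel.mean_nonneg[OF rk(1)] regular_kernel.mean_le_1[OF rk(1)] unfolding mean by blast+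
 have hm: "h x y t \<le> h x y t'" if "t \<le> t'" for x y t t' using h_mono that by (rule monoD)

 obtain V past fut c0 \<theta> a A where DP: "dependent_process M \<mu> X V past fut c0 \<theta> a A" and \<gamma>: "\<gamma> = 1 - 2 / A"
  using dependence
 proof (elim disjE exE conjE)
  fix \<alpha> r assume *: "8 \<le> \<alpha>" "alpha_coeff M X \<in> O(\<lambda>n. real n powr (- \<alpha>))" "1 / 5 < r"
   "integrable M (\<lambda>\<omega>. \<bar>X 1 \<omega>\<bar> powr r)" "\<gamma> = (\<alpha> - 2) / \<alpha>"
  have "\<exists>V past fut c0. dependent_process M \<mu> X V past fut c0 \<alpha> (max 12 (2 * \<alpha>)) \<alpha>"
   unfolding \<mu>_def by (rule M.dependent_process_strong_mixing[OF X_meas X_stationary *(1-4)])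
  moreover have "\<gamma> = 1 - 2 / \<alpha>" using *(1,5) by (simp add: field_simps)
  ultimately show thesis using that by blast
 next
  fix \<beta> b assume *: "8 \<le> \<beta>" "\<forall>n. Z n \<in> measurable M S" "beta_coeff M S Z \<in> O(\<lambda>n. real n powr (- \<beta>))"
   "near_epoch_dependent M X S Z b" "b \<in> O(\<lambda>n. real n powr (- max (\<beta> + 3) 12))" "\<gamma> = (\<beta> - 3) / (\<beta> + 1)"
  have "\<exists>V past fut c0. dependent_process M \<mu> X V past fut c0 \<beta> (max (\<beta> + 3) 12) ((\<beta> + 1) / 2)"
   unfolding \<mu>_def by (rule M.dependent_process_near_epoch[OF X_meas X_stationary *(2)[rule_format] *(1,3-5)])
  moreover have "\<gamma> = 1 - 2 / ((\<beta> + 1) / 2)" using *(1,6) by (simp add: field_simps)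
  ultimately show thesis using that by blast
 qed

 have C: "C1 < C2"
 proof (rule ccontr)
  assume n: "\<not> C1 < C2"
  interpret N: prob_space N by (rule N)
  have "U C2 \<le> U C1"
  proof -
   have i: "integrable \<mu> (regular_kernel.proj \<mu> (\<lambda>p. h (fst p) (snd p) t))" for t by (rule regular_kernel.integrable_proj[OF rk(1)])
   have "regular_kernel.proj \<mu> (\<lambda>p. h (fst p) (snd p) C2) x \<le> regular_kernel.proj \<mu> (\<lambda>p. h (fst p) (snd p) C1) x" for x
    unfolding regular_kernel.proj_def[OF rk(1)[of C1]] regular_kernel.proj_def[OF rk(1)[of C2]]
    using regular_kernel.integrable_k[OF rk(1)[of C1], of x] regular_kernel.integrable_k[OF rk(1)[of C2], of x] n hm
    by (intro integral_mono) auto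
   then show ?thesis 
    unfolding mean[symmetric] regular_kernel.mean_def[OF rk(1)[of C1]] regular_kernel.mean_def[OF rk(1)[of C2]] by (intro integral_mono i)
  qed
  then show False using D by linarith
 qed
 obtain \<kappa> where \<kappa>: "0 < \<kappa>" "\<And>t. C1 \<le> t \<Longrightarrow> t \<le> C2 \<Longrightarrow> \<kappa> \<le> u t"
 proof -
  obtain \<kappa> where k: "0 < ereal \<kappa>" "ereal \<kappa> < (INF t\<in>{C1..C2}. ereal (u t))" using ereal_dense2[OF u_inf] by blast
  have "\<kappa> \<le> u t" if "C1 \<le> t" "t \<le> C2" for t
  proof -
   have "ereal \<kappa> \<le> ereal (u t)" using that by (intro order_trans[OF less_imp_le[OF k(2)] INF_lower]) simp
   then show ?thesis by simp
  qed
  then show thesis using k(1) that by simp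
 qed
 obtain K where K: "\<And>t. C1 \<le> t \<Longrightarrow> t \<le> C2 \<Longrightarrow> u t \<le> K"
 proof -
  obtain K where k: "(SUP t\<in>{C1..C2}. ereal (u t)) < ereal K" using ereal_dense2[OF u_sup] by blast
  have "u t \<le> K" if "C1 \<le> t" "t \<le> C2" for t
  proof -
   have "ereal (u t) \<le> ereal K" using that by (intro order_trans[OF SUP_upper less_imp_le[OF k]]) simp
   then show ?thesis by simp
  qed
  then show thesis by (rule that)
 qed
 have K0: "0 \<le> K" using \<kappa>(1) \<kappa>(2)[of C1] K[of C1] C by linarith
 have mvt: "\<exists>s. C1 \<le> s \<and> s \<le> C2 \<and> U t' - U t = u s * (t' - t)" if t: "C1 \<le> t" "t \<le> t'" "t' \<le> C2" for t t'
 proof (cases "t = t'")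
  case False
  have d: "(U has_derivative (*) (u s)) (at s within {t..t'})" if s: "t \<le> s" "s \<le> t'" for s
  proof (rule has_derivative_subset)
   show "(U has_derivative (*) (u s)) (at s within {C1..C2})"
    using U_deriv[of s] s t unfolding has_field_derivative_def by simp
  qed (use t in simp)
  have "t < t'" using t False by simp
  then have "\<exists>s\<in>{t<..<t'}. U t' - U t = u s * (t' - t)" by (rule mvt_simple) (rule d)
  then obtain s where "s \<in> {t<..<t'}" "U t' - U t = u s * (t' - t)" by blast
  then show ?thesis using t by (intro exI[of _ s]) simp
 next
  case True
  then show ?thesis using t by (intro exI[of _ t]) simp
 qed
 obtain x0 Ce where ex: "0 < x0" "0 \<le> Ce"
  "\<And>t t'. C1 \<le> t \<Longrightarrow> t \<le> C2 \<Longrightarrow> C1 \<le> t' \<Longrightarrow> t' \<le> C2 \<Longrightarrow> \<bar>t - t'\<bar> \<le> x0 \<Longrightarrow>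
    \<bar>U t - U t' - u t * (t - t')\<bar> \<le> Ce * \<bar>t - t'\<bar> powr (5/4)"
 proof (rule expansion_bound_of_bigo[OF U01 _ U_expansion])
  show "\<bar>u t\<bar> \<le> K" if "C1 \<le> t" "t \<le> C2" for t using K[OF that] \<kappa>(1) \<kappa>(2)[OF that] by linarith
 qed blast

 have UP: "u_process M \<mu> X V past fut c0 \<theta> a A h L' K C1 C2"
 proof (intro u_process.intro DP u_process_axioms.intro rk(1) hm C K0)
  fix t t' assume t: "C1 \<le> t" "t \<le> t'" "t' \<le> C2"
  obtain s where s: "C1 \<le> s" "s \<le> C2" "U t' - U t = u s * (t' - t)" using mvt[OF t] by blast
  show "regular_kernel.mean \<mu> (\<lambda>p. h (fst p) (snd p) t') - regular_kernel.mean \<mu> (\<lambda>p. h (fst p) (snd p) t) \<le> K * (t' - t)"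
   unfolding mean s(3) using K[OF s(1,2)] t by (intro mult_right_mono) auto
 qed
 interpret P: u_process M \<mu> X V past fut c0 \<theta> a A h L' K C1 C2 by (rule UP)
 have Umean: "P.Umean = U" by (rule ext) (simp add: P.Umean_def P.kernel_at_def mean)
 interpret Q: u_quantile_process M \<mu> X V past fut c0 \<theta> a A h L' K C1 C2 u \<kappa> Ce x0 D1 D2
 proof (unfold_locales, unfold Umean)
  fix t t' assume t: "C1 \<le> t" "t \<le> t'" "t' \<le> C2"
  obtain s where s: "C1 \<le> s" "s \<le> C2" "U t' - U t = u s * (t' - t)" using mvt[OF t] by blast
  show "\<kappa> * (t' - t) \<le> U t' - U t"
   unfolding s(3) using \<kappa>(2)[OF s(1,2)] t by (intro mult_right_mono) auto
 qed (use \<kappa> ex D h_top h_bot in auto)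
 show ?thesis using Q.AE_sup_remainder_smallo unfolding Umean P.\<gamma>_def \<gamma> .
qed

end
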